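(* Let $q\ge3$ and $\delta\ge1$ be fixed, and let $G$ be uniformly random in $\mathbb G^q_{n,\delta}$ (or uniformly random in $\tilde{\mathbb G}^q_{n,\delta}$). Then, with probability tending to $1$ as $n\to\infty$, $G$ is an SYK graph (so that it represents a unicellular space, i.e. $G_{\hat 0}$ is connected) and the $(q-1)$-dimensional colored triangulation $\mathcal T(G_{\hat 0})$ dual to $G_{\hat 0}$ is a piecewise-linear manifold.
   Context: Fix an integer $q\ge 2$. A $(q+1)$-edge-colored graph (colored graph) is a finite connected graph, multiple edges allowed and no loops, whose edges carry colors in $\{0,1,\dots,q\}$ such that every vertex is incident to exactly one edge of each color. It is rooted if one color-0 edge is distinguished and oriented; it is bipartite if its vertices can be colored black and white so that every edge joins a black and a white vertex, with the convention that the origin of the root edge is black. $\tilde{\mathbb G}^q$ denotes the set of rooted colored graphs and $\mathbb G^q\subset\tilde{\mathbb G}^q$ the set of bipartite ones. For $i\in\{1,\dots,q\}$, a color-$0i$ cycle is a connected component of the subgraph formed by the edges of colors $0$ and $i$; $F_0(G)$ is the total number of such cycles over all $i$. The order of $G$ is $\delta_0(G)=1+\frac{q-1}{2}V(G)-F_0(G)$. $G_{\hat 0}$ denotes the graph obtained from $G$ by deleting all color-0 edges; $G$ is an SYK graph if $G_{\hat 0}$ is connected. $\mathbb G^q_{n,\delta}$ (resp. $\tilde{\mathbb G}^q_{n,\delta}$) is the set of graphs in $\mathbb G^q$ (resp. $\tilde{\mathbb G}^q$) with $2n$ vertices and order $\delta$. Dual triangulation: for a connected graph $H$ in which every vertex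 has exactly one incident edge of each color of a set $A$ with $|A|=k$, the dual $(k-1)$-dimensional colored triangulation $\mathcal T(H)$ is obtained by taking, for each vertex of $H$, a $(k-1)$-simplex whose vertices are labelled bijectively by $A$, and, for each edge of color $a$ of $H$, identifying the facets opposite to the vertex labelled $a$ in the simplices of its two endpoints, matching vertices with equal labels. *)

theory Defs
  imports Complex_Main
begin

text \<open>A (labelled) graph on the vertex set {0..<N} whose edges carry colours in a
finite set is encoded by a family of maps: sigma c v is the other endpoint of the unique
edge of colour c at v.  Outside the relevant range the maps are the identity, so that
for fixed N the set of encodings is finite.  The root edge is the colour-0 edge whose
origin is vertex 0.\<close>

definition colour_rel :: "(nat \<Rightarrow> nat \<Rightarrow> nat) \<Rightarrow> nat \<Rightarrow> nat set \<Rightarrow> (nat \<times> nat) set" where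
  "colour_rel \<sigma> N C = {(v, \<sigma> c v) | v c. v < N \<and> c \<in> C}"

definition residue :: "(nat \<Rightarrow> nat \<Rightarrow> nat) \<Rightarrow> nat \<Rightarrow> nat set \<Rightarrow> nat \<Rightarrow> nat set" where
  "residue \<sigma> N C v = {w. (v, w) \<in> (colour_rel \<sigma> N C)\<^sup>*}"

definition residues :: "(nat \<Rightarrow> nat \<Rightarrow> nat) \<Rightarrow> nat \<Rightarrow> nat set \<Rightarrow> nat set set" where
  "residues \<sigma> N C = residue \<sigma> N C ` {..<N}"

definition coloured_graph :: "nat \<Rightarrow> nat \<Rightarrow> (nat \<Rightarrow> nat \<Rightarrow> nat) \<Rightarrow> bool" where
  "coloured_graph q N \<sigma> \<longleftrightarrow>
     1 \<le> N \<and>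
     (\<forall>c v. (q < c \<or> N \<le> v) \<longrightarrow> \<sigma> c v = v) \<and>
     (\<forall>c\<le>q. \<forall>v<N. \<sigma> c v < N \<and> \<sigma> c v \<noteq> v \<and> \<sigma> c (\<sigma> c v) = v) \<and>
     residue \<sigma> N {..q} 0 = {..<N}"

definition bipartite_graph :: "nat \<Rightarrow> nat \<Rightarrow> (nat \<Rightarrow> nat \<Rightarrow> nat) \<Rightarrow> bool" where
  "bipartite_graph q N \<sigma> \<longleftrightarrow>
     (\<exists>black :: nat \<Rightarrow> bool. black 0 \<and> (\<forall>c\<le>q. \<forall>v<N. black (\<sigma> c v) \<noteq> black v))"

definition F0 :: "nat \<Rightarrow> nat \<Rightarrow> (nat \<Rightarrow> nat \<Rightarrow> nat) \<Rightarrow> nat" where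
  "F0 q N \<sigma> = (\<Sum>i\<in>{1..q}. card (residues \<sigma> N {0, i}))"

definition graph_order :: "nat \<Rightarrow> nat \<Rightarrow> (nat \<Rightarrow> nat \<Rightarrow> nat) \<Rightarrow> real" where
  "graph_order q N \<sigma> = 1 + (real q - 1) / 2 * real N - real (F0 q N \<sigma>)"

definition is_SYK :: "nat \<Rightarrow> nat \<Rightarrow> (nat \<Rightarrow> nat \<Rightarrow> nat) \<Rightarrow> bool" where
  "is_SYK q N \<sigma> \<longleftrightarrow> card (residues \<sigma> N {1..q}) = 1"

definition Gtilde :: "nat \<Rightarrow> nat \<Rightarrow> real \<Rightarrow> (nat \<Rightarrow> nat \<Rightarrow> nat) set" where
  "Gtilde q n \<delta> = {\<sigma>. coloured_graph q (2 * n) \<sigma> \<and> graph_order q (2 * n) \<sigma> = \<delta>}"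

definition Gbip :: "nat \<Rightarrow> nat \<Rightarrow> real \<Rightarrow> (nat \<Rightarrow> nat \<Rightarrow> nat) set" where
  "Gbip q n \<delta> = {\<sigma>. \<sigma> \<in> Gtilde q n \<delta> \<and> bipartite_graph q (2 * n) \<sigma>}"

definition is_complex :: "'a set set \<Rightarrow> bool" where
  "is_complex K \<longleftrightarrow> finite K \<and> (\<forall>s\<in>K. finite s \<and> s \<noteq> {}) \<and>
     (\<forall>s\<in>K. \<forall>t. t \<subseteq> s \<and> t \<noteq> {} \<longrightarrow> t \<in> K)"

definition link :: "'a set set \<Rightarrow> 'a set \<Rightarrow> 'a set set" where
  "link K s = {t \<in> K. t \<inter> s = {} \<and> t \<union> s \<in> K}"

definition stellar :: "'a set set \<Rightarrow> 'a set \<Rightarrow> 'a \<Rightarrow> 'a set set" where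
  "stellar K s a = {t \<in> K. \<not> s \<subseteq> t} \<union>
     {insert a (r \<union> t) | r t. r \<subset> s \<and> (t = {} \<or> t \<in> link K s)}"

text \<open>Stellar equivalence (Alexander--Newman): generated by isomorphisms and stellar
subdivisions and their inverses; it coincides with PL homeomorphism of polyhedra.\<close>
inductive stellar_equiv :: "nat set set \<Rightarrow> nat set set \<Rightarrow> bool" where
  se_refl: "is_complex K \<Longrightarrow> stellar_equiv K K"
| se_iso: "is_complex K \<Longrightarrow> inj_on f (\<Union>K) \<Longrightarrow> stellar_equiv K ((`) f ` K)"
| se_move: "is_complex K \<Longrightarrow> s \<in> K \<Longrightarrow> a \<notin> \<Union>K \<Longrightarrow> stellar_equiv K (stellar K s a)"
| se_sym: "stellar_equiv K L \<Longrightarrow> stellar_equiv L K"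
| se_trans: "stellar_equiv K L \<Longrightarrow> stellar_equiv L M \<Longrightarrow> stellar_equiv K M"

definition bd_simplex :: "nat \<Rightarrow> nat set set" where
  "bd_simplex d = {s. s \<noteq> {} \<and> s \<subset> {..d+1}}"

definition comb_sphere :: "nat \<Rightarrow> 'a set set \<Rightarrow> bool" where
  "comb_sphere d L \<longleftrightarrow> is_complex L \<and>
     (\<exists>f :: 'a \<Rightarrow> nat. inj_on f (\<Union>L) \<and> stellar_equiv ((`) f ` L) (bd_simplex d))"

definition comb_manifold :: "nat \<Rightarrow> 'a set set \<Rightarrow> bool" where
  "comb_manifold d K \<longleftrightarrow> is_complex K \<and> K \<noteq> {} \<and>
     (\<forall>v\<in>\<Union>K. comb_sphere (d - 1) (link K {v}))"

text \<open>For a graph with colour set A: the simplex of vertex v has its faces indexed by the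
nonempty label sets S \<subseteq> A.  Gluing along an edge of colour a identifies the face S of
the simplex of v with the face S of the simplex of the other endpoint whenever a \<notin> S.
Hence the face (v,S) of the glued complex is the class of (v,S) under the equivalence
generated by these identifications, namely the pairs (w,S) with w in the residue of v
for the colours A - S.\<close>
definition tri_face :: "(nat \<Rightarrow> nat \<Rightarrow> nat) \<Rightarrow> nat \<Rightarrow> nat set \<Rightarrow> nat \<Rightarrow> nat set \<Rightarrow> (nat \<times> nat set) set" where
  "tri_face \<sigma> N A v S = (\<lambda>w. (w, S)) ` residue \<sigma> N (A - S) v"

definition tri_faces :: "(nat \<Rightarrow> nat \<Rightarrow> nat) \<Rightarrow> nat \<Rightarrow> nat set \<Rightarrow> (nat \<times> nat set) set set" where
  "tri_faces \<sigma> N A = {tri_face \<sigma> N A v S | v S. v < N \<and> S \<subseteq> A \<and> S \<noteq> {}}"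

definition face_le :: "(nat \<Rightarrow> nat \<Rightarrow> nat) \<Rightarrow> nat \<Rightarrow> nat set \<Rightarrow>
    (nat \<times> nat set) set \<Rightarrow> (nat \<times> nat set) set \<Rightarrow> bool" where
  "face_le \<sigma> N A F F' \<longleftrightarrow> (\<exists>u S S'. u < N \<and> S \<noteq> {} \<and> S \<subseteq> S' \<and> S' \<subseteq> A \<and>
      F = tri_face \<sigma> N A u S \<and> F' = tri_face \<sigma> N A u S')"

text \<open>First barycentric subdivision of the dual triangulation: the order complex
(nonempty chains) of its face poset.\<close>
definition derived_complex :: "(nat \<Rightarrow> nat \<Rightarrow> nat) \<Rightarrow> nat \<Rightarrow> nat set \<Rightarrow> (nat \<times> nat set) set set set" where
  "derived_complex \<sigma> N A = {C. C \<noteq> {} \<and> C \<subseteq> tri_faces \<sigma> N A \<and>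
      (\<forall>F\<in>C. \<forall>F'\<in>C. face_le \<sigma> N A F F' \<or> face_le \<sigma> N A F' F)}"

definition dual_PL_manifold :: "(nat \<Rightarrow> nat \<Rightarrow> nat) \<Rightarrow> nat \<Rightarrow> nat set \<Rightarrow> bool" where
  "dual_PL_manifold \<sigma> N A \<longleftrightarrow> comb_manifold (card A - 1) (derived_complex \<sigma> N A)"

end

theory Submission
  imports Defs "HOL-Library.FuncSet" "HOL-Combinatorics.Permutations"
    "HOL-Computational_Algebra.Formal_Power_Series" "HOL-Real_Asymp.Real_Asymp"
begin

text \<open>
Join the colour-0 edges to the 0i-cycles through them: this incidence graph is connected and the
order is its cyclomatic number, so graphs of order 0 are trees. Removing an edge of the incidence
graph is a local surgery (a cut) on the coloured graph, and cutting a cycle lowers the order by one.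

If every cycle of the incidence graph meets all colours 1..q, then deleting a colour leaves a
forest. Deleting all colour-0 edges then keeps the graph connected, and the link of each vertex of
the dual triangulation comes from a tree; removing leaves of the tree turns its barycentric
subdivision, a flag complex, step by step into that of two glued simplices through edge
subdivisions and their inverses, so the link is a combinatorial sphere.

It remains to see that few graphs of order k + 1 have a cycle missing some colour c. Cut such a
cycle, and reattach the loose end at an arbitrary place; there are about n possibilities, all of order
k + 1. To undo this one has to name the reattached edge, which lies on a cycle, and the original
endpoint, which lies in the same component after removing colour c. Hence the proportion is at most
(number of edges on cycles) times (size of a component) over n, up to constants. In all but a
superpolynomially small proportion of the graphs these two numbers are at most of order n^(3/4) and
n^(1/8): every graph arises from one of order 0 by k + 1 insertions, which costs only polynomial
factors, and graphs of order 0 are encoded by q-ary trees, among which tall trees and trees with large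
components missing a colour are rare by generating function estimates.
\<close>

section \<open>Coloured graphs, cuts and cycles\<close>

text \<open>Labelled encodings are counted throughout. A rooted connected graph with properly
  coloured edges has no nontrivial automorphism, so every rooted graph has the same number (2n-1)!
  of encodings with the root origin at 0, and the two uniform laws agree. The obstacle is that the
  graphs of positive order are never enumerated: only ratios are compared, and each comparison of
  consecutive orders loses a power of n. Hence the tails of the tree statistics must decay faster
  than every power of n; bounds on expectations would be too weak. The exponents are a compromise. A
  critical tree of size n has height about n^(1/2), so the threshold n^(3/4) leaves room for a
  stretched exponential bound. Components missing a colour have exponential tails, so any positive
  power serves for them. Finally 3/4 + 1/8 < 1 makes the switching error vanish. Bipartite and
  general graphs are treated together: the only difference is which reattachment points are
  admissible, and there are at least n - 1 of them in both cases.\<close>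

definition orb :: "(nat \<Rightarrow> nat \<Rightarrow> nat) \<Rightarrow> nat set \<Rightarrow> nat \<Rightarrow> nat set" where
  "orb \<sigma> C v = {w. (v, w) \<in> {(u, \<sigma> c u) | u c. c \<in> C}\<^sup>*}"

text \<open>The vertex set is a parameter, and \<open>orb\<close> carries no vertex bound, because
  leaves are removed and components are split off as graphs of their own in the inductions
  below.\<close>

definition inv_on :: "(nat \<Rightarrow> nat \<Rightarrow> nat) \<Rightarrow> nat set \<Rightarrow> nat set \<Rightarrow> bool" where
  "inv_on \<sigma> C V \<longleftrightarrow> (\<forall>c\<in>C. \<forall>v\<in>V. \<sigma> c v \<in> V \<and> \<sigma> c (\<sigma> c v) = v \<and> \<sigma> c v \<noteq> v)"

lemma orb_self [simp]: "v \<in> orb \<sigma> C v"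
  by (simp add: orb_def)

lemma orb_step: "w \<in> orb \<sigma> C v \<Longrightarrow> c \<in> C \<Longrightarrow> \<sigma> c w \<in> orb \<sigma> C v"
  unfolding orb_def by (rule CollectI, erule CollectE, erule rtrancl_into_rtrancl) blast

lemma orb_induct [consumes 1, case_names self step]:
  assumes "w \<in> orb \<sigma> C v" and "P v"
    and "\<And>u c. u \<in> orb \<sigma> C v \<Longrightarrow> P u \<Longrightarrow> c \<in> C \<Longrightarrow> P (\<sigma> c u)"
  shows "P w"
proof -
  have "(v, w) \<in> {(u, \<sigma> c u) | u c. c \<in> C}\<^sup>*"
    using assms(1) by (simp add: orb_def)
  then show ?thesis
  proof (induction rule: rtrancl_induct)
    case base
    then show ?case using assms(2) by simp
  next
    case (step y z)
    then show ?case using assms(3)[of y] by (auto simp: orb_def)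
  qed
qed

lemma orb_subset:
  assumes "v \<in> S" and "\<And>u c. u \<in> S \<Longrightarrow> c \<in> C \<Longrightarrow> \<sigma> c u \<in> S"
  shows "orb \<sigma> C v \<subseteq> S"
proof
  fix w assume "w \<in> orb \<sigma> C v"
  then show "w \<in> S" by (induction rule: orb_induct) (use assms in auto)
qed

lemma orb_trans: "w \<in> orb \<sigma> C v \<Longrightarrow> orb \<sigma> C w \<subseteq> orb \<sigma> C v"
  by (rule orb_subset) (auto intro: orb_step)

lemma orb_mono: "C \<subseteq> D \<Longrightarrow> orb \<sigma> C v \<subseteq> orb \<sigma> D v"
  by (rule orb_subset) (auto intro: orb_step)

lemma inv_on_mono: "inv_on \<sigma> D V \<Longrightarrow> C \<subseteq> D \<Longrightarrow> inv_on \<sigma> C V"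
  unfolding inv_on_def by blast

lemma inv_onD:
  assumes "inv_on \<sigma> C V" "c \<in> C" "v \<in> V"
  shows "\<sigma> c v \<in> V" "\<sigma> c (\<sigma> c v) = v" "\<sigma> c v \<noteq> v"
  using assms unfolding inv_on_def by blast+

lemma orb_in: "inv_on \<sigma> C V \<Longrightarrow> v \<in> V \<Longrightarrow> orb \<sigma> C v \<subseteq> V"
  by (rule orb_subset) (auto simp: inv_on_def)

lemma orb_sym:
  assumes "inv_on \<sigma> C V" "v \<in> V" "w \<in> orb \<sigma> C v"
  shows "v \<in> orb \<sigma> C w"
  using assms(3)
proof (induction rule: orb_induct)
  case (step u c)
  have "u \<in> V" using step.hyps(1) orb_in[OF assms(1,2)] by blast
  then have "u = \<sigma> c (\<sigma> c u)" using assms(1) step.hyps(2) by (simp add: inv_on_def)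
  also have "\<sigma> c (\<sigma> c u) \<in> orb \<sigma> C (\<sigma> c u)" by (rule orb_step[OF orb_self step.hyps(2)])
  finally show ?case using step.IH orb_trans by blast
qed simp

lemma orb_eq:
  assumes "inv_on \<sigma> C V" "v \<in> V" "w \<in> orb \<sigma> C v"
  shows "orb \<sigma> C w = orb \<sigma> C v"
  using orb_trans[OF assms(3)] orb_trans[OF orb_sym[OF assms]] by blast

lemma orb_cong:
  assumes "inv_on \<sigma> C V" "v \<in> V" "\<And>c u. c \<in> C \<Longrightarrow> u \<in> V \<Longrightarrow> \<tau> c u = \<sigma> c u"
  shows "orb \<tau> C v = orb \<sigma> C v"
proof
  have *: "orb \<sigma> C v \<subseteq> V" by (rule orb_in[OF assms(1,2)])
  show "orb \<tau> C v \<subseteq> orb \<sigma> C v"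
  proof (rule orb_subset)
    fix u c assume "u \<in> orb \<sigma> C v" "c \<in> C"
    then show "\<tau> c u \<in> orb \<sigma> C v"
      using assms(3)[of c u] * orb_step[of u \<sigma> C v c] by auto
  qed simp
  have "orb \<sigma> C v \<subseteq> orb \<tau> C v \<inter> V"
  proof (rule orb_subset)
    fix u c assume "u \<in> orb \<tau> C v \<inter> V" "c \<in> C"
    then show "\<sigma> c u \<in> orb \<tau> C v \<inter> V"
      using assms(1,3) orb_step[of u \<tau> C v c] by (auto simp: inv_on_def)
  qed (use assms in auto)
  then show "orb \<sigma> C v \<subseteq> orb \<tau> C v" by blast
qed

definition cls :: "(nat \<Rightarrow> nat \<Rightarrow> nat) \<Rightarrow> nat set \<Rightarrow> nat set \<Rightarrow> nat set set" where
  "cls \<sigma> C V = orb \<sigma> C ` V"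

lemma finite_cls [simp]: "finite V \<Longrightarrow> finite (cls \<sigma> C V)"
  by (simp add: cls_def)

lemma cls_disjoint:
  assumes "inv_on \<sigma> C V" "X \<in> cls \<sigma> C V" "Y \<in> cls \<sigma> C V" "X \<noteq> Y"
  shows "X \<inter> Y = {}"
proof -
  obtain v w where "v \<in> V" "w \<in> V" "X = orb \<sigma> C v" "Y = orb \<sigma> C w"
    using assms unfolding cls_def by blast
  then show ?thesis
    using orb_eq[OF assms(1), of v] orb_eq[OF assms(1), of w] assms(4) by (metis disjoint_iff)
qed

lemma Union_cls: "inv_on \<sigma> C V \<Longrightarrow> \<Union> (cls \<sigma> C V) = V"
  unfolding cls_def using orb_in[of \<sigma> C V] orb_self[of _ \<sigma> C] by auto

lemma sum_card_cls:
  assumes "inv_on \<sigma> C V" "finite V"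
  shows "(\<Sum>X\<in>cls \<sigma> C V. card X) = card V"
proof -
  have fin: "\<forall>X\<in>cls \<sigma> C V. finite X"
    using Union_cls[OF assms(1)] assms(2) by (metis Union_upper finite_subset)
  have "card (\<Union> (cls \<sigma> C V)) = (\<Sum>X\<in>cls \<sigma> C V. card X)"
    by (rule card_Union_disjoint)
       (simp_all add: fin pairwise_def disjnt_def cls_disjoint[OF assms(1)])
  then show ?thesis by (simp add: Union_cls[OF assms(1)])
qed

lemma residue_eq_orb:
  assumes "inv_on \<sigma> C {..<N}" "v < N"
  shows "residue \<sigma> N C v = orb \<sigma> C v"
proof
  show "residue \<sigma> N C v \<subseteq> orb \<sigma> C v"
  proof -
    have "colour_rel \<sigma> N C \<subseteq> {(u, \<sigma> c u) | u c. c \<in> C}"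
      unfolding colour_rel_def by blast
    from rtrancl_mono[OF this] show ?thesis unfolding residue_def orb_def by blast
  qed
  have "orb \<sigma> C v \<subseteq> residue \<sigma> N C v \<inter> {..<N}"
  proof (rule orb_subset)
    fix u c assume u: "u \<in> residue \<sigma> N C v \<inter> {..<N}" and c: "c \<in> C"
    then have "(u, \<sigma> c u) \<in> colour_rel \<sigma> N C"
      unfolding colour_rel_def by auto
    moreover have "(v, u) \<in> (colour_rel \<sigma> N C)\<^sup>*" using u by (simp add: residue_def)
    ultimately have "\<sigma> c u \<in> residue \<sigma> N C v"
      unfolding residue_def by (simp add: rtrancl_into_rtrancl)
    then show "\<sigma> c u \<in> residue \<sigma> N C v \<inter> {..<N}"
      using u c inv_onD(1)[OF assms(1), of c u] by simp
  qed (use assms in \<open>auto simp: residue_def\<close>)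
  then show "orb \<sigma> C v \<subseteq> residue \<sigma> N C v" by blast
qed

lemma residues_eq_cls:
  assumes "inv_on \<sigma> C {..<N}"
  shows "residues \<sigma> N C = cls \<sigma> C {..<N}"
  unfolding residues_def cls_def
  by (rule image_cong) (simp_all add: residue_eq_orb[OF assms])

text \<open>Detaches the colour-0 edge at x from its 0i-cycle: it becomes a 0i-cycle of length two, and the rest
of the cycle is closed up. This removes one edge of the incidence graph.\<close>
definition cut :: "(nat \<Rightarrow> nat \<Rightarrow> nat) \<Rightarrow> nat \<Rightarrow> nat \<Rightarrow> nat \<Rightarrow> nat \<Rightarrow> nat" where
  "cut \<sigma> x i = \<sigma>(i := (\<sigma> i)(x := \<sigma> 0 x, \<sigma> 0 x := x,
                           \<sigma> i x := \<sigma> i (\<sigma> 0 x), \<sigma> i (\<sigma> 0 x) := \<sigma> i x))"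

section \<open>How a cut changes orbits and their number\<close>

lemma cut_other: "c \<noteq> i \<Longrightarrow> cut \<sigma> x i c = \<sigma> c"
  by (simp add: cut_def)

text \<open>The incidence need not be nontrivial: if \<open>a = y\<close> then \<open>b = x\<close>,
  all four updates agree with \<sigma>, and the cut is the identity. This spares case distinctions
  when cuts are composed.\<close>

locale cut_at =
  fixes \<sigma> :: "nat \<Rightarrow> nat \<Rightarrow> nat" and V :: "nat set" and x i :: nat
  assumes inv0i: "inv_on \<sigma> {0, i} V" and xV: "x \<in> V" and i0: "i \<noteq> 0"
begin

abbreviation "y \<equiv> \<sigma> 0 x"
abbreviation "a \<equiv> \<sigma> i x"
abbreviation "b \<equiv> \<sigma> i y"
abbreviation "\<tau> \<equiv> cut \<sigma> x i"

lemma basics: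
  "y \<in> V" "a \<in> V" "b \<in> V" "\<sigma> 0 y = x" "\<sigma> i a = x" "\<sigma> i b = y"
  "y \<noteq> x" "a \<noteq> x" "b \<noteq> y" "a \<noteq> b"
proof -
  show *: "y \<in> V" "a \<in> V" "\<sigma> 0 y = x" "\<sigma> i a = x" "y \<noteq> x" "a \<noteq> x"
    using inv_onD[OF inv0i _ xV] by auto
  show "b \<in> V" "\<sigma> i b = y" "b \<noteq> y"
    using inv_onD[OF inv0i _ *(1)] by auto
  then show "a \<noteq> b" using * by metis
qed

lemma triv_iff: "a = y \<longleftrightarrow> b = x"
  using basics by metis

lemma cut_vals:
  "\<tau> i x = y" "\<tau> i y = x" "\<tau> i a = b" "\<tau> i b = a" "\<tau> 0 = \<sigma> 0"
  using basics i0 by (auto simp: cut_def)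

lemma cut_val_away: "u \<notin> {x, y, a, b} \<Longrightarrow> \<tau> c u = \<sigma> c u"
  by (simp add: cut_def)

lemma inv_on_cut:
  assumes "inv_on \<sigma> C V"
  shows "inv_on \<tau> C V"
  unfolding inv_on_def
proof (intro ballI)
  fix c u assume c: "c \<in> C" and u: "u \<in> V"
  note * = inv_onD[OF assms c u]
  show "\<tau> c u \<in> V \<and> \<tau> c (\<tau> c u) = u \<and> \<tau> c u \<noteq> u"
  proof (cases "c = i \<and> u \<in> {x, y, a, b}")
    case True
    then show ?thesis using basics cut_vals xV by auto
  next
    case False
    then have 1: "\<tau> c u = \<sigma> c u" using cut_val_away cut_other by metis
    have "\<tau> c (\<sigma> c u) = \<sigma> c (\<sigma> c u)"
    proof (cases "c = i")
      case True
      then have "\<sigma> i u \<notin> {x, y, a, b}"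
        using False basics * by (metis insert_iff empty_iff)
      then show ?thesis using True cut_val_away by blast
    qed (simp add: cut_other)
    then show ?thesis using 1 * by simp
  qed
qed

text \<open>The two new edges run parallel to old paths: x-y to the colour-0 edge, and a-b to the
  path a, x, y, b. Colour i is in \<open>C\<close> whenever a new edge is used, but colour 0 has to
  be assumed.\<close>

lemma cut_step_in_orb:
  assumes "u \<in> V" "0 \<in> C" "c \<in> C"
  shows "\<tau> c u \<in> orb \<sigma> C u"
proof (cases "c = i \<and> u \<in> {x, y, a, b}")
  case True
  have s0: "\<sigma> 0 w \<in> orb \<sigma> C u" if "w \<in> orb \<sigma> C u" for w
    using that assms by (intro orb_step)
  have si: "\<sigma> i w \<in> orb \<sigma> C u" if "w \<in> orb \<sigma> C u" for w
    using that assms True by (intro orb_step) auto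
  have "u = x \<or> u = y \<or> u = a \<or> u = b" using True by blast
  then show ?thesis
  proof (elim disjE)
    assume "u = x" then show ?thesis using s0[of u] True cut_vals by simp
  next
    assume "u = y" then show ?thesis using s0[of u] True cut_vals basics by simp
  next
    assume u: "u = a"
    have "b \<in> orb \<sigma> C u" using si[OF s0[OF si[of u]]] u basics by simp
    then show ?thesis using u True cut_vals by simp
  next
    assume u: "u = b"
    have "a \<in> orb \<sigma> C u" using si[OF s0[OF si[of u]]] u basics by simp
    then show ?thesis using u True cut_vals by simp
  qed
next
  case False
  then have "\<tau> c u = \<sigma> c u" using cut_val_away cut_other by metis
  then show ?thesis using assms orb_step[of u \<sigma> C u c] by simp
qed

lemma orb_cut_subset:
  assumes "inv_on \<sigma> C V" "0 \<in> C" "w \<in> V"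
  shows "orb \<tau> C w \<subseteq> orb \<sigma> C w"
proof -
  have *: "orb \<sigma> C w \<subseteq> V" by (rule orb_in[OF assms(1,3)])
  show ?thesis
  proof (rule orb_subset)
    fix u c assume u: "u \<in> orb \<sigma> C w" and c: "c \<in> C"
    have "\<tau> c u \<in> orb \<sigma> C u" using u c * assms(2) by (intro cut_step_in_orb) auto
    then show "\<tau> c u \<in> orb \<sigma> C w" using orb_trans[OF u] by blast
  qed simp
qed

lemma orb_cut_y: "0 \<in> C \<Longrightarrow> y \<in> orb \<tau> C x"
  using orb_step[of x \<tau> C x 0] cut_vals by simp

lemma orb_cut_b: "i \<in> C \<Longrightarrow> b \<in> orb \<tau> C a"
  using orb_step[of a \<tau> C a i] cut_vals by simp

text \<open>After the cut \<open>x\<close> is still tied to \<open>y\<close> by colour 0 and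
  \<open>a\<close> to \<open>b\<close> by colour i, so at most two pieces arise. They may coincide,
  if \<open>a\<close> is reached from \<open>x\<close> in another way.\<close>

lemma orb_uncut:
  assumes "inv_on \<sigma> C V" "0 \<in> C" "i \<in> C"
  shows "orb \<sigma> C x = orb \<tau> C x \<union> orb \<tau> C a"
proof
  show "orb \<sigma> C x \<subseteq> orb \<tau> C x \<union> orb \<tau> C a"
  proof (rule orb_subset)
    fix u c assume u: "u \<in> orb \<tau> C x \<union> orb \<tau> C a" and c: "c \<in> C"
    show "\<sigma> c u \<in> orb \<tau> C x \<union> orb \<tau> C a"
    proof (cases "c = i \<and> u \<in> {x, y, a, b}")
      case True
      then show ?thesis using basics orb_cut_y orb_cut_b assms by auto
    next
      case False
      then have "\<tau> c u = \<sigma> c u" using cut_val_away cut_other by metis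
      then show ?thesis using u c orb_step by (metis Un_iff)
    qed
  qed simp
  have "a \<in> orb \<sigma> C x" using assms by (intro orb_step) auto
  then show "orb \<tau> C x \<union> orb \<tau> C a \<subseteq> orb \<sigma> C x"
    using orb_cut_subset[OF assms(1,2) xV] orb_cut_subset[OF assms(1,2) basics(2)] orb_trans[of a \<sigma> C x]
    by blast
qed

lemma orb_uncut_other:
  assumes "inv_on \<sigma> C V" "0 \<in> C" "w \<in> V" "w \<notin> orb \<sigma> C x"
  shows "orb \<tau> C w = orb \<sigma> C w"
proof (rule antisym)
  show "orb \<tau> C w \<subseteq> orb \<sigma> C w" by (rule orb_cut_subset[OF assms(1-3)])
  have "orb \<sigma> C w \<subseteq> orb \<tau> C w \<inter> orb \<sigma> C w"
  proof (rule orb_subset)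
    fix u c assume u: "u \<in> orb \<tau> C w \<inter> orb \<sigma> C w" and c: "c \<in> C"
    have "u \<notin> orb \<sigma> C x"
      using u assms(4) orb_eq[OF assms(1) xV, of u] orb_eq[OF assms(1,3), of u] orb_self[of w \<sigma> C] by blast
    then have "c = i \<Longrightarrow> u \<notin> {x, y, a, b}"
      using c assms(2) orb_step[of _ \<sigma> C x] orb_self by auto
    then have "\<tau> c u = \<sigma> c u" using cut_val_away cut_other by metis
    then show "\<sigma> c u \<in> orb \<tau> C w \<inter> orb \<sigma> C w" using u c orb_step by (metis Int_iff)
  qed simp
  then show "orb \<sigma> C w \<subseteq> orb \<tau> C w" by blast
qed

lemma orb_cut_pair: "C \<subseteq> {0, i} \<Longrightarrow> 0 \<in> C \<Longrightarrow> orb \<tau> C x = {x, y}"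
proof (rule antisym)
  assume "C \<subseteq> {0, i}" "0 \<in> C"
  then show "orb \<tau> C x \<subseteq> {x, y}"
    by (intro orb_subset) (use cut_vals basics in auto)
qed (use orb_cut_y in auto)

lemma orb_cut_pair_y: "orb \<tau> {0, i} y = {x, y}"
  using orb_eq[OF inv_on_cut[OF inv0i] xV, of y] orb_cut_y orb_cut_pair[of "{0, i}"] by auto

text \<open>Within the colours 0 and i the cut takes out the pair x, y and closes up the rest.
  Cycles not through \<open>x\<close> do not contain the pair, so one formula covers all
  vertices.\<close>

lemma orb_cut_isolate:
  assumes "u \<in> V" "u \<notin> {x, y}"
  shows "orb \<tau> {0, i} u = orb \<sigma> {0, i} u - {x, y}"
proof
  have "x \<notin> orb \<tau> {0, i} u" "y \<notin> orb \<tau> {0, i} u"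
    using orb_eq[OF inv_on_cut[OF inv0i] assms(1), of x] orb_eq[OF inv_on_cut[OF inv0i] assms(1), of y]
      orb_cut_pair[of "{0, i}"] orb_cut_pair_y assms(2) orb_self[of u \<tau> "{0, i}"] by blast+
  then show "orb \<tau> {0, i} u \<subseteq> orb \<sigma> {0, i} u - {x, y}"
    using orb_cut_subset[OF inv0i _ assms(1)] by blast
  show "orb \<sigma> {0, i} u - {x, y} \<subseteq> orb \<tau> {0, i} u"
  proof (cases "u \<in> orb \<sigma> {0, i} x")
    case False
    then show ?thesis using orb_uncut_other[OF inv0i _ assms(1)] by auto
  next
    case True
    then have *: "orb \<sigma> {0, i} u = {x, y} \<union> orb \<tau> {0, i} a"
      using orb_eq[OF inv0i xV True] orb_uncut[OF inv0i] orb_cut_pair[of "{0, i}"] by auto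
    then have "u \<in> orb \<tau> {0, i} a" using assms orb_self by blast
    then have "orb \<tau> {0, i} u = orb \<tau> {0, i} a"
      using orb_eq[OF inv_on_cut[OF inv0i]] basics by blast
    then show ?thesis using * by blast
  qed
qed

text \<open>Only the class of \<open>x\<close> can split, and it does so iff the loose end
  \<open>a\<close> is no longer reachable, that is, iff the deleted edge of the incidence graph is a
  bridge.\<close>

lemma card_cls_cut:
  assumes "inv_on \<sigma> C V" "0 \<in> C" "i \<in> C" "finite V"
  shows "card (cls \<tau> C V) = card (cls \<sigma> C V) + (if a \<in> orb \<tau> C x then 0 else 1)"
proof -
  let ?O = "orb \<sigma> C x"
  have inv': "inv_on \<tau> C V" by (rule inv_on_cut[OF assms(1)])
  have sub: "?O \<subseteq> V" by (rule orb_in[OF assms(1) xV])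
  have 1: "cls \<sigma> C V = insert ?O (orb \<sigma> C ` (V - ?O))"
  proof (intro equalityI subsetI)
    fix X assume "X \<in> cls \<sigma> C V"
    then obtain w where "w \<in> V" "X = orb \<sigma> C w" by (auto simp: cls_def)
    then show "X \<in> insert ?O (orb \<sigma> C ` (V - ?O))"
      using orb_eq[OF assms(1) xV, of w] by (cases "w \<in> ?O") auto
  qed (use xV in \<open>auto simp: cls_def\<close>)
  have 2: "?O \<notin> orb \<sigma> C ` (V - ?O)"
  proof
    assume "?O \<in> orb \<sigma> C ` (V - ?O)"
    then obtain w where "w \<notin> ?O" "?O = orb \<sigma> C w" by blast
    then show False using orb_self[of w \<sigma> C] by simp
  qed
  have eq: "orb \<sigma> C ` (V - ?O) = orb \<tau> C ` (V - ?O)"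
    using orb_uncut_other[OF assms(1,2)] by (intro image_cong) auto
  have 3: "cls \<tau> C V = {orb \<tau> C x, orb \<tau> C a} \<union> (orb \<tau> C ` (V - ?O))" (is "?L = ?R")
  proof
    show "?L \<subseteq> ?R"
    proof
      fix X assume "X \<in> ?L"
      then obtain w where w: "w \<in> V" "X = orb \<tau> C w" by (auto simp: cls_def)
      show "X \<in> ?R"
      proof (cases "w \<in> ?O")
        case True
        then have "w \<in> orb \<tau> C x \<or> w \<in> orb \<tau> C a" using orb_uncut[OF assms(1-3)] by blast
        then show ?thesis using orb_eq[OF inv' xV, of w] orb_eq[OF inv' basics(2), of w] w by auto
      qed (use w in auto)
    qed
    show "?R \<subseteq> ?L" using xV basics by (auto simp: cls_def)
  qed
  have 4: "X \<notin> orb \<tau> C ` (V - ?O)" if "X = orb \<tau> C x \<or> X = orb \<tau> C a" for X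
  proof
    assume "X \<in> orb \<tau> C ` (V - ?O)"
    then obtain w where "w \<in> V" "w \<notin> ?O" "X = orb \<tau> C w" by blast
    then show False using that orb_uncut[OF assms(1-3)] orb_self[of w \<tau> C] by auto
  qed
  have 5: "orb \<tau> C x = orb \<tau> C a \<longleftrightarrow> a \<in> orb \<tau> C x"
    using orb_eq[OF inv' xV, of a] orb_self[of a \<tau> C] by metis
  have f: "finite (orb \<tau> C ` (V - ?O))" using assms(4) by simp
  have 6: "card (cls \<sigma> C V) = Suc (card (orb \<tau> C ` (V - ?O)))"
    using 2 f unfolding 1 eq by (rule card_insert_disjoint[rotated])
  have 7: "card (cls \<tau> C V) = (if a \<in> orb \<tau> C x then 1 else 2) + card (orb \<tau> C ` (V - ?O))"
  proof -
    have "card (cls \<tau> C V) = card {orb \<tau> C x, orb \<tau> C a} + card (orb \<tau> C ` (V - ?O))"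
      unfolding 3 by (rule card_Un_disjoint) (use f 4 in blast)+
    moreover have "card {orb \<tau> C x, orb \<tau> C a} = (if a \<in> orb \<tau> C x then 1 else 2)"
      using 5 by (metis card_2_iff insert_absorb2 is_singletonI is_singleton_altdef)
    ultimately show ?thesis by simp
  qed
  show ?thesis unfolding 6 7 by simp
qed

text \<open>Allows the number of nontrivial incidences to serve as the induction measure of
  \<open>excess\<close>.\<close>

lemma nontriv_cut:
  assumes "\<tau> c u \<noteq> \<sigma> 0 u" "u \<in> V"
  shows "\<sigma> c u \<noteq> \<sigma> 0 u"
proof (cases "c = i \<and> u \<in> {x, y, a, b}")
  case False
  then have "\<tau> c u = \<sigma> c u" using cut_val_away cut_other by metis
  then show ?thesis using assms(1) by simp
next
  case True
  then have u: "u = a \<or> u = b" "c = i" using assms(1) cut_vals basics(4) by auto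
  show ?thesis
  proof
    assume eq: "\<sigma> c u = \<sigma> 0 u"
    have s: "\<sigma> 0 (\<sigma> 0 u) = u" using inv_onD(2)[OF inv0i, of 0 u] assms(2) by simp
    show False
    proof (cases "u = a")
      case True
      then have "u = y" using eq s u(2) basics(5) by simp
      then show False using assms(1) u(2) cut_vals(2) basics(4) by simp
    next
      case False
      then have "u = x" using eq s u basics(4,6) by simp
      then show False using assms(1) u(2) cut_vals(1) by simp
    qed
  qed
qed

end

section \<open>Acyclic incidence graphs and the Euler relation\<close>

definition gem :: "nat set \<Rightarrow> (nat \<Rightarrow> nat \<Rightarrow> nat) \<Rightarrow> nat set \<Rightarrow> bool" where
  "gem V \<sigma> B \<longleftrightarrow> finite V \<and> finite B \<and> 0 \<notin> B \<and> inv_on \<sigma> (insert 0 B) V"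

lemma gem_cut_at: "gem V \<sigma> B \<Longrightarrow> x \<in> V \<Longrightarrow> i \<in> B \<Longrightarrow> cut_at \<sigma> V x i"
  unfolding gem_def by unfold_locales (auto intro: inv_on_mono intro!: Nat.gr0I)

lemma gem_cut: "gem V \<sigma> B \<Longrightarrow> x \<in> V \<Longrightarrow> i \<in> B \<Longrightarrow> gem V (cut \<sigma> x i) B"
  using cut_at.inv_on_cut[OF gem_cut_at, of V \<sigma> B x i "insert 0 B"] unfolding gem_def by blast

text \<open>The incidence graph restricted to the colours in B has no cycle: each of its edges is a bridge, i.e.
its removal separates x from the remaining cycle.\<close>
definition acyc :: "nat set \<Rightarrow> (nat \<Rightarrow> nat \<Rightarrow> nat) \<Rightarrow> nat set \<Rightarrow> bool" where
  "acyc V \<sigma> B \<longleftrightarrow> (\<forall>x\<in>V. \<forall>i\<in>B. \<sigma> i x \<noteq> \<sigma> 0 x \<longrightarrow> \<sigma> i x \<notin> orb (cut \<sigma> x i) (insert 0 B) x)"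

lemma acyc_mono: "acyc V \<sigma> B \<Longrightarrow> W \<subseteq> V \<Longrightarrow> D \<subseteq> B \<Longrightarrow> acyc W \<sigma> D"
  unfolding acyc_def using orb_mono[of "insert 0 D" "insert 0 B"] by (meson insert_mono subsetD)

text \<open>The incidence graphs are nested, but the maps are not, since the first cut reroutes
  edges of colour i. The comparison is therefore made cycle by cycle, on orbits of two colours,
  where a cut merely deletes a pair of vertices.\<close>

lemma orb_cut_cut_subset:
  assumes g: "gem V \<sigma> B" and x: "x \<in> V" and i: "i \<in> B" and z: "z \<in> V" and j: "j \<in> B" and w: "w \<in> V"
  shows "orb (cut (cut \<sigma> x i) z j) (insert 0 B) w \<subseteq> orb (cut \<sigma> z j) (insert 0 B) w"
proof -
  let ?t = "cut \<sigma> x i" and ?C = "insert 0 B"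
  interpret c1: cut_at \<sigma> V x i by (rule gem_cut_at[OF g x i])
  interpret c2: cut_at \<sigma> V z j by (rule gem_cut_at[OF g z j])
  have g': "gem V ?t B" by (rule gem_cut[OF g x i])
  interpret c3: cut_at ?t V z j by (rule gem_cut_at[OF g' z j])
  have inv: "inv_on \<sigma> ?C V" "inv_on ?t ?C V" using g g' by (auto simp: gem_def)
  have t0: "?t 0 = \<sigma> 0" by (rule c1.cut_vals)
  have sub: "orb ?t {0, c} u \<subseteq> orb \<sigma> {0, c} u" if "u \<in> V" "c \<in> ?C" for u c
    using c1.orb_cut_subset[OF inv_on_mono[OF inv(1), of "{0, c}"], of u] that by auto
  have sub2: "orb (cut ?t z j) {0, c} u \<subseteq> orb (cut \<sigma> z j) {0, c} u" if "u \<in> V" "c \<in> ?C" for u c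
  proof (cases "c = j")
    case False
    have j0: "j \<noteq> 0" by (rule c2.i0)
    have "orb (cut ?t z j) {0, c} u = orb ?t {0, c} u"
      by (rule orb_cong[of _ _ V]) (use inv_on_mono[OF inv(2), of "{0, c}"] that False j0 in \<open>auto simp: cut_other\<close>)
    moreover have "orb (cut \<sigma> z j) {0, c} u = orb \<sigma> {0, c} u"
      by (rule orb_cong[of _ _ V]) (use inv_on_mono[OF inv(1), of "{0, c}"] that False j0 in \<open>auto simp: cut_other\<close>)
    ultimately show ?thesis using sub[OF that] by simp
  next
    case True
    show ?thesis
    proof (cases "u \<in> {z, \<sigma> 0 z}")
      case True2: True
      have "orb (cut ?t z j) {0, j} u = {z, \<sigma> 0 z}"
        using True2 c3.orb_cut_pair[of "{0, j}"] c3.orb_cut_pair_y t0 by auto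
      moreover have "orb (cut \<sigma> z j) {0, j} u = {z, \<sigma> 0 z}"
        using True2 c2.orb_cut_pair[of "{0, j}"] c2.orb_cut_pair_y by auto
      ultimately show ?thesis using True by simp
    next
      case False
      have "orb (cut ?t z j) {0, j} u = orb ?t {0, j} u - {z, \<sigma> 0 z}"
        using c3.orb_cut_isolate[of u] that False t0 by auto
      moreover have "orb (cut \<sigma> z j) {0, j} u = orb \<sigma> {0, j} u - {z, \<sigma> 0 z}"
        using c2.orb_cut_isolate[of u] that False by auto
      ultimately show ?thesis using sub[of u j] that True by auto
    qed
  qed
  have inv3: "inv_on (cut ?t z j) ?C V" by (rule c3.inv_on_cut[OF inv(2)])
  have inv2: "inv_on (cut \<sigma> z j) ?C V" by (rule c2.inv_on_cut[OF inv(1)])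
  have "orb (cut ?t z j) ?C w \<subseteq> orb (cut \<sigma> z j) ?C w \<inter> V"
  proof (rule orb_subset)
    fix u c assume u: "u \<in> orb (cut \<sigma> z j) ?C w \<inter> V" and c: "c \<in> ?C"
    have "cut ?t z j c u \<in> orb (cut ?t z j) {0, c} u" by (rule orb_step) auto
    then have "cut ?t z j c u \<in> orb (cut \<sigma> z j) {0, c} u" using sub2[of u c] u c by blast
    also have "\<dots> \<subseteq> orb (cut \<sigma> z j) ?C u" using c by (intro orb_mono) auto
    also have "\<dots> \<subseteq> orb (cut \<sigma> z j) ?C w" using u orb_trans by blast
    finally show "cut ?t z j c u \<in> orb (cut \<sigma> z j) ?C w \<inter> V"
      using inv3 u c by (auto simp: inv_on_def)
  qed (use w in auto)
  then show ?thesis by blast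
qed

text \<open>A bridge remains a bridge when another edge is deleted. The first cut may have changed
  the neighbour of \<open>z\<close>, but the old and the new neighbour lie on the same remnant of
  the 0j-cycle of \<open>z\<close>, so reaching one means reaching the other.\<close>

lemma acyc_cut:
  assumes g: "gem V \<sigma> B" and ac: "acyc V \<sigma> B" and x: "x \<in> V" and i: "i \<in> B"
  shows "acyc V (cut \<sigma> x i) B"
  unfolding acyc_def
proof (intro ballI impI notI)
  let ?t = "cut \<sigma> x i" and ?C = "insert 0 B"
  fix z j assume z: "z \<in> V" and j: "j \<in> B" and nt: "?t j z \<noteq> ?t 0 z"
    and mem: "?t j z \<in> orb (cut ?t z j) ?C z"
  interpret c1: cut_at \<sigma> V x i by (rule gem_cut_at[OF g x i])
  interpret c2: cut_at \<sigma> V z j by (rule gem_cut_at[OF g z j])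
  have g': "gem V ?t B" by (rule gem_cut[OF g x i])
  interpret c3: cut_at ?t V z j by (rule gem_cut_at[OF g' z j])
  have inv: "inv_on \<sigma> ?C V" using g by (auto simp: gem_def)
  have t0: "?t 0 = \<sigma> 0" by (rule c1.cut_vals)
  have sub: "orb ?t {0, j} z \<subseteq> orb \<sigma> {0, j} z"
    using c1.orb_cut_subset[OF inv_on_mono[OF inv, of "{0, j}"], of z] z j by auto
  have nts: "\<sigma> j z \<noteq> \<sigma> 0 z" using c1.nontriv_cut[of j z] nt z t0 by simp
  have "?t j z \<in> orb ?t {0, j} z" by (rule orb_step) auto
  then have p: "?t j z \<in> orb \<sigma> {0, j} z" using sub by blast
  have pz: "?t j z \<notin> {z, \<sigma> 0 z}" using nt t0 c3.basics by auto
  have pV: "?t j z \<in> V" using c3.basics by auto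
  have sp: "\<sigma> j z \<in> orb \<sigma> {0, j} z" by (rule orb_step) auto
  have "orb \<sigma> {0, j} (?t j z) = orb \<sigma> {0, j} z"
    by (rule orb_eq[OF c2.inv0i z p])
  then have "\<sigma> j z \<in> orb \<sigma> {0, j} (?t j z) - {z, \<sigma> 0 z}"
    using sp nts c2.basics by auto
  then have "\<sigma> j z \<in> orb (cut \<sigma> z j) {0, j} (?t j z)"
    using c2.orb_cut_isolate[OF pV pz] by simp
  also have "\<dots> \<subseteq> orb (cut \<sigma> z j) ?C (?t j z)" using j by (intro orb_mono) auto
  also have "\<dots> \<subseteq> orb (cut \<sigma> z j) ?C z" using subsetD[OF orb_cut_cut_subset[OF g x i z j z] mem] by (rule orb_trans)
  finally show False using ac z j nts unfolding acyc_def by blast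
qed

lemma card_cls_trivial:
  assumes "finite V" "inv_on \<sigma> C V" "0 \<in> C" "\<And>c v. c \<in> C \<Longrightarrow> v \<in> V \<Longrightarrow> \<sigma> c v = \<sigma> 0 v"
  shows "2 * card (cls \<sigma> C V) = card V"
proof -
  have "orb \<sigma> C v = {v, \<sigma> 0 v}" if "v \<in> V" for v
  proof
    show "orb \<sigma> C v \<subseteq> {v, \<sigma> 0 v}"
    proof (rule orb_subset)
      fix u c assume u: "u \<in> {v, \<sigma> 0 v}" and c: "c \<in> C"
      have "\<sigma> 0 v \<in> V" "\<sigma> 0 (\<sigma> 0 v) = v" using inv_onD[OF assms(2,3) that] by auto
      then show "\<sigma> c u \<in> {v, \<sigma> 0 v}" using u assms(4)[OF c] that by auto
    qed simp
    show "{v, \<sigma> 0 v} \<subseteq> orb \<sigma> C v"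
      using orb_step[of v \<sigma> C v 0] assms(3) by auto
  qed
  moreover have "card {v, \<sigma> 0 v} = 2" if "v \<in> V" for v
    using inv_onD(3)[OF assms(2,3) that] by (auto simp: card_insert_if)
  ultimately have "card X = 2" if "X \<in> cls \<sigma> C V" for X
    using that unfolding cls_def by auto
  then have "(\<Sum>X\<in>cls \<sigma> C V. card X) = (\<Sum>X\<in>cls \<sigma> C V. 2)" by (rule sum.cong[OF refl])
  then show ?thesis using sum_card_cls[OF assms(2,1)] by simp
qed

lemma card_cls_cut_colour:
  assumes "gem V \<sigma> B" "x \<in> V" "i \<in> B" "\<sigma> i x \<noteq> \<sigma> 0 x" "j \<in> B"
  shows "card (cls (cut \<sigma> x i) {0, j} V) = card (cls \<sigma> {0, j} V) + (if j = i then 1 else 0)"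
proof -
  interpret cut_at \<sigma> V x i by (rule gem_cut_at[OF assms(1-3)])
  have g: "finite V" "inv_on \<sigma> (insert 0 B) V" using assms(1) by (auto simp: gem_def)
  show ?thesis
  proof (cases "j = i")
    case True
    have "a \<notin> orb \<tau> {0, i} x" using orb_cut_pair[of "{0, i}"] basics assms(4) by auto
    then show ?thesis using card_cls_cut[OF inv0i] g(1) True by simp
  next
    case False
    have "cls \<tau> {0, j} V = cls \<sigma> {0, j} V"
      unfolding cls_def
    proof (intro image_cong refl orb_cong)
      show "inv_on \<sigma> {0, j} V" using g(2) assms(5) by (auto intro: inv_on_mono)
    qed (use False i0 in \<open>auto simp: cut_other\<close>)
    then show ?thesis using False by simp
  qed
qed

text \<open>The cyclomatic number is nonnegative and vanishes for forests, multiplied by two: the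
  incidence graph has card V / 2 edge vertices, one vertex per 0i-cycle, and card B * card V / 2
  edges. A cut raises the left side by two and the right side by two or, if the incidence is no
  bridge, by nothing. When nothing is left to cut, every component is a single colour-0 edge and
  equality holds.\<close>

lemma excess:
  assumes "gem V \<sigma> B"
  shows "card V + 2 * (\<Sum>i\<in>B. card (cls \<sigma> {0, i} V)) \<le> 2 * card (cls \<sigma> (insert 0 B) V) + card B * card V
    \<and> (acyc V \<sigma> B \<longrightarrow> card V + 2 * (\<Sum>i\<in>B. card (cls \<sigma> {0, i} V)) = 2 * card (cls \<sigma> (insert 0 B) V) + card B * card V)"
  using assms
proof (induction "card {(x, j). x \<in> V \<and> j \<in> B \<and> \<sigma> j x \<noteq> \<sigma> 0 x}" arbitrary: \<sigma> rule: less_induct)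
  case less
  have g: "finite V" "finite B" "0 \<notin> B" "inv_on \<sigma> (insert 0 B) V" using less.prems by (auto simp: gem_def)
  show ?case
  proof (cases "\<exists>x\<in>V. \<exists>i\<in>B. \<sigma> i x \<noteq> \<sigma> 0 x")
    case False
    have "2 * card (cls \<sigma> {0, i} V) = card V" if "i \<in> B" for i
      using g that False by (intro card_cls_trivial) (auto intro: inv_on_mono)
    then have "2 * (\<Sum>i\<in>B. card (cls \<sigma> {0, i} V)) = (\<Sum>i\<in>B. card V)"
      by (simp add: sum_distrib_left)
    moreover have "2 * card (cls \<sigma> (insert 0 B) V) = card V"
      using g False by (intro card_cls_trivial) auto
    ultimately show ?thesis by simp
  next
    case True
    then obtain x i where x: "x \<in> V" and i: "i \<in> B" and nt: "\<sigma> i x \<noteq> \<sigma> 0 x" by blast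
    interpret cut_at \<sigma> V x i by (rule gem_cut_at[OF less.prems x i])
    let ?t = "cut \<sigma> x i"
    have g': "gem V ?t B" by (rule gem_cut[OF less.prems x i])
    have fin: "finite {(x, j). x \<in> V \<and> j \<in> B \<and> \<sigma> j x \<noteq> \<sigma> 0 x}"
      by (rule finite_subset[of _ "V \<times> B"]) (use g in auto)
    have "{(x, j). x \<in> V \<and> j \<in> B \<and> ?t j x \<noteq> ?t 0 x} \<subset> {(x, j). x \<in> V \<and> j \<in> B \<and> \<sigma> j x \<noteq> \<sigma> 0 x}"
      (is "?N' \<subset> ?N")
    proof (rule psubsetI)
      show "?N' \<subseteq> ?N" using nontriv_cut cut_vals by auto
      have "(x, i) \<in> ?N" "(x, i) \<notin> ?N'" using x i nt cut_vals by auto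
      then show "?N' \<noteq> ?N" by blast
    qed
    then have "card ?N' < card ?N" using fin by (rule psubset_card_mono[rotated])
    note IH = less.hyps[OF this g']
    note F = card_cls_cut_colour[OF less.prems x i nt]
    have SF: "(\<Sum>j\<in>B. card (cls ?t {0, j} V)) = (\<Sum>j\<in>B. card (cls \<sigma> {0, j} V)) + 1"
      using i g(2) by (simp add: F sum.distrib)
    have comp: "card (cls ?t (insert 0 B) V) = card (cls \<sigma> (insert 0 B) V) + (if a \<in> orb ?t (insert 0 B) x then 0 else 1)"
      using card_cls_cut[OF g(4)] g(1) i by simp
    show ?thesis
    proof (intro conjI impI)
      show "card V + 2 * (\<Sum>i\<in>B. card (cls \<sigma> {0, i} V)) \<le> 2 * card (cls \<sigma> (insert 0 B) V) + card B * card V"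
        using IH comp SF by (auto split: if_splits)
      assume ac: "acyc V \<sigma> B"
      then have "a \<notin> orb ?t (insert 0 B) x" using x i nt by (auto simp: acyc_def)
      then show "card V + 2 * (\<Sum>i\<in>B. card (cls \<sigma> {0, i} V)) = 2 * card (cls \<sigma> (insert 0 B) V) + card B * card V"
        using IH comp SF acyc_cut[OF less.prems ac x i] by simp
    qed
  qed
qed

text \<open>A connected incidence graph with 1/2 card V edge vertices, one vertex per 0i-cycle and
1/2 card B * card V incidences is a tree iff its Euler characteristic is one, which is the last condition
multiplied by two.\<close>
definition tree :: "nat set \<Rightarrow> (nat \<Rightarrow> nat \<Rightarrow> nat) \<Rightarrow> nat set \<Rightarrow> bool" where
  "tree V \<sigma> B \<longleftrightarrow> gem V \<sigma> B \<and> V \<noteq> {} \<and> (\<forall>v\<in>V. orb \<sigma> (insert 0 B) v = V) \<and>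
     card V + 2 * (\<Sum>i\<in>B. card (cls \<sigma> {0, i} V)) = 2 + card B * card V"

text \<open>A cycle of length two has two vertices of weight 2; a longer one has at least four
  vertices, each of weight at least 1.\<close>

lemma card_cls_le_weight:
  assumes "finite V" "inv_on \<sigma> {0, i} V" "i \<noteq> 0"
  shows "4 * card (cls \<sigma> {0, i} V) \<le> (\<Sum>v\<in>V. if \<sigma> i v = \<sigma> 0 v then 2 else 1)"
proof -
  let ?g = "\<lambda>v. if \<sigma> i v = \<sigma> 0 v then 2 else (1::nat)"
  have sub: "X \<subseteq> V" if "X \<in> cls \<sigma> {0, i} V" for X
    using Union_cls[OF assms(2)] that by blast
  have ge: "4 \<le> (\<Sum>v\<in>X. ?g v)" if X: "X \<in> cls \<sigma> {0, i} V" for X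
  proof -
    obtain v where v: "v \<in> V" "X = orb \<sigma> {0, i} v" using X by (auto simp: cls_def)
    interpret cut_at \<sigma> V v i using assms v by unfold_locales auto
    have fX: "finite X" using sub[OF X] assms(1) finite_subset by blast
    have mem: "v \<in> X" "\<sigma> 0 v \<in> X" "\<sigma> i v \<in> X" "\<sigma> i (\<sigma> 0 v) \<in> X"
      unfolding v(2) by (auto intro!: orb_step)
    show ?thesis
    proof (cases "\<sigma> i v = \<sigma> 0 v")
      case True
      then have "\<sigma> i (\<sigma> 0 v) = \<sigma> 0 (\<sigma> 0 v)" using basics by metis
      then have "(\<Sum>u\<in>{v, \<sigma> 0 v}. ?g u) = 4" using True basics by simp
      moreover have "(\<Sum>u\<in>{v, \<sigma> 0 v}. ?g u) \<le> (\<Sum>u\<in>X. ?g u)"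
        using mem fX by (intro sum_mono2) auto
      ultimately show ?thesis by simp
    next
      case False
      then have "card {v, \<sigma> 0 v, \<sigma> i v, \<sigma> i (\<sigma> 0 v)} = 4"
        using basics triv_iff by (auto simp: card_insert_if)
      moreover have "card {v, \<sigma> 0 v, \<sigma> i v, \<sigma> i (\<sigma> 0 v)} \<le> card X"
        using mem fX by (intro card_mono) auto
      moreover have "card X \<le> (\<Sum>u\<in>X. ?g u)"
        using sum_mono[of X "\<lambda>_. 1" ?g] by simp
      ultimately show ?thesis by linarith
    qed
  qed
  have "4 * card (cls \<sigma> {0, i} V) = (\<Sum>X\<in>cls \<sigma> {0, i} V. 4)" by simp
  also have "\<dots> \<le> (\<Sum>X\<in>cls \<sigma> {0, i} V. \<Sum>v\<in>X. ?g v)" by (rule sum_mono) (rule ge)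
  also have "\<dots> = (\<Sum>v\<in>\<Union> (cls \<sigma> {0, i} V). ?g v)"
  proof -
    have "\<forall>X\<in>cls \<sigma> {0, i} V. finite X" using sub assms(1) by (meson finite_subset)
    moreover have "\<forall>X\<in>cls \<sigma> {0, i} V. \<forall>Y\<in>cls \<sigma> {0, i} V. X \<noteq> Y \<longrightarrow> X \<inter> Y = {}"
      by (intro ballI impI cls_disjoint[OF assms(2)])
    ultimately show ?thesis by (simp add: sum.Union_disjoint)
  qed
  finally show ?thesis using Union_cls[OF assms(2)] by simp
qed

text \<open>Double counting: if every vertex had two nontrivial colours, the weights of the
  preceding lemma would sum to at most (2 card B - 2) card V, which is four less than four times the
  number of cycles demanded by the tree equation.\<close>

lemma tree_leaf:
  assumes t: "tree V \<sigma> B" and "card V > 2"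
  shows "\<exists>x\<in>V. \<exists>i\<in>B. \<sigma> i x \<noteq> \<sigma> 0 x \<and> (\<forall>j\<in>B - {i}. \<sigma> j x = \<sigma> 0 x)"
proof -
  have g: "finite V" "finite B" "0 \<notin> B" "inv_on \<sigma> (insert 0 B) V"
    and conn: "\<And>v. v \<in> V \<Longrightarrow> orb \<sigma> (insert 0 B) v = V"
    and eq: "card V + 2 * (\<Sum>i\<in>B. card (cls \<sigma> {0, i} V)) = 2 + card B * card V"
    using t by (auto simp: tree_def gem_def)
  let ?g = "\<lambda>i v. if \<sigma> i v = \<sigma> 0 v then 2 else (1::nat)"
  let ?N = "\<lambda>v. {i\<in>B. \<sigma> i v \<noteq> \<sigma> 0 v}"
  have gsum: "(\<Sum>i\<in>B. ?g i v) + card (?N v) = 2 * card B" for v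
  proof -
    have "card (?N v) = (\<Sum>i\<in>B. if \<sigma> i v \<noteq> \<sigma> 0 v then 1 else 0)"
      using g(2) by (simp add: sum.If_cases Int_def)
    then have "(\<Sum>i\<in>B. ?g i v) + card (?N v) = (\<Sum>i\<in>B. ?g i v + (if \<sigma> i v \<noteq> \<sigma> 0 v then 1 else 0))"
      by (simp add: sum.distrib)
    also have "\<dots> = (\<Sum>i\<in>B. 2)" by (rule sum.cong) auto
    finally show ?thesis by simp
  qed
  \<comment> \<open>A vertex without nontrivial colour would form a whole component together with
    its colour-0 neighbour.\<close>
  have pos: "?N v \<noteq> {}" if "v \<in> V" for v
  proof
    assume "?N v = {}"
    then have triv: "\<sigma> c v = \<sigma> 0 v" if "c \<in> insert 0 B" for c using that by auto
    have y: "\<sigma> 0 v \<in> V" "\<sigma> 0 (\<sigma> 0 v) = v" using inv_onD[OF g(4), of 0 v] \<open>v \<in> V\<close> by auto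
    have "orb \<sigma> (insert 0 B) v \<subseteq> {v, \<sigma> 0 v}"
    proof (rule orb_subset)
      fix u c assume u: "u \<in> {v, \<sigma> 0 v}" and c: "c \<in> insert 0 B"
      have "\<sigma> c (\<sigma> 0 v) = v" using triv[OF c] inv_onD(2)[OF g(4) c \<open>v \<in> V\<close>] by simp
      then show "\<sigma> c u \<in> {v, \<sigma> 0 v}" using u triv[OF c] by auto
    qed simp
    then have "card V \<le> card {v, \<sigma> 0 v}" using conn[OF that] by (intro card_mono) auto
    also have "\<dots> \<le> 2" by (simp add: card_insert_if)
    finally show False using assms(2) by simp
  qed
  have "\<exists>x\<in>V. card (?N x) < 2"
  proof (rule ccontr)
    assume "\<not> ?thesis"
    then have two: "card (?N v) \<ge> 2" if "v \<in> V" for v using that by (meson not_less)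
    have "4 * (\<Sum>i\<in>B. card (cls \<sigma> {0, i} V)) = (\<Sum>i\<in>B. 4 * card (cls \<sigma> {0, i} V))"
      by (simp add: sum_distrib_left)
    also have "\<dots> \<le> (\<Sum>i\<in>B. \<Sum>v\<in>V. ?g i v)"
    proof (rule sum_mono)
      fix i assume i: "i \<in> B"
      then have "inv_on \<sigma> {0, i} V" using g(4) by (auto intro: inv_on_mono)
      moreover have "i \<noteq> 0" using i g(3) by metis
      ultimately show "4 * card (cls \<sigma> {0, i} V) \<le> (\<Sum>v\<in>V. ?g i v)"
        by (rule card_cls_le_weight[OF g(1)])
    qed
    also have "\<dots> = (\<Sum>v\<in>V. \<Sum>i\<in>B. ?g i v)" by (rule sum.swap)
    finally have "4 * (\<Sum>i\<in>B. card (cls \<sigma> {0, i} V)) + 2 * card V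
        \<le> (\<Sum>v\<in>V. \<Sum>i\<in>B. ?g i v) + (\<Sum>v\<in>V. card (?N v))"
      using sum_mono[of V "\<lambda>_. 2" "\<lambda>v. card (?N v)"] two by simp
    also have "\<dots> = (\<Sum>v\<in>V. 2 * card B)"
      unfolding sum.distrib[symmetric] by (rule sum.cong) (use gsum in auto)
    finally show False using eq by (simp add: algebra_simps)
  qed
  then obtain x where x: "x \<in> V" "card (?N x) < 2" by blast
  have "card (?N x) = 1"
  proof -
    have "card (?N x) > 0" unfolding card_gt_0_iff using pos[OF x(1)] g(2) by simp
    then show ?thesis using x(2) by linarith
  qed
  then obtain i where "?N x = {i}" by (auto simp: card_1_singleton_iff)
  then show ?thesis using x(1) by blast
qed

text \<open>After the cut all colours of \<open>B\<close> agree on the pair x, y, which can then be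
  dropped. The cut gains one cycle and the pair takes card B cycles of length two with it, which is
  the change that the tree equation needs when card V drops by two.\<close>

lemma tree_remove_leaf:
  assumes t: "tree V \<sigma> B" and x: "x \<in> V" and i: "i \<in> B" and nt: "\<sigma> i x \<noteq> \<sigma> 0 x"
    and leaf: "\<And>j. j \<in> B - {i} \<Longrightarrow> \<sigma> j x = \<sigma> 0 x"
  shows "tree (V - {x, \<sigma> 0 x}) (cut \<sigma> x i) B" "\<sigma> i x \<in> V - {x, \<sigma> 0 x}" "\<sigma> i (\<sigma> 0 x) \<in> V - {x, \<sigma> 0 x}"
proof -
  have gm: "gem V \<sigma> B" and g: "finite V" "finite B" "0 \<notin> B" "inv_on \<sigma> (insert 0 B) V"
    and conn: "\<And>v. v \<in> V \<Longrightarrow> orb \<sigma> (insert 0 B) v = V"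
    and eq: "card V + 2 * (\<Sum>i\<in>B. card (cls \<sigma> {0, i} V)) = 2 + card B * card V"
    using t by (auto simp: tree_def gem_def)
  interpret cut_at \<sigma> V x i by (rule gem_cut_at[OF gm x i])
  let ?V = "V - {x, y}"
  show a': "a \<in> ?V" using basics nt by auto
  show "b \<in> ?V" using basics nt triv_iff by auto
  have inv': "inv_on \<tau> (insert 0 B) V" by (rule inv_on_cut[OF g(4)])
  have tx: "\<tau> c x = y" if "c \<in> insert 0 B" for c
    using that leaf[of c] cut_vals cut_other[of c i \<sigma> x] by (cases "c = i") auto
  have ty: "\<tau> c y = x" if "c \<in> insert 0 B" for c
    using inv_onD(2)[OF inv' that x] tx[OF that] by simp
  have tV: "inv_on \<tau> (insert 0 B) ?V"
    unfolding inv_on_def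
  proof (intro ballI)
    fix c u assume c: "c \<in> insert 0 B" and u: "u \<in> ?V"
    have *: "\<tau> c u \<in> V" "\<tau> c (\<tau> c u) = u" "\<tau> c u \<noteq> u" using inv_onD[OF inv' c] u by auto
    have "\<tau> c u \<notin> {x, y}" using * tx[OF c] ty[OF c] u by auto
    then show "\<tau> c u \<in> ?V \<and> \<tau> c (\<tau> c u) = u \<and> \<tau> c u \<noteq> u" using * by auto
  qed
  have gV: "gem ?V \<tau> B" using g tV by (auto simp: gem_def)
  have orbx: "orb \<tau> C x = {x, y}" if "C \<subseteq> insert 0 B" "0 \<in> C" for C
  proof
    show "orb \<tau> C x \<subseteq> {x, y}"
      by (rule orb_subset) (use that tx ty in auto)
  qed (use orb_cut_y that in auto)
  have "V = {x, y} \<union> orb \<tau> (insert 0 B) a"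
    using orb_uncut[OF g(4)] i conn[OF x] orbx[of "insert 0 B"] by simp
  moreover have "orb \<tau> (insert 0 B) a \<subseteq> ?V" by (rule orb_in[OF tV a'])
  ultimately have oa: "orb \<tau> (insert 0 B) a = ?V" by blast
  have conn': "orb \<tau> (insert 0 B) v = ?V" if "v \<in> ?V" for v
    using orb_eq[OF tV a', of v] that oa by simp
  have F: "card (cls \<tau> {0, j} ?V) + 1 = card (cls \<sigma> {0, j} V) + (if j = i then 1 else 0)" if "j \<in> B" for j
  proof -
    have jB: "{0, j} \<subseteq> insert 0 B" using that by auto
    have "cls \<tau> {0, j} V = insert {x, y} (cls \<tau> {0, j} ?V)"
    proof -
      have "V = {x, y} \<union> ?V" using x basics by auto
      then have "cls \<tau> {0, j} V = orb \<tau> {0, j} ` {x, y} \<union> cls \<tau> {0, j} ?V"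
        unfolding cls_def by (metis image_Un)
      moreover have "orb \<tau> {0, j} y = {x, y}"
        using orb_eq[OF inv_on_mono[OF inv' jB] x, of y] orb_cut_y[of "{0, j}"] orbx[OF jB] by simp
      ultimately show ?thesis using orbx[OF jB] by auto
    qed
    moreover have "{x, y} \<notin> cls \<tau> {0, j} ?V"
      using Union_cls[OF inv_on_mono[OF tV jB]] by blast
    ultimately have "card (cls \<tau> {0, j} V) = card (cls \<tau> {0, j} ?V) + 1"
      using g(1) by simp
    then show ?thesis using card_cls_cut_colour[OF gm x i nt that] by simp
  qed
  have "(\<Sum>j\<in>B. card (cls \<tau> {0, j} ?V)) + card B = (\<Sum>j\<in>B. card (cls \<tau> {0, j} ?V) + 1)"
    unfolding sum.distrib by simp
  also have "\<dots> = (\<Sum>j\<in>B. card (cls \<sigma> {0, j} V) + (if j = i then 1 else 0))"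
    by (rule sum.cong) (use F in auto)
  also have "\<dots> = (\<Sum>j\<in>B. card (cls \<sigma> {0, j} V)) + 1"
    unfolding sum.distrib using i g(2) by simp
  finally have SF: "(\<Sum>j\<in>B. card (cls \<tau> {0, j} ?V)) + card B = (\<Sum>j\<in>B. card (cls \<sigma> {0, j} V)) + 1" .
  have "card ?V = card V - 2" using x basics g(1) by (simp add: card_Diff_subset)
  moreover have "card {x, y} \<le> card V" using x basics g(1) by (intro card_mono) auto
  then have "card V \<ge> 2" using basics by simp
  ultimately have cV: "card V = card ?V + 2" by simp
  have "card ?V + 2 * (\<Sum>i\<in>B. card (cls \<tau> {0, i} ?V)) = 2 + card B * card ?V"
    using eq SF unfolding cV by simp
  then show "tree ?V \<tau> B" unfolding tree_def using gV conn' a' by blast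
qed

lemma tree_induct [consumes 1, case_names base step]:
  assumes "tree V \<sigma> B"
    and base: "\<And>V \<sigma> x. tree V \<sigma> B \<Longrightarrow> V = {x, \<sigma> 0 x} \<Longrightarrow> x \<noteq> \<sigma> 0 x \<Longrightarrow> P V \<sigma>"
    and step: "\<And>V \<sigma> x i. tree V \<sigma> B \<Longrightarrow> x \<in> V \<Longrightarrow> i \<in> B \<Longrightarrow> \<sigma> i x \<noteq> \<sigma> 0 x \<Longrightarrow>
       (\<And>j. j \<in> B - {i} \<Longrightarrow> \<sigma> j x = \<sigma> 0 x) \<Longrightarrow> tree (V - {x, \<sigma> 0 x}) (cut \<sigma> x i) B \<Longrightarrow>
       P (V - {x, \<sigma> 0 x}) (cut \<sigma> x i) \<Longrightarrow> P V \<sigma>"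
  shows "P V \<sigma>"
  using assms(1)
proof (induction "card V" arbitrary: V \<sigma> rule: less_induct)
  case less
  have g: "finite V" "inv_on \<sigma> (insert 0 B) V" using less.prems by (auto simp: tree_def gem_def)
  obtain x where x: "x \<in> V" using less.prems by (auto simp: tree_def)
  have y: "\<sigma> 0 x \<in> V" "\<sigma> 0 x \<noteq> x" using inv_onD[OF g(2) _ x] by auto
  show ?case
  proof (cases "card V > 2")
    case False
    have "{x, \<sigma> 0 x} = V"
      by (rule card_subset_eq) (use g x y False card_mono[of V "{x, \<sigma> 0 x}"] in auto)
    then show ?thesis using base[OF less.prems, of x] y by auto
  next
    case True
    then obtain x i where xi: "x \<in> V" "i \<in> B" "\<sigma> i x \<noteq> \<sigma> 0 x" "\<And>j. j \<in> B - {i} \<Longrightarrow> \<sigma> j x = \<sigma> 0 x"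
      using tree_leaf[OF less.prems True] by blast
    have t': "tree (V - {x, \<sigma> 0 x}) (cut \<sigma> x i) B"
      by (rule tree_remove_leaf(1)[OF less.prems xi])
    have "card (V - {x, \<sigma> 0 x}) < card V"
      by (rule psubset_card_mono) (use g xi in auto)
    then show ?thesis using step[OF less.prems xi t'] less.hyps t' by blast
  qed
qed

lemma tree_base_vals:
  assumes "tree V \<sigma> B" "V = {x, \<sigma> 0 x}" "x \<noteq> \<sigma> 0 x" "c \<in> insert 0 B"
  shows "\<sigma> c x = \<sigma> 0 x" "\<sigma> c (\<sigma> 0 x) = x"
proof -
  have inv: "inv_on \<sigma> (insert 0 B) V" using assms(1) by (auto simp: tree_def gem_def)
  show "\<sigma> c x = \<sigma> 0 x" using inv_onD[OF inv assms(4), of x] assms(2) by auto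
  then show "\<sigma> c (\<sigma> 0 x) = x" using inv_onD[OF inv assms(4), of x] assms(2) by auto
qed

text \<open>A leaf pair is joined by any colour j other than i, which is where the second colour is
  needed, and the path a, x, y, b of colours i, j, i replaces the edge a-b of the smaller
  tree.\<close>

lemma tree_connected_without_0:
  assumes "tree V \<sigma> B" "2 \<le> card B" "v \<in> V"
  shows "orb \<sigma> B v = V"
  using assms(1,3)
proof (induction arbitrary: v rule: tree_induct)
  case (base V \<sigma> x)
  have inv: "inv_on \<sigma> B V" using base(1) by (auto simp: tree_def gem_def intro: inv_on_mono)
  obtain c where c: "c \<in> B" using assms(2) by fastforce
  have "\<sigma> c x = \<sigma> 0 x" "\<sigma> c (\<sigma> 0 x) = x"
    using tree_base_vals[OF base(1-3), of c] c by auto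
  then have "V \<subseteq> orb \<sigma> B v"
    using base.prems base.hyps(2) orb_step[OF orb_self[of v \<sigma> B] c] orb_self[of v \<sigma> B] by auto
  then show ?case using orb_in[OF inv base.prems] by blast
next
  case (step V \<sigma> x i)
  have gm: "gem V \<sigma> B" and g: "inv_on \<sigma> (insert 0 B) V"
    using step.hyps(1) by (auto simp: tree_def gem_def)
  have inv: "inv_on \<sigma> B V" using g by (auto intro: inv_on_mono)
  interpret cut_at \<sigma> V x i by (rule gem_cut_at[OF gm step.hyps(2,3)])
  let ?V = "V - {x, y}"
  have inv': "inv_on \<tau> B ?V" using step.hyps(6) by (auto simp: tree_def gem_def intro: inv_on_mono)
  have ab: "a \<in> ?V" "b \<in> ?V" using tree_remove_leaf(2,3)[OF step.hyps(1-5)] by auto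
  have "\<not> B \<subseteq> {i}"
  proof
    assume "B \<subseteq> {i}"
    then have "card B \<le> card {i}" by (intro card_mono) auto
    then show False using assms(2) by simp
  qed
  then obtain j where j: "j \<in> B - {i}" by blast
  have jx: "\<sigma> j x = y" using step.hyps(5)[OF j] .
  have xa: "x \<in> orb \<sigma> B a" using orb_step[OF orb_self[of a \<sigma> B] step.hyps(3)] basics by simp
  then have ya: "y \<in> orb \<sigma> B a" using orb_step[of x \<sigma> B a j] j jx by simp
  then have ba: "b \<in> orb \<sigma> B a" using orb_step[of y \<sigma> B a i] step.hyps(3) by simp
  have "orb \<tau> B a \<subseteq> orb \<sigma> B a \<inter> ?V"
  proof (rule orb_subset)
    fix u c assume u: "u \<in> orb \<sigma> B a \<inter> ?V" and c: "c \<in> B"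
    have "\<tau> c u \<in> orb \<sigma> B a"
    proof (cases "c = i \<and> u \<in> {a, b}")
      case True
      then show ?thesis using cut_vals ba by auto
    next
      case False
      then have "\<tau> c u = \<sigma> c u" using cut_val_away[of u c] cut_other u by auto
      then show ?thesis using u c orb_step[of u \<sigma> B a c] by simp
    qed
    then show "\<tau> c u \<in> orb \<sigma> B a \<inter> ?V" using inv_onD(1)[OF inv' c, of u] u by simp
  qed (use ab in simp)
  moreover have "orb \<tau> B a = ?V" using step.IH[OF ab(1)] .
  ultimately have "V \<subseteq> orb \<sigma> B a" using xa ya by blast
  then have oa: "orb \<sigma> B a = V" using orb_in[OF inv basics(2)] by blast
  then show ?case using orb_eq[OF inv basics(2), of v] step.prems by simp
qed

text \<open>Order zero thus forces bipartiteness, so the two families share their graphs of order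
  zero and one encoding serves both.\<close>

lemma tree_bipartite:
  assumes "tree V \<sigma> B"
  shows "\<exists>black :: nat \<Rightarrow> bool. \<forall>c\<in>insert 0 B. \<forall>v\<in>V. black (\<sigma> c v) \<noteq> black v"
  using assms
proof (induction rule: tree_induct)
  case (base V \<sigma> x)
  have "\<forall>c\<in>insert 0 B. \<forall>v\<in>V. (\<sigma> c v = x) \<noteq> (v = x)"
  proof (intro ballI)
    fix c v assume c: "c \<in> insert 0 B" and "v \<in> V"
    then have "v = x \<or> v = \<sigma> 0 x" using base.hyps(2) by simp
    then show "(\<sigma> c v = x) \<noteq> (v = x)"
      using tree_base_vals[OF base.hyps(1-3) c] base.hyps(3) by metis
  qed
  then show ?case by (rule exI[where P = "\<lambda>bl. \<forall>c\<in>insert 0 B. \<forall>v\<in>V. bl (\<sigma> c v) \<noteq> bl v"])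
next
  case (step V \<sigma> x i)
  have gm: "gem V \<sigma> B" and g: "inv_on \<sigma> (insert 0 B) V"
    using step.hyps(1) by (auto simp: tree_def gem_def)
  interpret cut_at \<sigma> V x i by (rule gem_cut_at[OF gm step.hyps(2,3)])
  let ?V = "V - {x, y}"
  have inv': "inv_on \<tau> (insert 0 B) ?V" using step.hyps(6) by (auto simp: tree_def gem_def)
  have ab: "a \<in> ?V" "b \<in> ?V" using tree_remove_leaf(2,3)[OF step.hyps(1-5)] by auto
  from step.IH obtain bl :: "nat \<Rightarrow> bool" where bl: "\<forall>c\<in>insert 0 B. \<forall>v\<in>?V. bl (\<tau> c v) \<noteq> bl v" ..
  let ?bl = "bl(x := \<not> bl a, y := bl a)"
  have blab: "bl b \<noteq> bl a" using bl[rule_format, of i a] step.hyps(3) ab(1) cut_vals by simp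
  have tx: "\<sigma> c x = (if c = i then a else y)" "\<sigma> c y = (if c = i then b else x)" if c: "c \<in> insert 0 B" for c
  proof -
    show *: "\<sigma> c x = (if c = i then a else y)" using step.hyps(5)[of c] c by auto
    then show "\<sigma> c y = (if c = i then b else x)"
      using inv_onD(2)[OF g c step.hyps(2)] by (cases "c = i") auto
  qed
  have "?bl (\<sigma> c v) \<noteq> ?bl v" if c: "c \<in> insert 0 B" and v: "v \<in> V" for c v
  proof (cases "v \<in> {x, y}")
    case True
    then show ?thesis using tx[OF c] ab blab basics i0 by (auto split: if_splits)
  next
    case False
    show ?thesis
    proof (cases "c = i \<and> v \<in> {a, b}")
      case True
      then show ?thesis using basics ab blab by auto
    next
      case F2: False
      then have eq: "\<tau> c v = \<sigma> c v" using cut_val_away[of v c] cut_other False by auto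
      have vV: "v \<in> ?V" using v False by simp
      have "\<tau> c v \<in> ?V" using inv_onD(1)[OF inv' c vV] .
      then have "\<sigma> c v \<notin> {x, y}" using eq by auto
      then show ?thesis using bl[rule_format, OF c vV] eq False by simp
    qed
  qed
  then show ?case by (intro exI[where x = ?bl] ballI)
qed

section \<open>Flag spheres\<close>

definition clq :: "'a set \<Rightarrow> ('a \<Rightarrow> 'a \<Rightarrow> bool) \<Rightarrow> 'a set set" where
  "clq X A = {C. C \<subseteq> X \<and> finite C \<and> C \<noteq> {} \<and> (\<forall>u\<in>C. \<forall>v\<in>C. u \<noteq> v \<longrightarrow> A u v)}"

definition add_edge :: "('a \<Rightarrow> 'a \<Rightarrow> bool) \<Rightarrow> 'a \<Rightarrow> 'a \<Rightarrow> 'a \<Rightarrow> 'a \<Rightarrow> bool" where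
  "add_edge A a b u v \<longleftrightarrow> A u v \<or> (u = a \<and> v = b) \<or> (u = b \<and> v = a)"

text \<open>Graphs whose clique complex is obtained from suspensions by inverse edge subdivisions: the middle
vertex x of the edge ab is removed and the edge restored. Working with flag complexes turns stellar moves into
statements about neighbourhoods.\<close>
inductive gsph :: "nat \<Rightarrow> 'a set \<Rightarrow> ('a \<Rightarrow> 'a \<Rightarrow> bool) \<Rightarrow> bool" where
  gsph_empty: "gsph 0 {} A"
| gsph_susp: "gsph k X A \<Longrightarrow> a \<notin> X \<Longrightarrow> b \<notin> X \<Longrightarrow> a \<noteq> b \<Longrightarrow> \<not> A a b \<Longrightarrow> \<not> A b a \<Longrightarrow>
    (\<And>u. u \<in> X \<Longrightarrow> A a u \<and> A u a \<and> A b u \<and> A u b) \<Longrightarrow> gsph (Suc k) (insert a (insert b X)) A"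
| gsph_unsub: "gsph k (X - {x}) (add_edge A a b) \<Longrightarrow> x \<in> X \<Longrightarrow> a \<in> X \<Longrightarrow> b \<in> X \<Longrightarrow>
    a \<noteq> b \<Longrightarrow> a \<noteq> x \<Longrightarrow> b \<noteq> x \<Longrightarrow> \<not> A a b \<Longrightarrow> A x a \<Longrightarrow> A x b \<Longrightarrow>
    (\<And>u. u \<in> X - {a, b, x} \<Longrightarrow> A x u \<longleftrightarrow> A a u \<and> A b u) \<Longrightarrow> gsph k X A"

lemma gsph_finite: "gsph k X A \<Longrightarrow> finite X"
  by (induction rule: gsph.induct) auto

lemma gsph_iso:
  assumes "gsph k X A" "inj_on f X" "\<And>u v. u \<in> X \<Longrightarrow> v \<in> X \<Longrightarrow> u \<noteq> v \<Longrightarrow> B (f u) (f v) = A u v"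
  shows "gsph k (f ` X) B"
  using assms
proof (induction arbitrary: B rule: gsph.induct)
  case (gsph_empty A)
  then show ?case by (simp add: gsph.gsph_empty)
next
  case (gsph_susp k X A a b)
  have 1: "gsph k (f ` X) B"
    by (rule gsph_susp.IH) (use gsph_susp.prems in \<open>auto simp: inj_on_insert\<close>)
  have inj: "inj_on f (insert a (insert b X))" by fact
  have ab: "f a \<noteq> f b" using inj \<open>a \<noteq> b\<close> by (auto simp: inj_on_def)
  have na: "f a \<notin> f ` X" "f b \<notin> f ` X" using inj gsph_susp.hyps by (auto simp: inj_on_def)
  have "gsph (Suc k) (insert (f a) (insert (f b) (f ` X))) B"
  proof (rule gsph.gsph_susp[OF 1 na ab])
    show "\<not> B (f a) (f b)" "\<not> B (f b) (f a)"
      using gsph_susp.prems(2)[of a b] gsph_susp.prems(2)[of b a] gsph_susp.hyps by auto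
    fix w assume "w \<in> f ` X"
    then obtain u where u: "u \<in> X" "w = f u" by blast
    have "u \<noteq> a" "u \<noteq> b" using u gsph_susp.hyps by auto
    then show "B (f a) w \<and> B w (f a) \<and> B (f b) w \<and> B w (f b)"
      using gsph_susp.prems(2)[of a u] gsph_susp.prems(2)[of u a] gsph_susp.prems(2)[of b u]
        gsph_susp.prems(2)[of u b] gsph_susp.hyps(7)[OF u(1)] u by auto
  qed
  then show ?case by simp
next
  case (gsph_unsub k X x A a b)
  have inj: "inj_on f X" by fact
  have eq: "f ` (X - {x}) = f ` X - {f x}"
    using inj gsph_unsub.hyps(2) by (auto simp: inj_on_def)
  have inj': "f u = f v \<longleftrightarrow> u = v" if "u \<in> X" "v \<in> X" for u v
    using inj that by (auto simp: inj_on_def)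
  have "gsph k (f ` (X - {x})) (add_edge B (f a) (f b))"
  proof (rule gsph_unsub.IH)
    show "inj_on f (X - {x})" using inj by (rule inj_on_diff)
    fix u v assume "u \<in> X - {x}" "v \<in> X - {x}" "u \<noteq> v"
    then show "add_edge B (f a) (f b) (f u) (f v) = add_edge A a b u v"
      using gsph_unsub.prems(2)[of u v] gsph_unsub.hyps inj' by (auto simp: add_edge_def)
  qed
  then have 1: "gsph k (f ` X - {f x}) (add_edge B (f a) (f b))" by (simp only: eq)
  show ?case
  proof (rule gsph.gsph_unsub[OF 1])
    show "f x \<in> f ` X" "f a \<in> f ` X" "f b \<in> f ` X" using gsph_unsub.hyps by auto
    show "f a \<noteq> f b" "f a \<noteq> f x" "f b \<noteq> f x" using gsph_unsub.hyps inj' by auto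
    show "\<not> B (f a) (f b)" "B (f x) (f a)" "B (f x) (f b)"
      using gsph_unsub.prems(2)[of a b] gsph_unsub.prems(2)[of x a] gsph_unsub.prems(2)[of x b]
        gsph_unsub.hyps by auto
    fix w assume "w \<in> f ` X - {f a, f b, f x}"
    then obtain u where u: "u \<in> X - {a, b, x}" "w = f u" by blast
    then show "B (f x) w \<longleftrightarrow> B (f a) w \<and> B (f b) w"
      using gsph_unsub.hyps(11)[OF u(1)] gsph_unsub.prems(2)[of x u] gsph_unsub.prems(2)[of a u]
        gsph_unsub.prems(2)[of b u] gsph_unsub.hyps(2-4) by auto
  qed
qed

lemma gsph_cong:
  assumes "gsph k X A" "\<And>u v. u \<in> X \<Longrightarrow> v \<in> X \<Longrightarrow> u \<noteq> v \<Longrightarrow> B u v = A u v"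
  shows "gsph k X B"
  using gsph_iso[OF assms(1), of "\<lambda>x. x" B] assms(2) by simp

text \<open>Only the first factor is taken apart. Both ends of a restored edge lie in it, so the
  second factor and the edges between the factors are untouched by the moves.\<close>

lemma gsph_join:
  assumes "gsph k X A" "gsph l Y A" "X \<inter> Y = {}"
    and "\<And>u v. u \<in> X \<Longrightarrow> v \<in> Y \<Longrightarrow> A u v \<and> A v u"
  shows "gsph (k + l) (X \<union> Y) A"
  using assms
proof (induction rule: gsph.induct)
  case (gsph_empty A)
  then show ?case by simp
next
  case (gsph_susp k X A a b)
  have 1: "gsph (k + l) (X \<union> Y) A" using gsph_susp.IH gsph_susp.prems by auto
  have "gsph (Suc (k + l)) (insert a (insert b (X \<union> Y))) A"
    by (rule gsph.gsph_susp[OF 1]) (use gsph_susp.hyps gsph_susp.prems in auto)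
  then show ?case by simp
next
  case (gsph_unsub k X x A a b)
  have Y: "gsph l Y (add_edge A a b)"
    by (rule gsph_cong[OF gsph_unsub.prems(1)]) (use gsph_unsub.prems(2) gsph_unsub.hyps in \<open>auto simp: add_edge_def\<close>)
  have 1: "gsph (k + l) (X - {x} \<union> Y) (add_edge A a b)"
    by (rule gsph_unsub.IH[OF Y]) (use gsph_unsub.prems in \<open>auto simp: add_edge_def\<close>)
  have eq: "X - {x} \<union> Y = (X \<union> Y) - {x}" using gsph_unsub.hyps(2) gsph_unsub.prems(2) by auto
  show ?case
    by (rule gsph.gsph_unsub[OF 1[unfolded eq]])
       (use gsph_unsub.hyps gsph_unsub.prems in auto)
qed

definition cone_edges :: "('a \<Rightarrow> 'a \<Rightarrow> bool) \<Rightarrow> 'a \<Rightarrow> 'a set \<Rightarrow> 'a \<Rightarrow> 'a \<Rightarrow> bool" where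
  "cone_edges A z D u v \<longleftrightarrow> A u v \<or> (u = z \<and> v \<in> D) \<or> (v = z \<and> u \<in> D)"

text \<open>Undoes the barycentric subdivision of a cone: \<open>S\<close> is the face poset of the
  base, \<open>z\<close> the apex, and \<open>e T\<close> the face spanned by \<open>z\<close> and
  \<open>T\<close>, here the midpoint of an edge from \<open>z\<close> to \<open>T\<close>. The
  midpoints disappear in increasing order, so that \<open>z\<close> is always joined to a down-set
  \<open>D\<close>. This order makes the neighbours of \<open>e T\<close> coincide with the common
  neighbours of its two ends.\<close>

lemma gsph_cone:
  fixes ht :: "'a \<Rightarrow> nat"
  assumes X: "finite X" "S \<subseteq> X" "z \<in> X" "e ` S \<subseteq> X" and inj: "inj_on e S"
    and dis: "z \<notin> S" "z \<notin> e ` S" "S \<inter> e ` S = {}"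
    and ht: "\<And>T T'. T \<in> S \<Longrightarrow> T' \<in> S \<Longrightarrow> R T T' \<Longrightarrow> ht T < ht T'"
    and sym: "\<And>u v. A u v \<Longrightarrow> A v u"
    and zT: "\<And>T. T \<in> S \<Longrightarrow> \<not> A z T \<and> A (e T) z \<and> A (e T) T"
    and ST: "\<And>T T'. T \<in> S \<Longrightarrow> T' \<in> S \<Longrightarrow> T \<noteq> T' \<Longrightarrow> A T T' \<longleftrightarrow> R T T' \<or> R T' T"
    and eST: "\<And>T T'. T \<in> S \<Longrightarrow> T' \<in> S \<Longrightarrow> T \<noteq> T' \<Longrightarrow> A (e T) (e T') \<longleftrightarrow> R T T' \<or> R T' T"
    and eT: "\<And>T T'. T \<in> S \<Longrightarrow> T' \<in> S \<Longrightarrow> T \<noteq> T' \<Longrightarrow> A (e T) T' \<longleftrightarrow> R T' T"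
    and out: "\<And>u. u \<in> X - ({z} \<union> S \<union> e ` S) \<Longrightarrow> \<not> A z u"
    and oute: "\<And>u T. u \<in> X - ({z} \<union> S \<union> e ` S) \<Longrightarrow> T \<in> S \<Longrightarrow> \<not> A (e T) u"
    and fin: "gsph k (X - e ` S) (cone_edges A z S)"
  shows "gsph k X A"
proof -
  have fS: "finite S" using X(1,2) finite_subset by blast
  \<comment> \<open>The induction starts from the unsubdivided cone \<open>D = S\<close> and puts
    the midpoints back one at a time.\<close>
  have main: "gsph k (X - e ` D) (cone_edges A z D)"
    if "D \<subseteq> S" "\<And>T T'. T \<in> S \<Longrightarrow> T' \<in> D \<Longrightarrow> R T T' \<Longrightarrow> T \<in> D" for D
    using that
  proof (induction "card (S - D)" arbitrary: D)
    case 0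
    then have "D = S" using fS by auto
    then show ?case using fin by simp
  next
    case (Suc m)
    have ne: "S - D \<noteq> {}" using Suc(2) by (metis card.empty nat.distinct(1))
    \<comment> \<open>By minimality everything below \<open>T\<close> is already in
      \<open>D\<close>, and since \<open>D\<close> is a down-set nothing above \<open>T\<close>
      is.\<close>
    define T where "T = arg_min_on ht (S - D)"
    have T: "T \<in> S - D" unfolding T_def using fS ne by (intro arg_min_if_finite) auto
    have Tmin: "\<not> ht T' < ht T" if "T' \<in> S - D" for T'
      using arg_min_if_finite(2)[of "S - D" ht] fS ne that unfolding T_def by blast
    have below: "T' \<in> D" if "T' \<in> S" "R T' T" for T'
      using Tmin[of T'] ht[of T' T] that T by blast
    have nbelow: "\<not> R T T'" if "T' \<in> D" for T' using Suc(4)[of T T'] that T by blast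
    have IH: "gsph k (X - e ` insert T D) (cone_edges A z (insert T D))"
    proof (rule Suc(1))
      have "S - insert T D = (S - D) - {T}" by auto
      then show "m = card (S - insert T D)" using Suc(2) T fS by simp
      show "insert T D \<subseteq> S" using Suc(3) T by auto
      fix T1 T2 assume "T1 \<in> S" "T2 \<in> insert T D" "R T1 T2"
      then show "T1 \<in> insert T D" using below Suc(4) by blast
    qed
    have eq1: "X - e ` insert T D = (X - e ` D) - {e T}" by auto
    have eq2: "cone_edges A z (insert T D) = add_edge (cone_edges A z D) z T"
      by (auto simp: cone_edges_def add_edge_def fun_eq_iff)
    have eTD: "e T \<notin> e ` D" using T Suc(3) inj by (auto simp: inj_on_def)
    have eTS: "e T \<in> e ` S" "T \<in> S" using T by auto
    have eDS: "e ` D \<subseteq> e ` S" using Suc(3) by (rule image_mono)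
    have nS: "e T \<notin> S" using eTS dis(3) by (metis disjoint_iff)
    have eTz: "e T \<noteq> z" "T \<noteq> z" "e T \<noteq> T" "T \<notin> e ` D" "z \<notin> e ` D" "e T \<notin> S"
      using eTS nS eDS dis by (metis, metis, metis, metis disjoint_iff subsetD, metis subsetD, metis)
    show ?case
    proof (rule gsph_unsub[OF IH[unfolded eq1 eq2]])
      show "e T \<in> X - e ` D" "z \<in> X - e ` D" "T \<in> X - e ` D"
        using X T eTD eTz by auto
      show "z \<noteq> T" "z \<noteq> e T" "T \<noteq> e T" using eTz by auto
      show "\<not> cone_edges A z D z T" "cone_edges A z D (e T) z" "cone_edges A z D (e T) T"
        using zT[of T] T eTz by (auto simp: cone_edges_def)
      fix u assume u: "u \<in> X - e ` D - {z, T, e T}"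
      have l: "cone_edges A z D (e T) u \<longleftrightarrow> A (e T) u"
        using u eTz by (auto simp: cone_edges_def)
      have r1: "cone_edges A z D z u \<longleftrightarrow> A z u \<or> u \<in> D"
        using u by (auto simp: cone_edges_def)
      have r2: "cone_edges A z D T u \<longleftrightarrow> A T u"
        using u eTz by (auto simp: cone_edges_def)
      consider (S) "u \<in> S" | (E) T' where "T' \<in> S" "u = e T'" | (O) "u \<in> X - ({z} \<union> S \<union> e ` S)"
        using u by blast
      then show "cone_edges A z D (e T) u \<longleftrightarrow> cone_edges A z D z u \<and> cone_edges A z D T u"
      proof cases
        case S
        then have "A (e T) u \<longleftrightarrow> R u T" "\<not> A z u" "A T u \<longleftrightarrow> R T u \<or> R u T"
          using eT[of T u] zT[of u] ST[of T u] u T by auto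
        then show ?thesis unfolding l r1 r2 using below[OF S] nbelow by blast
      next
        case E
        have T': "T' \<noteq> T" "T' \<notin> D" using E u by auto
        then have nR: "\<not> R T' T" using below[OF E(1)] by blast
        have "A (e T) u \<longleftrightarrow> R T T'" using eST[of T T'] E T T' nR by auto
        moreover have "A z u" using zT[OF E(1)] E(2) sym by blast
        moreover have "A T u \<longleftrightarrow> R T T'" using eT[of T' T] E T T' sym by blast
        ultimately show ?thesis unfolding l r1 r2 by blast
      next
        case O
        have "u \<notin> D" using O Suc(3) by auto
        then show ?thesis unfolding l r1 r2 using out[OF O] oute[OF O, of T] T by auto
      qed
    qed
  qed
  have "gsph k (X - e ` {}) (cone_edges A z {})" by (rule main) auto
  moreover have "cone_edges A z {} = A" by (auto simp: cone_edges_def fun_eq_iff)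
  ultimately show ?thesis by simp
qed

text \<open>This is the barycentric subdivision of the boundary of a simplex. For one more vertex i
  the boundary consists of the old simplex and the cone from i over the old boundary. With that cone
  unsubdivided, a suspension of the old sphere with poles \<open>{i}\<close> and \<open>S\<close>
  remains.\<close>

lemma gsph_bool:
  assumes "finite S" "S \<noteq> {}"
  shows "gsph (card S - 1) {T. T \<noteq> {} \<and> T \<subset> S} (\<lambda>T U. T \<subset> U \<or> U \<subset> T)"
  using assms
proof (induction rule: finite_ne_induct)
  case (singleton s)
  have "{T. T \<noteq> {} \<and> T \<subset> {s}} = {}" by auto
  then show ?case by (simp only: gsph_empty card.insert finite.emptyI card.empty diff_Suc_1 empty_iff not_False_eq_True)
next
  case (insert i S)
  let ?A = "\<lambda>T U :: 'a set. T \<subset> U \<or> U \<subset> T"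
  let ?S = "{T. T \<noteq> {} \<and> T \<subset> S}" and ?X = "{T. T \<noteq> {} \<and> T \<subset> insert i S}"
  let ?e = "insert i"
  have finX: "finite ?X" by (rule finite_subset[of _ "Pow (insert i S)"]) (use insert.hyps in auto)
  have Xeq: "?X - ?e ` ?S = insert {i} (insert S ?S)"
  proof (intro equalityI subsetI)
    fix T assume T: "T \<in> ?X - ?e ` ?S"
    show "T \<in> insert {i} (insert S ?S)"
    proof (cases "i \<in> T")
      case True
      then have "T = insert i (T - {i})" by auto
      moreover have "T - {i} \<subset> S" using T True insert.hyps by auto
      ultimately have "T - {i} = {}" using T by blast
      then show ?thesis using True by auto
    next
      case False
      then show ?thesis using T by auto
    qed
  next
    fix T assume "T \<in> insert {i} (insert S ?S)"
    then show "T \<in> ?X - ?e ` ?S" using insert.hyps by auto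
  qed
  have IH: "gsph (card S - 1) ?S (cone_edges ?A {i} ?S)"
    by (rule gsph_cong[OF insert.IH]) (use insert.hyps in \<open>auto simp: cone_edges_def\<close>)
  have "gsph (Suc (card S - 1)) (insert {i} (insert S ?S)) (cone_edges ?A {i} ?S)"
    by (rule gsph_susp[OF IH]) (use insert.hyps in \<open>auto simp: cone_edges_def\<close>)
  moreover have "Suc (card S - 1) = card (insert i S) - 1"
    using insert.hyps by (simp add: card_gt_0_iff)
  ultimately have fin: "gsph (card (insert i S) - 1) (?X - ?e ` ?S) (cone_edges ?A {i} ?S)"
    unfolding Xeq by simp
  show ?case
  proof (rule gsph_cone[where R = "(\<subset>)" and ht = card and z = "{i}" and e = ?e and S = ?S, OF finX _ _ _ _ _ _ _ _ _ _ _ _ _ _ _ fin])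
    show "inj_on ?e ?S" using insert.hyps by (auto simp: inj_on_def insert_eq_iff)
    fix T T' assume "T \<in> ?S" "T' \<in> ?S" "T \<subset> T'"
    then show "card T < card T'"
      using insert.hyps(1) finite_subset[of T' S] by (intro psubset_card_mono) auto
  next
    fix u T assume u: "u \<in> ?X - ({{i}} \<union> ?S \<union> ?e ` ?S)"
    then have "u \<in> ?X - ?e ` ?S" by blast
    then have "u \<in> insert {i} (insert S ?S)" by (simp only: Xeq)
    then have uS: "u = S" using u by blast
    then show "\<not> ({i} \<subset> u \<or> u \<subset> {i})" using insert.hyps by auto
    assume "T \<in> ?S"
    then show "\<not> (?e T \<subset> u \<or> u \<subset> ?e T)" using uS insert.hyps by auto
  qed (use insert.hyps in auto)
qed

section \<open>From flag spheres to combinatorial spheres by stellar moves\<close>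

definition bd :: "nat set \<Rightarrow> nat set set" where
  "bd M = {s. s \<noteq> {} \<and> s \<subset> M}"

definition joinb :: "nat set set \<Rightarrow> nat set \<Rightarrow> nat set set" where
  "joinb K M = {s \<union> t | s t. (s = {} \<or> s \<in> K) \<and> t \<subset> M \<and> s \<union> t \<noteq> {}}"

lemma joinbI: "u = s \<union> t \<Longrightarrow> s = {} \<or> s \<in> K \<Longrightarrow> t \<subset> M \<Longrightarrow> u \<noteq> {} \<Longrightarrow> u \<in> joinb K M"
  unfolding joinb_def by (rule CollectI, intro exI[of _ s] exI[of _ t]) simp

lemma is_complex_clq: "finite X \<Longrightarrow> is_complex (clq X A)"
  unfolding is_complex_def clq_def
  by (auto intro: finite_subset[of _ "Pow X"] finite_subset)

lemma is_complex_joinb: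
  assumes "is_complex K" "finite M"
  shows "is_complex (joinb K M)"
  unfolding is_complex_def
proof (intro conjI ballI allI impI)
  have "joinb K M \<subseteq> (\<lambda>(s, t). s \<union> t) ` (insert {} K \<times> Pow M)" unfolding joinb_def by auto
  moreover have "finite \<dots>" using assms by (auto simp: is_complex_def)
  ultimately show "finite (joinb K M)" by (rule finite_subset)
  fix s assume "s \<in> joinb K M"
  then obtain p r where s: "s = p \<union> r" "p = {} \<or> p \<in> K" "r \<subset> M" "s \<noteq> {}"
    unfolding joinb_def by blast
  show "finite s" using s assms by (auto simp: is_complex_def intro: finite_subset)
  show "s \<noteq> {}" by (rule s)
  fix t assume t: "t \<subseteq> s \<and> t \<noteq> {}"
  have "t = (t \<inter> p) \<union> (t \<inter> r)" using t s by auto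
  moreover have "t \<inter> p = {} \<or> t \<inter> p \<in> K"
    using s(2) assms(1) unfolding is_complex_def by (metis Int_empty_right inf_le2)
  moreover have "t \<inter> r \<subset> M" using s by auto
  ultimately show "t \<in> joinb K M" using t by (intro joinbI[of t "t \<inter> p" "t \<inter> r"]) auto
qed

text \<open>Starring the facet \<open>M\<close> of the boundary of the simplex on
  \<open>insert b M\<close> at \<open>a\<close> leaves the two cones from \<open>a\<close> and
  \<open>b\<close> over the boundary of \<open>M\<close>. A suspension is thereby traded for one
  more vertex of the auxiliary simplex.\<close>

lemma stellar_susp:
  assumes M: "M \<noteq> {}" and dis: "X \<inter> M = {}" "a \<notin> X" "b \<notin> X" "a \<noteq> b" "a \<notin> M" "b \<notin> M"
    and adj: "\<not> A a b" "\<And>u. u \<in> X \<Longrightarrow> A a u \<and> A u a \<and> A b u \<and> A u b"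
  shows "stellar (joinb (clq X A) (insert b M)) M a = joinb (clq (insert a (insert b X)) A) M"
    (is "?L = ?R")
proof -
  let ?K = "joinb (clq X A) (insert b M)"
  have K: "t \<in> ?K \<longleftrightarrow> t \<noteq> {} \<and> t \<subseteq> X \<union> insert b M \<and> (t \<inter> X = {} \<or> t \<inter> X \<in> clq X A) \<and> \<not> insert b M \<subseteq> t" for t
  proof
    assume "t \<in> ?K"
    then obtain s r where st: "t = s \<union> r" "s = {} \<or> s \<in> clq X A" "r \<subset> insert b M" "s \<union> r \<noteq> {}"
      unfolding joinb_def by blast
    have "s \<subseteq> X" using st by (auto simp: clq_def)
    then have "t \<inter> X = s" using st dis by auto
    moreover have "\<not> insert b M \<subseteq> t" using st \<open>s \<subseteq> X\<close> dis by blast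
    ultimately show "t \<noteq> {} \<and> t \<subseteq> X \<union> insert b M \<and> (t \<inter> X = {} \<or> t \<inter> X \<in> clq X A) \<and> \<not> insert b M \<subseteq> t"
      using st \<open>s \<subseteq> X\<close> by auto
  next
    assume t: "t \<noteq> {} \<and> t \<subseteq> X \<union> insert b M \<and> (t \<inter> X = {} \<or> t \<inter> X \<in> clq X A) \<and> \<not> insert b M \<subseteq> t"
    then have "t = (t \<inter> X) \<union> (t \<inter> insert b M)" "t \<inter> insert b M \<subset> insert b M" by auto
    then show "t \<in> ?K" using t by (intro joinbI[of t "t \<inter> X" "t \<inter> insert b M"]) auto
  qed
  have link: "link ?K M = clq X A"
  proof (intro equalityI subsetI)
    fix t assume "t \<in> link ?K M"
    then have t: "t \<in> ?K" "t \<inter> M = {}" "t \<union> M \<in> ?K" by (auto simp: link_def)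
    have "b \<notin> t" using t(3) unfolding K by auto
    then have "t \<subseteq> X" using t(1,2) unfolding K by auto
    then show "t \<in> clq X A" using t(1) unfolding K by (auto simp: Int_absorb2)
  next
    fix t assume t: "t \<in> clq X A"
    then have "t \<subseteq> X" "t \<noteq> {}" by (auto simp: clq_def)
    then have "t \<inter> X = t" "(t \<union> M) \<inter> X = t" "t \<inter> M = {}" "\<not> insert b M \<subseteq> t" "\<not> insert b M \<subseteq> t \<union> M" using dis by auto
    then show "t \<in> link ?K M" unfolding link_def using K t \<open>t \<subseteq> X\<close> \<open>t \<noteq> {}\<close> by auto
  qed
  have clq': "s \<in> clq (insert a (insert b X)) A \<longleftrightarrow> s \<in> clq X A
     \<or> (\<exists>p. (p = {} \<or> p \<in> clq X A) \<and> (s = insert a p \<or> s = insert b p))" for s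
  proof
    assume s: "s \<in> clq (insert a (insert b X)) A"
    have nab: "\<not> (a \<in> s \<and> b \<in> s)" using s adj(1) dis(4) by (auto simp: clq_def)
    have p: "s - {a, b} = {} \<or> s - {a, b} \<in> clq X A" using s by (auto simp: clq_def)
    consider "a \<in> s" | "b \<in> s" | "a \<notin> s" "b \<notin> s" by blast
    then show "s \<in> clq X A \<or> (\<exists>p. (p = {} \<or> p \<in> clq X A) \<and> (s = insert a p \<or> s = insert b p))"
    proof cases
      case 1
      then have "s = insert a (s - {a, b})" using nab by auto
      then show ?thesis using p by blast
    next
      case 2
      then have "s = insert b (s - {a, b})" using nab by auto
      then show ?thesis using p by blast
    next
      case 3
      then show ?thesis using s by (auto simp: clq_def)
    qed
  next
    assume "s \<in> clq X A \<or> (\<exists>p. (p = {} \<or> p \<in> clq X A) \<and> (s = insert a p \<or> s = insert b p))"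
    then show "s \<in> clq (insert a (insert b X)) A"
    proof (elim disjE exE conjE)
      assume "s \<in> clq X A" then show ?thesis by (auto simp: clq_def)
    qed (use adj(2) in \<open>auto simp: clq_def subset_iff\<close>)
  qed
  show ?thesis
  proof (intro equalityI subsetI)
    fix t assume "t \<in> ?L"
    then consider (1) "t \<in> ?K" "\<not> M \<subseteq> t"
      | (2) r p where "t = insert a (r \<union> p)" "r \<subset> M" "p = {} \<or> p \<in> clq X A"
      unfolding stellar_def link by blast
    then show "t \<in> ?R"
    proof cases
      case 1
      let ?p = "t \<inter> X"
      have p: "?p = {} \<or> ?p \<in> clq X A" using 1(1) unfolding K by blast
      show ?thesis
      proof (cases "b \<in> t")
        case True
        have "t = insert b ?p \<union> (t \<inter> M)" using 1(1) True unfolding K by auto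
        moreover have "insert b ?p \<in> clq (insert a (insert b X)) A" using clq' p by blast
        moreover have "t \<inter> M \<subset> M" using 1(2) by auto
        ultimately show ?thesis using True by (intro joinbI[of t "insert b ?p" "t \<inter> M"]) auto
      next
        case False
        have "t = ?p \<union> (t \<inter> M)" using 1(1) False unfolding K by auto
        moreover have "?p = {} \<or> ?p \<in> clq (insert a (insert b X)) A" using clq' p by blast
        moreover have "t \<inter> M \<subset> M" using 1(2) by auto
        moreover have "t \<noteq> {}" using 1(1) unfolding K by blast
        ultimately show ?thesis by (intro joinbI[of t ?p "t \<inter> M"])
      qed
    next
      case 2
      have "t = insert a p \<union> r" using 2 by auto
      moreover have "insert a p \<in> clq (insert a (insert b X)) A" using clq' 2 by blast
      ultimately show ?thesis using 2(1,2) by (intro joinbI[of t "insert a p" r]) auto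
    qed
  next
    fix t assume "t \<in> ?R"
    then obtain s r where st: "t = s \<union> r" "s = {} \<or> s \<in> clq (insert a (insert b X)) A" "r \<subset> M" "t \<noteq> {}"
      unfolding joinb_def by blast
    have sub: "p \<subseteq> X" if "p = {} \<or> p \<in> clq X A" for p using that by (auto simp: clq_def)
    have "(s = {} \<or> s \<in> clq X A) \<or> (\<exists>p. (p = {} \<or> p \<in> clq X A) \<and> (s = insert a p \<or> s = insert b p))"
      using st(2) clq' by blast
    then show "t \<in> ?L"
    proof (elim disjE[where P = "s = {} \<or> s \<in> clq X A"] exE conjE)
      assume s: "s = {} \<or> s \<in> clq X A"
      have "s \<subseteq> X" by (rule sub[OF s])
      then have "t \<inter> X = s" "\<not> M \<subseteq> t" using st dis by auto
      then have "t \<in> ?K" using s st \<open>s \<subseteq> X\<close> unfolding K by auto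
      then show ?thesis using \<open>\<not> M \<subseteq> t\<close> unfolding stellar_def by blast
    next
      fix p assume p: "p = {} \<or> p \<in> clq X A" and s: "s = insert a p \<or> s = insert b p"
      have pX: "p \<subseteq> X" by (rule sub[OF p])
      from s show ?thesis
      proof
        assume "s = insert a p"
        then have "t = insert a (r \<union> p)" using st by auto
        then show ?thesis unfolding stellar_def link using st(3) p by blast
      next
        assume s: "s = insert b p"
        then have "t \<inter> X = p" "\<not> M \<subseteq> t" using st dis pX by auto
        then have "t \<in> ?K" using s st pX p unfolding K by auto
        then show ?thesis using \<open>\<not> M \<subseteq> t\<close> unfolding stellar_def by blast
      qed
    qed
  qed
qed

text \<open>In a flag complex the link of the edge ab is the flag complex of the common neighbours
  of its ends. The condition on \<open>x\<close> therefore says that its link is the suspension of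
  that link by \<open>a\<close> and \<open>b\<close>, as for the new vertex of a stellar
  subdivision. The factor \<open>M\<close> is carried along.\<close>

lemma stellar_unsub:
  assumes dis: "X \<inter> M = {}" "M \<noteq> {}" and x: "x \<in> X" "x \<notin> M" "a \<in> X" "b \<in> X" "a \<noteq> b" "a \<noteq> x" "b \<noteq> x"
    and adj: "\<not> A a b" "A x a" "A x b"
    and nb: "\<And>u. u \<in> X - {a, b, x} \<Longrightarrow> A x u \<longleftrightarrow> A a u \<and> A b u"
    and sym: "\<And>u v. u \<in> X \<Longrightarrow> v \<in> X \<Longrightarrow> A u v \<Longrightarrow> A v u"
  shows "stellar (joinb (clq (X - {x}) (add_edge A a b)) M) {a, b} x = joinb (clq X A) M"
proof -
  let ?C = "clq (X - {x}) (add_edge A a b)"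
  let ?K = "joinb ?C M"
  have K: "t \<in> ?K \<longleftrightarrow> t \<noteq> {} \<and> t \<subseteq> (X - {x}) \<union> M \<and> (t \<inter> X = {} \<or> t \<inter> X \<in> ?C) \<and> \<not> M \<subseteq> t" for t
  proof
    assume "t \<in> ?K"
    then obtain s r where st: "t = s \<union> r" "s = {} \<or> s \<in> ?C" "r \<subset> M" "s \<union> r \<noteq> {}"
      unfolding joinb_def by blast
    have s: "s \<subseteq> X - {x}" using st by (auto simp: clq_def)
    have "t \<inter> X = s" using st s dis by auto
    moreover have "\<not> M \<subseteq> t" using st s dis by blast
    ultimately show "t \<noteq> {} \<and> t \<subseteq> (X - {x}) \<union> M \<and> (t \<inter> X = {} \<or> t \<inter> X \<in> ?C) \<and> \<not> M \<subseteq> t"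
      using st s by auto
  next
    assume t: "t \<noteq> {} \<and> t \<subseteq> (X - {x}) \<union> M \<and> (t \<inter> X = {} \<or> t \<inter> X \<in> ?C) \<and> \<not> M \<subseteq> t"
    then have "t = (t \<inter> X) \<union> (t \<inter> M)" "t \<inter> M \<subset> M" by auto
    then show "t \<in> ?K" using t by (intro joinbI[of t "t \<inter> X" "t \<inter> M"]) auto
  qed
  have K2: "t \<in> joinb (clq X A) M \<longleftrightarrow> t \<noteq> {} \<and> t \<subseteq> X \<union> M \<and> (t \<inter> X = {} \<or> t \<inter> X \<in> clq X A) \<and> \<not> M \<subseteq> t" for t
  proof
    assume "t \<in> joinb (clq X A) M"
    then obtain s r where st: "t = s \<union> r" "s = {} \<or> s \<in> clq X A" "r \<subset> M" "s \<union> r \<noteq> {}"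
      unfolding joinb_def by blast
    have s: "s \<subseteq> X" using st by (auto simp: clq_def)
    have "t \<inter> X = s" using st s dis by auto
    moreover have "\<not> M \<subseteq> t" using st s dis by blast
    ultimately show "t \<noteq> {} \<and> t \<subseteq> X \<union> M \<and> (t \<inter> X = {} \<or> t \<inter> X \<in> clq X A) \<and> \<not> M \<subseteq> t"
      using st s by auto
  next
    assume t: "t \<noteq> {} \<and> t \<subseteq> X \<union> M \<and> (t \<inter> X = {} \<or> t \<inter> X \<in> clq X A) \<and> \<not> M \<subseteq> t"
    then have "t = (t \<inter> X) \<union> (t \<inter> M)" "t \<inter> M \<subset> M" by auto
    then show "t \<in> joinb (clq X A) M" using t by (intro joinbI[of t "t \<inter> X" "t \<inter> M"]) auto
  qed
  have sub: "s \<in> ?C" if "s' \<in> ?C" "s \<subseteq> s'" "s \<noteq> {}" for s s'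
    using that by (auto simp: clq_def intro: finite_subset)
  have noedge: "s \<in> ?C \<longleftrightarrow> s \<in> clq X A \<and> x \<notin> s" if "\<not> {a, b} \<subseteq> s" for s
    using that unfolding clq_def add_edge_def by blast
  have nbx: "A u x \<longleftrightarrow> A x u" if "u \<in> X" for u using sym that x(1) by blast
  show ?thesis
  proof (intro equalityI subsetI)
    fix t assume "t \<in> stellar ?K {a, b} x"
    then consider (1) "t \<in> ?K" "\<not> {a, b} \<subseteq> t"
      | (2) r p where "t = insert x (r \<union> p)" "r \<subset> {a, b}" "p = {} \<or> p \<in> link ?K {a, b}"
      unfolding stellar_def by blast
    then show "t \<in> joinb (clq X A) M"
    proof cases
      case 1
      then have "\<not> {a, b} \<subseteq> t \<inter> X" by blast
      then have "t \<inter> X \<in> clq X A" if "t \<inter> X \<noteq> {}" using 1(1) that noedge[of "t \<inter> X"] unfolding K by blast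
      then show ?thesis using 1(1) unfolding K K2 by blast
    next
      case 2
      have abC: "{a, b} \<in> ?C" using x by (auto simp: clq_def add_edge_def)
      have p: "p \<subseteq> (X - {x}) \<union> M" "\<not> M \<subseteq> p" "p \<inter> {a, b} = {}"
        using 2(3) dis(2) unfolding link_def K by auto
      have "(p \<union> {a, b}) \<inter> X = (p \<inter> X) \<union> {a, b}" using x by auto
      then have Q: "(p \<inter> X) \<union> {a, b} \<in> ?C"
        using 2(3) abC unfolding link_def K by auto
      have r: "r \<subseteq> {a, b}" "\<not> (a \<in> r \<and> b \<in> r)" using 2(2) by auto
      have tX: "t \<inter> X = insert x (r \<union> (p \<inter> X))" using 2(1) r x by auto
      have Axu: "A x u" if "u \<in> r \<union> (p \<inter> X)" for u
      proof (cases "u \<in> {a, b}")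
        case True
        then show ?thesis using adj by auto
      next
        case False
        then have u: "u \<in> p \<inter> X" using that r by auto
        then have "u \<in> X - {a, b, x}" using False p(1) dis(1) by blast
        moreover have "add_edge A a b a u" "add_edge A a b b u"
          using Q u False by (auto simp: clq_def)
        then have "A a u" "A b u" using False by (auto simp: add_edge_def)
        ultimately show ?thesis using nb by blast
      qed
      have Auv: "A u v" if "u \<in> r \<union> (p \<inter> X)" "v \<in> r \<union> (p \<inter> X)" "u \<noteq> v" for u v
      proof -
        have "add_edge A a b u v" using Q that r(1) unfolding clq_def by blast
        moreover have "\<not> (u = a \<and> v = b)" "\<not> (u = b \<and> v = a)" using that r p(3) by auto
        ultimately show ?thesis by (auto simp: add_edge_def)
      qed
      have rX: "r \<union> (p \<inter> X) \<subseteq> X" using r x by auto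
      have fin: "finite (t \<inter> X)" unfolding tX using Q r by (auto simp: clq_def intro: finite_subset)
      have "t \<inter> X \<in> clq X A"
        unfolding clq_def
      proof (intro CollectI conjI ballI impI)
        fix u v assume uv: "u \<in> t \<inter> X" "v \<in> t \<inter> X" "u \<noteq> v"
        have "u = x \<or> u \<in> r \<union> (p \<inter> X)" "v = x \<or> v \<in> r \<union> (p \<inter> X)" using uv tX by blast+
        then show "A u v" using uv(3) Axu Auv nbx uv by blast
      qed (use tX fin in auto)
      moreover have "\<not> M \<subseteq> t" using 2(1) p(2) r x dis(1) by blast
      ultimately show ?thesis unfolding K2 using 2(1) p(1) r x by auto
    qed
  next
    fix t assume "t \<in> joinb (clq X A) M"
    then have t: "t \<noteq> {}" "t \<subseteq> X \<union> M" "t \<inter> X = {} \<or> t \<inter> X \<in> clq X A" "\<not> M \<subseteq> t" unfolding K2 by auto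
    have nab: "\<not> {a, b} \<subseteq> t"
    proof
      assume "{a, b} \<subseteq> t"
      then have "a \<in> t \<inter> X" "b \<in> t \<inter> X" using x by auto
      then show False using t(3) adj(1) x(5) by (auto simp: clq_def)
    qed
    show "t \<in> stellar ?K {a, b} x"
    proof (cases "x \<in> t")
      case False
      have "t \<in> ?K" unfolding K using t noedge[of "t \<inter> X"] nab False by blast
      then show ?thesis unfolding stellar_def using nab by blast
    next
      case True
      let ?r = "t \<inter> {a, b}" and ?p = "t - {x, a, b}"
      have clqt: "t \<inter> X \<in> clq X A" using t(3) True x(1) by auto
      have tA: "A u v" if "u \<in> t \<inter> X" "v \<in> t \<inter> X" "u \<noteq> v" for u v
        using clqt that by (auto simp: clq_def)
      have fin: "finite (t \<inter> X)" using clqt by (simp add: clq_def)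
      have teq: "t = insert x (?r \<union> ?p)" using True by auto
      have r: "?r \<subset> {a, b}" using nab by auto
      have "?p \<in> link ?K {a, b}" if "?p \<noteq> {}"
        unfolding link_def
      proof (intro CollectI conjI)
        have finp: "finite (?p \<inter> X)" by (rule finite_subset[OF _ fin]) auto
        have pX: "?p \<inter> X \<in> ?C" if "?p \<inter> X \<noteq> {}"
          using that finp tA by (auto simp: clq_def add_edge_def)
        show "?p \<in> ?K" unfolding K using that t pX by auto
        show "?p \<inter> {a, b} = {}" by auto
        have ab: "A a u" "A b u" if "u \<in> ?p \<inter> X" for u
          using nb[of u] tA[of x u] that True x(1) by auto
        have "(?p \<inter> X) \<union> {a, b} \<in> ?C"
          unfolding clq_def
        proof (intro CollectI conjI ballI impI)
          show "finite ((?p \<inter> X) \<union> {a, b})" using finp by simp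
          fix u v assume uv: "u \<in> (?p \<inter> X) \<union> {a, b}" "v \<in> (?p \<inter> X) \<union> {a, b}" "u \<noteq> v"
          consider "u \<in> ?p \<inter> X" "v \<in> ?p \<inter> X" | "u \<in> {a, b}" "v \<in> {a, b}"
            | "u \<in> {a, b}" "v \<in> ?p \<inter> X" | "u \<in> ?p \<inter> X" "v \<in> {a, b}" using uv by blast
          then show "add_edge A a b u v"
          proof cases
            case 1 then show ?thesis using tA uv(3) by (auto simp: add_edge_def)
          next
            case 2 then show ?thesis using uv(3) by (auto simp: add_edge_def)
          next
            case 3 then show ?thesis using ab[of v] by (auto simp: add_edge_def)
          next
            case 4 then show ?thesis using ab[of u] sym[of a u] sym[of b u] x(3,4) by (auto simp: add_edge_def)
          qed
        qed (use x in auto)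
        moreover have "(?p \<union> {a, b}) \<inter> X = (?p \<inter> X) \<union> {a, b}" using x by auto
        moreover have "\<not> M \<subseteq> ?p \<union> {a, b}" using t(4) x dis(1) by blast
        ultimately show "?p \<union> {a, b} \<in> ?K" unfolding K using t(2) x by auto
      qed
      then show ?thesis unfolding stellar_def using teq r by blast
    qed
  qed
qed

text \<open>The auxiliary simplex is arbitrary so that each suspension can be absorbed by enlarging
  it; its final size records the dimension.\<close>

lemma gsph_stellar:
  fixes X :: "nat set"
  assumes "gsph k X A" "finite M" "M \<noteq> {}" "X \<inter> M = {}"
    and "\<And>u v. u \<in> X \<Longrightarrow> v \<in> X \<Longrightarrow> A u v \<Longrightarrow> A v u"
  shows "\<exists>M'. finite M' \<and> card M' = card M + k \<and> stellar_equiv (joinb (clq X A) M) (bd M')"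
  using assms
proof (induction arbitrary: M rule: gsph.induct)
  case (gsph_empty A)
  have "joinb (clq {} A) M = bd M" unfolding joinb_def bd_def clq_def by auto
  moreover have "is_complex (joinb (clq {} A) M)"
    using gsph_empty by (intro is_complex_joinb is_complex_clq) auto
  ultimately show ?case using gsph_empty by (intro exI[of _ M]) (auto intro: se_refl)
next
  case (gsph_susp k X A a b)
  let ?K = "joinb (clq X A) (insert b M)"
  have fX: "finite X" using gsph_finite[OF gsph_susp.hyps(1)] .
  have ab: "a \<notin> M" "b \<notin> M" using gsph_susp.prems(3) by auto
  have "\<exists>M'. finite M' \<and> card M' = card (insert b M) + k \<and> stellar_equiv ?K (bd M')"
  proof (rule gsph_susp.IH)
    show "finite (insert b M)" "insert b M \<noteq> {}" using gsph_susp.prems(1) by auto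
    show "X \<inter> insert b M = {}" using gsph_susp.prems(3) gsph_susp.hyps(3) by auto
    show "A u v \<Longrightarrow> A v u" if "u \<in> X" "v \<in> X" for u v using gsph_susp.prems(4)[of u v] that by simp
  qed
  then obtain M' where M': "finite M'" "card M' = card (insert b M) + k" "stellar_equiv ?K (bd M')" by blast
  have st: "stellar ?K M a = joinb (clq (insert a (insert b X)) A) M"
    by (rule stellar_susp) (use gsph_susp.hyps gsph_susp.prems(1-3) ab in auto)
  have "stellar_equiv ?K (stellar ?K M a)"
  proof (rule se_move)
    show "is_complex ?K" using fX gsph_susp.prems(1) by (intro is_complex_joinb is_complex_clq) auto
    show "M \<in> ?K" using gsph_susp.prems(1-3) ab by (intro joinbI[of M "{}" M]) auto
    have "\<Union> ?K \<subseteq> X \<union> insert b M" unfolding joinb_def clq_def by blast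
    then show "a \<notin> \<Union> ?K" using gsph_susp.hyps ab by auto
  qed
  then have "stellar_equiv (joinb (clq (insert a (insert b X)) A) M) (bd M')"
    using st M'(3) se_sym se_trans by metis
  then show ?case using M'(1,2) gsph_susp.prems(1) ab by (intro exI[of _ M']) auto
next
  case (gsph_unsub k X x A a b)
  let ?K = "joinb (clq (X - {x}) (add_edge A a b)) M"
  have fX: "finite (X - {x})" using gsph_finite[OF gsph_unsub.hyps(1)] .
  have xM: "x \<notin> M" using gsph_unsub.hyps(2) gsph_unsub.prems(3) by blast
  have "\<exists>M'. finite M' \<and> card M' = card M + k \<and> stellar_equiv ?K (bd M')"
  proof (rule gsph_unsub.IH[OF gsph_unsub.prems(1,2)])
    show "(X - {x}) \<inter> M = {}" using gsph_unsub.prems(3) by auto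
    show "add_edge A a b u v \<Longrightarrow> add_edge A a b v u" if "u \<in> X - {x}" "v \<in> X - {x}" for u v
      using gsph_unsub.prems(4)[of u v] that unfolding add_edge_def by blast
  qed
  then obtain M' where M': "finite M'" "card M' = card M + k" "stellar_equiv ?K (bd M')" by blast
  have st: "stellar ?K {a, b} x = joinb (clq X A) M"
    by (rule stellar_unsub[OF gsph_unsub.prems(3,2) gsph_unsub.hyps(2) xM gsph_unsub.hyps(3-11) gsph_unsub.prems(4)])
  have "stellar_equiv ?K (stellar ?K {a, b} x)"
  proof (rule se_move)
    show "is_complex ?K" using fX gsph_unsub.prems(1) by (intro is_complex_joinb is_complex_clq) auto
    show "{a, b} \<in> ?K"
      by (rule joinbI[of _ "{a, b}" "{}"])
         (use gsph_unsub.prems(1-3) gsph_unsub.hyps(3-7) in \<open>auto simp: clq_def add_edge_def\<close>)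
    have "\<Union> ?K \<subseteq> (X - {x}) \<union> M" unfolding joinb_def clq_def by blast
    then show "x \<notin> \<Union> ?K" using xM by auto
  qed
  then have "stellar_equiv (joinb (clq X A) M) (bd M')"
    using st M'(3) se_sym se_trans by metis
  then show ?case using M'(1,2) by (intro exI[of _ M']) auto
qed

text \<open>A one-element \<open>M\<close> starts the induction, since joining with its boundary
  does nothing. The vertices are first moved to natural numbers, over which
  \<open>stellar_equiv\<close> is defined. The simplex obtained has d + 2 vertices, as in
  \<open>bd_simplex d\<close>.\<close>

lemma gsph_comb_sphere:
  fixes X :: "'a set"
  assumes "gsph (Suc d) X A" "\<And>u v. u \<in> X \<Longrightarrow> v \<in> X \<Longrightarrow> A u v \<Longrightarrow> A v u"
  shows "comb_sphere d (clq X A)"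
proof -
  have fX: "finite X" by (rule gsph_finite[OF assms(1)])
  obtain f :: "'a \<Rightarrow> nat" where f: "inj_on f X"
    using finite_imp_inj_to_nat_seg[OF fX] by blast
  let ?B = "\<lambda>u v. A (inv_into X f u) (inv_into X f v)"
  have B: "?B (f u) (f v) = A u v" if "u \<in> X" "v \<in> X" for u v
    using f that by simp
  have g: "gsph (Suc d) (f ` X) ?B" by (rule gsph_iso[OF assms(1) f]) (use B in auto)
  obtain m where m: "m \<notin> f ` X" using fX by (metis ex_new_if_finite finite_imageI infinite_UNIV_nat)
  obtain M' where M': "finite M'" "card M' = card {m} + Suc d" "stellar_equiv (joinb (clq (f ` X) ?B) {m}) (bd M')"
  proof -
    have "\<exists>M'. finite M' \<and> card M' = card {m} + Suc d \<and> stellar_equiv (joinb (clq (f ` X) ?B) {m}) (bd M')"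
    proof (rule gsph_stellar[OF g])
      fix u v assume "u \<in> f ` X" "v \<in> f ` X" "?B u v"
      then show "?B v u" using assms(2)[of "inv_into X f u" "inv_into X f v"] inv_into_into[of _ f X] by simp
    qed (use m in auto)
    then show ?thesis using that by blast
  qed
  have psub: "t \<subset> {m} \<longleftrightarrow> t = {}" for t by auto
  have j: "joinb K {m} = K" if "{} \<notin> K" for K unfolding joinb_def psub using that by auto
  have im: "(`) f ` clq X A = clq (f ` X) ?B"
  proof (intro equalityI subsetI)
    fix s assume "s \<in> (`) f ` clq X A"
    then obtain C where C: "C \<in> clq X A" "s = f ` C" by blast
    then have "C \<subseteq> X" by (simp add: clq_def)
    then show "s \<in> clq (f ` X) ?B" using C B by (auto simp: clq_def subset_iff)
  next
    fix s assume s: "s \<in> clq (f ` X) ?B"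
    define C where "C = inv_into X f ` s"
    have sX: "s \<subseteq> f ` X" using s by (simp add: clq_def)
    have sC: "s = f ` C" unfolding C_def using sX by (simp add: image_inv_into_cancel)
    have CX: "C \<subseteq> X" unfolding C_def by (rule image_subsetI, rule inv_into_into) (use sX in blast)
    have "C \<in> clq X A"
      unfolding clq_def
    proof (intro CollectI conjI ballI impI)
      show "finite C" "C \<noteq> {}" using s by (auto simp: C_def clq_def)
      fix u v assume uv: "u \<in> C" "v \<in> C" "u \<noteq> v"
      then have "f u \<noteq> f v" using f CX by (auto simp: inj_on_def)
      then have "?B (f u) (f v)" using s uv unfolding sC clq_def by blast
      then show "A u v" using B uv CX by auto
    qed (rule CX)
    then show "s \<in> (`) f ` clq X A" using sC by blast
  qed
  have "stellar_equiv ((`) f ` clq X A) (bd M')"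
    using M'(3) unfolding im by (subst (asm) j) (auto simp: clq_def)
  moreover have "stellar_equiv (bd M') (bd_simplex d)"
  proof -
    obtain g where gb: "bij_betw g M' {..<card M'}"
      using ex_bij_betw_finite_nat[OF M'(1)] by (auto simp: atLeast0LessThan)
    have M'eq: "g ` M' = {..d + 1}" using gb M'(2) by (auto simp: bij_betw_def)
    have inj: "inj_on g M'" using gb by (simp add: bij_betw_def)
    have "(`) g ` bd M' = bd_simplex d"
    proof (intro equalityI subsetI)
      fix s assume "s \<in> (`) g ` bd M'"
      then obtain r where r: "r \<noteq> {}" "r \<subset> M'" "s = g ` r" by (auto simp: bd_def)
      then have "s \<subset> g ` M'" using inj by (metis image_strict_mono)
      then show "s \<in> bd_simplex d" using r M'eq by (auto simp: bd_simplex_def)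
    next
      fix s assume "s \<in> bd_simplex d"
      then have s: "s \<noteq> {}" "s \<subset> g ` M'" using M'eq by (auto simp: bd_simplex_def)
      then obtain r where r: "r \<subseteq> M'" "s = g ` r" by (meson psubset_imp_subset subset_imageE)
      then have "r \<in> bd M'" using s by (auto simp: bd_def)
      then show "s \<in> (`) g ` bd M'" using r by blast
    qed
    moreover have "is_complex (bd M')" unfolding is_complex_def bd_def
      using M'(1) by (auto intro: finite_subset[of _ "Pow M'"] finite_subset)
    moreover have "inj_on g (\<Union> (bd M'))" by (rule inj_on_subset[OF inj]) (auto simp: bd_def)
    ultimately show ?thesis using se_iso[of "bd M'" g] by simp
  qed
  ultimately have "stellar_equiv ((`) f ` clq X A) (bd_simplex d)" by (rule se_trans)
  moreover have "inj_on f (\<Union> (clq X A))" by (rule inj_on_subset[OF f]) (auto simp: clq_def)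
  ultimately show ?thesis unfolding comb_sphere_def using is_complex_clq[OF fX] by blast
qed

section \<open>Faces of tree-like graphs\<close>

text \<open>The faces of the dual triangulation, kept as pairs instead of the tagged sets of
  \<open>tri_face\<close>, so that incidence can be read off from label sets and residues
  separately.\<close>

definition faces :: "nat set \<Rightarrow> (nat \<Rightarrow> nat \<Rightarrow> nat) \<Rightarrow> nat set \<Rightarrow> (nat set \<times> nat set) set" where
  "faces V \<sigma> B = {(S, orb \<sigma> (B - S) v) | S v. v \<in> V \<and> S \<subseteq> B \<and> S \<noteq> {}}"

text \<open>Comparability of faces; in a residue structure it suffices that the label sets are nested and the
residues meet.\<close>
definition fadj :: "nat set \<times> nat set \<Rightarrow> nat set \<times> nat set \<Rightarrow> bool" where
  "fadj F G \<longleftrightarrow> (fst F \<subset> fst G \<or> fst G \<subset> fst F) \<and> snd F \<inter> snd G \<noteq> {}"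

lemma facesI: "v \<in> V \<Longrightarrow> S \<subseteq> B \<Longrightarrow> S \<noteq> {} \<Longrightarrow> Q = orb \<sigma> (B - S) v \<Longrightarrow> (S, Q) \<in> faces V \<sigma> B"
  unfolding faces_def by blast

lemma facesE:
  assumes "F \<in> faces V \<sigma> B"
  obtains S v where "F = (S, orb \<sigma> (B - S) v)" "v \<in> V" "S \<subseteq> B" "S \<noteq> {}"
  using assms unfolding faces_def by blast

lemma fadj_sym: "fadj F G \<Longrightarrow> fadj G F"
  unfolding fadj_def by blast

section \<open>Removing a melon from the face poset\<close>

lemma orb_empty [simp]: "orb \<sigma> {} v = {v}"
  using orb_subset[of v "{v}" "{}" \<sigma>] orb_self[of v \<sigma> "{}"] by blast

lemma orb_single: "\<sigma> c (\<sigma> c v) = v \<Longrightarrow> orb \<sigma> {c} v = {v, \<sigma> c v}"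
proof (rule antisym)
  assume "\<sigma> c (\<sigma> c v) = v"
  then show "orb \<sigma> {c} v \<subseteq> {v, \<sigma> c v}" by (intro orb_subset) auto
  show "{v, \<sigma> c v} \<subseteq> orb \<sigma> {c} v" using orb_step[of v \<sigma> "{c}" v c] by simp
qed

text \<open>The local picture at a leaf, with colour 0 forgotten: the simplices of \<open>x\<close>
  and \<open>y\<close> share all facets except those opposite to the label i, across which lie
  \<open>a\<close> and \<open>b\<close>. In \<tau> the two simplices are gone and \<open>a\<close>
  and \<open>b\<close> are glued directly.\<close>

locale melon =
  fixes V :: "nat set" and \<sigma> \<tau> :: "nat \<Rightarrow> nat \<Rightarrow> nat" and B :: "nat set" and x y a b i :: nat
  assumes finV: "finite V" and finB: "finite B" and inv: "inv_on \<sigma> B V" and iB: "i \<in> B" and B2: "B \<noteq> {i}"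
    and xV: "x \<in> V" and yV: "y \<in> V" and aV: "a \<in> V" and bV: "b \<in> V"
    and neq: "x \<noteq> y" "a \<noteq> x" "a \<noteq> y" "b \<noteq> x" "b \<noteq> y" "a \<noteq> b"
    and sx: "\<And>j. j \<in> B \<Longrightarrow> j \<noteq> i \<Longrightarrow> \<sigma> j x = y"
    and sy: "\<And>j. j \<in> B \<Longrightarrow> j \<noteq> i \<Longrightarrow> \<sigma> j y = x"
    and six: "\<sigma> i x = a" and siy: "\<sigma> i y = b" and sia: "\<sigma> i a = x" and sib: "\<sigma> i b = y"
    and tia: "\<tau> i a = b" and tib: "\<tau> i b = a"
    and tau: "\<And>c u. c \<in> B \<Longrightarrow> u \<in> V - {x, y} \<Longrightarrow> \<not> (c = i \<and> u \<in> {a, b}) \<Longrightarrow> \<tau> c u = \<sigma> c u"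
    and inv': "inv_on \<tau> B (V - {x, y})"
begin

abbreviation "V' \<equiv> V - {x, y}"
abbreviation "W \<equiv> B - {i}"
abbreviation "X \<equiv> faces V \<sigma> B"
abbreviation "X' \<equiv> faces V' \<tau> B"
text \<open>\<open>bt\<close> and \<open>tp\<close> are the facets of the simplices of
  \<open>x\<close> and \<open>y\<close> opposite to the label i, \<open>U\<close> is the simplex of
  \<open>a\<close>, and \<open>z\<close> is the vertex labelled i that only the simplices of
  \<open>x\<close> and \<open>y\<close> contain. \<open>Sg\<close> collects the faces of these two
  simplices that avoid \<open>z\<close>, and \<open>e\<close> spans such a face with
  \<open>z\<close>.\<close>

definition "bt = (W, {x, a})"
definition "tp = (W, {y, b})"
definition "U = (B, {a})"
definition "z = ({i}, {x, y})"
definition "Sg = {bt, tp} \<union> {(T, orb \<sigma> (B - T) x) | T. T \<noteq> {} \<and> T \<subset> W}"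
definition "e G = (insert i (fst G), snd G \<inter> {x, y})"

lemma Wne: "W \<noteq> {}" using iB B2 by auto

lemma a': "a \<in> V'" and b': "b \<in> V'" using aV bV neq by auto

lemma fst_simps [simp]: "fst bt = W" "fst tp = W" "fst U = B" "fst z = {i}" "fst (e G) = insert i (fst G)"
  and snd_simps [simp]: "snd bt = {x, a}" "snd tp = {y, b}" "snd U = {a}" "snd z = {x, y}" "snd (e G) = snd G \<inter> {x, y}"
  by (auto simp: bt_def tp_def U_def z_def e_def)

lemma orb_pair:
  assumes "S \<subseteq> B" "i \<in> S" "S \<noteq> B" "u \<in> {x, y}"
  shows "orb \<sigma> (B - S) u = {x, y}"
proof
  show "orb \<sigma> (B - S) u \<subseteq> {x, y}"
  proof (rule orb_subset)
    fix w c assume "w \<in> {x, y}" "c \<in> B - S"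
    moreover then have "c \<in> B" "c \<noteq> i" using assms(2) by auto
    ultimately show "\<sigma> c w \<in> {x, y}" using sx sy by auto
  qed (use assms in auto)
  obtain j where j: "j \<in> B - S" using assms by blast
  then have jB: "j \<in> B" "j \<noteq> i" using assms(2) by auto
  show "{x, y} \<subseteq> orb \<sigma> (B - S) u"
    using orb_step[OF orb_self j, of \<sigma> u] orb_self[of u \<sigma> "B - S"] assms(4) sx[OF jB] sy[OF jB] by auto
qed

lemma orb_single_V: "u \<in> V \<Longrightarrow> orb \<sigma> {i} u = {u, \<sigma> i u}"
  by (rule orb_single) (rule inv_onD(2)[OF inv iB])

lemma orb_single_V': "u \<in> V' \<Longrightarrow> orb \<tau> {i} u = {u, \<tau> i u}"
  by (rule orb_single) (rule inv_onD(2)[OF inv' iB])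

lemma diff_W: "B - W = {i}" using iB by auto

lemma orb_big:
  assumes "S \<subset> W" "u \<in> {x, y, a, b}"
  shows "{x, y, a, b} \<subseteq> orb \<sigma> (B - S) u" "orb \<sigma> (B - S) u = orb \<sigma> (B - S) x"
proof -
  have i: "i \<in> B - S" using iB assms by auto
  obtain j where j: "j \<in> B - S" "j \<noteq> i" "j \<in> B" using assms(1) by blast
  have 1: "{x, y, a, b} \<subseteq> orb \<sigma> (B - S) x"
  proof -
    have "a \<in> orb \<sigma> (B - S) x" using orb_step[OF orb_self i, of \<sigma> x] six by simp
    moreover have y: "y \<in> orb \<sigma> (B - S) x" using orb_step[OF orb_self j(1), of \<sigma> x] sx[OF j(3,2)] by simp
    moreover have "b \<in> orb \<sigma> (B - S) x" using orb_step[OF y i] siy by simp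
    ultimately show ?thesis by simp
  qed
  show "orb \<sigma> (B - S) u = orb \<sigma> (B - S) x"
    by (rule orb_eq[OF inv_on_mono[OF inv] xV]) (use 1 assms(2) in auto)
  then show "{x, y, a, b} \<subseteq> orb \<sigma> (B - S) u" using 1 by simp
qed

lemma orb_tau_i: "S \<subseteq> B \<Longrightarrow> i \<in> S \<Longrightarrow> w \<in> V' \<Longrightarrow> orb \<sigma> (B - S) w = orb \<tau> (B - S) w"
  by (rule orb_cong[OF inv_on_mono[OF inv']]) (auto intro!: tau[symmetric])

lemma orb_tau_in: "w \<in> V' \<Longrightarrow> orb \<tau> (B - S) w \<subseteq> V'"
  by (rule orb_in[OF inv_on_mono[OF inv']]) auto

lemma ab_tau: "i \<in> C \<Longrightarrow> a \<in> orb \<tau> C w \<longleftrightarrow> b \<in> orb \<tau> C w"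
  using orb_step[of a \<tau> C w i] orb_step[of b \<tau> C w i] tia tib by auto

text \<open>The colours of \<open>B - S\<close> include i and a further one, so reinserting the pair
  attaches both \<open>x\<close> and \<open>y\<close> to the residue through \<open>a\<close> and
  \<open>b\<close> and leaves the others as they were.\<close>

lemma orb_tau_big:
  assumes S: "S \<subset> W" and w: "w \<in> V'"
  shows "orb \<sigma> (B - S) w = orb \<tau> (B - S) w \<union> (if a \<in> orb \<tau> (B - S) w then {x, y} else {})"
    (is "?L = ?R")
proof
  let ?C = "B - S"
  have i: "i \<in> ?C" using iB S by auto
  obtain j where j: "j \<in> ?C" "j \<noteq> i" "j \<in> B" using S by blast
  have tV: "orb \<tau> ?C w \<subseteq> V'" by (rule orb_tau_in[OF w])
  show "?L \<subseteq> ?R"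
  proof (rule orb_subset)
    fix u c assume u: "u \<in> ?R" and c: "c \<in> ?C"
    have cB: "c \<in> B" using c by auto
    show "\<sigma> c u \<in> ?R"
    proof (cases "u \<in> {x, y}")
      case True
      then have "a \<in> orb \<tau> ?C w" using u tV by (auto split: if_splits)
      moreover then have "b \<in> orb \<tau> ?C w" using ab_tau[OF i] by blast
      moreover have "\<sigma> c u \<in> {x, y, a, b}" using True sx[OF cB] sy[OF cB] six siy by (cases "c = i") auto
      ultimately show ?thesis by auto
    next
      case False
      then have uo: "u \<in> orb \<tau> ?C w" using u by (auto split: if_splits)
      show ?thesis
      proof (cases "c = i \<and> u \<in> {a, b}")
        case True
        then have "a \<in> orb \<tau> ?C w" using uo ab_tau[OF i] by auto
        then show ?thesis using True sia sib by auto
      next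
        case F2: False
        have "\<tau> c u = \<sigma> c u" using tau[OF cB _ F2] uo tV by blast
        then show ?thesis using orb_step[OF uo c] by simp
      qed
    qed
  qed simp
  have "orb \<tau> ?C w \<subseteq> orb \<sigma> ?C w \<inter> V'"
  proof (rule orb_subset)
    fix u c assume u: "u \<in> orb \<sigma> ?C w \<inter> V'" and c: "c \<in> ?C"
    have cB: "c \<in> B" using c by auto
    have uV: "u \<in> V'" "u \<in> orb \<sigma> ?C w" using u by auto
    have "\<tau> c u \<in> orb \<sigma> ?C w"
    proof (cases "c = i \<and> u \<in> {a, b}")
      case True
      then have "\<tau> c u \<in> {a, b}" using tia tib by auto
      moreover have "{x, y, a, b} \<subseteq> orb \<sigma> ?C u" using orb_big(1)[OF S, of u] True by auto
      ultimately show ?thesis using orb_trans[OF uV(2)] by auto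
    next
      case False
      then show ?thesis using tau[OF cB uV(1) False] orb_step[OF uV(2) c] by simp
    qed
    then show "\<tau> c u \<in> orb \<sigma> ?C w \<inter> V'" using inv_onD(1)[OF inv' cB uV(1)] by simp
  qed (use w in simp)
  moreover have "{x, y} \<subseteq> orb \<sigma> ?C w" if "a \<in> orb \<sigma> ?C w"
    using orb_big(1)[OF S, of a] orb_trans[OF that] by auto
  ultimately show "?R \<subseteq> ?L" by auto
qed

lemma Sg_props:
  assumes "G \<in> Sg"
  shows "i \<notin> fst G" "fst G \<noteq> {}" "fst G \<subseteq> W" "snd G \<inter> {x, y} \<noteq> {}" "fst G \<subset> W \<Longrightarrow> {x, y, a, b} \<subseteq> snd G"
  using assms Wne orb_big(1)[of "fst G" x] unfolding Sg_def by auto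

lemma Sg_same_fst:
  assumes "G \<in> Sg" "H \<in> Sg" "fst G = fst H"
  shows "G = H \<or> snd G \<inter> snd H = {}"
proof (cases "fst G \<subset> W")
  case True
  then have "G = (fst G, orb \<sigma> (B - fst G) x)" "H = (fst H, orb \<sigma> (B - fst H) x)"
    using assms unfolding Sg_def by auto
  then show ?thesis using assms(3) by metis
next
  case False
  then have "G = bt \<or> G = tp" "H = bt \<or> H = tp" using assms unfolding Sg_def by auto
  then show ?thesis using neq by auto
qed

lemma in_X: "z \<in> X" "bt \<in> X" "tp \<in> X" "U \<in> X" "Sg \<subseteq> X" "e ` Sg \<subseteq> X"
proof -
  have Wi: "W \<subseteq> B" "W \<noteq> {}" using Wne by auto
  show "z \<in> X" unfolding z_def
    by (rule facesI[OF xV]) (use iB B2 orb_pair[of "{i}" x] in auto)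
  show F: "bt \<in> X" unfolding bt_def
    by (rule facesI[OF xV Wi]) (use orb_single_V[OF xV] six diff_W in auto)
  show t: "tp \<in> X" unfolding tp_def
    by (rule facesI[OF yV Wi]) (use orb_single_V[OF yV] siy diff_W in auto)
  show "U \<in> X" unfolding U_def by (rule facesI[OF aV]) (use iB in auto)
  have "(T, orb \<sigma> (B - T) x) \<in> X" if "T \<noteq> {}" "T \<subset> W" for T
    by (rule facesI[OF xV _ that(1) refl]) (use that in auto)
  then show SX: "Sg \<subseteq> X" unfolding Sg_def using F t by auto
  show "e ` Sg \<subseteq> X"
  proof
    fix H assume "H \<in> e ` Sg"
    then obtain G where G: "G \<in> Sg" "H = e G" by blast
    show "H \<in> X"
    proof (cases "fst G \<subset> W")
      case True
      then have "H = (insert i (fst G), {x, y})" using G Sg_props(5)[OF G(1)] by (auto simp: e_def)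
      moreover have "insert i (fst G) \<subseteq> B" "insert i (fst G) \<noteq> B" using True iB by auto
      ultimately show ?thesis using orb_pair[of "insert i (fst G)" x]
        by (auto intro!: facesI[OF xV])
    next
      case False
      then have "G = bt \<or> G = tp" using G unfolding Sg_def by auto
      then show ?thesis
      proof
        assume "G = bt"
        then have "H = (B, {x})" using G(2) iB neq by (auto simp: e_def bt_def)
        then show ?thesis using iB by (auto intro!: facesI[OF xV])
      next
        assume "G = tp"
        then have "H = (B, {y})" using G(2) iB neq by (auto simp: e_def tp_def)
        then show ?thesis using iB by (auto intro!: facesI[OF yV])
      qed
    qed
  qed
qed

text \<open>A face meeting \<open>x\<close> or \<open>y\<close> is a face of one of the two
  simplices: it equals \<open>z\<close>, avoids \<open>z\<close>, or contains \<open>z\<close>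
  properly. These are the three kinds listed.\<close>

lemma outside:
  assumes "F \<in> X" "F \<notin> {z} \<union> Sg \<union> e ` Sg"
  shows "snd F \<inter> {x, y} = {}"
proof (rule ccontr)
  assume ne: "snd F \<inter> {x, y} \<noteq> {}"
  obtain S v where F: "F = (S, orb \<sigma> (B - S) v)" "v \<in> V" "S \<subseteq> B" "S \<noteq> {}" by (rule facesE[OF assms(1)])
  obtain u where u: "u \<in> {x, y}" "u \<in> orb \<sigma> (B - S) v" using ne F(1) by auto
  have Fu: "F = (S, orb \<sigma> (B - S) u)"
    using orb_eq[OF inv_on_mono[OF inv] F(2) u(2)] F(1) by auto
  have btS: "bt \<in> Sg" "tp \<in> Sg" unfolding Sg_def by auto
  consider "S = B" | "i \<in> S" "S \<noteq> B" | "S = W" | "S \<subset> W" using F(3) by blast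
  then show False
  proof cases
    case 1
    have "e bt = (B, {x})" "e tp = (B, {y})" using iB neq by (auto simp: e_def)
    then have "F \<in> e ` Sg" using Fu 1 u(1) btS by (metis Diff_cancel empty_iff image_eqI insert_iff orb_empty)
    then show False using assms(2) by blast
  next
    case 2
    have F': "F = (S, {x, y})" using Fu orb_pair[OF F(3) 2 u(1)] by simp
    show False
    proof (cases "S = {i}")
      case True
      then show False using F' assms(2) by (simp add: z_def)
    next
      case False
      let ?T = "S - {i}"
      have T: "?T \<noteq> {}" "?T \<subset> W" "insert i ?T = S" using False 2 F(3,4) by auto
      have "(?T, orb \<sigma> (B - ?T) x) \<in> Sg" unfolding Sg_def using T by blast
      moreover have "e (?T, orb \<sigma> (B - ?T) x) = F"
        using orb_big(1)[OF T(2), of x] T(3) F' by (auto simp: e_def)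
      ultimately show False using assms(2) by blast
    qed
  next
    case 3
    then have "F = bt \<or> F = tp"
      using Fu u(1) orb_single_V[OF xV] orb_single_V[OF yV] six siy diff_W by (auto simp: bt_def tp_def)
    then show False using btS assms(2) by auto
  next
    case 4
    have "F = (S, orb \<sigma> (B - S) x)" using Fu orb_big(2)[OF 4, of u] u(1) by auto
    then have "F \<in> Sg" unfolding Sg_def using 4 F(4) by auto
    then show False using assms(2) by blast
  qed
qed

lemma finite_X: "finite X"
proof -
  have "X \<subseteq> (\<lambda>(S, v). (S, orb \<sigma> (B - S) v)) ` (Pow B \<times> V)" unfolding faces_def by auto
  then show ?thesis by (rule finite_subset) (use finB finV in auto)
qed

text \<open>The star of \<open>z\<close> is the cone over \<open>Sg\<close>, so its subdivision can
  be undone first.\<close>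

lemma reduce_cone:
  assumes "gsph k (X - e ` Sg) (cone_edges fadj z Sg)"
  shows "gsph k X fadj"
proof (rule gsph_cone[where R = "\<lambda>G H. fst G \<subset> fst H" and ht = "\<lambda>G. card (fst G)", OF finite_X in_X(5,1,6) _ _ _ _ _ _ _ _ _ _ _ _ assms])
  have fin: "finite (fst G)" if "G \<in> Sg" for G
    using Sg_props(3)[OF that] finB by (meson finite_Diff finite_subset)
  show "inj_on e Sg"
  proof (rule inj_onI)
    fix G H assume GH: "G \<in> Sg" "H \<in> Sg" and eq: "e G = e H"
    have "insert i (fst G) = insert i (fst H)" "snd G \<inter> {x, y} = snd H \<inter> {x, y}" using eq by (auto simp: e_def)
    then have "fst G = fst H" using Sg_props(1)[OF GH(1)] Sg_props(1)[OF GH(2)] by (metis insert_ident)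
    moreover have "snd G \<inter> snd H \<noteq> {}" using \<open>snd G \<inter> {x, y} = snd H \<inter> {x, y}\<close> Sg_props(4)[OF GH(1)] by blast
    ultimately show "G = H" using Sg_same_fst[OF GH] by blast
  qed
  show "z \<notin> Sg" using Sg_props(1)[of z] by auto
  show "z \<notin> e ` Sg"
  proof
    assume "z \<in> e ` Sg"
    then obtain G where G: "G \<in> Sg" "z = e G" by blast
    then have "insert i (fst G) = {i}" by (metis fst_simps(4,5))
    then show False using Sg_props(1,2)[OF G(1)] by auto
  qed
  show "Sg \<inter> e ` Sg = {}"
  proof -
    have "i \<in> fst (e G)" for G by simp
    then show ?thesis using Sg_props(1) by blast
  qed
  show "card (fst G) < card (fst H)" if "G \<in> Sg" "H \<in> Sg" "fst G \<subset> fst H" for G H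
    using that fin by (intro psubset_card_mono) auto
  show "fadj v u" if "fadj u v" for u v using that by (rule fadj_sym)
  show "\<not> fadj z G \<and> fadj (e G) z \<and> fadj (e G) G" if "G \<in> Sg" for G
    using Sg_props[OF that] unfolding fadj_def by auto
  show "fadj G H \<longleftrightarrow> fst G \<subset> fst H \<or> fst H \<subset> fst G" if GH: "G \<in> Sg" "H \<in> Sg" for G H
    using Sg_props[OF GH(1)] Sg_props[OF GH(2)] unfolding fadj_def by blast
  show "fadj (e G) (e H) \<longleftrightarrow> fst G \<subset> fst H \<or> fst H \<subset> fst G" if GH: "G \<in> Sg" "H \<in> Sg" for G H
  proof -
    have "fst (e G) \<subset> fst (e H) \<longleftrightarrow> fst G \<subset> fst H" "fst (e H) \<subset> fst (e G) \<longleftrightarrow> fst H \<subset> fst G"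
      using Sg_props(1)[OF GH(1)] Sg_props(1)[OF GH(2)] by auto
    moreover have "snd (e G) \<inter> snd (e H) \<noteq> {}" if "fst G \<subset> fst H \<or> fst H \<subset> fst G"
      using that Sg_props[OF GH(1)] Sg_props[OF GH(2)] unfolding snd_simps by blast
    ultimately show ?thesis unfolding fadj_def by blast
  qed
  show "fadj (e G) H \<longleftrightarrow> fst H \<subset> fst G" if GH: "G \<in> Sg" "H \<in> Sg" "G \<noteq> H" for G H
  proof -
    note p = Sg_props[OF GH(1)] Sg_props[OF GH(2)]
    have 1: "\<not> fst (e G) \<subset> fst H" using p by auto
    have 2: "fst H \<subset> fst (e G) \<longleftrightarrow> fst H \<subseteq> fst G" using p(1) p(6) by auto
    show ?thesis
    proof
      assume "fadj (e G) H"
      then have "fst H \<subseteq> fst G" "snd G \<inter> snd H \<noteq> {}" using 1 2 unfolding fadj_def by auto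
      then show "fst H \<subset> fst G" using Sg_same_fst[OF GH(1,2)] GH(3) by blast
    next
      assume "fst H \<subset> fst G"
      then have "fst H \<subset> fst (e G)" "{x, y} \<subseteq> snd H" using 2 p by auto
      then show "fadj (e G) H" using p(4) unfolding fadj_def snd_simps by blast
    qed
  qed
  show "\<not> fadj z u" if "u \<in> X - ({z} \<union> Sg \<union> e ` Sg)" for u
    using outside[of u] that unfolding fadj_def by auto
  show "\<not> fadj (e G) u" if "u \<in> X - ({z} \<union> Sg \<union> e ` Sg)" for u G
    using outside[of u] that unfolding fadj_def by auto
qed

text \<open>Three stages: the star of \<open>z\<close> unsubdivided, then \<open>bt\<close> removed,
  then \<open>z\<close> removed. The restored edges carry the contact of \<open>U\<close> from
  \<open>bt\<close> to \<open>z\<close> and on to \<open>tp\<close>, which ends up as the facet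
  between \<open>a\<close> and \<open>b\<close>.\<close>

definition "A1 = cone_edges fadj z Sg"
definition "A2 = add_edge A1 U z"
definition "A3 = add_edge A2 U tp"
definition "X1 = X - e ` Sg"

lemma mem_Sg: "bt \<in> Sg" "tp \<in> Sg" "bt \<noteq> tp" "U \<notin> Sg" "z \<notin> Sg" "U \<noteq> z" "z \<noteq> bt" "z \<noteq> tp" "U \<noteq> bt" "U \<noteq> tp"
proof -
  show "bt \<in> Sg" "tp \<in> Sg" by (auto simp: Sg_def)
  show "bt \<noteq> tp" "U \<noteq> z" using neq by (auto simp: bt_def tp_def U_def z_def)
  show "U \<notin> Sg" "z \<notin> Sg" using Sg_props(1)[of U] Sg_props(1)[of z] iB by auto
  then show "z \<noteq> bt" "z \<noteq> tp" "U \<noteq> bt" "U \<noteq> tp" using \<open>bt \<in> Sg\<close> \<open>tp \<in> Sg\<close> by auto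
qed

lemma mem_X1: "z \<in> X1" "bt \<in> X1" "tp \<in> X1" "U \<in> X1"
proof -
  have "z \<notin> e ` Sg"
  proof
    assume "z \<in> e ` Sg"
    then obtain G where G: "G \<in> Sg" "z = e G" by blast
    then have "insert i (fst G) = {i}" by (metis fst_simps(4,5))
    then show False using Sg_props(1,2)[OF G(1)] by auto
  qed
  moreover have "H \<notin> e ` Sg" if "H \<in> Sg" for H
  proof
    assume "H \<in> e ` Sg"
    then have "i \<in> fst H" by auto
    then show False using Sg_props(1)[OF that] by blast
  qed
  moreover have "U \<notin> e ` Sg"
  proof
    assume "U \<in> e ` Sg"
    then obtain G where G: "G \<in> Sg" "U = e G" by blast
    then have "snd G \<inter> {x, y} = {a}" by (metis snd_simps(3,5))
    then show False using neq by auto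
  qed
  ultimately show "z \<in> X1" "bt \<in> X1" "tp \<in> X1" "U \<in> X1" unfolding X1_def using in_X mem_Sg by auto
qed

lemma X1_cases:
  assumes "H \<in> X1" "H \<noteq> z"
  shows "H = bt \<or> H = tp \<or> (H \<in> Sg \<and> fst H \<subset> W \<and> {x, y, a, b} \<subseteq> snd H) \<or> (H \<notin> Sg \<and> snd H \<inter> {x, y} = {})"
proof (cases "H \<in> Sg")
  case True
  then have "H = bt \<or> H = tp \<or> fst H \<subset> W" unfolding Sg_def by auto
  then show ?thesis using Sg_props(5)[OF True] True by blast
next
  case False
  then show ?thesis using outside[of H] assms unfolding X1_def by auto
qed

text \<open>Such a residue admits i and a further colour, hence would lead from \<open>a\<close> or
  \<open>b\<close> to \<open>x\<close>.\<close>

lemma out_small: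
  assumes "H \<in> X1" "H \<noteq> z" "snd H \<inter> {x, y} = {}" "fst H \<subset> W"
  shows "a \<notin> snd H" "b \<notin> snd H"
proof -
  obtain S v where F: "H = (S, orb \<sigma> (B - S) v)" "v \<in> V"
    using facesE[of H V \<sigma> B] assms(1) unfolding X1_def by blast
  have "w \<notin> orb \<sigma> (B - S) v" if "w \<in> {a, b}" for w
  proof
    assume w: "w \<in> orb \<sigma> (B - S) v"
    have "x \<in> orb \<sigma> (B - S) w" using orb_big(1)[of S w] that F assms(4) by auto
    then show False using orb_trans[OF w] assms(3) F by auto
  qed
  then show "a \<notin> snd H" "b \<notin> snd H" using F by auto
qed

lemma face_top:
  assumes "H \<in> X" "fst H = B" "w \<in> snd H"
  shows "H = (B, {w})"
  using facesE[OF assms(1)] assms(2,3) by (metis Diff_cancel fst_conv orb_empty singletonD snd_conv)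

lemma A1_z: "H \<in> X1 \<Longrightarrow> H \<noteq> z \<Longrightarrow> A1 z H \<longleftrightarrow> H \<in> Sg"
proof -
  assume H: "H \<in> X1" "H \<noteq> z"
  have "\<not> fadj z H" using X1_cases[OF H] Sg_props(1,2)[of H] mem_Sg unfolding fadj_def by auto
  then show "A1 z H \<longleftrightarrow> H \<in> Sg" unfolding A1_def cone_edges_def using mem_Sg by auto
qed

lemma A1_other: "G \<noteq> z \<Longrightarrow> H \<noteq> z \<Longrightarrow> A1 G H \<longleftrightarrow> fadj G H"
  unfolding A1_def cone_edges_def by auto

lemma A1_sym: "A1 G H \<Longrightarrow> A1 H G"
  unfolding A1_def cone_edges_def using fadj_sym by blast

text \<open>Apart from \<open>U\<close> and \<open>z\<close>, the neighbours of \<open>bt\<close>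
  are the lower faces in \<open>Sg\<close>, and these are also the common neighbours of
  \<open>U\<close> and \<open>z\<close>. So \<open>bt\<close> is a midpoint of the missing edge
  between them.\<close>

lemma reduce_bt:
  assumes "gsph k (X1 - {bt}) A2"
  shows "gsph k X1 A1"
proof (rule gsph_unsub[OF assms[unfolded A2_def] mem_X1(2) mem_X1(4) mem_X1(1)])
  show "U \<noteq> z" "U \<noteq> bt" "z \<noteq> bt" using mem_Sg by auto
  have "A1 z U \<longleftrightarrow> U \<in> Sg" using A1_z[OF mem_X1(4)] mem_Sg by auto
  then show "\<not> A1 U z" using mem_Sg A1_sym by blast
  show "A1 bt U" using A1_other[of bt U] mem_Sg iB by (auto simp: fadj_def)
  show "A1 bt z" using A1_z[OF mem_X1(2)] mem_Sg(1,7) by (intro A1_sym[of z]) auto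
  fix H assume H: "H \<in> X1 - {U, z, bt}"
  then have H1: "H \<in> X1" "H \<noteq> z" "H \<noteq> U" "H \<noteq> bt" by auto
  have HX: "H \<in> X" using H1(1) by (simp add: X1_def)
  have eqs: "A1 bt H \<longleftrightarrow> fadj bt H" "A1 U H \<longleftrightarrow> fadj U H" "A1 z H \<longleftrightarrow> H \<in> Sg"
    using A1_other[of bt H] A1_other[of U H] A1_z[OF H1(1,2)] H1 mem_Sg by auto
  from X1_cases[OF H1(1,2)] show "A1 bt H \<longleftrightarrow> A1 U H \<and> A1 z H"
  proof (elim disjE)
    assume "H = bt" then show ?thesis using H1 by simp
  next
    assume "H = tp" then show ?thesis unfolding eqs using neq by (auto simp: fadj_def)
  next
    assume "H \<in> Sg \<and> fst H \<subset> W \<and> {x, y, a, b} \<subseteq> snd H"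
    then show ?thesis unfolding eqs by (auto simp: fadj_def)
  next
    assume H2: "H \<notin> Sg \<and> snd H \<inter> {x, y} = {}"
    have "\<not> fadj bt H"
    proof
      assume f: "fadj bt H"
      then have aH: "a \<in> snd H" using H2 unfolding fadj_def by auto
      have "\<not> fst H \<subset> W" using out_small(1)[OF H1(1,2)] H2 aH by blast
      moreover have "fst H \<subseteq> B" using facesE[OF HX] by (metis fst_conv)
      ultimately have "fst H = B" using f unfolding fadj_def by auto
      then show False using face_top[OF HX _ aH] H1(3) by (simp add: U_def)
    qed
    then show ?thesis unfolding eqs using H2 by blast
  qed
qed

text \<open>Now \<open>z\<close> is a midpoint in its turn: besides \<open>U\<close> and
  \<open>tp\<close> it sees only the lower faces in \<open>Sg\<close>, which are incident with
  both.\<close>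

lemma reduce_z:
  assumes "gsph k (X1 - {bt} - {z}) A3"
  shows "gsph k (X1 - {bt}) A2"
proof (rule gsph_unsub[OF assms[unfolded A3_def]])
  show "z \<in> X1 - {bt}" "U \<in> X1 - {bt}" "tp \<in> X1 - {bt}" using mem_X1 mem_Sg by auto
  show "U \<noteq> tp" "U \<noteq> z" "tp \<noteq> z" using mem_Sg by auto
  have "\<not> fadj U tp" using neq by (auto simp: fadj_def)
  then show "\<not> A2 U tp" using A1_other[of U tp] mem_Sg by (auto simp: A2_def add_edge_def)
  show "A2 z U" by (simp add: A2_def add_edge_def)
  show "A2 z tp" using A1_z[OF mem_X1(3)] mem_Sg by (auto simp: A2_def add_edge_def)
  fix H assume "H \<in> X1 - {bt} - {U, tp, z}"
  then have H1: "H \<in> X1" "H \<noteq> z" "H \<noteq> U" "H \<noteq> bt" "H \<noteq> tp" by auto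
  have HX: "H \<in> X" using H1(1) by (simp add: X1_def)
  have eqs: "A2 z H \<longleftrightarrow> H \<in> Sg" "A2 U H \<longleftrightarrow> fadj U H" "A2 tp H \<longleftrightarrow> fadj tp H"
    using A1_other[of tp H] A1_other[of U H] A1_z[OF H1(1,2)] H1 mem_Sg by (auto simp: A2_def add_edge_def)
  from X1_cases[OF H1(1,2)] show "A2 z H \<longleftrightarrow> A2 U H \<and> A2 tp H"
  proof (elim disjE)
    assume "H \<in> Sg \<and> fst H \<subset> W \<and> {x, y, a, b} \<subseteq> snd H"
    then show ?thesis unfolding eqs by (auto simp: fadj_def)
  next
    assume H2: "H \<notin> Sg \<and> snd H \<inter> {x, y} = {}"
    have "\<not> (fadj U H \<and> fadj tp H)"
    proof
      assume f: "fadj U H \<and> fadj tp H"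
      then have aH: "a \<in> snd H" unfolding fadj_def by auto
      have "\<not> fst H \<subset> W" using out_small(1)[OF H1(1,2)] H2 aH by blast
      moreover have "fst H \<subseteq> B" using facesE[OF HX] by (metis fst_conv)
      ultimately have "fst H = B" using f unfolding fadj_def by auto
      then show False using f unfolding fadj_def by auto
    qed
    then show ?thesis unfolding eqs using H2 by blast
  qed (use H1 in auto)
qed

text \<open>Matches the faces of the reduced graph with the faces left after the three stages: a
  residue through \<open>a\<close> and \<open>b\<close> regains \<open>x\<close> and
  \<open>y\<close>, and the facet with residue \<open>{a, b}\<close> becomes
  \<open>tp\<close>.\<close>

definition "f G = (if fst G = W then (if a \<in> snd G then tp else G)
    else if i \<in> fst G then G else (fst G, if a \<in> snd G then snd G \<union> {x, y} else snd G))"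

lemma fst_f [simp]: "fst (f G) = fst G"
  unfolding f_def by auto

lemma f_fst_eq: "f G = K \<Longrightarrow> fst G = fst K"
  using fst_f[of G] by simp

lemma X'_sub:
  assumes "G \<in> X'"
  shows "snd G \<subseteq> V'"
proof -
  obtain S w where G: "G = (S, orb \<tau> (B - S) w)" "w \<in> V'" by (rule facesE[OF assms])
  show ?thesis unfolding G(1) snd_conv by (rule orb_tau_in[OF G(2)])
qed

lemma X'_W:
  assumes "G \<in> X'" "fst G = W" "a \<in> snd G"
  shows "G = (W, {a, b})"
proof -
  obtain S w where G: "G = (S, orb \<tau> (B - S) w)" "w \<in> V'" by (rule facesE[OF assms(1)])
  have S: "S = W" using G assms(2) by simp
  have "a \<in> orb \<tau> {i} w" using G assms(3) S diff_W by simp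
  then have "orb \<tau> {i} w = orb \<tau> {i} a"
    using orb_eq[OF inv_on_mono[OF inv', of "{i}"] G(2), of a] iB by simp
  then show ?thesis using G S diff_W orb_single_V'[OF a'] tia by simp
qed

lemma X'_ab:
  assumes "G \<in> X'" "i \<notin> fst G"
  shows "a \<in> snd G \<longleftrightarrow> b \<in> snd G"
proof -
  obtain S w where G: "G = (S, orb \<tau> (B - S) w)" by (rule facesE[OF assms(1)])
  then have "i \<in> B - S" using assms(2) iB by simp
  from ab_tau[OF this, of w] show ?thesis using G by simp
qed

lemma X'_fst: "G \<in> X' \<Longrightarrow> fst G \<subseteq> B"
  by (auto elim!: facesE)

lemma f_W: "fst G = W \<Longrightarrow> f G = (if a \<in> snd G then tp else G)"
  by (simp add: f_def)

lemma f_i: "i \<in> fst G \<Longrightarrow> f G = G"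
  unfolding f_def by auto

lemma f_small: "fst G \<subset> W \<Longrightarrow> f G = (fst G, if a \<in> snd G then snd G \<union> {x, y} else snd G)"
  unfolding f_def by auto

lemma X'_cases:
  assumes "G \<in> X'"
  obtains "i \<in> fst G" | "fst G = W" | "fst G \<subset> W" "i \<notin> fst G"
  using X'_fst[OF assms] by blast

lemma inj_f: "inj_on f X'"
proof (rule inj_onI)
  fix G H assume G: "G \<in> X'" and H: "H \<in> X'" and eq: "f G = f H"
  have fst: "fst G = fst H" using eq by (metis fst_f)
  have GV: "snd G \<subseteq> V'" "snd H \<subseteq> V'" using X'_sub G H by auto
  have ytp: "y \<in> snd tp" by simp
  show "G = H"
  proof (rule X'_cases[OF G])
    assume "i \<in> fst G"
    then show ?thesis using eq fst f_i by metis
  next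
    assume W: "fst G = W"
    have HW: "fst H = W" using W fst by simp
    have "G \<noteq> tp" "H \<noteq> tp" using GV ytp by blast+
    then have iff: "a \<in> snd G \<longleftrightarrow> a \<in> snd H"
      using eq unfolding f_W[OF W] f_W[OF HW] by metis
    show ?thesis
    proof (cases "a \<in> snd G")
      case True
      then show ?thesis using X'_W[OF G W] X'_W[OF H HW] iff by simp
    next
      case False
      then show ?thesis using eq iff unfolding f_W[OF W] f_W[OF HW] by simp
    qed
  next
    assume sm: "fst G \<subset> W"
    have "snd (f G) \<inter> V' = snd G" using f_small[OF sm] GV by auto
    moreover have "snd (f H) \<inter> V' = snd H" using f_small[of H] sm fst GV by auto
    ultimately show ?thesis using eq fst by (metis prod.collapse)
  qed
qed

lemma not_e: "snd H \<inter> {x, y} = {} \<or> i \<notin> fst H \<Longrightarrow> H \<notin> e ` Sg"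
proof
  assume *: "snd H \<inter> {x, y} = {} \<or> i \<notin> fst H" "H \<in> e ` Sg"
  then obtain G where G: "G \<in> Sg" "H = e G" by blast
  then have "i \<in> fst H" "snd H \<inter> {x, y} \<noteq> {}" using Sg_props(4)[OF G(1)] by auto
  then show False using * by blast
qed

lemma image_f: "f ` X' = X1 - {bt} - {z}"
proof (intro equalityI subsetI)
  fix H assume "H \<in> f ` X'"
  then obtain G where G: "G \<in> X'" "H = f G" by blast
  obtain S w where S: "G = (S, orb \<tau> (B - S) w)" "w \<in> V'" "S \<subseteq> B" "S \<noteq> {}" by (rule facesE[OF G(1)])
  have wV: "w \<in> V" using S by auto
  have GV: "snd G \<inter> {x, y} = {}" using X'_sub[OF G(1)] by auto
  have keep: "G \<in> X1 - {bt} - {z}" if "G \<in> X"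
    using that GV not_e[of G] unfolding X1_def by auto
  show "H \<in> X1 - {bt} - {z}"
  proof (rule X'_cases[OF G(1)])
    assume i: "i \<in> fst G"
    then have "G = (S, orb \<sigma> (B - S) w)" using orb_tau_i[of S w] S by simp
    then have "G \<in> X" using facesI[OF wV S(3,4)] by blast
    then show ?thesis using keep f_i[OF i] G(2) by simp
  next
    assume W: "fst G = W"
    then have SW: "S = W" using S by simp
    show ?thesis
    proof (cases "a \<in> snd G")
      case True
      then show ?thesis using f_W[OF W] G(2) mem_X1(3) mem_Sg by auto
    next
      case False
      have Gs: "snd G = {w, \<tau> i w}" using S SW diff_W orb_single_V'[OF S(2)] by simp
      then have "w \<notin> {a, b}" using False tib by auto
      then have "\<tau> i w = \<sigma> i w" using tau[OF iB S(2)] by simp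
      then have "G = (W, orb \<sigma> (B - W) w)" using Gs S SW diff_W orb_single_V[OF wV] by (metis prod.collapse W)
      then have "G \<in> X" using facesI[OF wV] S SW by blast
      then show ?thesis using keep f_W[OF W] False G(2) by simp
    qed
  next
    assume sm: "fst G \<subset> W" "i \<notin> fst G"
    then have SW: "S \<subset> W" using S by simp
    have "H = (S, orb \<sigma> (B - S) w)" using f_small[OF sm(1)] G(2) S orb_tau_big[OF SW S(2)] by simp
    then have "H \<in> X" using facesI[OF wV S(3,4)] by blast
    moreover have "H \<notin> e ` Sg" using not_e[of H] sm G(2) by simp
    moreover have "H \<noteq> bt" "H \<noteq> z" using f_fst_eq[of G bt] f_fst_eq[of G z] sm G(2) by auto
    ultimately show ?thesis unfolding X1_def by auto
  qed
next
  fix H assume "H \<in> X1 - {bt} - {z}"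
  then have H: "H \<in> X1" "H \<noteq> bt" "H \<noteq> z" by auto
  have HX: "H \<in> X" using H(1) by (simp add: X1_def)
  obtain S v where S: "H = (S, orb \<sigma> (B - S) v)" "v \<in> V" "S \<subseteq> B" "S \<noteq> {}" by (rule facesE[OF HX])
  from X1_cases[OF H(1,3)] H(2) show "H \<in> f ` X'"
  proof (elim disjE)
    assume "H = bt" then show ?thesis using H by simp
  next
    assume "H = tp"
    have "(W, {a, b}) \<in> X'" by (rule facesI[OF a']) (use Wne orb_single_V'[OF a'] tia diff_W in auto)
    moreover have "f (W, {a, b}) = H" using f_W[of "(W, {a, b})"] \<open>H = tp\<close> by simp
    ultimately show ?thesis by (metis image_eqI)
  next
    assume Hs: "H \<in> Sg \<and> fst H \<subset> W \<and> {x, y, a, b} \<subseteq> snd H"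
    then have SW: "S \<subset> W" using S by simp
    have "a \<in> orb \<sigma> (B - S) v" using Hs S by simp
    then have "orb \<sigma> (B - S) v = orb \<sigma> (B - S) a"
      using orb_eq[OF inv_on_mono[OF inv] S(2), of "B - S" a] by auto
    then have "H = f (S, orb \<tau> (B - S) a)"
      using f_small[of "(S, orb \<tau> (B - S) a)"] SW orb_tau_big[OF SW a'] S by simp
    moreover have "(S, orb \<tau> (B - S) a) \<in> X'" by (rule facesI[OF a' S(3,4) refl])
    ultimately show ?thesis by blast
  next
    assume out: "H \<notin> Sg \<and> snd H \<inter> {x, y} = {}"
    have dj: "orb \<sigma> (B - S) v \<inter> {x, y} = {}" using out S by simp
    have vV: "v \<in> V'" using dj S(2) orb_self[of v \<sigma> "B - S"] by blast
    consider "i \<in> S" | "S = W" | "S \<subset> W" using S(3) by blast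
    then show ?thesis
    proof cases
      case 1
      then have "H = (S, orb \<tau> (B - S) v)" using S orb_tau_i[OF S(3) _ vV] by simp
      then have "H \<in> X'" using facesI[OF vV S(3,4)] by blast
      then show ?thesis using f_i[of H] 1 S by (metis fst_conv image_eqI)
    next
      case 2
      have o: "orb \<sigma> (B - S) v = {v, \<sigma> i v}" using 2 diff_W orb_single_V[OF S(2)] by simp
      have nab: "v \<notin> {a, b}" using o dj sia sib by auto
      have t: "\<tau> i v = \<sigma> i v" using tau[OF iB vV] nab by simp
      have "H = (S, orb \<tau> (B - S) v)" using S(1) o t 2 diff_W orb_single_V'[OF vV] by simp
      then have "H \<in> X'" using facesI[OF vV S(3,4)] by blast
      moreover have "a \<notin> snd H"
      proof
        assume "a \<in> snd H"
        then have "\<sigma> i v = a" using S(1) o nab by auto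
        then have "v = x" using inv_onD(2)[OF inv iB S(2)] sia by simp
        then show False using vV by simp
      qed
      ultimately show ?thesis using f_W[of H] 2 S by (metis fst_conv image_eqI)
    next
      case 3
      have "a \<notin> orb \<tau> (B - S) v"
      proof
        assume "a \<in> orb \<tau> (B - S) v"
        then have "x \<in> orb \<sigma> (B - S) v" unfolding orb_tau_big[OF 3 vV] by simp
        then show False using dj by blast
      qed
      then have "orb \<sigma> (B - S) v = orb \<tau> (B - S) v" unfolding orb_tau_big[OF 3 vV] by simp
      then have "H = (S, orb \<tau> (B - S) v)" using S(1) by simp
      moreover then have "H \<in> X'" using facesI[OF vV S(3,4)] by blast
      moreover have "f H = H"
        unfolding \<open>H = (S, orb \<tau> (B - S) v)\<close> using f_small[of "(S, orb \<tau> (B - S) v)"] 3 \<open>a \<notin> orb \<tau> (B - S) v\<close> by simp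
      ultimately show ?thesis by (metis image_eqI)
    qed
  qed
qed

text \<open>The exceptional pair is unavoidable: the residue of \<open>tp\<close> is
  \<open>{y, b}\<close> and misses \<open>a\<close>, so its incidence with \<open>U\<close> comes
  from the restored edge and not from meeting residues.\<close>

lemma f_meet:
  assumes G: "G \<in> X'" and H: "H \<in> X'" and lt: "fst G \<subset> fst H"
  shows "snd (f G) \<inter> snd (f H) \<noteq> {} \<or> (f G = tp \<and> f H = U) \<longleftrightarrow> snd G \<inter> snd H \<noteq> {}"
proof -
  have GV: "snd G \<subseteq> V'" "snd H \<subseteq> V'" using X'_sub G H by auto
  have HB: "fst H \<subseteq> B" by (rule X'_fst[OF H])
  show ?thesis
  proof (rule X'_cases[OF G])
    assume i: "i \<in> fst G"
    then have "i \<in> fst H" using lt by auto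
    moreover have "f G \<noteq> tp" using i f_fst_eq[of G tp] by auto
    ultimately show ?thesis using f_i i by simp
  next
    assume W: "fst G = W"
    then have HB': "fst H = B" using lt HB iB by auto
    then have fH: "f H = H" using f_i iB by simp
    obtain w where w: "H = (B, {w})" using facesE[OF H] HB' by (metis Diff_cancel fst_conv orb_empty)
    then have "w \<in> V'" using GV by auto
    show ?thesis
    proof (cases "a \<in> snd G")
      case True
      then have "f G = tp" "G = (W, {a, b})" using f_W[OF W] X'_W[OF G W] by auto
      then show ?thesis using fH w \<open>w \<in> V'\<close> neq by (auto simp: U_def)
    next
      case False
      then have "f G = G" using f_W[OF W] by simp
      moreover then have "f G \<noteq> tp" using GV by auto
      ultimately show ?thesis using fH by simp
    qed
  next
    assume sm: "fst G \<subset> W" "i \<notin> fst G"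
    have fG: "snd (f G) = (if a \<in> snd G then snd G \<union> {x, y} else snd G)" using f_small[OF sm(1)] by simp
    have ntp: "f G \<noteq> tp" using sm f_fst_eq[of G tp] by auto
    have ab: "a \<in> snd G \<longleftrightarrow> b \<in> snd G" by (rule X'_ab[OF G sm(2)])
    show ?thesis
    proof (rule X'_cases[OF H])
      assume "i \<in> fst H"
      then have "f H = H" by (rule f_i)
      then show ?thesis using fG GV ntp by (simp split: if_splits) blast
    next
      assume W: "fst H = W"
      show ?thesis
      proof (cases "a \<in> snd H")
        case True
        then have "f H = tp" "H = (W, {a, b})" using f_W[OF W] X'_W[OF H W] by auto
        then show ?thesis using fG ab GV ntp by auto
      next
        case False
        then have "f H = H" using f_W[OF W] by simp
        then show ?thesis using fG GV ntp by auto
      qed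
    next
      assume "fst H \<subset> W"
      then have "snd (f H) = (if a \<in> snd H then snd H \<union> {x, y} else snd H)" using f_small by simp
      then show ?thesis using fG GV ntp by auto
    qed
  qed
qed

lemma A3_f:
  assumes G: "G \<in> X'" and H: "H \<in> X'"
  shows "A3 (f G) (f H) \<longleftrightarrow> fadj G H"
proof -
  have nz: "f G \<noteq> z" "f H \<noteq> z" using image_f G H by blast+
  have A3: "A3 (f G) (f H) \<longleftrightarrow> fadj (f G) (f H) \<or> (f G = U \<and> f H = tp) \<or> (f G = tp \<and> f H = U)"
    using A1_other[OF nz] nz unfolding A3_def A2_def add_edge_def by auto
  have fU: "f K = U \<Longrightarrow> fst K = B" "f K = tp \<Longrightarrow> fst K = W" for K by (metis fst_f fst_simps(2,3))+
  have WB: "W \<subset> B" using iB by auto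
  have GB: "fst G \<subseteq> B" "fst H \<subseteq> B" using X'_fst G H by auto
  consider (1) "fst G \<subset> fst H" | (2) "fst H \<subset> fst G" | (3) "\<not> fst G \<subset> fst H" "\<not> fst H \<subset> fst G" by blast
  then show ?thesis
  proof cases
    case 1
    have "\<not> f G = U" using fU(1)[of G] 1 GB by auto
    then show ?thesis unfolding A3 fadj_def fst_f using 1 f_meet[OF G H 1] by simp
  next
    case 2
    have "\<not> f H = U" using fU(1)[of H] 2 GB by auto
    then show ?thesis unfolding A3 fadj_def fst_f using 2 f_meet[OF H G 2] by (auto simp: Int_commute)
  next
    case 3
    have "\<not> (f G = U \<and> f H = tp)" "\<not> (f G = tp \<and> f H = U)"
      using fU(1)[of G] fU(2)[of H] fU(1)[of H] fU(2)[of G] 3 WB by auto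
    then show ?thesis unfolding A3 fadj_def fst_f using 3 by simp
  qed
qed

lemma melon_gsph: "gsph k X' fadj \<Longrightarrow> gsph k X fadj"
proof -
  assume "gsph k X' fadj"
  then have "gsph k (f ` X') A3" by (rule gsph_iso) (use inj_f A3_f in auto)
  then have "gsph k X1 A1" unfolding image_f by (intro reduce_bt reduce_z)
  then show "gsph k X fadj" unfolding X1_def A1_def by (rule reduce_cone)
qed

end

text \<open>Two simplices glued along their whole boundary: the proper label sets give the boundary
  of a simplex, and the two top faces are the poles of a suspension.\<close>

lemma faces_dipole:
  assumes "finite B" "B \<noteq> {}" "x \<noteq> y" "\<And>j. j \<in> B \<Longrightarrow> \<sigma> j x = y" "\<And>j. j \<in> B \<Longrightarrow> \<sigma> j y = x"
  shows "gsph (card B) (faces {x, y} \<sigma> B) fadj"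
proof -
  let ?V = "{x, y}" and ?Y = "{T. T \<noteq> {} \<and> T \<subset> B}"
  have orb: "orb \<sigma> (B - S) v = ?V" if "v \<in> ?V" "S \<subset> B" for S v
  proof
    show "orb \<sigma> (B - S) v \<subseteq> ?V" by (rule orb_subset) (use assms that in auto)
    have "B - S \<noteq> {}" using that(2) by auto
    then obtain j where j: "j \<in> B - S" by auto
    then have "\<sigma> j v \<in> orb \<sigma> (B - S) v" by (intro orb_step) auto
    then show "?V \<subseteq> orb \<sigma> (B - S) v" using that(1) assms(4,5)[of j] j by auto
  qed
  have "gsph (card B - 1) ((\<lambda>S. (S, ?V)) ` ?Y) fadj"
    by (rule gsph_iso[OF gsph_bool[OF assms(1,2)]]) (auto simp: inj_on_def fadj_def)
  then have "gsph (Suc (card B - 1)) (insert (B, {x}) (insert (B, {y}) ((\<lambda>S. (S, ?V)) ` ?Y))) fadj"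
    by (rule gsph_susp) (use assms(3) in \<open>auto simp: fadj_def\<close>)
  moreover have "insert (B, {x}) (insert (B, {y}) ((\<lambda>S. (S, ?V)) ` ?Y)) = faces ?V \<sigma> B" (is "?L = ?R")
  proof (intro equalityI subsetI)
    fix F assume "F \<in> ?L"
    then consider "F = (B, {x})" | "F = (B, {y})" | S where "F = (S, ?V)" "S \<noteq> {}" "S \<subset> B" by blast
    then show "F \<in> ?R"
    proof cases
      case 1 then show ?thesis using assms(2) by (auto intro!: facesI[of x])
    next
      case 2 then show ?thesis using assms(2) by (auto intro!: facesI[of y])
    next
      case 3 then show ?thesis using orb[of x S] by (auto intro!: facesI[of x])
    qed
  next
    fix F assume "F \<in> ?R"
    then obtain S v where F: "F = (S, orb \<sigma> (B - S) v)" "v \<in> ?V" "S \<subseteq> B" "S \<noteq> {}" by (rule facesE)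
    show "F \<in> ?L"
    proof (cases "S = B")
      case True
      then show ?thesis using F by auto
    next
      case False
      then show ?thesis using F orb[of v S] by auto
    qed
  qed
  moreover have "Suc (card B - 1) = card B" using assms(1,2) by (simp add: card_gt_0_iff)
  ultimately show ?thesis by simp
qed

lemma tree_faces_gsph:
  assumes "tree V \<sigma> B" "2 \<le> card B"
  shows "gsph (card B) (faces V \<sigma> B) fadj"
  using assms(1)
proof (induction rule: tree_induct)
  case (base V \<sigma> x)
  have "finite B" "B \<noteq> {}" using assms by (auto simp: tree_def gem_def)
  then have "gsph (card B) (faces {x, \<sigma> 0 x} \<sigma> B) fadj"
  proof (rule faces_dipole)
    show "x \<noteq> \<sigma> 0 x" by (rule base.hyps(3))
    show "\<sigma> j x = \<sigma> 0 x" "\<sigma> j (\<sigma> 0 x) = x" if "j \<in> B" for j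
      using tree_base_vals[OF base.hyps(1-3), of j] that by simp_all
  qed
  then show ?case using base.hyps(2) by metis
next
  case (step V \<sigma> x i)
  have gm: "gem V \<sigma> B" and g: "inv_on \<sigma> (insert 0 B) V" "finite V" "finite B"
    using step.hyps(1) by (auto simp: tree_def gem_def)
  interpret cut_at \<sigma> V x i by (rule gem_cut_at[OF gm step.hyps(2,3)])
  have inv': "inv_on \<tau> B (V - {x, y})" using step.hyps(6) by (auto simp: tree_def gem_def intro: inv_on_mono)
  have ab: "a \<in> V - {x, y}" "b \<in> V - {x, y}" using tree_remove_leaf(2,3)[OF step.hyps(1-5)] by auto
  have sy: "\<sigma> j y = x" if "j \<in> B" "j \<noteq> i" for j
    using inv_onD(2)[OF g(1), of j x] step.hyps(2) step.hyps(5)[of j] that by simp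
  interpret melon V \<sigma> \<tau> B x y a b i
  proof unfold_locales
    show "inv_on \<sigma> B V" using g(1) by (auto intro: inv_on_mono)
    show "B \<noteq> {i}" using assms(2) by auto
    show "\<tau> c u = \<sigma> c u" if "c \<in> B" "u \<in> V - {x, y}" "\<not> (c = i \<and> u \<in> {a, b})" for c u
      using that cut_val_away[of u c] cut_other[of c i \<sigma> x] by auto
    show "x \<in> V" "i \<in> B" "finite V" "finite B" "inv_on \<tau> B (V - {x, y})" by fact+
    show "y \<in> V" "a \<in> V" "b \<in> V" "\<sigma> i a = x" "\<sigma> i b = y" "a \<noteq> b" "a \<noteq> x" "b \<noteq> y"
      using basics by auto
    show "x \<noteq> y" using basics(7) by metis
    show "a \<noteq> y" "b \<noteq> x" using ab by auto
    show "\<sigma> j x = y" if "j \<in> B" "j \<noteq> i" for j using step.hyps(5)[of j] that by simp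
    show "\<sigma> j y = x" if "j \<in> B" "j \<noteq> i" for j by (rule sy[OF that])
    show "\<tau> i a = b" "\<tau> i b = a" by (rule cut_vals)+
  qed simp_all
  show ?case by (rule melon_gsph[OF step.IH])
qed

section \<open>Graphs in which every incidence cycle uses all colours\<close>

lemma coloured_graph_inv: "coloured_graph q N \<sigma> \<Longrightarrow> inv_on \<sigma> {..q} {..<N}"
  unfolding coloured_graph_def inv_on_def by auto

lemma coloured_graph_conn:
  assumes "coloured_graph q N \<sigma>" "v < N"
  shows "orb \<sigma> {..q} v = {..<N}"
proof -
  have inv: "inv_on \<sigma> {..q} {..<N}" by (rule coloured_graph_inv[OF assms(1)])
  have N: "0 < N" using assms by simp
  have "orb \<sigma> {..q} 0 = {..<N}"
    using residue_eq_orb[OF inv N] assms(1) by (simp add: coloured_graph_def)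
  then show ?thesis using orb_eq[OF inv, of 0 v] N assms(2) by simp
qed

lemma acyc_component_tree:
  assumes g: "gem V \<sigma> B" and ac: "acyc V \<sigma> B" and v: "v \<in> V"
  shows "tree (orb \<sigma> (insert 0 B) v) \<sigma> B"
proof -
  let ?V = "orb \<sigma> (insert 0 B) v"
  have inv: "inv_on \<sigma> (insert 0 B) V" and fin: "finite V" "finite B" "0 \<notin> B" using g by (auto simp: gem_def)
  have sub: "?V \<subseteq> V" by (rule orb_in[OF inv v])
  have inv': "inv_on \<sigma> (insert 0 B) ?V"
    unfolding inv_on_def
  proof (intro ballI conjI)
    fix c u assume c: "c \<in> insert 0 B" and u: "u \<in> ?V"
    then show "\<sigma> c u \<in> ?V" by (intro orb_step)
    show "\<sigma> c (\<sigma> c u) = u" "\<sigma> c u \<noteq> u" using inv_onD[OF inv c, of u] sub u by auto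
  qed
  have conn: "orb \<sigma> (insert 0 B) u = ?V" if "u \<in> ?V" for u by (rule orb_eq[OF inv v that])
  have g': "gem ?V \<sigma> B" using inv' fin finite_subset[OF sub] by (auto simp: gem_def)
  have ac': "acyc ?V \<sigma> B" by (rule acyc_mono[OF ac sub]) simp
  have "cls \<sigma> (insert 0 B) ?V = {?V}"
  proof -
    have "cls \<sigma> (insert 0 B) ?V = (\<lambda>_. ?V) ` ?V" unfolding cls_def by (rule image_cong[OF refl conn])
    also have "\<dots> = {?V}" by (rule image_constant[OF orb_self])
    finally show ?thesis .
  qed
  then have "card ?V + 2 * (\<Sum>i\<in>B. card (cls \<sigma> {0, i} ?V)) = 2 + card B * card ?V"
    using excess[OF g'] ac' by simp
  moreover have "?V \<noteq> {}" using orb_self[of v \<sigma> "insert 0 B"] by blast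
  ultimately show ?thesis unfolding tree_def using g' conn by blast
qed

locale good_graph =
  fixes q N :: nat and \<sigma> :: "nat \<Rightarrow> nat \<Rightarrow> nat" and A :: "nat set"
  assumes q3: "3 \<le> q" and cg: "coloured_graph q N \<sigma>" and A_def: "A = {1..q}"
    and good: "\<And>c. c \<in> A \<Longrightarrow> acyc {..<N} \<sigma> (A - {c})"
begin

lemma A_facts: "finite A" "card A = q" "0 \<notin> A" "A \<subseteq> {..q}" "1 \<in> A" "\<And>c. c \<le> q \<Longrightarrow> c \<noteq> 0 \<Longrightarrow> c \<in> A"
  using q3 by (auto simp: A_def)

lemma inv: "inv_on \<sigma> {..q} {..<N}" by (rule coloured_graph_inv[OF cg])

lemma invA: "B \<subseteq> A \<Longrightarrow> inv_on \<sigma> B {..<N}" by (rule inv_on_mono[OF inv]) (use A_facts(4) in auto)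

lemma gemA: "B \<subseteq> A \<Longrightarrow> gem {..<N} \<sigma> B"
  unfolding gem_def using A_facts finite_subset[of B A] by (auto intro!: inv_on_mono[OF inv])

lemma tree_comp:
  assumes "B \<subseteq> A - {c}" "c \<in> A" "v < N"
  shows "tree (orb \<sigma> (insert 0 B) v) \<sigma> B"
proof (rule acyc_component_tree)
  show "gem {..<N} \<sigma> B" by (rule gemA) (use assms in auto)
  show "acyc {..<N} \<sigma> B" by (rule acyc_mono[OF good[OF assms(2)]]) (use assms in auto)
qed (use assms in simp)

lemma comp_connected:
  assumes "B \<subseteq> A - {c}" "c \<in> A" "v < N" "2 \<le> card B"
  shows "orb \<sigma> B v = orb \<sigma> (insert 0 B) v"
  by (rule tree_connected_without_0[OF tree_comp[OF assms(1-3)] assms(4)]) simp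

lemma SYK: "is_SYK q N \<sigma>"
proof -
  have N: "0 < N" using cg by (simp add: coloured_graph_def)
  have B: "A - {1} \<subseteq> A - {1}" "1 \<in> A" "2 \<le> card (A - {1})" using q3 A_facts by auto
  \<comment> \<open>A colour-0 edge can be bypassed inside its tree for the colours
    \<open>A - {1}\<close>, of which two are left because q is at least 3.\<close>
  have s0: "\<sigma> 0 u \<in> orb \<sigma> A u" if "u < N" for u
  proof -
    have "\<sigma> 0 u \<in> orb \<sigma> (insert 0 (A - {1})) u" by (rule orb_step) auto
    then have "\<sigma> 0 u \<in> orb \<sigma> (A - {1}) u" using comp_connected[OF B(1,2) that B(3)] by simp
    then show ?thesis using orb_mono[of "A - {1}" A \<sigma> u] by auto
  qed
  have all: "orb \<sigma> A v = {..<N}" if v: "v < N" for v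
  proof
    have vV: "v \<in> {..<N}" using v by simp
    show sub: "orb \<sigma> A v \<subseteq> {..<N}" by (rule orb_in[OF invA[OF order_refl] vV])
    have "orb \<sigma> {..q} v \<subseteq> orb \<sigma> A v"
    proof (rule orb_subset)
      fix u c assume u: "u \<in> orb \<sigma> A v" and c: "c \<in> {..q}"
      show "\<sigma> c u \<in> orb \<sigma> A v"
      proof (cases "c = 0")
        case True
        have "u < N" using u sub by auto
        then show ?thesis using s0[of u] orb_trans[OF u] True by auto
      next
        case False
        then show ?thesis using c A_facts(6) by (intro orb_step[OF u]) auto
      qed
    qed simp
    then show "{..<N} \<subseteq> orb \<sigma> A v" using coloured_graph_conn[OF cg v] by simp
  qed
  have "residues \<sigma> N A = (\<lambda>v. {..<N}) ` {..<N}"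
    unfolding residues_eq_cls[OF invA[OF order_refl]] cls_def by (rule image_cong) (simp_all add: all)
  also have "\<dots> = {{..<N}}" using N by auto
  finally show ?thesis by (simp add: is_SYK_def A_def)
qed

abbreviation "X \<equiv> faces {..<N} \<sigma> A"

text \<open>The faces above a face form the dual complex of its residue. Residues with two or more
  colours are trees. One colour is treated apart, because there the tree with colour 0 is larger
  than the residue, which is a single edge and yields two points.\<close>

lemma upper_gsph:
  assumes S: "S \<subseteq> A" "S \<noteq> {}" and v: "v < N"
  shows "gsph (card (A - S)) (faces (orb \<sigma> (A - S) v) \<sigma> (A - S)) fadj"
proof -
  let ?B = "A - S"
  obtain c where c: "c \<in> S" using S by auto
  have cA: "c \<in> A" "?B \<subseteq> A - {c}" using c S by auto
  consider "card ?B = 0" | "card ?B = 1" | "2 \<le> card ?B" by linarith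
  then show ?thesis
  proof cases
    case 1
    then have "?B = {}" using A_facts(1) by simp
    then have "faces (orb \<sigma> ?B v) \<sigma> ?B = {}" unfolding faces_def by auto
    then show ?thesis using 1 gsph_empty by simp
  next
    case 2
    then obtain j where j: "?B = {j}" by (auto simp: card_1_singleton_iff)
    have jA: "j \<in> A" using j by auto
    have vals: "\<sigma> j (\<sigma> j v) = v" "\<sigma> j v \<noteq> v"
      using inv_onD[OF invA[OF order_refl] jA, of v] v by auto
    have "orb \<sigma> {j} v = {v, \<sigma> j v}" by (rule orb_single) (rule vals(1))
    moreover have "gsph (card {j}) (faces {v, \<sigma> j v} \<sigma> {j}) fadj"
      by (rule faces_dipole) (use vals in auto)
    ultimately show ?thesis unfolding j by simp
  next
    case 3
    show ?thesis
      using tree_faces_gsph[OF tree_comp[OF cA(2,1) v] 3] comp_connected[OF cA(2,1) v 3] by simp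
  qed
qed

text \<open>The link of a face in the subdivision is the join of the subdivided boundary of the face
  with the complex of the faces above it. Their dimensions are card S - 2 and card (A - S) - 1, and
  the join has dimension q - 2.\<close>

lemma link_gsph:
  assumes S: "S \<subseteq> A" "S \<noteq> {}" and v: "v < N"
  shows "gsph (q - 1) {Q \<in> X. fadj (S, orb \<sigma> (A - S) v) Q} fadj"
proof -
  let ?Q = "orb \<sigma> (A - S) v"
  let ?L = "(\<lambda>T. (T, orb \<sigma> (A - T) v)) ` {T. T \<noteq> {} \<and> T \<subset> S}"
  let ?g = "\<lambda>P. (S \<union> fst P, snd P)"
  let ?U = "?g ` faces ?Q \<sigma> (A - S)"
  have fS: "finite S" using S A_facts(1) finite_subset by blast
  have vV: "v \<in> {..<N}" using v by simp
  have QV: "?Q \<subseteq> {..<N}" by (rule orb_in[OF invA vV]) auto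
  have L: "gsph (card S - 1) ?L fadj"
  proof (rule gsph_iso[OF gsph_bool[OF fS S(2)]])
    show "inj_on (\<lambda>T. (T, orb \<sigma> (A - T) v)) {T. T \<noteq> {} \<and> T \<subset> S}" by (auto simp: inj_on_def)
    fix T T' :: "nat set"
    have "v \<in> orb \<sigma> (A - T) v \<inter> orb \<sigma> (A - T') v" by simp
    then have "orb \<sigma> (A - T) v \<inter> orb \<sigma> (A - T') v \<noteq> {}" by blast
    then show "fadj (T, orb \<sigma> (A - T) v) (T', orb \<sigma> (A - T') v) = (T \<subset> T' \<or> T' \<subset> T)"
      unfolding fadj_def fst_conv snd_conv by simp
  qed
  have fstF: "fst P \<subseteq> A - S" "fst P \<noteq> {}" if "P \<in> faces ?Q \<sigma> (A - S)" for P
    using that by (auto elim!: facesE)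
  have U: "gsph (card (A - S)) ?U fadj"
  proof (rule gsph_iso[OF upper_gsph[OF S v]])
    show "inj_on ?g (faces ?Q \<sigma> (A - S))"
    proof (rule inj_onI)
      fix P R assume P: "P \<in> faces ?Q \<sigma> (A - S)" "R \<in> faces ?Q \<sigma> (A - S)" and eq: "?g P = ?g R"
      have "fst P = fst R" using fstF[OF P(1)] fstF[OF P(2)] eq by auto
      then show "P = R" using eq by (simp add: prod_eq_iff)
    qed
    fix P R assume P: "P \<in> faces ?Q \<sigma> (A - S)" "R \<in> faces ?Q \<sigma> (A - S)"
    have "S \<union> fst P \<subset> S \<union> fst R \<longleftrightarrow> fst P \<subset> fst R" "S \<union> fst R \<subset> S \<union> fst P \<longleftrightarrow> fst R \<subset> fst P"
      using fstF[OF P(1)] fstF[OF P(2)] by auto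
    then show "fadj (?g P) (?g R) = fadj P R" unfolding fadj_def by simp
  qed
  have "gsph (card S - 1 + card (A - S)) (?L \<union> ?U) fadj"
  proof (rule gsph_join[OF L U])
    have "fst P \<subset> S" if "P \<in> ?L" for P using that by auto
    moreover have "S \<subset> fst P" if "P \<in> ?U" for P using that fstF by fastforce
    ultimately show "?L \<inter> ?U = {}" by blast
    fix P R assume "P \<in> ?L" "R \<in> ?U"
    then obtain T R' where T: "P = (T, orb \<sigma> (A - T) v)" "T \<subset> S" "R = ?g R'" "R' \<in> faces ?Q \<sigma> (A - S)" by blast
    obtain S1 w where w: "R' = (S1, orb \<sigma> (A - S - S1) w)" "w \<in> ?Q" by (rule facesE[OF T(4)])
    have "w \<in> orb \<sigma> (A - T) v" using w(2) orb_mono[of "A - S" "A - T" \<sigma> v] T(2) by auto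
    then have "w \<in> snd P \<inter> snd R" using T w by simp
    moreover have "fst P \<subset> fst R" using T by auto
    ultimately show "fadj P R \<and> fadj R P" unfolding fadj_def by blast
  qed
  moreover have "card S - 1 + card (A - S) = q - 1"
  proof -
    have "card (A - S) = q - card S" using card_Diff_subset[OF fS S(1)] A_facts(2) by simp
    moreover have "card S \<le> q" using card_mono[of A S] S(1) A_facts(1,2) by simp
    moreover have "0 < card S" using fS S(2) by (simp add: card_gt_0_iff)
    ultimately show ?thesis by simp
  qed
  moreover have "?L \<union> ?U = {Q \<in> X. fadj (S, ?Q) Q}"
  proof (intro equalityI subsetI)
    fix P assume "P \<in> ?L \<union> ?U"
    then show "P \<in> {Q \<in> X. fadj (S, ?Q) Q}"
    proof
      assume "P \<in> ?L"
      then obtain T where T: "P = (T, orb \<sigma> (A - T) v)" "T \<noteq> {}" "T \<subset> S" by blast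
      have "v \<in> ?Q \<inter> orb \<sigma> (A - T) v" by simp
      then have "?Q \<inter> orb \<sigma> (A - T) v \<noteq> {}" by blast
      then have "fadj (S, ?Q) P" unfolding fadj_def T(1) fst_conv snd_conv using T(3) by simp
      moreover have "P \<in> X" unfolding T(1) by (rule facesI[OF vV _ T(2) refl]) (use T S in auto)
      ultimately show ?thesis by simp
    next
      assume "P \<in> ?U"
      then obtain R where R: "P = ?g R" "R \<in> faces ?Q \<sigma> (A - S)" by blast
      obtain S1 w where w: "R = (S1, orb \<sigma> (A - S - S1) w)" "w \<in> ?Q" "S1 \<subseteq> A - S" "S1 \<noteq> {}" by (rule facesE[OF R(2)])
      have eq: "A - S - S1 = A - (S \<union> S1)" by auto
      have P: "P = (S \<union> S1, orb \<sigma> (A - (S \<union> S1)) w)" using R w(1) eq by simp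
      have "w \<in> ?Q \<inter> orb \<sigma> (A - (S \<union> S1)) w" using w by simp
      then have "?Q \<inter> orb \<sigma> (A - (S \<union> S1)) w \<noteq> {}" by blast
      moreover have "S \<subset> S \<union> S1" using w by auto
      ultimately have "fadj (S, ?Q) P" unfolding fadj_def P fst_conv snd_conv by simp
      moreover have "P \<in> X" unfolding P by (rule facesI[OF _ _ _ refl]) (use w S QV in auto)
      ultimately show ?thesis by simp
    qed
  next
    fix P assume "P \<in> {Q \<in> X. fadj (S, ?Q) Q}"
    then have P: "P \<in> X" "fadj (S, ?Q) P" by auto
    obtain T w where w: "P = (T, orb \<sigma> (A - T) w)" "w \<in> {..<N}" "T \<subseteq> A" "T \<noteq> {}" by (rule facesE[OF P(1)])
    obtain u where u: "u \<in> ?Q" "u \<in> orb \<sigma> (A - T) w" using P(2) w(1) unfolding fadj_def by auto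
    have Pu: "orb \<sigma> (A - T) w = orb \<sigma> (A - T) u"
      by (rule orb_eq[OF invA[OF Diff_subset] w(2) u(2), symmetric])
    have "T \<subset> S \<or> S \<subset> T" using P(2) w(1) unfolding fadj_def by auto
    then show "P \<in> ?L \<union> ?U"
    proof
      assume T: "T \<subset> S"
      have "u \<in> orb \<sigma> (A - T) v" using u(1) orb_mono[of "A - S" "A - T" \<sigma> v] T by auto
      then have "orb \<sigma> (A - T) u = orb \<sigma> (A - T) v" by (rule orb_eq[OF invA[OF Diff_subset] vV])
      then have "P = (T, orb \<sigma> (A - T) v)" using w(1) Pu by simp
      then show ?thesis using w(4) T by blast
    next
      assume T: "S \<subset> T"
      have eq: "A - S - (T - S) = A - T" using T by auto
      have "(T - S, orb \<sigma> (A - S - (T - S)) u) \<in> faces ?Q \<sigma> (A - S)"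
        by (rule facesI[OF u(1) _ _ refl]) (use T w in auto)
      moreover have "P = ?g (T - S, orb \<sigma> (A - S - (T - S)) u)" unfolding eq using w(1) Pu T by auto
      ultimately show ?thesis by blast
    qed
  qed
  ultimately show ?thesis by simp
qed

text \<open>Returns from pairs to the tagged sets of \<open>tri_face\<close>, for comparison with
  \<open>derived_complex\<close>.\<close>

definition "\<phi> P = (\<lambda>w. (w, fst P)) ` snd P" for P :: "nat set \<times> nat set"

lemma tri_face_eq: "v < N \<Longrightarrow> tri_face \<sigma> N A v S = \<phi> (S, orb \<sigma> (A - S) v)"
  unfolding tri_face_def \<phi>_def using residue_eq_orb[OF invA] by simp

lemma X_ne: "P \<in> X \<Longrightarrow> snd P \<noteq> {}"
proof -
  assume "P \<in> X"
  then obtain S v where "P = (S, orb \<sigma> (A - S) v)" by (rule facesE)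
  then show ?thesis using orb_self[of v \<sigma> "A - S"] by (metis empty_iff snd_conv)
qed

lemma \<phi>_inj: "\<phi> P = \<phi> Q \<Longrightarrow> snd P \<noteq> {} \<Longrightarrow> P = Q"
proof -
  assume eq: "\<phi> P = \<phi> Q" and ne: "snd P \<noteq> {}"
  have s: "snd P = fst ` \<phi> P" "snd Q = fst ` \<phi> Q" unfolding \<phi>_def by (auto simp: image_image)
  then have sn: "snd P = snd Q" using eq by simp
  have "snd ` \<phi> P = {fst P}" "snd ` \<phi> Q = {fst Q}" using ne sn unfolding \<phi>_def by (auto simp: image_image)
  then show ?thesis using eq sn by (auto simp: prod_eq_iff)
qed

lemma inj_\<phi>: "inj_on \<phi> X"
  by (rule inj_onI) (use \<phi>_inj X_ne in blast)

lemma tri_faces_eq: "tri_faces \<sigma> N A = \<phi> ` X"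
proof (intro equalityI subsetI)
  fix F assume "F \<in> tri_faces \<sigma> N A"
  then obtain v S where F: "F = tri_face \<sigma> N A v S" "v < N" "S \<subseteq> A" "S \<noteq> {}" unfolding tri_faces_def by blast
  then have "F = \<phi> (S, orb \<sigma> (A - S) v)" using tri_face_eq by simp
  moreover have "(S, orb \<sigma> (A - S) v) \<in> X" by (rule facesI[OF _ F(3,4) refl]) (use F in simp)
  ultimately show "F \<in> \<phi> ` X" by blast
next
  fix F assume "F \<in> \<phi> ` X"
  then obtain P where P: "F = \<phi> P" "P \<in> X" by blast
  obtain S v where S: "P = (S, orb \<sigma> (A - S) v)" "v \<in> {..<N}" "S \<subseteq> A" "S \<noteq> {}" by (rule facesE[OF P(2)])
  then have "F = tri_face \<sigma> N A v S" "v < N" using tri_face_eq[of v S] P(1) by auto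
  then show "F \<in> tri_faces \<sigma> N A" unfolding tri_faces_def using S(3,4) by blast
qed

definition "cmp F G \<longleftrightarrow> face_le \<sigma> N A F G \<or> face_le \<sigma> N A G F"

lemma face_le_iff:
  assumes "P \<in> X" "Q \<in> X"
  shows "face_le \<sigma> N A (\<phi> P) (\<phi> Q) \<longleftrightarrow> fst P \<subseteq> fst Q \<and> snd P \<inter> snd Q \<noteq> {}"
proof
  assume "face_le \<sigma> N A (\<phi> P) (\<phi> Q)"
  then obtain u S S' where u: "u < N" "S \<subseteq> S'" "\<phi> P = tri_face \<sigma> N A u S" "\<phi> Q = tri_face \<sigma> N A u S'"
    unfolding face_le_def by blast
  have "P = (S, orb \<sigma> (A - S) u)" "Q = (S', orb \<sigma> (A - S') u)"
    using \<phi>_inj[OF _ X_ne[OF assms(1)]] \<phi>_inj[OF _ X_ne[OF assms(2)]] u tri_face_eq by auto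
  moreover have "u \<in> orb \<sigma> (A - S) u \<inter> orb \<sigma> (A - S') u" by simp
  then have "orb \<sigma> (A - S) u \<inter> orb \<sigma> (A - S') u \<noteq> {}" by blast
  ultimately show "fst P \<subseteq> fst Q \<and> snd P \<inter> snd Q \<noteq> {}" using u(2) by simp
next
  assume *: "fst P \<subseteq> fst Q \<and> snd P \<inter> snd Q \<noteq> {}"
  obtain S v where P: "P = (S, orb \<sigma> (A - S) v)" "v \<in> {..<N}" "S \<subseteq> A" "S \<noteq> {}" by (rule facesE[OF assms(1)])
  obtain S' w where Q: "Q = (S', orb \<sigma> (A - S') w)" "w \<in> {..<N}" "S' \<subseteq> A" "S' \<noteq> {}" by (rule facesE[OF assms(2)])
  obtain u where u: "u \<in> orb \<sigma> (A - S) v" "u \<in> orb \<sigma> (A - S') w" using * P(1) Q(1) by auto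
  have uN: "u < N" using u(1) orb_in[OF invA[OF Diff_subset] P(2)] by blast
  have "orb \<sigma> (A - S) v = orb \<sigma> (A - S) u" by (rule orb_eq[OF invA[OF Diff_subset] P(2) u(1), symmetric])
  then have P': "\<phi> P = tri_face \<sigma> N A u S" using tri_face_eq[OF uN] P(1) by simp
  have "orb \<sigma> (A - S') w = orb \<sigma> (A - S') u" by (rule orb_eq[OF invA[OF Diff_subset] Q(2) u(2), symmetric])
  then have Q': "\<phi> Q = tri_face \<sigma> N A u S'" using tri_face_eq[OF uN] Q(1) by simp
  have "S \<subseteq> S'" using * P(1) Q(1) by simp
  then show "face_le \<sigma> N A (\<phi> P) (\<phi> Q)" unfolding face_le_def using uN P' Q' P(4) Q(3) by blast
qed

text \<open>Residues for the same colours are equal or disjoint, so distinct comparable faces have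
  different label sets and the strict inclusions of \<open>fadj\<close> suffice.\<close>

lemma cmp_iff:
  assumes "P \<in> X" "Q \<in> X" "P \<noteq> Q"
  shows "cmp (\<phi> P) (\<phi> Q) \<longleftrightarrow> fadj P Q"
proof -
  have "snd P \<inter> snd Q = {}" if eq: "fst P = fst Q"
  proof (rule ccontr)
    assume "snd P \<inter> snd Q \<noteq> {}"
    then obtain u where u: "u \<in> snd P" "u \<in> snd Q" by blast
    obtain S v where P: "P = (S, orb \<sigma> (A - S) v)" "v \<in> {..<N}" by (rule facesE[OF assms(1)])
    obtain S' w where Q: "Q = (S', orb \<sigma> (A - S') w)" "w \<in> {..<N}" by (rule facesE[OF assms(2)])
    have "orb \<sigma> (A - S) u = orb \<sigma> (A - S) v" by (rule orb_eq[OF invA[OF Diff_subset] P(2)]) (use u P in simp)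
    moreover have "orb \<sigma> (A - S') u = orb \<sigma> (A - S') w" by (rule orb_eq[OF invA[OF Diff_subset] Q(2)]) (use u Q in simp)
    ultimately show False using P Q eq assms(3) by auto
  qed
  then show ?thesis unfolding cmp_def face_le_iff[OF assms(1,2)] face_le_iff[OF assms(2,1)] fadj_def
    by (auto simp: Int_commute psubset_eq)
qed

lemma cmp_self: "P \<in> X \<Longrightarrow> cmp (\<phi> P) (\<phi> P)"
  unfolding cmp_def using face_le_iff X_ne by simp

lemma finite_X: "finite X"
proof -
  have "X \<subseteq> (\<lambda>(S, v). (S, orb \<sigma> (A - S) v)) ` (Pow A \<times> {..<N})" unfolding faces_def by auto
  then show ?thesis by (rule finite_subset) (use A_facts(1) in auto)
qed

lemma derived_eq: "derived_complex \<sigma> N A = clq (\<phi> ` X) cmp"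
proof -
  have self: "cmp F F" if "F \<in> \<phi> ` X" for F using that cmp_self by (elim imageE) simp
  show ?thesis
    unfolding derived_complex_def clq_def tri_faces_eq cmp_def[symmetric]
  proof (intro equalityI subsetI CollectI; elim CollectE conjE)
    fix C assume C: "C \<noteq> {}" "C \<subseteq> \<phi> ` X" "\<forall>F\<in>C. \<forall>G\<in>C. cmp F G"
    then have "finite C" using finite_X by (meson finite_imageI finite_subset)
    then show "C \<subseteq> \<phi> ` X \<and> finite C \<and> C \<noteq> {} \<and> (\<forall>u\<in>C. \<forall>v\<in>C. u \<noteq> v \<longrightarrow> cmp u v)" using C by simp
  next
    fix C assume C: "C \<noteq> {}" "C \<subseteq> \<phi> ` X" "\<forall>u\<in>C. \<forall>v\<in>C. u \<noteq> v \<longrightarrow> cmp u v"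
    have "cmp F G" if "F \<in> C" "G \<in> C" for F G
      using C(3) self[of F] C(2) that by (cases "F = G") auto
    then show "C \<noteq> {} \<and> C \<subseteq> \<phi> ` X \<and> (\<forall>F\<in>C. \<forall>G\<in>C. cmp F G)" using C by simp
  qed
qed

lemma manifold: "dual_PL_manifold \<sigma> N A"
proof -
  let ?K = "derived_complex \<sigma> N A"
  have cx: "is_complex ?K" unfolding derived_eq by (rule is_complex_clq) (use finite_X in simp)
  have "(A, orb \<sigma> (A - A) 0) \<in> X"
    by (rule facesI[OF _ order_refl _ refl]) (use cg A_facts(5) in \<open>auto simp: coloured_graph_def\<close>)
  then have "{\<phi> (A, orb \<sigma> (A - A) 0)} \<in> ?K" unfolding derived_eq clq_def by auto
  then have ne: "?K \<noteq> {}" by blast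
  have "comb_sphere (q - 2) (link ?K {F})" if "F \<in> \<Union> ?K" for F
  proof -
    have "F \<in> \<phi> ` X" using that unfolding derived_eq clq_def by blast
    then obtain P where P: "F = \<phi> P" "P \<in> X" by blast
    obtain S v where S: "P = (S, orb \<sigma> (A - S) v)" "v \<in> {..<N}" "S \<subseteq> A" "S \<noteq> {}" by (rule facesE[OF P(2)])
    let ?Nb = "{Q \<in> X. fadj P Q}"
    have nP: "P \<notin> ?Nb" by (simp add: fadj_def)
    have "gsph (q - 1) ?Nb fadj" using link_gsph[OF S(3,4)] S(1,2) by simp
    then have g: "gsph (q - 1) (\<phi> ` ?Nb) cmp"
    proof (rule gsph_iso)
      show "inj_on \<phi> ?Nb" by (rule inj_on_subset[OF inj_\<phi>]) auto
    qed (use cmp_iff in auto)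
    have q1: "q - 1 = Suc (q - 2)" using q3 by simp
    have "comb_sphere (q - 2) (clq (\<phi> ` ?Nb) cmp)"
      by (rule gsph_comb_sphere[OF g[unfolded q1]]) (auto simp: cmp_def)
    \<comment> \<open>In a flag complex the link of a vertex is the flag complex of its
      neighbours.\<close>
    moreover have "link ?K {F} = clq (\<phi> ` ?Nb) cmp"
    proof (intro equalityI subsetI)
      fix t assume "t \<in> link ?K {F}"
      then have t: "t \<in> clq (\<phi> ` X) cmp" "F \<notin> t" "insert F t \<in> clq (\<phi> ` X) cmp"
        unfolding link_def derived_eq by auto
      have "G \<in> \<phi> ` ?Nb" if G: "G \<in> t" for G
      proof -
        obtain Q where Q: "G = \<phi> Q" "Q \<in> X" using t(1) G unfolding clq_def by blast
        have "F \<noteq> G" using t(2) G by auto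
        then have "cmp F G" using t(3) G unfolding clq_def by blast
        then have "fadj P Q" using cmp_iff[OF P(2) Q(2)] P Q \<open>F \<noteq> G\<close> by auto
        then show ?thesis using Q by blast
      qed
      then show "t \<in> clq (\<phi> ` ?Nb) cmp" using t(1) unfolding clq_def by blast
    next
      fix t assume t: "t \<in> clq (\<phi> ` ?Nb) cmp"
      have sub: "t \<subseteq> \<phi> ` ?Nb" using t by (simp add: clq_def)
      have Ft: "F \<notin> t"
      proof
        assume "F \<in> t"
        then obtain Q where "Q \<in> ?Nb" "F = \<phi> Q" using sub by blast
        then show False using inj_\<phi> P nP by (auto simp: inj_on_def)
      qed
      have cF: "cmp F G \<and> cmp G F" if "G \<in> t" for G
      proof -
        have "G \<in> \<phi> ` ?Nb" using sub that by blast
        then obtain Q where Q: "Q \<in> ?Nb" "G = \<phi> Q" by (rule imageE)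
        then have "cmp F G" using cmp_iff[OF P(2), of Q] P(1) nP by auto
        then show ?thesis by (auto simp: cmp_def)
      qed
      have t1: "t \<in> clq (\<phi> ` X) cmp" using t unfolding clq_def by blast
      have "insert F t \<in> clq (\<phi> ` X) cmp" using t1 cF P unfolding clq_def by auto
      then show "t \<in> link ?K {F}" unfolding link_def derived_eq using t1 Ft by simp
    qed
    ultimately show ?thesis by simp
  qed
  moreover have "card A - 1 - 1 = q - 2" using A_facts(2) by simp
  ultimately show ?thesis unfolding dual_PL_manifold_def comb_manifold_def using cx ne by simp
qed

end

section \<open>Counting trees\<close>

text \<open>Nodes of a q-ary tree are words read from the node up to the root, so the parent of i # w is w.\<close>
definition qtree :: "nat set \<Rightarrow> nat list set \<Rightarrow> bool" where
  "qtree A P \<longleftrightarrow> finite P \<and> (\<forall>w\<in>P. set w \<subseteq> A) \<and> (\<forall>i w. i # w \<in> P \<longrightarrow> w \<in> P)"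

text \<open>Bounding the height rather than the size gives a finite family with an exact recursion.
  The empty tree belongs to it and stands for an absent child.\<close>

definition TH :: "nat set \<Rightarrow> nat \<Rightarrow> nat list set set" where
  "TH A h = {P. qtree A P \<and> (\<forall>w\<in>P. length w < h)}"

definition graft :: "nat set \<Rightarrow> (nat \<Rightarrow> nat list set) \<Rightarrow> nat list set" where
  "graft A g = insert [] (\<Union>i\<in>A. (\<lambda>w. w @ [i]) ` g i)"

definition sub :: "nat list set \<Rightarrow> nat list \<Rightarrow> nat list set" where
  "sub P u = {w. w @ u \<in> P}"

lemma qtree_suffix: "qtree A P \<Longrightarrow> v @ w \<in> P \<Longrightarrow> w \<in> P"
  by (induction v) (auto simp: qtree_def)

lemma qtree_Nil: "qtree A P \<Longrightarrow> P \<noteq> {} \<Longrightarrow> [] \<in> P"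
  using qtree_suffix[of A P _ "[]"] by fastforce

lemma mem_graft_snoc: "w @ [i] \<in> graft A g \<longleftrightarrow> i \<in> A \<and> w \<in> g i"
  unfolding graft_def by auto

lemma Nil_graft [simp]: "[] \<in> graft A g" by (simp add: graft_def)

lemma sub_graft: "i \<in> A \<Longrightarrow> sub (graft A g) (u @ [i]) = sub (g i) u"
  unfolding sub_def append_assoc[symmetric] mem_graft_snoc by simp

lemma sub_Nil [simp]: "sub P [] = P" by (simp add: sub_def)

lemma TH_0: "TH A 0 = {{}}"
  unfolding TH_def qtree_def by auto

lemma finite_TH: "finite A \<Longrightarrow> finite (TH A h)"
proof -
  assume "finite A"
  then have "finite {w. set w \<subseteq> A \<and> length w \<le> h}" by (rule finite_lists_length_le)
  then have "finite (Pow {w. set w \<subseteq> A \<and> length w \<le> h})" by simp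
  then show ?thesis by (rule finite_subset[rotated]) (auto simp: TH_def qtree_def less_imp_le)
qed

lemma empty_TH [simp]: "{} \<in> TH A h" by (simp add: TH_def qtree_def)

lemma graft_TH:
  assumes "finite A" "g \<in> PiE A (\<lambda>_. TH A h)"
  shows "graft A g \<in> TH A (Suc h)"
proof -
  have g: "qtree A (g i)" "\<And>w. w \<in> g i \<Longrightarrow> length w < h" if "i \<in> A" for i
    using assms(2) that by (auto simp: TH_def)
  have "finite (graft A g)" unfolding graft_def using assms(1) g by (auto simp: qtree_def)
  moreover have "set w \<subseteq> A" if "w \<in> graft A g" for w
    using that g(1) unfolding graft_def qtree_def by fastforce
  moreover have "w \<in> graft A g" if "j # w \<in> graft A g" for j w
  proof (cases w rule: rev_cases)
    case (snoc w' i)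
    then have "(j # w') @ [i] \<in> graft A g" using that by simp
    then have "i \<in> A" "j # w' \<in> g i" unfolding mem_graft_snoc by auto
    then have "w' \<in> g i" using g by (auto simp: qtree_def)
    then show ?thesis using \<open>i \<in> A\<close> snoc mem_graft_snoc by simp
  qed simp
  moreover have "length w < Suc h" if "w \<in> graft A g" for w
    using that g unfolding graft_def by auto
  ultimately show ?thesis unfolding TH_def qtree_def by blast
qed

lemma bij_graft:
  assumes "finite A"
  shows "bij_betw (graft A) (PiE A (\<lambda>_. TH A h)) (TH A (Suc h) - {{}})"
proof (rule bij_betw_byWitness[where f' = "\<lambda>P. \<lambda>i\<in>A. sub P [i]"])
  show "\<forall>g\<in>PiE A (\<lambda>_. TH A h). (\<lambda>i\<in>A. sub (graft A g) [i]) = g"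
  proof
    fix g assume g: "g \<in> PiE A (\<lambda>_. TH A h)"
    show "(\<lambda>i\<in>A. sub (graft A g) [i]) = g"
    proof
      fix i show "(\<lambda>i\<in>A. sub (graft A g) [i]) i = g i"
        using g by (cases "i \<in> A") (auto simp: sub_def mem_graft_snoc PiE_def extensional_def)
    qed
  qed
  show "\<forall>P\<in>TH A (Suc h) - {{}}. graft A (\<lambda>i\<in>A. sub P [i]) = P"
  proof
    fix P assume P: "P \<in> TH A (Suc h) - {{}}"
    have q: "qtree A P" and ne: "P \<noteq> {}" using P by (auto simp: TH_def)
    show "graft A (\<lambda>i\<in>A. sub P [i]) = P"
    proof (intro set_eqI)
      fix w show "w \<in> graft A (\<lambda>i\<in>A. sub P [i]) \<longleftrightarrow> w \<in> P"
      proof (cases w rule: rev_cases)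
        case Nil
        then show ?thesis using qtree_Nil[OF q ne] by simp
      next
        case (snoc w' i)
        have "i \<in> A" if "w' @ [i] \<in> P" using q that by (auto simp: qtree_def)
        then show ?thesis unfolding snoc mem_graft_snoc by (auto simp: sub_def)
      qed
    qed
  qed
  show "graft A ` PiE A (\<lambda>_. TH A h) \<subseteq> TH A (Suc h) - {{}}"
    using graft_TH[OF assms] Nil_graft by blast
  show "(\<lambda>P. \<lambda>i\<in>A. sub P [i]) ` (TH A (Suc h) - {{}}) \<subseteq> PiE A (\<lambda>_. TH A h)"
  proof (intro image_subsetI restrict_PiE_iff[THEN iffD2] ballI)
    fix P i assume "P \<in> TH A (Suc h) - {{}}" and i: "i \<in> A"
    then have P: "P \<in> TH A (Suc h)" by simp
    have q: "qtree A P" and len: "\<And>w. w \<in> P \<Longrightarrow> length w < Suc h" using P by (auto simp: TH_def)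
    have "finite (sub P [i])"
    proof -
      have "(\<lambda>w. w @ [i]) ` sub P [i] \<subseteq> P" by (auto simp: sub_def)
      then have "finite ((\<lambda>w. w @ [i]) ` sub P [i])" using q by (auto simp: qtree_def intro: finite_subset)
      then show ?thesis by (rule finite_imageD) (auto simp: inj_on_def)
    qed
    moreover have "set w \<subseteq> A" if "w \<in> sub P [i]" for w using q that unfolding sub_def qtree_def by fastforce
    moreover have "w \<in> sub P [i]" if "j # w \<in> sub P [i]" for j w
      using q that by (auto simp: sub_def qtree_def)
    moreover have "length w < h" if "w \<in> sub P [i]" for w using len[of "w @ [i]"] that by (auto simp: sub_def)
    ultimately show "sub P [i] \<in> TH A h" unfolding TH_def qtree_def by blast
  qed
qed

lemma sum_TH_Suc:
  fixes F :: "nat list set \<Rightarrow> 'b::comm_monoid_add"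
  assumes "finite A"
  shows "(\<Sum>P\<in>TH A (Suc h). F P) = F {} + (\<Sum>g\<in>PiE A (\<lambda>_. TH A h). F (graft A g))"
proof -
  have "(\<Sum>P\<in>TH A (Suc h). F P) = F {} + (\<Sum>P\<in>TH A (Suc h) - {{}}. F P)"
    by (rule sum.remove) (use finite_TH[OF assms] in auto)
  also have "(\<Sum>P\<in>TH A (Suc h) - {{}}. F P) = (\<Sum>g\<in>PiE A (\<lambda>_. TH A h). F (graft A g))"
    by (rule sum.reindex_bij_betw[OF bij_graft[OF assms], symmetric])
  finally show ?thesis .
qed

text \<open>The root contributes \<open>c\<close> and the subtrees vary independently. Semirings are
  allowed so that both real weights and power series are covered.\<close>

lemma sum_TH_Suc_prod:
  fixes F :: "nat list set \<Rightarrow> 'b::comm_semiring_1"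
  assumes "finite A"
    and "\<And>g. g \<in> PiE A (\<lambda>_. TH A h) \<Longrightarrow> F (graft A g) = c * (\<Prod>i\<in>A. G i (g i))"
  shows "(\<Sum>P\<in>TH A (Suc h). F P) = F {} + c * (\<Prod>i\<in>A. \<Sum>P\<in>TH A h. G i P)"
proof -
  have "(\<Sum>g\<in>PiE A (\<lambda>_. TH A h). F (graft A g)) = (\<Sum>g\<in>PiE A (\<lambda>_. TH A h). c * (\<Prod>i\<in>A. G i (g i)))"
    by (rule sum.cong) (use assms(2) in auto)
  also have "\<dots> = c * (\<Prod>i\<in>A. \<Sum>P\<in>TH A h. G i P)"
    by (subst prod_sum_PiE) (use assms(1) finite_TH in \<open>auto simp: sum_distrib_left\<close>)
  finally show ?thesis using sum_TH_Suc[OF assms(1)] by metis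
qed

lemma card_graft_filter:
  assumes "finite A" "\<And>i. i \<in> A \<Longrightarrow> finite (g i)" "Q []"
    and "\<And>w i. i \<in> A \<Longrightarrow> Q (w @ [i]) \<longleftrightarrow> Q' i w"
  shows "card {w \<in> graft A g. Q w} = 1 + (\<Sum>i\<in>A. card {w \<in> g i. Q' i w})"
proof -
  have eq: "{w \<in> graft A g. Q w} = insert [] (\<Union>i\<in>A. (\<lambda>w. w @ [i]) ` {w \<in> g i. Q' i w})"
    unfolding graft_def using assms(3,4) by auto
  have fin: "finite (\<Union>i\<in>A. (\<lambda>w. w @ [i]) ` {w \<in> g i. Q' i w})" using assms(1,2) by auto
  have "card (\<Union>i\<in>A. (\<lambda>w. w @ [i]) ` {w \<in> g i. Q' i w}) = (\<Sum>i\<in>A. card ((\<lambda>w. w @ [i]) ` {w \<in> g i. Q' i w}))"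
    by (rule card_UN_disjoint) (use assms(1,2) in auto)
  also have "\<dots> = (\<Sum>i\<in>A. card {w \<in> g i. Q' i w})"
    by (rule sum.cong) (auto intro!: card_image simp: inj_on_def)
  finally show ?thesis unfolding eq using fin by (subst card_insert_disjoint) auto
qed

lemma PiE_TH_finite: "g \<in> PiE A (\<lambda>_. TH A h) \<Longrightarrow> i \<in> A \<Longrightarrow> finite (g i)"
  by (auto simp: TH_def qtree_def PiE_def Pi_def)

lemma card_graft: "finite A \<Longrightarrow> g \<in> PiE A (\<lambda>_. TH A h) \<Longrightarrow> card (graft A g) = 1 + (\<Sum>i\<in>A. card (g i))"
  using card_graft_filter[of A g "\<lambda>_. True" "\<lambda>_ _. True"] PiE_TH_finite[of g A h] by simp

text \<open>The probability of P under the Galton--Watson law in which each of the q child positions is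
occupied with probability p; the root is present with probability p as well.\<close>
definition wt :: "nat \<Rightarrow> real \<Rightarrow> nat list set \<Rightarrow> real" where
  "wt q p P = p ^ card P * (1 - p) ^ ((q - 1) * card P + 1)"

lemma wt_nonneg: "0 \<le> p \<Longrightarrow> p \<le> 1 \<Longrightarrow> 0 \<le> wt q p P"
  by (simp add: wt_def)

lemma wt_empty: "wt q p {} = 1 - p" by (simp add: wt_def)

lemma wt_graft:
  assumes "finite A" "card A = q" "1 \<le> q" "g \<in> PiE A (\<lambda>_. TH A h)"
  shows "wt q p (graft A g) = p * (\<Prod>i\<in>A. wt q p (g i))"
proof -
  have "(\<Prod>i\<in>A. wt q p (g i)) = p ^ (\<Sum>i\<in>A. card (g i)) * (1 - p) ^ (\<Sum>i\<in>A. (q - 1) * card (g i) + 1)"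
    unfolding wt_def prod.distrib power_sum by simp
  moreover have "(\<Sum>i\<in>A. (q - 1) * card (g i) + 1) = (q - 1) * (1 + (\<Sum>i\<in>A. card (g i))) + 1"
  proof -
    have "(\<Sum>i\<in>A. (q - 1) * card (g i) + 1) = (q - 1) * (\<Sum>i\<in>A. card (g i)) + q"
      using assms(2) by (simp only: sum.distrib sum_distrib_left sum_constant) simp
    moreover have "(q - 1) * (1 + (\<Sum>i\<in>A. card (g i))) + 1 = (q - 1) * (\<Sum>i\<in>A. card (g i)) + ((q - 1) + 1)"
      by (simp only: distrib_left mult_1_right add.commute add.left_commute)
    moreover have "(q - 1) + 1 = q" using assms(3) by simp
    ultimately show ?thesis by (simp only:)
  qed
  ultimately show ?thesis unfolding wt_def card_graft[OF assms(1,4)] by simp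
qed

text \<open>The component of the root when all tree edges with label c are deleted.\<close>

definition comp_sz :: "nat \<Rightarrow> nat list set \<Rightarrow> nat" where
  "comp_sz c P = card {w \<in> P. c \<notin> set w}"

context
  fixes A :: "nat set" and q :: nat and p :: real
  assumes A: "finite A" "card A = q" "1 \<le> q" and p: "0 \<le> p" "p \<le> 1"
begin

text \<open>The mass of the trees of bounded height is iterated by x -> 1 - p + p * x ^ q, which
  maps the unit interval into itself. No infinite sum and no information about p is
  involved.\<close>

lemma sum_wt_le_1: "(\<Sum>P\<in>TH A h. wt q p P) \<le> 1"
proof (induction h)
  case 0
  show ?case using p by (simp add: TH_0 wt_empty)
next
  case (Suc h)
  have nn: "0 \<le> (\<Sum>P\<in>TH A h. wt q p P)" by (rule sum_nonneg) (use wt_nonneg p in auto)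
  have "(\<Sum>P\<in>TH A (Suc h). wt q p P) = wt q p {} + p * (\<Prod>i\<in>A. \<Sum>P\<in>TH A h. wt q p P)"
    by (rule sum_TH_Suc_prod[OF A(1)]) (rule wt_graft[OF A])
  also have "\<dots> \<le> (1 - p) + p * 1"
    unfolding wt_empty using p(1) nn Suc by (intro add_mono mult_left_mono) (auto simp: power_le_one)
  finally show ?case by simp
qed

text \<open>The subtree behind the child c does not belong to the component and contributes mass at
  most 1, while each of the other q - 1 subtrees contributes the moment itself. So the moment obeys
  x -> (1 - p) + p * l * x ^ (q - 1) as an upper bound, and the last hypothesis makes
  \<open>K\<close> a barrier.\<close>

lemma sum_wt_comp:
  assumes "c \<in> A" "0 \<le> l" "1 \<le> K" "(1 - p) + p * l * K ^ (q - 1) \<le> K"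
  shows "(\<Sum>P\<in>TH A h. wt q p P * l ^ comp_sz c P) \<le> K"
proof (induction h)
  case 0
  have "comp_sz c {} = 0" by (simp add: comp_sz_def)
  then show ?case using p assms(3) by (simp add: TH_0 wt_empty)
next
  case (Suc h)
  let ?G = "\<lambda>i P. if i = c then wt q p P else wt q p P * l ^ comp_sz c P"
  have nn: "0 \<le> (\<Sum>P\<in>TH A h. wt q p P * l ^ comp_sz c P)"
    by (rule sum_nonneg) (use wt_nonneg p assms(2) in auto)
  have nn1: "0 \<le> (\<Sum>P\<in>TH A h. wt q p P)" by (rule sum_nonneg) (use wt_nonneg p in auto)
  have "(\<Sum>P\<in>TH A (Suc h). wt q p P * l ^ comp_sz c P) = wt q p {} * l ^ comp_sz c {} + (p * l) * (\<Prod>i\<in>A. \<Sum>P\<in>TH A h. ?G i P)"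
  proof (rule sum_TH_Suc_prod[OF A(1)])
    fix g assume g: "g \<in> PiE A (\<lambda>_. TH A h)"
    have "comp_sz c (graft A g) = 1 + (\<Sum>i\<in>A. card {w \<in> g i. i \<noteq> c \<and> c \<notin> set w})"
      unfolding comp_sz_def by (rule card_graft_filter[OF A(1)]) (use PiE_TH_finite[OF g] in auto)
    also have "(\<Sum>i\<in>A. card {w \<in> g i. i \<noteq> c \<and> c \<notin> set w}) = (\<Sum>i\<in>A. if i = c then 0 else comp_sz c (g i))"
      by (rule sum.cong) (auto simp: comp_sz_def)
    finally have "l ^ comp_sz c (graft A g) = l * (\<Prod>i\<in>A. if i = c then 1 else l ^ comp_sz c (g i))"
      by (simp add: power_add power_sum if_distrib cong: if_cong)
    then have "wt q p (graft A g) * l ^ comp_sz c (graft A g)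
        = (p * l) * ((\<Prod>i\<in>A. wt q p (g i)) * (\<Prod>i\<in>A. if i = c then 1 else l ^ comp_sz c (g i)))"
      unfolding wt_graft[OF A g] by simp
    also have "(\<Prod>i\<in>A. wt q p (g i)) * (\<Prod>i\<in>A. if i = c then 1 else l ^ comp_sz c (g i)) = (\<Prod>i\<in>A. ?G i (g i))"
      unfolding prod.distrib[symmetric] by (rule prod.cong) auto
    finally show "wt q p (graft A g) * l ^ comp_sz c (graft A g) = (p * l) * (\<Prod>i\<in>A. ?G i (g i))" .
  qed
  also have "(\<Prod>i\<in>A. \<Sum>P\<in>TH A h. ?G i P)
      = (\<Sum>P\<in>TH A h. wt q p P) * (\<Sum>P\<in>TH A h. wt q p P * l ^ comp_sz c P) ^ (q - 1)"
  proof -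
    have "(\<Prod>i\<in>A. \<Sum>P\<in>TH A h. ?G i P) = (\<Sum>P\<in>TH A h. ?G c P) * (\<Prod>i\<in>A - {c}. \<Sum>P\<in>TH A h. ?G i P)"
      by (rule prod.remove[OF A(1) assms(1)])
    also have "(\<Prod>i\<in>A - {c}. \<Sum>P\<in>TH A h. ?G i P) = (\<Prod>i\<in>A - {c}. \<Sum>P\<in>TH A h. wt q p P * l ^ comp_sz c P)"
      by (rule prod.cong) auto
    also have "\<dots> = (\<Sum>P\<in>TH A h. wt q p P * l ^ comp_sz c P) ^ (q - 1)"
      using A assms(1) by simp
    finally show ?thesis by simp
  qed
  also have "(\<Sum>P\<in>TH A h. wt q p P) * (\<Sum>P\<in>TH A h. wt q p P * l ^ comp_sz c P) ^ (q - 1) \<le> 1 * K ^ (q - 1)"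
    using sum_wt_le_1 nn nn1 Suc by (intro mult_mono power_mono) auto
  finally have "(\<Sum>P\<in>TH A (Suc h). wt q p P * l ^ comp_sz c P) \<le> wt q p {} * l ^ comp_sz c {} + p * l * (1 * K ^ (q - 1))"
    using p(1) assms(2) by (simp add: mult_left_mono)
  moreover have "comp_sz c {} = 0" by (simp add: comp_sz_def)
  ultimately show ?case using assms(4) by (simp add: wt_empty)
qed

text \<open>Spine decomposition: each step from the root towards \<open>u\<close> costs a factor p,
  the subtrees off the spine have mass at most 1, and the subtree at \<open>u\<close> is weighted as
  a tree of its own.\<close>

lemma sum_wt_marked:
  assumes f: "\<And>P. 0 \<le> f P" and K: "\<And>h. (\<Sum>P\<in>TH A h. if P \<noteq> {} then wt q p P * f P else 0) \<le> K" and u: "set u \<subseteq> A"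
  shows "(\<Sum>P\<in>TH A h. if u \<in> P then wt q p P * f (sub P u) else 0) \<le> p ^ length u * K"
  using u
proof (induction u arbitrary: h rule: rev_induct)
  case Nil
  have "(\<Sum>P\<in>TH A h. if [] \<in> P then wt q p P * f (sub P []) else 0) = (\<Sum>P\<in>TH A h. if P \<noteq> {} then wt q p P * f P else 0)"
    by (rule sum.cong) (auto simp: TH_def dest: qtree_Nil)
  then show ?case using K by simp
next
  case (snoc i u)
  have i: "i \<in> A" and u: "set u \<subseteq> A" using snoc.prems by auto
  have K0: "0 \<le> K" using K[of 0] by (simp add: TH_0)
  show ?case
  proof (cases h)
    case 0
    then show ?thesis using K0 p by (simp add: TH_0)
  next
    case (Suc m)
    let ?G = "\<lambda>j P. if j = i then (if u \<in> P then wt q p P * f (sub P u) else 0) else wt q p P"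
    have nn: "0 \<le> (\<Sum>P\<in>TH A m. if u \<in> P then wt q p P * f (sub P u) else 0)"
      by (rule sum_nonneg) (use wt_nonneg p f in auto)
    have nn1: "0 \<le> (\<Sum>P\<in>TH A m. wt q p P)" by (rule sum_nonneg) (use wt_nonneg p in auto)
    have "(\<Sum>P\<in>TH A (Suc m). if u @ [i] \<in> P then wt q p P * f (sub P (u @ [i])) else 0)
       = (if u @ [i] \<in> {} then wt q p {} * f (sub {} (u @ [i])) else 0) + p * (\<Prod>j\<in>A. \<Sum>P\<in>TH A m. ?G j P)"
    proof (rule sum_TH_Suc_prod[OF A(1)])
      fix g assume g: "g \<in> PiE A (\<lambda>_. TH A m)"
      have "(\<Prod>j\<in>A. ?G j (g j)) = ?G i (g i) * (\<Prod>j\<in>A - {i}. ?G j (g j))"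
        by (rule prod.remove[OF A(1) i])
      also have "(\<Prod>j\<in>A - {i}. ?G j (g j)) = (\<Prod>j\<in>A - {i}. wt q p (g j))" by (rule prod.cong) auto
      finally have 1: "(\<Prod>j\<in>A. ?G j (g j)) = (if u \<in> g i then wt q p (g i) * f (sub (g i) u) else 0) * (\<Prod>j\<in>A - {i}. wt q p (g j))"
        by simp
      have 2: "wt q p (graft A g) = p * (wt q p (g i) * (\<Prod>j\<in>A - {i}. wt q p (g j)))"
        unfolding wt_graft[OF A g] by (subst prod.remove[OF A(1) i]) simp
      show "(if u @ [i] \<in> graft A g then wt q p (graft A g) * f (sub (graft A g) (u @ [i])) else 0) = p * (\<Prod>j\<in>A. ?G j (g j))"
        unfolding 1 2 mem_graft_snoc sub_graft[OF i] using i by simp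
    qed
    also have "\<dots> = p * (\<Prod>j\<in>A. \<Sum>P\<in>TH A m. ?G j P)" by simp
    also have "(\<Prod>j\<in>A. \<Sum>P\<in>TH A m. ?G j P)
       = (\<Sum>P\<in>TH A m. if u \<in> P then wt q p P * f (sub P u) else 0) * (\<Prod>j\<in>A - {i}. \<Sum>P\<in>TH A m. ?G j P)"
      by (subst prod.remove[OF A(1) i]) simp
    also have "(\<Prod>j\<in>A - {i}. \<Sum>P\<in>TH A m. ?G j P) = (\<Sum>P\<in>TH A m. wt q p P) ^ (q - 1)"
      using A i by simp
    also have "p * ((\<Sum>P\<in>TH A m. if u \<in> P then wt q p P * f (sub P u) else 0) * (\<Sum>P\<in>TH A m. wt q p P) ^ (q - 1))
        \<le> p * ((p ^ length u * K) * 1)"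
      using p nn nn1 sum_wt_le_1 snoc.IH[OF u] K0
      by (intro mult_left_mono mult_mono) (auto simp: power_le_one)
    finally show ?thesis unfolding Suc by (simp add: mult.assoc)
  qed
qed

end

section \<open>Trees with a given number of nodes\<close>

definition PN :: "nat set \<Rightarrow> nat \<Rightarrow> nat list set set" where
  "PN A n = {P. qtree A P \<and> card P = n}"

lemma length_less_card:
  assumes "qtree A P" "u \<in> P"
  shows "length u < card P"
proof -
  have fin: "finite P" using assms(1) by (simp add: qtree_def)
  have inj: "inj_on (\<lambda>k. drop k u) {..length u}"
  proof (rule inj_onI)
    fix k l assume kl: "k \<in> {..length u}" "l \<in> {..length u}" "drop k u = drop l u"
    then have "length u - k = length u - l" by (metis length_drop)
    then show "k = l" using kl by simp
  qed
  have "(\<lambda>k. drop k u) ` {..length u} \<subseteq> P"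
  proof (rule image_subsetI)
    fix k show "drop k u \<in> P" by (rule qtree_suffix[OF assms(1), of "take k u"]) (simp add: assms(2))
  qed
  then have "card ((\<lambda>k. drop k u) ` {..length u}) \<le> card P" by (rule card_mono[OF fin])
  then show ?thesis using card_image[OF inj] by simp
qed

lemma PN_eq: "n \<le> h \<Longrightarrow> PN A n = {P \<in> TH A h. card P = n}"
  unfolding PN_def TH_def using length_less_card[of A] by fastforce

lemma PN_subset_TH: "PN A n \<subseteq> TH A n" using PN_eq[of n n A] by auto

lemma finite_PN: "finite A \<Longrightarrow> finite (PN A n)"
  using finite_subset[OF PN_subset_TH] finite_TH by blast

lemma fps_power_agree:
  fixes a b :: "'a::comm_ring_1 fps"
  assumes "\<And>m. m \<le> n \<Longrightarrow> fps_nth a m = fps_nth b m"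
  shows "m \<le> n \<Longrightarrow> fps_nth (a ^ k) m = fps_nth (b ^ k) m"
proof (induction k arbitrary: m)
  case (Suc k)
  show ?case unfolding power_Suc fps_mult_nth
    by (rule sum.cong) (use Suc assms in auto)
qed simp

text \<open>The series of the trees of height below h satisfies the recursion exactly and has the
  final coefficients up to degree h, so the functional equation can be checked coefficient by
  coefficient.\<close>

lemma fps_PN:
  fixes A :: "nat set"
  assumes A: "finite A"
  defines "U \<equiv> Abs_fps (\<lambda>n. real (card (PN A n)))"
  shows "U = 1 + fps_X * U ^ card A"
proof -
  define a where "a h = (\<Sum>P\<in>TH A h. fps_X ^ card P :: real fps)" for h
  have a_nth: "fps_nth (a h) n = real (card {P \<in> TH A h. card P = n})" for h n
  proof -
    have "fps_nth (a h) n = (\<Sum>P\<in>TH A h. if card P = n then 1 else 0)"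
      unfolding a_def fps_sum_nth by (rule sum.cong) (auto simp: fps_X_power_nth)
    also have "\<dots> = real (card {P \<in> TH A h. card P = n})"
      using finite_TH[OF A] by (simp add: sum.If_cases Int_def)
    finally show ?thesis .
  qed
  have aU: "fps_nth (a h) n = fps_nth U n" if "n \<le> h" for h n
    unfolding a_nth U_def using PN_eq[OF that, of A] by simp
  have a_Suc: "a (Suc h) = 1 + fps_X * a h ^ card A" for h
  proof -
    have "a (Suc h) = fps_X ^ card ({} :: nat list set) + fps_X * (\<Prod>i\<in>A. \<Sum>P\<in>TH A h. fps_X ^ card P)"
      unfolding a_def
      by (rule sum_TH_Suc_prod[OF A]) (simp add: card_graft[OF A] power_sum)
    then show ?thesis by (simp add: a_def)
  qed
  show ?thesis
  proof (rule fps_ext)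
    fix n
    have "fps_nth U n = fps_nth (a (Suc n)) n" using aU[of n "Suc n"] by simp
    also have "\<dots> = fps_nth (1 + fps_X * a n ^ card A) n" by (simp only: a_Suc)
    also have "\<dots> = fps_nth (1 + fps_X * U ^ card A) n"
      using fps_power_agree[of n "a n" U "n - 1" "card A"] aU[of _ n] by (cases n) auto
    finally show "fps_nth U n = fps_nth (1 + fps_X * U ^ card A) n" .
  qed
qed

text \<open>The Fuss-Catalan (Raney) numbers for all powers at once: U ^ (k + 1) = U ^ k + X * U ^
  (k + q) leads from (n + 1, k) and (n, k + q) to (n + 1, k + 1). The denominator is kept on the
  left because it vanishes at n = k = 0.\<close>

lemma fuss_catalan_fps:
  fixes U :: "real fps"
  assumes U: "U = 1 + fps_X * U ^ q" and q: "1 \<le> q"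
  shows "real (q * n + k) * fps_nth (U ^ k) n = real k * real ((q * n + k) choose n)"
proof (induction n arbitrary: k)
  case 0
  have "fps_nth U 0 = 1" by (subst U) simp
  then show ?case by (simp add: fps_nth_power_0)
next
  case (Suc n)
  show ?case
  proof (induction k)
    case 0
    show ?case by simp
  next
    case (Suc k)
    let ?m = "q * Suc n + k"
    let ?c = "real (?m choose n)" and ?d = "real (?m choose Suc n)"
    have "U ^ Suc k = U ^ k * U" by (simp add: mult.commute)
    also have "\<dots> = U ^ k * (1 + fps_X * U ^ q)" using U by simp
    also have "\<dots> = U ^ k + fps_X * U ^ (k + q)" by (simp add: algebra_simps power_add)
    finally have eq: "fps_nth (U ^ Suc k) (Suc n) = fps_nth (U ^ k) (Suc n) + fps_nth (U ^ (k + q)) n" by simp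
    have m0: "real ?m > 0" using q by (simp only: of_nat_0_less_iff) auto
    have 1: "real ?m * fps_nth (U ^ k) (Suc n) = real k * ?d" using Suc.IH by simp
    have mm: "q * n + (k + q) = ?m" by simp
    have 2: "real ?m * fps_nth (U ^ (k + q)) n = real (k + q) * ?c"
      using \<open>\<And>k. real (q * n + k) * fps_nth (U ^ k) n = real k * real ((q * n + k) choose n)\<close>[of "k + q"]
      unfolding mm .
    have nm: "n \<le> ?m"
    proof -
      have "1 * n \<le> q * n" by (rule mult_le_mono1[OF q])
      also have "\<dots> \<le> ?m" by simp
      finally show ?thesis by simp
    qed
    have abs: "real (Suc n) * ?d = (real ?m - real n) * ?c"
    proof -
      have "Suc n * (?m choose Suc n) = (?m - n) * (?m choose n)"
        unfolding binomial_absorption binomial_absorb_comp ..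
      then have "real (Suc n * (?m choose Suc n)) = real ((?m - n) * (?m choose n))" by simp
      then show ?thesis by (simp only: of_nat_mult of_nat_diff[OF nm])
    qed
    have pas: "real (Suc ?m choose Suc n) = ?c + ?d" by simp
    \<comment> \<open>Once \<open>?d\<close> has been eliminated by the absorption identity
      \<open>abs\<close>, a polynomial identity remains.\<close>
    have key: "(real ?m + 1) * (real k * ?d + real (k + q) * ?c) = real ?m * (real (Suc k) * (?c + ?d))"
    proof -
      have mr: "real ?m = real q * (real n + 1) + real k" by (simp add: algebra_simps)
      have "(real ?m + 1) * (real k * ?d + real (k + q) * ?c) - real ?m * (real (Suc k) * (?c + ?d))
        = - (real q * (real (Suc n) * ?d)) + ?c * (real ?m * real q - real ?m + real k + real q)"
        unfolding mr by (simp add: algebra_simps)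
      also have "\<dots> = 0" unfolding abs unfolding mr by (simp add: algebra_simps)
      finally show ?thesis by simp
    qed
    have "real ?m * (real (Suc ?m) * fps_nth (U ^ Suc k) (Suc n)) = (real ?m + 1) * (real k * ?d + real (k + q) * ?c)"
      unfolding eq using 1 2 by (simp add: algebra_simps)
    also have "\<dots> = real ?m * (real (Suc k) * real (Suc ?m choose Suc n))" unfolding key pas ..
    finally have "real (Suc ?m) * fps_nth (U ^ Suc k) (Suc n) = real (Suc k) * real (Suc ?m choose Suc n)"
      using m0 by (simp only: mult_left_cancel[OF less_imp_neq[OF m0, symmetric]])
    then show ?case by simp
  qed
qed

lemma card_PN:
  assumes "finite A" "A \<noteq> {}"
  shows "(card A * n + 1) * card (PN A n) = (card A * n + 1) choose n"
proof -
  have "1 \<le> card A" using assms by (simp add: Suc_le_eq card_gt_0_iff)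
  from fuss_catalan_fps[OF fps_PN[OF assms(1)] this, of n 1]
  have "real ((card A * n + 1) * card (PN A n)) = real ((card A * n + 1) choose n)"
    by (simp only: of_nat_mult of_nat_1 mult_1_left power_one_right fps_nth_Abs_fps)
  then show ?thesis by (simp only: of_nat_eq_iff)
qed

text \<open>Up to normalisation these are the weights of the binomial law with q n trials and
  success probability 1 / q. Its mode is n, as the ratios of consecutive terms show.\<close>

lemma central_term_max:
  fixes q n j :: nat
  assumes q: "2 \<le> q" and j: "j \<le> q * n"
  defines "t \<equiv> \<lambda>j. real ((q * n) choose j) * (real q - 1) ^ (q * n - j)"
  shows "t j \<le> t n"
proof -
  have step: "(real (Suc j) * (real q - 1)) * t (Suc j) = real (q * n - j) * t j" if "j < q * n" for j
  proof -
    have "Suc j * ((q * n) choose Suc j) = (q * n - j) * ((q * n) choose j)"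
      unfolding binomial_absorption binomial_absorb_comp ..
    then have s1: "real (Suc j) * real ((q * n) choose Suc j) = real (q * n - j) * real ((q * n) choose j)"
      by (simp only: of_nat_mult[symmetric])
    have s2: "(real q - 1) ^ (q * n - j) = (real q - 1) ^ (q * n - Suc j) * (real q - 1)"
      using that by (metis Suc_diff_Suc power_Suc2)
    have "(real (Suc j) * (real q - 1)) * t (Suc j)
        = (real (Suc j) * real ((q * n) choose Suc j)) * ((real q - 1) ^ (q * n - Suc j) * (real q - 1))"
      unfolding t_def by (simp only: mult_ac)
    also have "\<dots> = (real (q * n - j) * real ((q * n) choose j)) * (real q - 1) ^ (q * n - j)" by (simp only: s1 s2)
    also have "\<dots> = real (q * n - j) * t j" unfolding t_def by (simp only: mult_ac)
    finally show ?thesis .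
  qed
  have tnn: "0 \<le> t j" for j unfolding t_def using q by simp
  have up: "t j \<le> t (Suc j)" if "j < n" for j
  proof -
    have jq: "j < q * n"
    proof -
      have "1 * n \<le> q * n" by (rule mult_le_mono1) (use q in simp)
      then show ?thesis using that by linarith
    qed
    have "real (Suc j) * (real q - 1) \<le> real (q * n - j)"
    proof -
      have "real (Suc j) \<le> real n" using that by simp
      then have "real q * real (Suc j) \<le> real q * real n" by (intro mult_left_mono) auto
      then show ?thesis using jq by (simp add: of_nat_diff algebra_simps)
    qed
    then have "(real (Suc j) * (real q - 1)) * t j \<le> real (q * n - j) * t j" using tnn by (rule mult_right_mono)
    also have "\<dots> = (real (Suc j) * (real q - 1)) * t (Suc j)" by (rule step[OF jq, symmetric])
    finally show ?thesis by (rule mult_left_le_imp_le) (use q in auto)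
  qed
  have down: "t (Suc j) \<le> t j" if "n \<le> j" "j < q * n" for j
  proof -
    have "real (q * n - j) \<le> real (Suc j) * (real q - 1)"
    proof -
      have h: "real q * real n \<le> real q * real j" using that by (intro mult_left_mono) auto
      have e1: "real (q * n - j) = real q * real n - real j" using that by (simp add: of_nat_diff)
      have e2: "real (Suc j) * (real q - 1) = real q * real j - real j + (real q - 1)" by (simp add: algebra_simps)
      have "real q \<ge> 2" using q by simp
      then show ?thesis unfolding e1 e2 using h by linarith
    qed
    then have "real (q * n - j) * t j \<le> (real (Suc j) * (real q - 1)) * t j" using tnn by (rule mult_right_mono)
    then have "(real (Suc j) * (real q - 1)) * t (Suc j) \<le> (real (Suc j) * (real q - 1)) * t j"
      by (simp only: step[OF that(2)])
    then show ?thesis by (rule mult_left_le_imp_le) (use q in auto)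
  qed
  show ?thesis
  proof (cases "j \<le> n")
    case True
    then show ?thesis by (induction j rule: inc_induct) (use up order_trans in blast)+
  next
    case False
    then have "n \<le> j" by simp
    then show ?thesis using j
    proof (induction j rule: dec_induct)
      case (step m)
      then show ?case using down[of m] by simp
    qed simp
  qed
qed

text \<open>Takes the place of Stirling's formula: the largest of the q n + 1 terms in the expansion
  of (1 + (q - 1)) ^ (q n) is at least their mean. The polynomial loss is harmless.\<close>

lemma card_PN_ge:
  assumes A: "finite A" "card A = q" and q: "2 \<le> q"
  shows "1 \<le> real ((q * n + 1)\<^sup>2 * card (PN A n)) * ((1 / real q) ^ n * (1 - 1 / real q) ^ ((q - 1) * n))"
proof -
  let ?t = "\<lambda>j. real ((q * n) choose j) * (real q - 1) ^ (q * n - j)"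
  have qn: "q * n - n = (q - 1) * n" using q by (simp add: diff_mult_distrib)
  have "real q ^ (q * n) = (1 + (real q - 1)) ^ (q * n)" by simp
  also have "\<dots> = (\<Sum>j\<le>q * n. ?t j)" unfolding binomial_ring by simp
  also have "\<dots> \<le> (\<Sum>j\<le>q * n. ?t n)" by (rule sum_mono) (use central_term_max[OF q] in auto)
  also have "\<dots> = real (q * n + 1) * ?t n" by simp
  also have "?t n = real ((q * n) choose n) * (real q - 1) ^ ((q - 1) * n)" unfolding qn ..
  also have "real ((q * n) choose n) \<le> real ((q * n + 1) * card (PN A n))"
  proof -
    have "A \<noteq> {}" using A q by auto
    then have "(q * n + 1) * card (PN A n) = (q * n + 1) choose n" using card_PN[OF A(1), of n] A(2) by simp
    moreover have "(q * n) choose n \<le> (q * n + 1) choose n" by (rule binomial_right_mono) simp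
    ultimately show ?thesis by simp
  qed
  finally have 1: "real q ^ (q * n) \<le> real (q * n + 1) * (real ((q * n + 1) * card (PN A n)) * (real q - 1) ^ ((q - 1) * n))"
    using q by (simp add: mult_left_mono mult_right_mono)
  have "(1 / real q) ^ n * (1 - 1 / real q) ^ ((q - 1) * n) = (real q - 1) ^ ((q - 1) * n) / real q ^ (q * n)"
  proof -
    have "1 - 1 / real q = (real q - 1) / real q" using q by (simp add: field_simps)
    moreover have "real q ^ n * real q ^ ((q - 1) * n) = real q ^ (q * n)"
      unfolding power_add[symmetric] using q by (simp add: diff_mult_distrib)
    ultimately show ?thesis by (simp add: power_divide)
  qed
  moreover have "real q ^ (q * n) > 0" using q by simp
  moreover have "real q ^ (q * n) \<le> real ((q * n + 1)\<^sup>2 * card (PN A n)) * (real q - 1) ^ ((q - 1) * n)"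
    using 1 by (simp only: power2_eq_square of_nat_mult mult.assoc)
  ultimately show ?thesis by (simp only: le_divide_eq_1_pos times_divide_eq_right)
qed

lemma sum_wt_containing:
  assumes "finite A" "card A = q" "1 \<le> q" "0 \<le> p" "p \<le> 1" "set u \<subseteq> A"
  shows "(\<Sum>P\<in>TH A h. if u \<in> P then wt q p P else 0) \<le> p ^ length u"
proof -
  have "(\<Sum>P\<in>TH A h. if P \<noteq> {} then wt q p P * 1 else 0) \<le> 1" for h
  proof -
    have "(\<Sum>P\<in>TH A h. if P \<noteq> {} then wt q p P * 1 else 0) \<le> (\<Sum>P\<in>TH A h. wt q p P)"
      by (rule sum_mono) (use wt_nonneg[OF assms(4,5)] in auto)
    also have "\<dots> \<le> 1" by (rule sum_wt_le_1[OF assms(1-5)])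
    finally show ?thesis .
  qed
  from sum_wt_marked[OF assms(1-5), of "\<lambda>_. 1" 1, OF _ this assms(6), of h] show ?thesis by (simp only: mult_1_right zero_le_one)
qed

text \<open>First moment over the q ^ h words of length h, each of which is a node with weight at
  most p ^ h.\<close>

lemma tall_bound:
  assumes "finite A" "card A = q" "1 \<le> q" "0 \<le> p" "p \<le> 1"
  shows "real (card {P \<in> PN A n. \<exists>u\<in>P. length u = h}) * (p ^ n * (1 - p) ^ ((q - 1) * n + 1)) \<le> (real q * p) ^ h"
proof -
  let ?S = "{P \<in> PN A n. \<exists>u\<in>P. length u = h}" and ?W = "{u. set u \<subseteq> A \<and> length u = h}"
  have fW: "finite ?W" by (rule finite_lists_length_eq[OF assms(1)])
  have SP: "?S \<subseteq> TH A n" using PN_subset_TH by auto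
  have "real (card ?S) * (p ^ n * (1 - p) ^ ((q - 1) * n + 1)) = (\<Sum>P\<in>?S. wt q p P)"
    by (simp add: wt_def PN_def)
  also have "\<dots> \<le> (\<Sum>P\<in>?S. \<Sum>u\<in>?W. if u \<in> P then wt q p P else 0)"
  proof (rule sum_mono)
    fix P assume "P \<in> ?S"
    then obtain u where u: "u \<in> P" "length u = h" and q: "qtree A P" by (auto simp: PN_def)
    have "u \<in> ?W" using u q by (auto simp: qtree_def)
    then show "wt q p P \<le> (\<Sum>u\<in>?W. if u \<in> P then wt q p P else 0)"
      using member_le_sum[of u ?W "\<lambda>u. if u \<in> P then wt q p P else 0"] fW u(1) wt_nonneg[OF assms(4,5)] by auto
  qed
  also have "\<dots> \<le> (\<Sum>P\<in>TH A n. \<Sum>u\<in>?W. if u \<in> P then wt q p P else 0)"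
    by (rule sum_mono2[OF finite_TH[OF assms(1)] SP]) (auto intro!: sum_nonneg wt_nonneg[OF assms(4,5)])
  also have "\<dots> = (\<Sum>u\<in>?W. \<Sum>P\<in>TH A n. if u \<in> P then wt q p P else 0)" by (rule sum.swap)
  also have "\<dots> \<le> (\<Sum>u\<in>?W. p ^ h)"
    by (rule sum_mono) (use sum_wt_containing[OF assms] in auto)
  also have "\<dots> = (real q * p) ^ h"
    using card_lists_length_eq[OF assms(1), of h] assms(2) by (simp add: power_mult_distrib)
  finally show ?thesis .
qed

text \<open>At p = 1 / q every level has mean size at most 1, so summing over all nodes at levels
  below n costs only a factor n; the colours contribute the factor q.\<close>

lemma fat_bound:
  assumes A: "finite A" "card A = q" "1 \<le> q" and l: "1 \<le> l" "1 \<le> K"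
    and fix_pt: "(1 - 1 / real q) + 1 / real q * l * K ^ (q - 1) \<le> K"
  shows "real (card {P \<in> PN A n. \<exists>u\<in>P. \<exists>c\<in>A. s \<le> comp_sz c (sub P u)})
    * ((1 / real q) ^ n * (1 - 1 / real q) ^ ((q - 1) * n + 1)) * l ^ s \<le> real q * real n * K"
proof -
  define p where "p = 1 / real q"
  have p: "0 \<le> p" "p \<le> 1" using A(3) by (auto simp: p_def)
  let ?S = "{P \<in> PN A n. \<exists>u\<in>P. \<exists>c\<in>A. s \<le> comp_sz c (sub P u)}"
  let ?W = "\<lambda>d. {u. set u \<subseteq> A \<and> length u = d}"
  let ?F = "\<lambda>P c u. if u \<in> P then wt q p P * l ^ comp_sz c (sub P u) else 0"
  have fW: "finite (?W d)" for d by (rule finite_lists_length_eq[OF A(1)])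
  have SP: "?S \<subseteq> TH A n" using PN_subset_TH by auto
  have nn: "0 \<le> ?F P c u" for P c u using wt_nonneg[OF p] l by auto
  have "real (card ?S) * (p ^ n * (1 - p) ^ ((q - 1) * n + 1)) * l ^ s = (\<Sum>P\<in>?S. wt q p P * l ^ s)"
    by (simp add: wt_def PN_def)
  also have "\<dots> \<le> (\<Sum>P\<in>?S. \<Sum>c\<in>A. \<Sum>d<n. \<Sum>u\<in>?W d. ?F P c u)"
  proof (rule sum_mono)
    fix P assume "P \<in> ?S"
    then obtain u c where u: "u \<in> P" "c \<in> A" "s \<le> comp_sz c (sub P u)" and q: "qtree A P" "card P = n"
      by (auto simp: PN_def)
    have ul: "length u < n" using length_less_card[OF q(1) u(1)] q(2) by simp
    have uW: "u \<in> ?W (length u)" using u q by (auto simp: qtree_def)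
    have "wt q p P * l ^ s \<le> ?F P c u"
      using u(1,3) wt_nonneg[OF p] l(1) by (auto intro!: mult_left_mono power_increasing)
    also have "\<dots> \<le> (\<Sum>u\<in>?W (length u). ?F P c u)" by (rule member_le_sum[OF uW nn fW])
    also have "\<dots> \<le> (\<Sum>d<n. \<Sum>u\<in>?W d. ?F P c u)"
      by (rule member_le_sum[of "length u" "{..<n}" "\<lambda>d. \<Sum>u\<in>?W d. ?F P c u"]) (use ul nn in \<open>auto intro!: sum_nonneg\<close>)
    also have "\<dots> \<le> (\<Sum>c\<in>A. \<Sum>d<n. \<Sum>u\<in>?W d. ?F P c u)"
      by (rule member_le_sum[OF u(2) _ A(1)]) (use nn in \<open>auto intro!: sum_nonneg\<close>)
    finally show "wt q p P * l ^ s \<le> (\<Sum>c\<in>A. \<Sum>d<n. \<Sum>u\<in>?W d. ?F P c u)" .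
  qed
  also have "\<dots> \<le> (\<Sum>P\<in>TH A n. \<Sum>c\<in>A. \<Sum>d<n. \<Sum>u\<in>?W d. ?F P c u)"
    by (rule sum_mono2[OF finite_TH[OF A(1)] SP]) (use nn in \<open>auto intro!: sum_nonneg\<close>)
  also have "\<dots> = (\<Sum>c\<in>A. \<Sum>P\<in>TH A n. \<Sum>d<n. \<Sum>u\<in>?W d. ?F P c u)" by (rule sum.swap)
  also have "\<dots> = (\<Sum>c\<in>A. \<Sum>d<n. \<Sum>P\<in>TH A n. \<Sum>u\<in>?W d. ?F P c u)"
    by (rule sum.cong[OF refl]) (rule sum.swap)
  also have "\<dots> = (\<Sum>c\<in>A. \<Sum>d<n. \<Sum>u\<in>?W d. \<Sum>P\<in>TH A n. ?F P c u)"
    by (rule sum.cong[OF refl], rule sum.cong[OF refl]) (rule sum.swap)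
  also have "\<dots> \<le> (\<Sum>c\<in>A. \<Sum>d<n. \<Sum>u\<in>?W d. p ^ d * K)"
  proof (intro sum_mono)
    fix c d u assume c: "c \<in> A" and u: "u \<in> ?W d"
    have "(\<Sum>P\<in>TH A h. if P \<noteq> {} then wt q p P * l ^ comp_sz c P else 0) \<le> K" for h
    proof -
      have "(\<Sum>P\<in>TH A h. if P \<noteq> {} then wt q p P * l ^ comp_sz c P else 0) \<le> (\<Sum>P\<in>TH A h. wt q p P * l ^ comp_sz c P)"
        by (rule sum_mono) (use wt_nonneg[OF p] l in auto)
      also have "\<dots> \<le> K"
        by (rule sum_wt_comp[OF A p c]) (use l fix_pt in \<open>auto simp: p_def\<close>)
      finally show ?thesis .
    qed
    from sum_wt_marked[OF A p, of "\<lambda>P. l ^ comp_sz c P" K, OF _ this, of u n] u l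
    show "(\<Sum>P\<in>TH A n. ?F P c u) \<le> p ^ d * K" by auto
  qed
  also have "\<dots> = (\<Sum>c\<in>A. \<Sum>d<n. K)"
  proof (intro sum.cong refl)
    fix c d
    have "(\<Sum>u\<in>?W d. p ^ d * K) = (real q * p) ^ d * K"
      using card_lists_length_eq[OF A(1), of d] A(2) by (simp add: power_mult_distrib)
    also have "real q * p = 1" using A(3) by (simp add: p_def)
    finally show "(\<Sum>u\<in>?W d. p ^ d * K) = K" by simp
  qed
  also have "\<dots> = real q * real n * K" using A(2) by simp
  finally show ?thesis unfolding p_def .
qed

definition fine :: "nat set \<Rightarrow> nat \<Rightarrow> nat \<Rightarrow> nat list set \<Rightarrow> bool" where
  "fine A h s P \<longleftrightarrow> (\<forall>u\<in>P. length u < h) \<and> (\<forall>u\<in>P. \<forall>c\<in>A. comp_sz c (sub P u) < s)"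

text \<open>Tall trees are compared under the Galton--Watson law with the critical parameter perturbed by t, fat ones
by an exponential moment; conditioning on the size n costs only a polynomial factor.\<close>
lemma rare_trees:
  assumes q: "2 \<le> q"
  shows "\<exists>l K :: real. 1 < l \<and> 1 \<le> K \<and> (\<forall>A n h s t. finite A \<longrightarrow> card A = q \<longrightarrow> 0 \<le> t \<longrightarrow> t < 1 \<longrightarrow>
    real (card {P \<in> PN A n. \<not> fine A h s P})
      \<le> real (card (PN A n)) * (2 * (real q * real n + 1)\<^sup>2 * ((1 - t) ^ h / (1 - t\<^sup>2) ^ n + real q * real n * K / l ^ s)))"
proof -
  \<comment> \<open>\<open>l\<close> is chosen so that \<open>K = 1 + e\<close> solves the recursion
    of \<open>sum_wt_comp\<close> at p = 1 / q with equality. Then l > 1 amounts to (1 + e) ^ (q -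
    1) < 1 + q * e, which holds for small e > 0; the value 1 / q ^ 2 is small enough.\<close>
  define e where "e = 1 / (real q)\<^sup>2"
  define K where "K = 1 + e"
  define l where "l = (1 + real q * e) / (1 + e) ^ (q - 1)"
  have rq: "2 \<le> real q" using q by simp
  have e0: "0 < e" "e < 1" using rq by (auto simp: e_def power2_eq_square field_simps intro: less_le_trans[of 1 "2 * real q"])
  have l1: "1 < l"
  proof -
    have "(1 + e) ^ (q - 1) * (1 - real (q - 1) * e) \<le> (1 + e) ^ (q - 1) * (1 - e) ^ (q - 1)"
      using Bernoulli_inequality[of "- e" "q - 1"] e0 by (intro mult_left_mono) auto
    also have "\<dots> = (1 - e\<^sup>2) ^ (q - 1)"
      unfolding power_mult_distrib[symmetric] by (simp add: algebra_simps power2_eq_square)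
    also have "\<dots> \<le> 1" using e0 by (intro power_le_one) (auto simp: power2_eq_square mult_le_one)
    finally have 1: "(1 + e) ^ (q - 1) * (1 - (real q - 1) * e) \<le> 1" using q by (simp add: of_nat_diff)
    have qe: "real q * (real q * e) = 1" using rq by (simp add: e_def power2_eq_square)
    have "1 < (1 + real q * e) * (1 - (real q - 1) * e)"
    proof -
      have "(1 + real q * e) * (1 - (real q - 1) * e) = 1 + e - real q * (real q * e) * e + real q * e * e"
        by (simp add: algebra_simps)
      also have "\<dots> = 1 + real q * e * e" using qe by simp
      finally show ?thesis using e0 rq by simp
    qed
    then have "(1 + e) ^ (q - 1) * 1 < (1 + e) ^ (q - 1) * ((1 + real q * e) * (1 - (real q - 1) * e))"
      using e0 by (intro mult_strict_left_mono) auto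
    also have "\<dots> = (1 + real q * e) * ((1 + e) ^ (q - 1) * (1 - (real q - 1) * e))" by (simp only: mult_ac)
    also have "\<dots> \<le> (1 + real q * e) * 1" using 1 e0 by (intro mult_left_mono) auto
    finally show ?thesis unfolding l_def using e0 by (simp add: less_divide_eq)
  qed
  have fp: "(1 - 1 / real q) + 1 / real q * l * K ^ (q - 1) \<le> K"
  proof -
    have "l * K ^ (q - 1) = 1 + real q * e" unfolding l_def K_def using e0 by simp
    then have "1 / real q * l * K ^ (q - 1) = 1 / real q * (1 + real q * e)" by (simp only: mult.assoc)
    also have "\<dots> = 1 / real q + e" using rq by (simp add: field_simps)
    finally show ?thesis unfolding K_def by simp
  qed
  have K1: "1 \<le> K" using e0 by (simp add: K_def)
  have main: "real (card {P \<in> PN A n. \<not> fine A h s P})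
      \<le> real (card (PN A n)) * (2 * (real q * real n + 1)\<^sup>2 * ((1 - t) ^ h / (1 - t\<^sup>2) ^ n + real q * real n * K / l ^ s))"
    if A: "finite A" "card A = q" and t: "0 \<le> t" "t < 1" for A :: "nat set" and n h s :: nat and t :: real
  proof -
    have q1: "1 \<le> q" using q by simp
    let ?Z = "real (card (PN A n))" and ?b = "(real q * real n + 1)\<^sup>2"
    define z where "z = (1 / real q) ^ n * (1 - 1 / real q) ^ ((q - 1) * n)"
    have z0: "0 < z" unfolding z_def using rq by (auto simp: field_simps)
    have Z: "1 \<le> ?b * ?Z * z" using card_PN_ge[OF A q, of n] unfolding z_def by (simp add: add.commute)
    let ?T = "{P \<in> PN A n. \<exists>u\<in>P. length u = h}"
    let ?Fa = "{P \<in> PN A n. \<exists>u\<in>P. \<exists>c\<in>A. s \<le> comp_sz c (sub P u)}"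
    have sub: "{P \<in> PN A n. \<not> fine A h s P} \<subseteq> ?T \<union> ?Fa"
    proof
      fix P assume "P \<in> {P \<in> PN A n. \<not> fine A h s P}"
      then have P: "P \<in> PN A n" "\<not> fine A h s P" by auto
      have qt: "qtree A P" using P by (simp add: PN_def)
      show "P \<in> ?T \<union> ?Fa"
      proof (cases "\<forall>u\<in>P. length u < h")
        case False
        then obtain u where u: "u \<in> P" "h \<le> length u" by force
        have "drop (length u - h) u \<in> P"
          by (rule qtree_suffix[OF qt, of "take (length u - h) u"]) (use u in simp)
        moreover have "length (drop (length u - h) u) = h" using u by simp
        ultimately show ?thesis using P by blast
      next
        case True
        then show ?thesis using P unfolding fine_def by (auto simp: not_less)
      qed
    qed
    have "card {P \<in> PN A n. \<not> fine A h s P} \<le> card (?T \<union> ?Fa)"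
      by (rule card_mono[OF _ sub]) (use finite_PN[OF A(1)] in auto)
    also have "\<dots> \<le> card ?T + card ?Fa" by (rule card_Un_le)
    finally have le: "real (card {P \<in> PN A n. \<not> fine A h s P}) \<le> real (card ?T) + real (card ?Fa)"
      by (simp only: of_nat_add[symmetric] of_nat_le_iff)
    have T: "real (card ?T) \<le> ?Z * (2 * ?b * ((1 - t) ^ h / (1 - t\<^sup>2) ^ n))"
    proof -
      \<comment> \<open>A slightly subcritical law, for which level h has mean size at most (1 - t)
        ^ h. Since 1 / q maximises p * (1 - p) ^ (q - 1), the weight of a tree of size n suffers
        only in second order, by at most 1 - t ^ 2 per node.\<close>
      define p where "p = (1 - t) / real q"
      have p: "0 \<le> p" "p \<le> 1 / 2" using t rq by (auto simp: p_def field_simps)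
      have t2: "0 < 1 - t\<^sup>2" using t by (simp add: abs_square_less_1)
      have one: "1 - p = (1 - 1 / real q) * (1 + t / (real q - 1))"
        using rq by (simp add: p_def field_simps)
      have bern: "1 + t \<le> (1 + t / (real q - 1)) ^ (q - 1)"
      proof -
        have "0 \<le> t / (real q - 1)" using t rq by simp
        then have "- 1 \<le> t / (real q - 1)" by linarith
        from Bernoulli_inequality[OF this, of "q - 1"] show ?thesis using rq q by (simp add: of_nat_diff)
      qed
      have zle: "z * (1 - t\<^sup>2) ^ n \<le> p ^ n * (1 - p) ^ ((q - 1) * n)"
      proof -
        have "p ^ n = (1 / real q) ^ n * (1 - t) ^ n" by (simp add: p_def power_divide)
        moreover have "(1 - p) ^ ((q - 1) * n) = (1 - 1 / real q) ^ ((q - 1) * n) * ((1 + t / (real q - 1)) ^ (q - 1)) ^ n"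
          unfolding one power_mult_distrib by (simp add: power_mult)
        ultimately have "p ^ n * (1 - p) ^ ((q - 1) * n) = z * ((1 - t) * (1 + t / (real q - 1)) ^ (q - 1)) ^ n"
          unfolding z_def power_mult_distrib by (simp only: mult_ac)
        moreover have "(1 - t\<^sup>2) ^ n \<le> ((1 - t) * (1 + t / (real q - 1)) ^ (q - 1)) ^ n"
        proof (rule power_mono)
          have "1 - t\<^sup>2 = (1 - t) * (1 + t)" by (simp add: algebra_simps power2_eq_square)
          also have "\<dots> \<le> (1 - t) * (1 + t / (real q - 1)) ^ (q - 1)" using bern t by (intro mult_left_mono) auto
          finally show "1 - t\<^sup>2 \<le> (1 - t) * (1 + t / (real q - 1)) ^ (q - 1)" .
        qed (use t2 in simp)
        ultimately show ?thesis using z0 by simp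
      qed
      have "real (card ?T) * (z * (1 - t\<^sup>2) ^ n) * (1 / 2) \<le> real (card ?T) * (p ^ n * (1 - p) ^ ((q - 1) * n)) * (1 - p)"
        by (rule mult_mono[OF mult_left_mono[OF zle]]) (use p z0 t2 in auto)
      also have "\<dots> = real (card ?T) * (p ^ n * (1 - p) ^ ((q - 1) * n + 1))" by simp
      also have "\<dots> \<le> (real q * p) ^ h" by (rule tall_bound[OF A q1]) (use p in auto)
      also have "real q * p = 1 - t" using rq by (simp add: p_def)
      finally have 1: "real (card ?T) * z \<le> 2 * ((1 - t) ^ h / (1 - t\<^sup>2) ^ n)"
        using t2 by (simp add: field_simps)
      have "real (card ?T) \<le> real (card ?T) * (?b * ?Z * z)" using Z by (simp add: mult_le_cancel_left1)
      also have "\<dots> = (?b * ?Z) * (real (card ?T) * z)" by (simp only: mult_ac)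
      also have "\<dots> \<le> (?b * ?Z) * (2 * ((1 - t) ^ h / (1 - t\<^sup>2) ^ n))" using 1 by (intro mult_left_mono) auto
      finally show ?thesis by (simp only: mult_ac)
    qed
    have Fa: "real (card ?Fa) \<le> ?Z * (2 * ?b * (real q * real n * K / l ^ s))"
    proof -
      have "real (card ?Fa) * (z * (1 / 2)) * l ^ s \<le> real (card ?Fa) * ((1 / real q) ^ n * (1 - 1 / real q) ^ ((q - 1) * n + 1)) * l ^ s"
      proof (intro mult_right_mono mult_left_mono)
        have "1 / 2 \<le> 1 - 1 / real q" using rq by (simp add: field_simps)
        then have "z * (1 / 2) \<le> z * (1 - 1 / real q)" using z0 by (intro mult_left_mono) auto
        then show "z * (1 / 2) \<le> (1 / real q) ^ n * (1 - 1 / real q) ^ ((q - 1) * n + 1)"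
          unfolding z_def by (simp add: mult_ac)
      qed (use l1 in auto)
      also have "\<dots> \<le> real q * real n * K" by (rule fat_bound[OF A q1 _ K1 fp]) (use l1 in simp)
      finally have 1: "real (card ?Fa) * z \<le> 2 * (real q * real n * K / l ^ s)"
        using l1 by (simp add: field_simps)
      have "real (card ?Fa) \<le> real (card ?Fa) * (?b * ?Z * z)" using Z by (simp add: mult_le_cancel_left1)
      also have "\<dots> = (?b * ?Z) * (real (card ?Fa) * z)" by (simp only: mult_ac)
      also have "\<dots> \<le> (?b * ?Z) * (2 * (real q * real n * K / l ^ s))" using 1 by (intro mult_left_mono) auto
      finally show ?thesis by (simp only: mult_ac)
    qed
    have "?Z * (2 * ?b * ((1 - t) ^ h / (1 - t\<^sup>2) ^ n)) + ?Z * (2 * ?b * (real q * real n * K / l ^ s))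
       = ?Z * (2 * ?b * ((1 - t) ^ h / (1 - t\<^sup>2) ^ n + real q * real n * K / l ^ s))"
      by (simp only: distrib_left)
    then show ?thesis using le T Fa by linarith
  qed
  show ?thesis by (intro exI[of _ l] exI[of _ K] conjI l1 K1 allI impI main)
qed

section \<open>Graphs of order zero\<close>

text \<open>A step consists of a colour-0 edge followed by an edge of colour i, so in a bipartite
  graph rooted at a black vertex all nodes are black. The last step is the first letter, as for the
  words of \<open>qtree\<close>.\<close>

fun walk :: "(nat \<Rightarrow> nat \<Rightarrow> nat) \<Rightarrow> nat \<Rightarrow> nat list \<Rightarrow> nat" where
  "walk \<sigma> r [] = r"
| "walk \<sigma> r (i # w) = \<sigma> i (\<sigma> 0 (walk \<sigma> r w))"

text \<open>In the graph encoded by P a node w carries the colour-0 edge between (w, False) and (w, True). The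
0i-cycle through w runs down the i-chain below w and from its end returns to the top of the chain; rot P i is one step
along it.\<close>
definition rot :: "nat list set \<Rightarrow> nat \<Rightarrow> nat list \<Rightarrow> nat list" where
  "rot P i w = (if i # w \<in> P then i # w else dropWhile ((=) i) w)"

definition lab :: "(nat \<Rightarrow> nat \<Rightarrow> nat) \<Rightarrow> nat \<Rightarrow> nat list \<times> bool \<Rightarrow> nat" where
  "lab \<sigma> r x = (if snd x then \<sigma> 0 (walk \<sigma> r (fst x)) else walk \<sigma> r (fst x))"

text \<open>The tops of the i-chains; each one represents a 0i-cycle.\<close>

definition heads :: "nat list set \<Rightarrow> nat \<Rightarrow> nat list set" where
  "heads P i = {w \<in> P. \<forall>w'. w \<noteq> i # w'}"

lemma dropWhile_in: "qtree A P \<Longrightarrow> w \<in> P \<Longrightarrow> dropWhile Q w \<in> P"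
  by (rule qtree_suffix[of A P "takeWhile Q w"]) simp_all

lemma dropWhile_heads: "qtree A P \<Longrightarrow> w \<in> P \<Longrightarrow> dropWhile ((=) i) w \<in> heads P i"
  unfolding heads_def
proof (intro CollectI conjI allI notI)
  fix w' assume eq: "dropWhile ((=) i) w = i # w'"
  then show False using hd_dropWhile[of "(=) i" w] by simp
qed (rule dropWhile_in)

text \<open>Every node other than the root fails to be a head for exactly one colour, namely its
  first letter.\<close>

lemma sum_card_heads:
  assumes "finite A" "qtree A P" "card P = n" "n \<ge> 1"
  shows "(\<Sum>i\<in>A. card (heads P i)) + n = card A * n + 1"
proof -
  let ?H = "\<lambda>i. {w \<in> P. \<exists>w'. w = i # w'}"
  have fP: "finite P" using assms(2) by (simp add: qtree_def)
  have ne: "[] \<in> P" using qtree_Nil[OF assms(2)] assms(3,4) by fastforce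
  have "card (heads P i) + card (?H i) = n" for i
  proof -
    have "card (heads P i \<union> ?H i) = card (heads P i) + card (?H i)"
      by (rule card_Un_disjoint) (use fP in \<open>auto simp: heads_def\<close>)
    moreover have "heads P i \<union> ?H i = P" by (auto simp: heads_def)
    ultimately show ?thesis using assms(3) by simp
  qed
  then have 1: "(\<Sum>i\<in>A. card (heads P i)) + (\<Sum>i\<in>A. card (?H i)) = card A * n"
    by (simp add: sum.distrib[symmetric])
  have "(\<Sum>i\<in>A. card (?H i)) = card (\<Union>i\<in>A. ?H i)"
    by (rule card_UN_disjoint[symmetric]) (use assms(1) fP in auto)
  also have "(\<Union>i\<in>A. ?H i) = P - {[]}"
  proof (intro equalityI subsetI)
    fix w assume w: "w \<in> P - {[]}"
    then obtain i w' where "w = i # w'" by (cases w) auto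
    moreover then have "i \<in> A" using w assms(2) by (auto simp: qtree_def)
    ultimately show "w \<in> (\<Union>i\<in>A. ?H i)" using w by auto
  qed auto
  also have "card (P - {[]}) = n - 1" using ne fP assms(3) by simp
  finally show ?thesis using 1 assms(4) by simp
qed

lemma order0_tree:
  assumes cg: "coloured_graph q (2 * n) \<sigma>" and F: "F0 q (2 * n) \<sigma> = (q - 1) * n + 1" and q: "1 \<le> q"
  shows "tree {..<2 * n} \<sigma> {1..q}"
proof -
  let ?V = "{..<2 * n}"
  have inv: "inv_on \<sigma> {..q} ?V" by (rule coloured_graph_inv[OF cg])
  have I: "insert 0 {1..q} = {..q}" by auto
  have g: "gem ?V \<sigma> {1..q}" unfolding gem_def I using inv by auto
  have "(\<Sum>i\<in>{1..q}. card (cls \<sigma> {0, i} ?V)) = F0 q (2 * n) \<sigma>"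
    unfolding F0_def
  proof (rule sum.cong[OF refl])
    fix i assume "i \<in> {1..q}"
    then have "inv_on \<sigma> {0, i} ?V" by (intro inv_on_mono[OF inv]) auto
    then show "card (cls \<sigma> {0, i} ?V) = card (residues \<sigma> (2 * n) {0, i})" by (simp add: residues_eq_cls)
  qed
  moreover have "2 * n + 2 * ((q - 1) * n + 1) = 2 + q * (2 * n)"
  proof -
    have "n + (q - 1) * n = q * n" using q by (cases q) auto
    then show ?thesis by simp
  qed
  ultimately have eq: "card ?V + 2 * (\<Sum>i\<in>{1..q}. card (cls \<sigma> {0, i} ?V)) = 2 + card {1..q} * card ?V"
    using F by simp
  have "0 \<in> ?V" using cg by (simp add: coloured_graph_def)
  then have "?V \<noteq> {}" by blast
  then show ?thesis unfolding tree_def I using g eq coloured_graph_conn[OF cg] by blast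
qed

text \<open>\<open>P\<close> is a largest tree whose nodes reach different vertices. Maximality
  makes the visited vertices closed under all steps, so every black vertex is visited. The heads
  represent all 0i-cycles, and order zero makes their number equal to the number of cycles. Hence
  different heads lie on different cycles, which pins down where a step leaving \<open>P\<close>
  arrives.\<close>

lemma order0_encoding:
  assumes cg: "coloured_graph q (2 * n) \<sigma>" and F: "F0 q (2 * n) \<sigma> = (q - 1) * n + 1" and q: "1 \<le> q"
    and A: "A = {1..q}"
  shows "\<exists>P\<in>PN A n. bij_betw (lab \<sigma> 0) (P \<times> UNIV) {..<2 * n} \<and>
     (\<forall>w\<in>P. \<forall>i\<in>A. walk \<sigma> 0 (i # w) = walk \<sigma> 0 (rot P i w)) \<and> (\<forall>i\<in>A. rot P i ` P = P)"
proof -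
  let ?V = "{..<2 * n}" and ?W = "walk \<sigma> 0"
  have tr: "tree ?V \<sigma> A" unfolding A by (rule order0_tree[OF cg F q])
  have inv: "inv_on \<sigma> {..q} ?V" by (rule coloured_graph_inv[OF cg])
  have invA: "inv_on \<sigma> (insert 0 A) ?V" by (rule inv_on_mono[OF inv]) (auto simp: A)
  have n1: "n \<ge> 1" using cg by (simp add: coloured_graph_def)
  have finA: "finite A" "card A = q" "0 \<notin> A" by (auto simp: A)
  obtain bl :: "nat \<Rightarrow> bool" where bl: "\<And>c v. c \<in> insert 0 A \<Longrightarrow> v \<in> ?V \<Longrightarrow> bl (\<sigma> c v) \<noteq> bl v"
    using tree_bipartite[OF tr] by metis
  have s0: "\<sigma> 0 v \<in> ?V" "\<sigma> 0 (\<sigma> 0 v) = v" if "v \<in> ?V" for v using inv_onD[OF invA _ that] by auto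
  have si: "\<sigma> i v \<in> ?V" "\<sigma> i (\<sigma> i v) = v" if "v \<in> ?V" "i \<in> A" for v i using inv_onD[OF invA _ that(1)] that(2) by auto
  have WV: "?W w \<in> ?V" if "set w \<subseteq> A" for w
    using that
  proof (induction w)
    case Nil then show ?case using n1 by simp
  next
    case (Cons i w)
    then show ?case using s0(1)[of "?W w"] si(1)[of "\<sigma> 0 (?W w)" i] by simp
  qed
  have blW: "bl (?W w) = bl 0" if "set w \<subseteq> A" for w
    using that
  proof (induction w)
    case (Cons i w)
    then have w: "?W w \<in> ?V" "i \<in> A" using WV by auto
    show ?case using bl[of i "\<sigma> 0 (?W w)"] bl[of 0 "?W w"] s0(1)[OF w(1)] w Cons by auto
  qed simp
  define good where "good P \<longleftrightarrow> qtree A P \<and> inj_on ?W P" for P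
  have bound: "card P \<le> 2 * n" if "good P" for P
  proof -
    have "?W ` P \<subseteq> ?V" using that WV unfolding good_def qtree_def by blast
    then have "card (?W ` P) \<le> card ?V" by (intro card_mono) auto
    then show ?thesis using that by (simp add: good_def card_image)
  qed
  have "good {[]}" by (auto simp: good_def qtree_def)
  then obtain P where P: "good P" "\<And>P'. good P' \<Longrightarrow> card P' \<le> card P"
    using ex_has_greatest_nat[of good "{[]}" card "Suc (2 * n)"] bound by (auto simp: less_Suc_eq_le)
  have qt: "qtree A P" and inj: "inj_on ?W P" using P(1) by (auto simp: good_def)
  have fP: "finite P" and setP: "\<And>w. w \<in> P \<Longrightarrow> set w \<subseteq> A" using qt by (auto simp: qtree_def)
  have PV: "?W w \<in> ?V" if "w \<in> P" for w using WV setP[OF that] by blast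
  have ne: "[] \<in> P"
  proof -
    have "P \<noteq> {}" using P(2)[OF \<open>good {[]}\<close>] by auto
    then show ?thesis by (rule qtree_Nil[OF qt])
  qed
  let ?B = "?W ` P"
  have closed: "\<sigma> i (\<sigma> 0 v) \<in> ?B" if vB: "v \<in> ?B" and iA: "i \<in> A" for v i
  proof (rule ccontr)
    assume no: "\<sigma> i (\<sigma> 0 v) \<notin> ?B"
    obtain w where w: "w \<in> P" "v = ?W w" using vB by blast
    have niw: "i # w \<notin> P" using no w by (metis imageI walk.simps(2))
    have "good (insert (i # w) P)"
      unfolding good_def
    proof
      show "qtree A (insert (i # w) P)" unfolding qtree_def using qt w iA setP by (auto simp: qtree_def)
      show "inj_on ?W (insert (i # w) P)" using inj no w niw by (auto simp: inj_on_insert)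
    qed
    from P(2)[OF this] niw fP show False by simp
  qed
  have BV: "?B \<subseteq> ?V" using PV by blast
  have onto: "(\<lambda>v. \<sigma> i (\<sigma> 0 v)) ` ?B = ?B" if i: "i \<in> A" for i
  proof (rule endo_inj_surj)
    show "finite ?B" using fP by simp
    show "(\<lambda>v. \<sigma> i (\<sigma> 0 v)) ` ?B \<subseteq> ?B" using closed i by auto
    show "inj_on (\<lambda>v. \<sigma> i (\<sigma> 0 v)) ?B"
    proof (rule inj_onI)
      fix u v assume u: "u \<in> ?B" and v: "v \<in> ?B" and eq: "\<sigma> i (\<sigma> 0 u) = \<sigma> i (\<sigma> 0 v)"
      have uV: "u \<in> ?V" and vV: "v \<in> ?V" using u v BV by blast+
      have "\<sigma> 0 u = \<sigma> 0 v" using eq si(2)[OF s0(1)[OF uV] i] si(2)[OF s0(1)[OF vV] i] by metis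
      then show "u = v" using s0(2)[OF uV] s0(2)[OF vV] by metis
    qed
  qed
  let ?Vis = "?B \<union> \<sigma> 0 ` ?B"
  have "orb \<sigma> {..q} 0 \<subseteq> ?Vis"
  proof (rule orb_subset)
    show "0 \<in> ?Vis" using ne by force
    fix u c assume u: "u \<in> ?Vis" and c: "c \<in> {..q}"
    show "\<sigma> c u \<in> ?Vis"
    proof (cases "c = 0")
      case True
      from u show ?thesis
      proof
        assume "u \<in> \<sigma> 0 ` ?B"
        then obtain v where "v \<in> ?B" "u = \<sigma> 0 v" by blast
        then show ?thesis using True s0(2)[of v] BV by auto
      qed (use True in auto)
    next
      case False
      then have cA: "c \<in> A" using c by (auto simp: A)
      from u show ?thesis
      proof
        assume "u \<in> ?B"
        then obtain v where v: "v \<in> ?B" "u = \<sigma> c (\<sigma> 0 v)" using onto[OF cA] by blast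
        have "v \<in> ?V" using v BV by blast
        then have "\<sigma> c u = \<sigma> 0 v" using v(2) si(2)[OF s0(1) cA] by simp
        then show ?thesis using v by auto
      next
        assume "u \<in> \<sigma> 0 ` ?B"
        then show ?thesis using closed[OF _ cA] by auto
      qed
    qed
  qed
  moreover have "orb \<sigma> {..q} 0 = ?V" using coloured_graph_conn[OF cg, of 0] n1 by simp
  ultimately have Vis: "?Vis = ?V" using BV s0(1) by blast
  \<comment> \<open>A step uses two edges and so preserves the bipartition: visited vertices have
    the colour of the root, their colour-0 neighbours the other one.\<close>
  have dis: "?B \<inter> \<sigma> 0 ` ?B = {}"
  proof -
    have "bl v = bl 0" if "v \<in> ?B" for v using that blW setP by auto
    moreover have "bl v \<noteq> bl 0" if "v \<in> \<sigma> 0 ` ?B" for v using that bl[of 0] blW setP BV by auto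
    ultimately show ?thesis by blast
  qed
  have inj0: "inj_on (\<sigma> 0) ?B" by (rule inj_on_inverseI[of _ "\<sigma> 0"]) (use s0(2) BV in blast)
  have "card ?V = card ?B + card (\<sigma> 0 ` ?B)" unfolding Vis[symmetric] by (rule card_Un_disjoint) (use fP dis in auto)
  then have cP: "card P = n" using card_image[OF inj] card_image[OF inj0] by simp
  have PN: "P \<in> PN A n" using qt cP by (simp add: PN_def)
  have bij: "bij_betw (lab \<sigma> 0) (P \<times> UNIV) ?V"
  proof (rule bij_betw_imageI)
    show "lab \<sigma> 0 ` (P \<times> UNIV) = ?V"
    proof -
      have "P \<times> (UNIV :: bool set) = P \<times> {False} \<union> P \<times> {True}" by auto
      then have "lab \<sigma> 0 ` (P \<times> UNIV) = lab \<sigma> 0 ` (P \<times> {False}) \<union> lab \<sigma> 0 ` (P \<times> {True})" by (simp only: image_Un)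
      also have "P \<times> {False} = (\<lambda>w. (w, False)) ` P" by auto
      also have "P \<times> {True} = (\<lambda>w. (w, True)) ` P" by auto
      also have "lab \<sigma> 0 ` (\<lambda>w. (w, False)) ` P = ?B" by (simp only: image_image lab_def fst_conv snd_conv if_False)
      also have "lab \<sigma> 0 ` (\<lambda>w. (w, True)) ` P = \<sigma> 0 ` ?B" by (simp only: image_image lab_def fst_conv snd_conv if_True)
      finally show ?thesis using Vis by simp
    qed
    show "inj_on (lab \<sigma> 0) (P \<times> UNIV)"
    proof (rule inj_onI)
      fix a b assume ab: "a \<in> P \<times> UNIV" "b \<in> P \<times> UNIV" "lab \<sigma> 0 a = lab \<sigma> 0 b"
      have m: "fst a \<in> P" "fst b \<in> P" using ab by auto
      have "snd a = snd b"
        using ab(3) m dis unfolding lab_def by (auto split: if_splits)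
      moreover have "?W (fst a) = ?W (fst b)"
        using ab(3) calculation s0(2)[OF PV[OF m(1)]] s0(2)[OF PV[OF m(2)]] unfolding lab_def by metis
      then have "fst a = fst b" using inj m by (auto simp: inj_on_def)
      ultimately show "a = b" by (simp add: prod_eq_iff)
    qed
  qed
  have inv0: "inv_on \<sigma> {0, i} ?V" if "i \<in> A" for i by (rule inv_on_mono[OF invA]) (use that in auto)
  have run: "orb \<sigma> {0, i} (?W (dropWhile ((=) i) w)) = orb \<sigma> {0, i} (?W w)" if "i \<in> A" "set w \<subseteq> A" for i w
    using that(2)
  proof (induction w)
    case (Cons j w)
    show ?case
    proof (cases "i = j")
      case True
      have w: "?W w \<in> ?V" using WV Cons by simp
      have "\<sigma> 0 (?W w) \<in> orb \<sigma> {0, i} (?W w)" by (rule orb_step) auto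
      then have "\<sigma> i (\<sigma> 0 (?W w)) \<in> orb \<sigma> {0, i} (?W w)" by (rule orb_step) auto
      then have "orb \<sigma> {0, i} (\<sigma> i (\<sigma> 0 (?W w))) = orb \<sigma> {0, i} (?W w)"
        by (rule orb_eq[OF inv0[OF that(1)] w])
      then have "orb \<sigma> {0, i} (?W (j # w)) = orb \<sigma> {0, i} (?W w)" using True by simp
      then show ?thesis using Cons True by simp
    qed simp
  qed simp
  let ?k = "\<lambda>i w. orb \<sigma> {0, i} (?W w)"
  have kimg: "?k i ` heads P i = cls \<sigma> {0, i} ?V" if i: "i \<in> A" for i
  proof
    show "?k i ` heads P i \<subseteq> cls \<sigma> {0, i} ?V" unfolding cls_def heads_def using PV by auto
    show "cls \<sigma> {0, i} ?V \<subseteq> ?k i ` heads P i"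
    proof
      fix X assume "X \<in> cls \<sigma> {0, i} ?V"
      then obtain v where v: "v \<in> ?V" "X = orb \<sigma> {0, i} v" by (auto simp: cls_def)
      have "\<exists>w\<in>P. X = ?k i w"
      proof -
        have "v \<in> ?B \<or> v \<in> \<sigma> 0 ` ?B" using v(1) Vis by blast
        then show ?thesis
        proof
          assume "v \<in> ?B" then show ?thesis using v by auto
        next
          assume "v \<in> \<sigma> 0 ` ?B"
          then obtain w where w: "w \<in> P" "v = \<sigma> 0 (?W w)" by auto
          have "v \<in> orb \<sigma> {0, i} (?W w)" unfolding w(2) by (rule orb_step) auto
          then have "orb \<sigma> {0, i} v = ?k i w" by (rule orb_eq[OF inv0[OF i] PV[OF w(1)]])
          then show ?thesis using v w by blast
        qed
      qed
      then obtain w where w: "w \<in> P" "X = ?k i w" by blast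
      then have "X = ?k i (dropWhile ((=) i) w)" using run[OF i setP[OF w(1)]] by simp
      then show "X \<in> ?k i ` heads P i" using dropWhile_heads[OF qt w(1)] by blast
    qed
  qed
  have fH: "finite (heads P i)" for i using fP by (simp add: heads_def)
  have le: "card (cls \<sigma> {0, i} ?V) \<le> card (heads P i)" if "i \<in> A" for i
    using card_image_le[OF fH, of "?k i" i] kimg[OF that] by simp
  \<comment> \<open>Equal totals, together with a surjection for each colour, force equality colour
    by colour.\<close>
  have "(\<Sum>i\<in>A. card (cls \<sigma> {0, i} ?V)) = (\<Sum>i\<in>A. card (heads P i))"
  proof -
    have "card ?V + 2 * (\<Sum>i\<in>A. card (cls \<sigma> {0, i} ?V)) = 2 + card A * card ?V" using tr by (simp add: tree_def)
    moreover have "(\<Sum>i\<in>A. card (heads P i)) + n = card A * n + 1" by (rule sum_card_heads[OF finA(1) qt cP n1])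
    ultimately show ?thesis by simp
  qed
  then have eqc: "card (cls \<sigma> {0, i} ?V) = card (heads P i)" if "i \<in> A" for i
    using sum_mono_inv[of "\<lambda>i. card (cls \<sigma> {0, i} ?V)" A "\<lambda>i. card (heads P i)" i] le that finA(1) by blast
  have injk: "inj_on (?k i) (heads P i)" if "i \<in> A" for i
    by (rule eq_card_imp_inj_on[OF fH]) (use eqc[OF that] kimg[OF that] in simp)
  \<comment> \<open>The endpoint is some visited \<open>z\<close>. If \<open>z\<close> began with i,
    injectivity would put \<open>i # w\<close> into \<open>P\<close>. So \<open>z\<close> is a head,
    on the same cycle as the top of the chain of \<open>w\<close>.\<close>
  have strip: "?W (i # w) = ?W (dropWhile ((=) i) w)" if w: "w \<in> P" and i: "i \<in> A" and niw: "i # w \<notin> P" for w i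
  proof -
    have "?W (i # w) \<in> ?B" using closed[OF imageI[OF w] i] by simp
    then obtain z where z: "z \<in> P" "?W (i # w) = ?W z" by blast
    have zh: "z \<in> heads P i"
      unfolding heads_def
    proof (intro CollectI conjI allI notI)
      show "z \<in> P" by (rule z)
      fix z' assume z': "z = i # z'"
      then have zP: "z' \<in> P" using z(1) qt by (auto simp: qtree_def)
      have "\<sigma> i (\<sigma> 0 (?W w)) = \<sigma> i (\<sigma> 0 (?W z'))" using z z' by simp
      then have "\<sigma> 0 (?W w) = \<sigma> 0 (?W z')" using si(2)[OF s0(1)[OF PV[OF w]] i] si(2)[OF s0(1)[OF PV[OF zP]] i] by metis
      then have "?W w = ?W z'" using s0(2)[OF PV[OF w]] s0(2)[OF PV[OF zP]] by metis
      then have "w = z'" using inj w zP by (auto simp: inj_on_def)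
      then show False using niw z' z(1) by simp
    qed
    have "?k i z = ?k i (i # w)" using z by simp
    also have "\<dots> = ?k i (dropWhile ((=) i) (i # w))" by (rule run[OF i, symmetric]) (use setP[OF w] i in auto)
    also have "\<dots> = ?k i (dropWhile ((=) i) w)" by simp
    finally have "z = dropWhile ((=) i) w"
      using injk[OF i] zh dropWhile_heads[OF qt w, of i] by (auto simp: inj_on_def)
    then show ?thesis using z by simp
  qed
  have rotW: "?W (i # w) = ?W (rot P i w)" if "w \<in> P" "i \<in> A" for w i
    using strip[OF that] unfolding rot_def by auto
  have "rot P i ` P = P" if i: "i \<in> A" for i
  proof -
    have rP: "rot P i w \<in> P" if "w \<in> P" for w using that dropWhile_in[OF qt that] by (auto simp: rot_def)
    have "?W ` (rot P i ` P) = (\<lambda>v. \<sigma> i (\<sigma> 0 v)) ` ?B"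
      unfolding image_image by (rule image_cong[OF refl]) (use rotW[OF _ i] in auto)
    then have "?W ` (rot P i ` P) = ?W ` P" using onto[OF i] by simp
    then show ?thesis using inj_on_image_eq_iff[OF inj, of "rot P i ` P" P] rP by blast
  qed
  then show ?thesis using PN bij rotW by blast
qed

section \<open>From labelled trees back to graphs\<close>

definition bld :: "nat \<Rightarrow> nat \<Rightarrow> nat list set \<Rightarrow> (nat list \<times> bool \<Rightarrow> nat) \<Rightarrow> nat \<Rightarrow> nat \<Rightarrow> nat" where
  "bld q N P g c v = (if c \<le> q \<and> v < N then
     (let w = fst (inv_into (P \<times> UNIV) g v); b = snd (inv_into (P \<times> UNIV) g v) in
      if c = 0 then g (w, \<not> b) else if b then g (rot P c w, False)
      else g (inv_into P (rot P c) w, True)) else v)"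

lemma rot_in: "qtree A P \<Longrightarrow> w \<in> P \<Longrightarrow> rot P i w \<in> P"
  unfolding rot_def using dropWhile_in by auto

text \<open>\<open>rot\<close> permutes each i-chain cyclically. The point is that a chain has only
  one bottom: a longer word of the chain of \<open>w\<close> would have \<open>i # w\<close> as a
  suffix, and trees are closed under suffixes.\<close>

lemma rot_bij:
  assumes "qtree A P"
  shows "bij_betw (rot P i) P P"
proof -
  have fin: "finite P" using assms by (simp add: qtree_def)
  have key: "w = w'" if w: "w \<in> P" "i # w \<notin> P" and w': "w' \<in> P" and eq: "dropWhile ((=) i) w = dropWhile ((=) i) w'"
    and le: "length w \<le> length w'" for w w'
  proof -
    let ?t = "takeWhile ((=) i) w" and ?t' = "takeWhile ((=) i) w'" and ?d = "dropWhile ((=) i) w"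
    have rep: "takeWhile ((=) i) u = replicate (length (takeWhile ((=) i) u)) i" for u :: "nat list"
      by (induction u) auto
    have "length ?t + length ?d = length w" "length ?t' + length ?d = length w'"
      using eq by (metis length_append takeWhile_dropWhile_id)+
    then have tl: "length ?t \<le> length ?t'" using le by linarith
    show ?thesis
    proof (cases "length ?t = length ?t'")
      case True
      then have "?t = ?t'" using rep by metis
      then show ?thesis using eq by (metis takeWhile_dropWhile_id)
    next
      case False
      define k where "k = length ?t' - Suc (length ?t)"
      have "length ?t' = k + Suc (length ?t)" using False tl by (simp add: k_def)
      then have "?t' = replicate k i @ i # ?t" using rep[of w'] rep[of w] by (metis replicate_Suc replicate_add)
      then have "w' = replicate k i @ (i # w)" using eq by (metis append_Cons append_assoc takeWhile_dropWhile_id)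
      then have "i # w \<in> P" using qtree_suffix[OF assms] w' by metis
      then show ?thesis using w by blast
    qed
  qed
  have hd: "dropWhile ((=) i) w \<noteq> i # w'" for w w' :: "nat list"
    using hd_dropWhile[of "(=) i" w] by fastforce
  have inj: "inj_on (rot P i) P"
  proof (rule inj_onI)
    fix w w' assume w: "w \<in> P" "w' \<in> P" and eq: "rot P i w = rot P i w'"
    show "w = w'"
    proof (cases "i # w \<in> P")
      case True
      then show ?thesis using eq hd[of w' w] unfolding rot_def by (metis list.inject)
    next
      case False
      then have n': "i # w' \<notin> P" using eq hd[of w w'] unfolding rot_def by (auto split: if_splits)
      then have d: "dropWhile ((=) i) w = dropWhile ((=) i) w'" using eq False unfolding rot_def by simp
      show ?thesis
        using key[OF w(1) False w(2) d] key[OF w(2) n' w(1) d[symmetric]] by (metis nle_le)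
    qed
  qed
  moreover have "rot P i ` P = P" by (rule endo_inj_surj[OF fin _ inj]) (use rot_in[OF assms] in auto)
  ultimately show ?thesis by (simp add: bij_betw_def)
qed

lemma dropWhile_rot: "dropWhile ((=) i) (rot P i w) = dropWhile ((=) i) w"
  unfolding rot_def by (simp add: dropWhile_idem)

locale build =
  fixes q n :: nat and A :: "nat set" and P :: "nat list set" and g :: "nat list \<times> bool \<Rightarrow> nat"
  assumes A_def: "A = {1..q}" and q1: "1 \<le> q" and n1: "1 \<le> n" and PN: "P \<in> PN A n"
    and bij: "bij_betw g (P \<times> UNIV) {..<2 * n}"
begin

abbreviation "\<sigma> \<equiv> bld q (2 * n) P g"
abbreviation "V \<equiv> {..<2 * n}"

lemma qt: "qtree A P" and cP: "card P = n" using PN by (auto simp: PN_def)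

lemma Nil_P: "[] \<in> P"
proof -
  have "P \<noteq> {}" using cP n1 by auto
  then show ?thesis by (rule qtree_Nil[OF qt])
qed

lemma gV: "w \<in> P \<Longrightarrow> g (w, b) \<in> V" using bij by (auto simp: bij_betw_def)

lemma g_inj: "w \<in> P \<Longrightarrow> w' \<in> P \<Longrightarrow> g (w, b) = g (w', b') \<longleftrightarrow> w = w' \<and> b = b'"
  using bij by (auto simp: bij_betw_def inj_on_def)

lemma g_inv: "w \<in> P \<Longrightarrow> inv_into (P \<times> UNIV) g (g (w, b)) = (w, b)"
  using bij by (auto simp: bij_betw_def intro: inv_into_f_f)

lemma V_cases:
  assumes "v \<in> V"
  obtains w b where "w \<in> P" "v = g (w, b)"
  using assms bij unfolding bij_betw_def by blast

lemma s0: "w \<in> P \<Longrightarrow> \<sigma> 0 (g (w, b)) = g (w, \<not> b)"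
  using gV[of w b] g_inv[of w b] by (simp add: bld_def)

lemma iA: "i \<in> A \<longleftrightarrow> i \<noteq> 0 \<and> i \<le> q" by (auto simp: A_def)

lemma siT: "w \<in> P \<Longrightarrow> i \<in> A \<Longrightarrow> \<sigma> i (g (w, True)) = g (rot P i w, False)"
  using gV[of w True] g_inv[of w True] by (simp add: bld_def iA)

lemma siF: "w \<in> P \<Longrightarrow> i \<in> A \<Longrightarrow> \<sigma> i (g (w, False)) = g (inv_into P (rot P i) w, True)"
  using gV[of w False] g_inv[of w False] by (simp add: bld_def iA)

lemma rot_inv: "w \<in> P \<Longrightarrow> inv_into P (rot P i) w \<in> P \<and> rot P i (inv_into P (rot P i) w) = w"
  using rot_bij[OF qt, of i] by (metis bij_betw_def f_inv_into_f inv_into_into)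

lemma inv_rot: "w \<in> P \<Longrightarrow> inv_into P (rot P i) (rot P i w) = w"
  using rot_bij[OF qt, of i] by (simp add: bij_betw_def)

lemma inv: "inv_on \<sigma> {..q} V"
  unfolding inv_on_def
proof (intro ballI)
  fix c v assume c: "c \<in> {..q}" and v: "v \<in> V"
  obtain w b where w: "w \<in> P" "v = g (w, b)" by (rule V_cases[OF v])
  show "\<sigma> c v \<in> V \<and> \<sigma> c (\<sigma> c v) = v \<and> \<sigma> c v \<noteq> v"
  proof (cases "c = 0")
    case True
    then show ?thesis using w s0 gV[OF w(1)] g_inj by auto
  next
    case False
    then have i: "c \<in> A" using c iA by auto
    show ?thesis
    proof (cases b)
      case True
      have r: "rot P c w \<in> P" by (rule rot_in[OF qt w(1)])
      have "\<sigma> c v = g (rot P c w, False)" using siT[OF w(1) i] w True by simp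
      moreover have "\<sigma> c (g (rot P c w, False)) = v" using siF[OF r i] inv_rot[OF w(1)] w True by simp
      ultimately show ?thesis using gV[OF r] g_inj[OF r w(1)] w True by auto
    next
      case b: False
      have r: "inv_into P (rot P c) w \<in> P" "rot P c (inv_into P (rot P c) w) = w" using rot_inv[OF w(1)] by auto
      have "\<sigma> c v = g (inv_into P (rot P c) w, True)" using siF[OF w(1) i] w b by simp
      moreover have "\<sigma> c (g (inv_into P (rot P c) w, True)) = v" using siT[OF r(1) i] r(2) w b by simp
      ultimately show ?thesis using gV[OF r(1)] g_inj[OF r(1) w(1)] w b by auto
    qed
  qed
qed

lemma conn: "orb \<sigma> {..q} 0 = V"
proof -
  let ?r = "g ([], False)"
  have rV: "?r \<in> V" by (rule gV[OF Nil_P])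
  have F: "g (w, False) \<in> orb \<sigma> {..q} ?r" if "w \<in> P" for w
    using that
  proof (induction w)
    case (Cons i w)
    have w: "w \<in> P" and i: "i \<in> A" using Cons.prems qt by (auto simp: qtree_def)
    have "\<sigma> 0 (g (w, False)) \<in> orb \<sigma> {..q} ?r" by (rule orb_step[OF Cons.IH[OF w]]) simp
    then have "\<sigma> i (g (w, True)) \<in> orb \<sigma> {..q} ?r" using s0[OF w] i by (intro orb_step) (auto simp: iA)
    then show ?case using siT[OF w i] Cons.prems by (simp add: rot_def)
  qed simp
  have "V \<subseteq> orb \<sigma> {..q} ?r"
  proof
    fix v assume "v \<in> V"
    then obtain w b where w: "w \<in> P" "v = g (w, b)" by (rule V_cases)
    have "\<sigma> 0 (g (w, False)) \<in> orb \<sigma> {..q} ?r" by (rule orb_step[OF F[OF w(1)]]) simp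
    then show "v \<in> orb \<sigma> {..q} ?r" using F[OF w(1)] s0[OF w(1)] w by (cases b) auto
  qed
  then have r: "orb \<sigma> {..q} ?r = V" using orb_in[OF inv rV] by blast
  show ?thesis using orb_eq[OF inv rV, of 0] r n1 by simp
qed

lemma coloured: "coloured_graph q (2 * n) \<sigma>"
  unfolding coloured_graph_def
proof (intro conjI allI impI)
  show "1 \<le> 2 * n" using n1 by simp
  show "\<sigma> c v = v" if "q < c \<or> 2 * n \<le> v" for c v using that by (auto simp: bld_def)
  show "\<sigma> c v < 2 * n" "\<sigma> c v \<noteq> v" "\<sigma> c (\<sigma> c v) = v" if "c \<le> q" "v < 2 * n" for c v
    using inv_onD[OF inv, of c v] that by auto
  show "residue \<sigma> (2 * n) {..q} 0 = {..<2 * n}" using residue_eq_orb[OF inv, of 0] n1 conn by simp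
qed

text \<open>The top of the i-chain is constant along a 0i-cycle, and every vertex is joined to the
  top of its chain by the colours 0 and i.\<close>

lemma card_cls_heads:
  assumes i: "i \<in> A"
  shows "card (cls \<sigma> {0, i} V) = card (heads P i)"
proof -
  let ?k = "\<lambda>w. orb \<sigma> {0, i} (g (w, False))"
  have inv0: "inv_on \<sigma> {0, i} V" by (rule inv_on_mono[OF inv]) (use i in \<open>auto simp: iA\<close>)
  have hP: "w \<in> P" if "w \<in> heads P i" for w using that by (simp add: heads_def)
  have TF: "orb \<sigma> {0, i} (g (w, True)) = ?k w" if "w \<in> P" for w
  proof (rule orb_eq[OF inv0 gV[OF that]])
    have "\<sigma> 0 (g (w, False)) \<in> ?k w" by (rule orb_step) auto
    then show "g (w, True) \<in> ?k w" using s0[OF that] by simp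
  qed
  have down: "?k w = ?k (dropWhile ((=) i) w)" if "w \<in> P" for w
    using that
  proof (induction w)
    case (Cons j w)
    have w: "w \<in> P" using Cons.prems qt by (auto simp: qtree_def)
    show ?case
    proof (cases "i = j")
      case True
      have "\<sigma> i (g (w, True)) \<in> orb \<sigma> {0, i} (g (w, True))" by (rule orb_step) auto
      then have "g (j # w, False) \<in> ?k w" using siT[OF w i] Cons.prems True TF[OF w] by (simp add: rot_def)
      then have "?k (j # w) = ?k w" by (rule orb_eq[OF inv0 gV[OF w]])
      then show ?thesis using Cons.IH[OF w] True by simp
    qed simp
  qed simp
  have img: "?k ` heads P i = cls \<sigma> {0, i} V"
  proof
    show "?k ` heads P i \<subseteq> cls \<sigma> {0, i} V" unfolding cls_def using gV hP by blast
    show "cls \<sigma> {0, i} V \<subseteq> ?k ` heads P i"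
    proof
      fix X assume "X \<in> cls \<sigma> {0, i} V"
      then obtain v where v: "v \<in> V" "X = orb \<sigma> {0, i} v" by (auto simp: cls_def)
      obtain w b where w: "w \<in> P" "v = g (w, b)" by (rule V_cases[OF v(1)])
      have "X = ?k w" using v(2) w TF[OF w(1)] by (cases b) auto
      then have "X = ?k (dropWhile ((=) i) w)" using down[OF w(1)] by simp
      then show "X \<in> ?k ` heads P i" using dropWhile_heads[OF qt w(1)] by blast
    qed
  qed
  have sub: "?k d \<subseteq> {g (w, b) | w b. w \<in> P \<and> dropWhile ((=) i) w = dropWhile ((=) i) d}" (is "_ \<subseteq> ?S d") if "d \<in> P" for d
  proof (rule orb_subset)
    show "g (d, False) \<in> ?S d" using that by blast
    fix u c assume "u \<in> ?S d" and c: "c \<in> {0, i}"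
    then obtain w b where w: "u = g (w, b)" "w \<in> P" "dropWhile ((=) i) w = dropWhile ((=) i) d" by blast
    show "\<sigma> c u \<in> ?S d"
    proof (cases "c = 0")
      case True
      then have "\<sigma> c u = g (w, \<not> b)" using s0[OF w(2)] w(1) by simp
      then show ?thesis using w by blast
    next
      case False
      then have ci: "c = i" using c by simp
      show ?thesis
      proof (cases b)
        case True
        then have "\<sigma> c u = g (rot P i w, False)" using siT[OF w(2) i] w(1) ci by simp
        then show ?thesis using rot_in[OF qt w(2)] dropWhile_rot w(3) by auto
      next
        case b: False
        have r: "inv_into P (rot P i) w \<in> P" "rot P i (inv_into P (rot P i) w) = w" using rot_inv[OF w(2)] by auto
        have "\<sigma> c u = g (inv_into P (rot P i) w, True)" using siF[OF w(2) i] w(1) ci b by simp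
        moreover have "dropWhile ((=) i) (inv_into P (rot P i) w) = dropWhile ((=) i) w"
          using dropWhile_rot[of i P "inv_into P (rot P i) w"] r(2) by simp
        ultimately show ?thesis using r(1) w(3) by auto
      qed
    qed
  qed
  have hid: "dropWhile ((=) i) w = w" if "w \<in> heads P i" for w
    using that by (cases w) (auto simp: heads_def)
  have "inj_on ?k (heads P i)"
  proof (rule inj_onI)
    fix d d' assume d: "d \<in> heads P i" "d' \<in> heads P i" and eq: "?k d = ?k d'"
    have "g (d, False) \<in> ?k d'" using eq orb_self[of "g (d, False)" \<sigma> "{0, i}"] by simp
    then obtain w b where w: "g (d, False) = g (w, b)" "w \<in> P" "dropWhile ((=) i) w = dropWhile ((=) i) d'"
      using sub[OF hP[OF d(2)]] by blast
    then have "w = d" using g_inj[OF hP[OF d(1)] w(2)] by blast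
    then show "d = d'" using w(3) hid[OF d(1)] hid[OF d(2)] by simp
  qed
  then show ?thesis using img card_image by metis
qed

lemma F0: "F0 q (2 * n) \<sigma> = (q - 1) * n + 1"
proof -
  have "F0 q (2 * n) \<sigma> = (\<Sum>i\<in>A. card (heads P i))"
    unfolding F0_def A_def[symmetric]
  proof (rule sum.cong[OF refl])
    fix i assume i: "i \<in> A"
    then have "inv_on \<sigma> {0, i} V" by (intro inv_on_mono[OF inv]) (auto simp: iA)
    then show "card (residues \<sigma> (2 * n) {0, i}) = card (heads P i)"
      using card_cls_heads[OF i] by (simp add: residues_eq_cls)
  qed
  moreover have "(\<Sum>i\<in>A. card (heads P i)) + n = card A * n + 1"
    by (rule sum_card_heads[OF _ qt cP n1]) (simp add: A_def)
  moreover have "card A * n = (q - 1) * n + n" using q1 by (cases q) (auto simp: A_def)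
  ultimately show ?thesis by linarith
qed

lemma bip: "bipartite_graph q (2 * n) \<sigma>"
proof -
  let ?s = "\<lambda>v. snd (inv_into (P \<times> UNIV) g v)"
  have "?s (\<sigma> c v) \<noteq> ?s v" if "c \<le> q" "v < 2 * n" for c v
  proof -
    have "v \<in> V" using that by simp
    then obtain w b where w: "w \<in> P" "v = g (w, b)" by (rule V_cases)
    show ?thesis
    proof (cases "c = 0")
      case True
      then show ?thesis using s0[OF w(1)] g_inv[OF w(1)] w by simp
    next
      case False
      then have i: "c \<in> A" using that by (simp add: iA)
      show ?thesis
        using siT[OF w(1) i] siF[OF w(1) i] g_inv[OF w(1)] g_inv[OF rot_in[OF qt w(1)]] g_inv[of "inv_into P (rot P c) w"]
          rot_inv[OF w(1), of c] w by (cases b) auto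
    qed
  qed
  then show ?thesis unfolding bipartite_graph_def by (intro exI[of _ "\<lambda>v. ?s v = ?s 0"]) auto
qed

text \<open>The labelling can be read off from the graph once the label of the tree root is known.
  This is what makes the construction injective.\<close>

lemma g_walk: "w \<in> P \<Longrightarrow> g (w, False) = walk \<sigma> (g ([], False)) w"
proof (induction w)
  case (Cons i w)
  have w: "w \<in> P" and i: "i \<in> A" using Cons.prems qt by (auto simp: qtree_def)
  have "g (i # w, False) = \<sigma> i (g (w, True))" using siT[OF w i] Cons.prems by (simp add: rot_def)
  also have "g (w, True) = \<sigma> 0 (g (w, False))" using s0[OF w] by simp
  finally show ?case using Cons.IH[OF w] by simp
qed simp

lemma g_lab: "w \<in> P \<Longrightarrow> g (w, b) = lab \<sigma> (g ([], False)) (w, b)"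
  using g_walk[of w] s0[of w False] by (cases b) (auto simp: lab_def)

end

text \<open>If \<open>i # w\<close> were missing from the second tree, colour i would lead to the
  top of the chain of \<open>w\<close> in one description and to the longer word
  \<open>i # w\<close> in the other.\<close>

lemma build_subset:
  assumes "build q n A P g" "build q n A P' g'"
    and eq: "bld q (2 * n) P g = bld q (2 * n) P' g'" and r: "g ([], False) = g' ([], False)"
  shows "P \<subseteq> P'"
proof
  interpret b1: build q n A P g by fact
  interpret b2: build q n A P' g' by fact
  fix w assume "w \<in> P"
  then show "w \<in> P'"
  proof (induction w)
    case Nil
    show ?case by (rule b2.Nil_P)
  next
    case (Cons i w)
    have w: "w \<in> P" and i: "i \<in> A" using Cons.prems b1.qt by (auto simp: qtree_def)
    have w': "w \<in> P'" by (rule Cons.IH[OF w])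
    show ?case
    proof (rule ccontr)
      assume no: "i # w \<notin> P'"
      let ?d = "dropWhile ((=) i) w"
      have d: "?d \<in> P" "?d \<in> P'" using dropWhile_in b1.qt b2.qt w w' by blast+
      have gg: "g (u, b) = g' (u, b)" if "u \<in> P" "u \<in> P'" for u b
        using b1.g_lab[OF that(1)] b2.g_lab[OF that(2)] eq r by simp
      have "g (i # w, False) = bld q (2 * n) P g i (g (w, True))"
        using b1.siT[OF w i] Cons.prems by (simp add: rot_def)
      also have "\<dots> = bld q (2 * n) P' g' i (g' (w, True))" using eq gg[OF w w'] by simp
      also have "\<dots> = g' (?d, False)" using b2.siT[OF w' i] no by (simp add: rot_def)
      also have "\<dots> = g (?d, False)" using gg[OF d] by simp
      finally have "i # w = ?d" using b1.g_inj[OF Cons.prems d(1)] by blast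
      moreover have "length ?d \<le> length w" by (rule length_dropWhile_le)
      ultimately show False by (metis Suc_n_not_le_n length_Cons)
    qed
  qed
qed

section \<open>Counting graphs of order zero by labelled trees\<close>

lemma finite_coloured: "finite {\<sigma>. coloured_graph q N \<sigma>}"
proof -
  let ?R = "\<lambda>\<sigma>. restrict (\<lambda>(c, v). \<sigma> c v) ({..q} \<times> {..<N})"
  have "?R ` {\<sigma>. coloured_graph q N \<sigma>} \<subseteq> PiE ({..q} \<times> {..<N}) (\<lambda>_. {..<N})"
    by (auto simp: coloured_graph_def)
  moreover have "finite (PiE ({..q} \<times> {..<N}) (\<lambda>_. {..<N}))" by (intro finite_PiE) auto
  ultimately have fin: "finite (?R ` {\<sigma>. coloured_graph q N \<sigma>})" by (rule finite_subset)
  have "inj_on ?R {\<sigma>. coloured_graph q N \<sigma>}"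
  proof (rule inj_onI)
    fix \<sigma> \<tau> assume s: "\<sigma> \<in> {\<sigma>. coloured_graph q N \<sigma>}" "\<tau> \<in> {\<sigma>. coloured_graph q N \<sigma>}" and eq: "?R \<sigma> = ?R \<tau>"
    show "\<sigma> = \<tau>"
    proof (intro ext)
      fix c v show "\<sigma> c v = \<tau> c v"
      proof (cases "c \<le> q \<and> v < N")
        case True
        then show ?thesis using fun_cong[OF eq, of "(c, v)"] by simp
      next
        case False
        then show ?thesis using s by (auto simp: coloured_graph_def not_le not_less)
      qed
    qed
  qed
  then show ?thesis using fin finite_imageD by blast
qed

text \<open>A reference numbering turns all labellings of \<open>P\<close> into permutations, so
  that there are (2n)! of them.\<close>

definition idx :: "nat \<Rightarrow> nat list set \<Rightarrow> nat list \<times> bool \<Rightarrow> nat" where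
  "idx n P = (SOME f. bij_betw f (P \<times> UNIV) {..<2 * n})"

lemma idx_bij:
  assumes "P \<in> PN A n"
  shows "bij_betw (idx n P) (P \<times> UNIV) {..<2 * n}"
proof -
  have "finite P" "card P = n" using assms by (auto simp: PN_def qtree_def)
  then have "finite (P \<times> (UNIV :: bool set))" "card (P \<times> (UNIV :: bool set)) = card {..<2 * n}"
    by (auto simp: card_cartesian_product)
  then have "\<exists>f. bij_betw f (P \<times> (UNIV :: bool set)) {..<2 * n}"
    by (intro finite_same_card_bij) auto
  then show ?thesis unfolding idx_def by (rule someI_ex)
qed

text \<open>The tree root may receive any label, whereas graphs are rooted at vertex 0. So the graph
  together with the label of the tree root determines the tree and the permutation, at the price of
  the factor 2n.\<close>

lemma order0_count_lower:
  assumes A: "A = {1..q}" and q: "1 \<le> q" and n: "1 \<le> n"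
  shows "card (PN A n) * fact (2 * n) \<le> 2 * n *
    card {\<sigma>. coloured_graph q (2 * n) \<sigma> \<and> F0 q (2 * n) \<sigma> = (q - 1) * n + 1 \<and> bipartite_graph q (2 * n) \<sigma>}"
    (is "_ \<le> 2 * n * card ?S")
proof -
  let ?D = "PN A n \<times> {\<pi>. \<pi> permutes {..<2 * n}}"
  let ?g = "\<lambda>x. snd x \<circ> idx n (fst x)"
  let ?f = "\<lambda>x. (bld q (2 * n) (fst x) (?g x), ?g x ([], False))"
  have b: "build q n A (fst x) (?g x)" if "x \<in> ?D" for x
  proof
    show "bij_betw (?g x) (fst x \<times> UNIV) {..<2 * n}"
      by (rule bij_betw_trans[OF idx_bij]) (use that permutes_imp_bij in auto)
  qed (use that A q n in auto)
  have inj: "inj_on ?f ?D"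
  proof (rule inj_onI)
    fix x y assume x: "x \<in> ?D" and y: "y \<in> ?D" and eq: "?f x = ?f y"
    have e1: "bld q (2 * n) (fst x) (?g x) = bld q (2 * n) (fst y) (?g y)" and e2: "?g x ([], False) = ?g y ([], False)"
      using eq by auto
    have P: "fst x = fst y"
      using build_subset[OF b[OF x] b[OF y] e1 e2] build_subset[OF b[OF y] b[OF x] e1[symmetric] e2[symmetric]] by blast
    interpret b1: build q n A "fst x" "?g x" by (rule b[OF x])
    interpret b2: build q n A "fst y" "?g y" by (rule b[OF y])
    have gg: "?g x z = ?g y z" if "z \<in> fst x \<times> UNIV" for z
    proof -
      obtain w c where z: "z = (w, c)" "w \<in> fst x" using \<open>z \<in> fst x \<times> UNIV\<close> by auto
      show ?thesis using b1.g_lab[OF z(2), of c] b2.g_lab[of w c] z P e1 e2 by simp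
    qed
    have "snd x = snd y"
    proof
      fix v show "snd x v = snd y v"
      proof (cases "v \<in> {..<2 * n}")
        case True
        have "fst x \<in> PN A n" using x by auto
        then have "v \<in> idx n (fst x) ` (fst x \<times> UNIV)"
          using idx_bij[of "fst x" A n] True unfolding bij_betw_def by blast
        then obtain z where z: "v = idx n (fst x) z" "z \<in> fst x \<times> UNIV" by (rule imageE)
        then show ?thesis using gg[OF z(2)] P by simp
      next
        case False
        then show ?thesis using x y by (auto simp: permutes_def)
      qed
    qed
    then show "x = y" using P by (simp add: prod_eq_iff)
  qed
  have img: "?f ` ?D \<subseteq> ?S \<times> {..<2 * n}"
  proof (rule image_subsetI)
    fix x assume x: "x \<in> ?D"
    interpret build q n A "fst x" "?g x" by (rule b[OF x])
    show "?f x \<in> ?S \<times> {..<2 * n}" using coloured F0 bip gV[OF Nil_P, of False] by simp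
  qed
  have fS: "finite ?S" by (rule finite_subset[OF _ finite_coloured[of q "2 * n"]]) auto
  have "card (PN A n) * fact (2 * n) = card ?D"
    by (simp add: card_cartesian_product card_permutations[of "{..<2 * n}" "2 * n"])
  also have "\<dots> \<le> card (?S \<times> {..<2 * n})" by (rule card_inj_on_le[OF inj img]) (use fS in simp)
  also have "\<dots> = 2 * n * card ?S" by (simp only: card_cartesian_product card_lessThan mult.commute)
  finally show ?thesis .
qed

definition enc :: "nat set \<Rightarrow> nat \<Rightarrow> (nat \<Rightarrow> nat \<Rightarrow> nat) \<Rightarrow> nat list set \<Rightarrow> bool" where
  "enc A n \<sigma> P \<longleftrightarrow> P \<in> PN A n \<and> bij_betw (lab \<sigma> 0) (P \<times> UNIV) {..<2 * n} \<and>
     (\<forall>w\<in>P. \<forall>i\<in>A. walk \<sigma> 0 (i # w) = walk \<sigma> 0 (rot P i w)) \<and> (\<forall>i\<in>A. rot P i ` P = P)"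

lemma enc_unique:
  assumes A: "A = {1..q}" and s: "coloured_graph q (2 * n) \<sigma>" "enc A n \<sigma> P" and t: "coloured_graph q (2 * n) \<tau>" "enc A n \<tau> P"
    and eq: "\<And>z. z \<in> P \<times> UNIV \<Longrightarrow> lab \<sigma> 0 z = lab \<tau> 0 z"
  shows "\<sigma> = \<tau>"
proof (intro ext)
  fix c v
  show "\<sigma> c v = \<tau> c v"
  proof (cases "c \<le> q \<and> v < 2 * n")
    case False
    then show ?thesis using s(1) t(1) by (auto simp: coloured_graph_def not_le not_less)
  next
    case True
    have inv: "inv_on \<sigma> {..q} {..<2 * n}" "inv_on \<tau> {..q} {..<2 * n}"
      using coloured_graph_inv s(1) t(1) by auto
    have qt: "qtree A P" using s(2) by (simp add: enc_def PN_def)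
    have W: "walk \<sigma> 0 w = walk \<tau> 0 w" "\<sigma> 0 (walk \<sigma> 0 w) = \<tau> 0 (walk \<sigma> 0 w)" "walk \<sigma> 0 w < 2 * n" if "w \<in> P" for w
    proof -
      show e: "walk \<sigma> 0 w = walk \<tau> 0 w" using eq[of "(w, False)"] that by (simp add: lab_def)
      show "\<sigma> 0 (walk \<sigma> 0 w) = \<tau> 0 (walk \<sigma> 0 w)" using eq[of "(w, True)"] that e by (simp add: lab_def)
      have "lab \<sigma> 0 (w, False) \<in> {..<2 * n}" using s(2) that unfolding enc_def bij_betw_def by blast
      then show "walk \<sigma> 0 w < 2 * n" by (simp add: lab_def)
    qed
    have T: "\<sigma> i (\<sigma> 0 (walk \<sigma> 0 w)) = walk \<sigma> 0 (rot P i w)" "\<tau> i (\<sigma> 0 (walk \<sigma> 0 w)) = walk \<sigma> 0 (rot P i w)"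
      if "w \<in> P" "i \<in> A" for w i
    proof -
      show "\<sigma> i (\<sigma> 0 (walk \<sigma> 0 w)) = walk \<sigma> 0 (rot P i w)" using s(2) that by (auto simp: enc_def)
      have "\<tau> i (\<tau> 0 (walk \<tau> 0 w)) = walk \<tau> 0 (rot P i w)" using t(2) that by (auto simp: enc_def)
      then show "\<tau> i (\<sigma> 0 (walk \<sigma> 0 w)) = walk \<sigma> 0 (rot P i w)"
        using W[OF that(1)] W(1)[OF rot_in[OF qt that(1)]] by simp
    qed
    obtain w b where w: "w \<in> P" "v = lab \<sigma> 0 (w, b)"
      using s(2) True unfolding enc_def bij_betw_def by (metis (no_types, lifting) imageE lessThan_iff mem_Sigma_iff surj_pair)
    have ss: "\<sigma> c (\<sigma> c u) = u" "\<tau> c (\<tau> c u) = u" if "u < 2 * n" for c u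
      using inv_onD(2)[OF inv(1), of c u] inv_onD(2)[OF inv(2), of c u] that s(1) t(1)
      by (cases "c \<le> q"; auto simp: coloured_graph_def not_le)+
    show ?thesis
    proof (cases "c = 0")
      case True
      then show ?thesis using w W[OF w(1)] ss[of "walk \<sigma> 0 w" 0] by (cases b) (auto simp: lab_def)
    next
      case False
      then have i: "c \<in> A" using \<open>c \<le> q \<and> v < 2 * n\<close> by (simp add: A)
      show ?thesis
      proof (cases b)
        case True
        then show ?thesis using w T[OF w(1) i] by (simp add: lab_def)
      next
        case b: False
        have "w \<in> rot P c ` P" using s(2) i w(1) by (auto simp: enc_def)
        then obtain w' where w': "w' \<in> P" "w = rot P c w'" by blast
        have u: "\<sigma> 0 (walk \<sigma> 0 w') < 2 * n" using inv_onD(1)[OF inv(1), of 0] W(3)[OF w'(1)] by simp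
        have "\<sigma> c v = \<sigma> 0 (walk \<sigma> 0 w')" "\<tau> c v = \<sigma> 0 (walk \<sigma> 0 w')"
          using w b T[OF w'(1) i] w'(2) ss[OF u, of c] by (auto simp: lab_def)
        then show ?thesis by simp
      qed
    qed
  qed
qed

text \<open>Here the tree root has label 0, and the graph is recovered from its tree and labelling.
  Combined with the lower bound, a proportion among graphs exceeds the one among trees of size n by
  a factor of at most 2n.\<close>

lemma order0_count_upper:
  assumes A: "A = {1..q}" and q: "1 \<le> q"
    and S: "\<And>\<sigma>. \<sigma> \<in> S \<Longrightarrow> coloured_graph q (2 * n) \<sigma> \<and> F0 q (2 * n) \<sigma> = (q - 1) * n + 1"
    and Bad: "\<And>\<sigma> P. \<sigma> \<in> S \<Longrightarrow> enc A n \<sigma> P \<Longrightarrow> P \<in> Bad" "Bad \<subseteq> PN A n"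
  shows "card S \<le> card Bad * fact (2 * n)"
proof -
  have "\<exists>P. enc A n \<sigma> P" if "\<sigma> \<in> S" for \<sigma>
    using order0_encoding[of q n \<sigma> A] S[OF that] q A unfolding enc_def by blast
  then obtain Pf where Pf: "\<And>\<sigma>. \<sigma> \<in> S \<Longrightarrow> enc A n \<sigma> (Pf \<sigma>)" by metis
  have PN: "Pf \<sigma> \<in> PN A n" if "\<sigma> \<in> S" for \<sigma> using Pf[OF that] by (simp add: enc_def)
  let ?pi = "\<lambda>\<sigma> v. if v \<in> {..<2 * n} then lab \<sigma> 0 (inv_into (Pf \<sigma> \<times> UNIV) (idx n (Pf \<sigma>)) v) else v"
  have perm: "?pi \<sigma> permutes {..<2 * n}" if "\<sigma> \<in> S" for \<sigma>
  proof (rule bij_imp_permutes)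
    have "bij_betw (lab \<sigma> 0 \<circ> inv_into (Pf \<sigma> \<times> UNIV) (idx n (Pf \<sigma>))) {..<2 * n} {..<2 * n}"
      using bij_betw_trans[OF bij_betw_inv_into[OF idx_bij[OF PN[OF that]]]] Pf[OF that] unfolding enc_def by blast
    then show "bij_betw (?pi \<sigma>) {..<2 * n} {..<2 * n}" by (rule bij_betw_cong[THEN iffD1, rotated]) simp
  qed simp
  have inj: "inj_on (\<lambda>\<sigma>. (Pf \<sigma>, ?pi \<sigma>)) S"
  proof (rule inj_onI)
    fix \<sigma> \<tau> assume s: "\<sigma> \<in> S" and t: "\<tau> \<in> S" and eq: "(Pf \<sigma>, ?pi \<sigma>) = (Pf \<tau>, ?pi \<tau>)"
    have P: "Pf \<sigma> = Pf \<tau>" and pi: "\<And>v. ?pi \<sigma> v = ?pi \<tau> v" using eq by (auto simp: fun_eq_iff)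
    show "\<sigma> = \<tau>"
    proof (rule enc_unique[OF A _ Pf[OF s]])
      show "enc A n \<tau> (Pf \<sigma>)" using Pf[OF t] P by simp
      show "coloured_graph q (2 * n) \<sigma>" "coloured_graph q (2 * n) \<tau>" using S s t by auto
      fix z assume z: "z \<in> Pf \<sigma> \<times> (UNIV :: bool set)"
      have b: "bij_betw (idx n (Pf \<sigma>)) (Pf \<sigma> \<times> UNIV) {..<2 * n}" by (rule idx_bij[OF PN[OF s]])
      have "idx n (Pf \<sigma>) z \<in> {..<2 * n}" using b z by (auto simp: bij_betw_def)
      moreover have "inv_into (Pf \<sigma> \<times> UNIV) (idx n (Pf \<sigma>)) (idx n (Pf \<sigma>) z) = z"
        using b z by (simp add: bij_betw_def)
      ultimately show "lab \<sigma> 0 z = lab \<tau> 0 z" using pi[of "idx n (Pf \<sigma>) z"] P by simp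
    qed
  qed
  have img: "(\<lambda>\<sigma>. (Pf \<sigma>, ?pi \<sigma>)) ` S \<subseteq> Bad \<times> {\<pi>. \<pi> permutes {..<2 * n}}"
    using perm Bad(1) Pf by blast
  have finB: "finite Bad" using Bad(2) finite_PN[of A n] A finite_subset by blast
  have "card S \<le> card (Bad \<times> {\<pi>. \<pi> permutes {..<2 * n}})"
    by (rule card_inj_on_le[OF inj img]) (use finB finite_permutations in auto)
  then show ?thesis by (simp add: card_cartesian_product card_permutations[of "{..<2 * n}" "2 * n"])
qed

section \<open>Cutting and inserting\<close>

text \<open>The inverse of a cut: the colour-0 edge at x, which forms a 0i-cycle of length two, is inserted into
the 0i-cycle of v.\<close>
definition ins :: "(nat \<Rightarrow> nat \<Rightarrow> nat) \<Rightarrow> nat \<Rightarrow> nat \<Rightarrow> nat \<Rightarrow> nat \<Rightarrow> nat \<Rightarrow> nat" where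
  "ins \<sigma> x i v = \<sigma>(i := (\<sigma> i)(x := v, v := x, \<sigma> 0 x := \<sigma> i v, \<sigma> i v := \<sigma> 0 x))"

text \<open>Order k, rearranged into an equation between natural numbers; the flag selects the bipartite graphs.\<close>
definition GK :: "bool \<Rightarrow> nat \<Rightarrow> nat \<Rightarrow> nat \<Rightarrow> (nat \<Rightarrow> nat \<Rightarrow> nat) set" where
  "GK \<beta> q n k = {\<sigma>. coloured_graph q (2 * n) \<sigma> \<and> F0 q (2 * n) \<sigma> + k = (q - 1) * n + 1 \<and>
     (\<beta> \<longrightarrow> bipartite_graph q (2 * n) \<sigma>)}"

text \<open>The incidences lying on a cycle of the incidence graph, and those separating y from the root.\<close>
definition Lset :: "nat \<Rightarrow> nat \<Rightarrow> (nat \<Rightarrow> nat \<Rightarrow> nat) \<Rightarrow> (nat \<times> nat) set" where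
  "Lset q N \<sigma> = {(x, i). x < N \<and> i \<in> {1..q} \<and> \<sigma> i x \<noteq> \<sigma> 0 x \<and> \<sigma> i x \<in> orb (cut \<sigma> x i) {..q} x}"

definition Sep :: "nat \<Rightarrow> nat \<Rightarrow> (nat \<Rightarrow> nat \<Rightarrow> nat) \<Rightarrow> nat \<Rightarrow> (nat \<times> nat) set" where
  "Sep q N \<sigma> y = {(x, i). x < N \<and> i \<in> {1..q} \<and> y \<notin> orb (cut \<sigma> x i) {..q} 0}"

text \<open>\<open>j\<close> counts insertions, and the bounds are shaped by what one insertion
  does: it creates no separating incidence, puts at most 2 D + 4 further incidences on cycles, and
  at most doubles the components missing a colour.\<close>

definition thin :: "nat \<Rightarrow> nat \<Rightarrow> nat \<Rightarrow> nat \<Rightarrow> nat \<Rightarrow> (nat \<Rightarrow> nat \<Rightarrow> nat) \<Rightarrow> bool" where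
  "thin q N D s j \<sigma> \<longleftrightarrow> (\<forall>y<N. card (Sep q N \<sigma> y) \<le> D) \<and> card (Lset q N \<sigma>) \<le> j * (2 * D + 4) \<and>
     (\<forall>c\<in>{1..q}. \<forall>y<N. card (orb \<sigma> ({..q} - {c}) y) \<le> 2 ^ j * s)"

lemma finite_Lset: "finite (Lset q N \<sigma>)"
  by (rule finite_subset[of _ "{..<N} \<times> {1..q}"]) (auto simp: Lset_def)

lemma finite_Sep: "finite (Sep q N \<sigma> y)"
  by (rule finite_subset[of _ "{..<N} \<times> {1..q}"]) (auto simp: Sep_def)

lemma finite_GK: "finite (GK \<beta> q n k)"
  by (rule finite_subset[OF _ finite_coloured[of q "2 * n"]]) (auto simp: GK_def)

lemma coloured_gem: "coloured_graph q N \<sigma> \<Longrightarrow> gem {..<N} \<sigma> {1..q}"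
proof -
  assume "coloured_graph q N \<sigma>"
  then have inv: "inv_on \<sigma> {..q} {..<N}" by (rule coloured_graph_inv)
  have "insert 0 {1..q} = {..q}" by auto
  then show ?thesis unfolding gem_def using inv by simp
qed

lemma F0_eq_cls:
  assumes "inv_on \<sigma> {..q} {..<N}"
  shows "F0 q N \<sigma> = (\<Sum>i\<in>{1..q}. card (cls \<sigma> {0, i} {..<N}))"
  unfolding F0_def
proof (rule sum.cong[OF refl])
  fix i assume "i \<in> {1..q}"
  then have "inv_on \<sigma> {0, i} {..<N}" by (intro inv_on_mono[OF assms]) auto
  then show "card (residues \<sigma> N {0, i}) = card (cls \<sigma> {0, i} {..<N})" by (simp add: residues_eq_cls)
qed

lemma coloured_graphI:
  assumes "1 \<le> N" "inv_on \<sigma> {..q} {..<N}" "\<And>c v. q < c \<or> N \<le> v \<Longrightarrow> \<sigma> c v = v" "orb \<sigma> {..q} 0 = {..<N}"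
  shows "coloured_graph q N \<sigma>"
  unfolding coloured_graph_def
proof (intro conjI allI impI)
  show "\<sigma> c v < N" "\<sigma> c v \<noteq> v" "\<sigma> c (\<sigma> c v) = v" if "c \<le> q" "v < N" for c v
    using inv_onD[OF assms(2), of c v] that by auto
  show "residue \<sigma> N {..q} 0 = {..<N}" using residue_eq_orb[OF assms(2), of 0] assms(1,4) by simp
qed (use assms in auto)

lemma F0_cut:
  assumes cg: "coloured_graph q N \<sigma>" and x: "x < N" and i: "i \<in> {1..q}" and nt: "\<sigma> i x \<noteq> \<sigma> 0 x"
  shows "F0 q N (cut \<sigma> x i) = F0 q N \<sigma> + 1"
proof -
  have g: "gem {..<N} \<sigma> {1..q}" by (rule coloured_gem[OF cg])
  have xV: "x \<in> {..<N}" using x by simp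
  have inv: "inv_on \<sigma> {..q} {..<N}" by (rule coloured_graph_inv[OF cg])
  have inv': "inv_on (cut \<sigma> x i) {..q} {..<N}" by (rule cut_at.inv_on_cut[OF gem_cut_at[OF g xV i] inv])
  have "(\<Sum>j\<in>{1..q}. card (cls (cut \<sigma> x i) {0, j} {..<N}))
      = (\<Sum>j\<in>{1..q}. card (cls \<sigma> {0, j} {..<N}) + (if j = i then 1 else 0))"
    by (rule sum.cong[OF refl]) (rule card_cls_cut_colour[OF g xV i nt])
  also have "\<dots> = (\<Sum>j\<in>{1..q}. card (cls \<sigma> {0, j} {..<N})) + 1"
    unfolding sum.distrib using i by simp
  finally show ?thesis unfolding F0_eq_cls[OF inv] F0_eq_cls[OF inv'] .
qed

lemma coloured_cut:
  assumes cg: "coloured_graph q N \<sigma>" and x: "x < N" and i: "i \<in> {1..q}"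
    and con: "\<sigma> i x \<in> orb (cut \<sigma> x i) {..q} x"
  shows "coloured_graph q N (cut \<sigma> x i)"
proof (rule coloured_graphI)
  have g: "gem {..<N} \<sigma> {1..q}" by (rule coloured_gem[OF cg])
  have xV: "x \<in> {..<N}" using x by simp
  interpret cut_at \<sigma> "{..<N}" x i by (rule gem_cut_at[OF g xV i])
  have inv: "inv_on \<sigma> {..q} {..<N}" by (rule coloured_graph_inv[OF cg])
  show inv': "inv_on \<tau> {..q} {..<N}" by (rule inv_on_cut[OF inv])
  show N1: "1 \<le> N" using cg by (simp add: coloured_graph_def)
  show "\<tau> c v = v" if "q < c \<or> N \<le> v" for c v
  proof -
    have "\<not> (c = i \<and> v \<in> {x, y, a, b})" using that i basics xV by auto
    then have "\<tau> c v = \<sigma> c v" using cut_val_away cut_other by metis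
    then show ?thesis using cg that by (auto simp: coloured_graph_def)
  qed
  have "orb \<tau> {..q} a = orb \<tau> {..q} x" by (rule orb_eq[OF inv' xV con])
  then have "orb \<tau> {..q} x = {..<N}"
    using orb_uncut[OF inv] i coloured_graph_conn[OF cg x] by simp
  then show "orb \<tau> {..q} 0 = {..<N}" using orb_eq[OF inv' xV, of 0] N1 by simp
qed

lemma bipartite_cut:
  assumes cg: "coloured_graph q N \<sigma>" and x: "x < N" and i: "i \<in> {1..q}" and bip: "bipartite_graph q N \<sigma>"
  shows "bipartite_graph q N (cut \<sigma> x i)"
proof -
  obtain bl :: "nat \<Rightarrow> bool" where bl0: "bl 0" and bl: "\<And>c v. c \<le> q \<Longrightarrow> v < N \<Longrightarrow> bl (\<sigma> c v) \<noteq> bl v"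
    using bip unfolding bipartite_graph_def by metis
  have g: "gem {..<N} \<sigma> {1..q}" by (rule coloured_gem[OF cg])
  have xV: "x \<in> {..<N}" using x by simp
  interpret cut_at \<sigma> "{..<N}" x i by (rule gem_cut_at[OF g xV i])
  have iq: "i \<le> q" using i by simp
  have e: "bl y \<noteq> bl x" "bl a \<noteq> bl x" "bl b \<noteq> bl y"
    using bl[of 0 x] bl[OF iq, of x] bl[OF iq, of y] basics x by auto
  have "bl (\<tau> c v) \<noteq> bl v" if "c \<le> q" "v < N" for c v
  proof (cases "c = i \<and> v \<in> {x, y, a, b}")
    case True
    then show ?thesis using e cut_vals by auto
  next
    case False
    then have "\<tau> c v = \<sigma> c v" using cut_val_away cut_other by metis
    then show ?thesis using bl[OF that] by simp
  qed
  then show ?thesis unfolding bipartite_graph_def using bl0 by blast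
qed

text \<open>Nonnegativity of the order: \<open>excess\<close> for a single component.\<close>

lemma F0_le:
  assumes cg: "coloured_graph q (2 * n) \<sigma>" and q: "1 \<le> q"
  shows "F0 q (2 * n) \<sigma> \<le> (q - 1) * n + 1"
proof -
  have g: "gem {..<2 * n} \<sigma> {1..q}" by (rule coloured_gem[OF cg])
  have inv: "inv_on \<sigma> {..q} {..<2 * n}" by (rule coloured_graph_inv[OF cg])
  have I: "insert 0 {1..q} = {..q}" by auto
  have n: "0 < 2 * n" using cg by (simp add: coloured_graph_def)
  have "cls \<sigma> {..q} {..<2 * n} = (\<lambda>_. {..<2 * n}) ` {..<2 * n}"
    unfolding cls_def by (rule image_cong[OF refl]) (simp add: coloured_graph_conn[OF cg])
  also have "\<dots> = {{..<2 * n}}" using n by (intro image_constant[of 0]) simp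
  finally have "card (cls \<sigma> {..q} {..<2 * n}) = 1" by simp
  then have "2 * n + 2 * F0 q (2 * n) \<sigma> \<le> 2 * 1 + q * (2 * n)"
    using excess[OF g] unfolding I F0_eq_cls[OF inv] by simp
  moreover have "q * (2 * n) = 2 * ((q - 1) * n) + 2 * n" using q by (cases q) auto
  ultimately show ?thesis by simp
qed

lemma GK_cut:
  assumes s: "\<sigma> \<in> GK \<beta> q n k" and x: "x < 2 * n" and i: "i \<in> {1..q}" and nt: "\<sigma> i x \<noteq> \<sigma> 0 x"
    and con: "\<sigma> i x \<in> orb (cut \<sigma> x i) {..q} x" and q: "1 \<le> q"
  shows "1 \<le> k" "cut \<sigma> x i \<in> GK \<beta> q n (k - 1)"
proof -
  have cg: "coloured_graph q (2 * n) \<sigma>" and F: "F0 q (2 * n) \<sigma> + k = (q - 1) * n + 1" using s by (auto simp: GK_def)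
  have cg': "coloured_graph q (2 * n) (cut \<sigma> x i)" by (rule coloured_cut[OF cg x i con])
  have F': "F0 q (2 * n) (cut \<sigma> x i) = F0 q (2 * n) \<sigma> + 1" by (rule F0_cut[OF cg x i nt])
  show "1 \<le> k" using F0_le[OF cg' q] F F' by simp
  then show "cut \<sigma> x i \<in> GK \<beta> q n (k - 1)"
    using cg' F F' bipartite_cut[OF cg x i] s by (auto simp: GK_def)
qed

lemma ins_cut:
  assumes cg: "coloured_graph q N \<sigma>" and x: "x < N" and i: "i \<in> {1..q}" and nt: "\<sigma> i x \<noteq> \<sigma> 0 x"
  shows "ins (cut \<sigma> x i) x i (\<sigma> i x) = \<sigma>" "cut \<sigma> x i i x = cut \<sigma> x i 0 x"
proof -
  have xV: "x \<in> {..<N}" using x by simp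
  interpret cut_at \<sigma> "{..<N}" x i by (rule gem_cut_at[OF coloured_gem[OF cg] xV i])
  show "cut \<sigma> x i i x = cut \<sigma> x i 0 x" using cut_vals by simp
  have d: "a \<noteq> y" "b \<noteq> x" using nt triv_iff by auto
  have "ins \<tau> x i a c u = \<sigma> c u" for c u
  proof (cases "c = i")
    case True
    then show ?thesis
      using basics d cut_vals cut_val_away[of u i] unfolding ins_def by (cases "u \<in> {x, y, a, b}") auto
  next
    case False
    then show ?thesis by (simp add: ins_def cut_def)
  qed
  then show "ins (cut \<sigma> x i) x i (\<sigma> i x) = \<sigma>" by (intro ext)
qed

section \<open>The effect of an insertion\<close>

locale insertion =
  fixes q N :: nat and \<sigma> :: "nat \<Rightarrow> nat \<Rightarrow> nat" and x i v :: nat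
  assumes cg: "coloured_graph q N \<sigma>" and x: "x < N" and i: "i \<in> {1..q}" and triv: "\<sigma> i x = \<sigma> 0 x"
    and v: "v < N" "v \<noteq> x" "v \<noteq> \<sigma> 0 x"
begin

abbreviation "y \<equiv> \<sigma> 0 x"
abbreviation "b \<equiv> \<sigma> i v"
abbreviation "\<tau> \<equiv> ins \<sigma> x i v"
abbreviation "V \<equiv> {..<N}"

lemma inv: "inv_on \<sigma> {..q} V" by (rule coloured_graph_inv[OF cg])

lemma i0: "i \<noteq> 0" "i \<le> q" using i by auto

lemma facts: "y < N" "b < N" "\<sigma> 0 y = x" "\<sigma> i y = x" "\<sigma> i b = v" "y \<noteq> x" "b \<noteq> v" "b \<noteq> x" "b \<noteq> y"
proof -
  show *: "y < N" "\<sigma> 0 y = x" "y \<noteq> x" using inv_onD[OF inv, of 0 x] x by auto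
  show "\<sigma> i y = x" using inv_onD[OF inv, of i x] x triv i0 by auto
  show **: "b < N" "\<sigma> i b = v" "b \<noteq> v" using inv_onD[OF inv, of i v] v i0 by auto
  show "b \<noteq> x" using ** triv v by auto
  show "b \<noteq> y" using ** \<open>\<sigma> i y = x\<close> v by auto
qed

lemma ins_vals: "\<tau> i x = v" "\<tau> i v = x" "\<tau> i y = b" "\<tau> i b = y" "\<tau> 0 = \<sigma> 0"
  using facts v i0 by (auto simp: ins_def)

lemma ins_other: "c \<noteq> i \<Longrightarrow> \<tau> c = \<sigma> c" by (simp add: ins_def)

lemma ins_away: "u \<notin> {x, y, v, b} \<Longrightarrow> \<tau> c u = \<sigma> c u" by (simp add: ins_def)

lemma inv_ins: "inv_on \<tau> {..q} V"
  unfolding inv_on_def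
proof (intro ballI)
  fix c u assume c: "c \<in> {..q}" and u: "u \<in> V"
  note * = inv_onD[OF inv c u]
  show "\<tau> c u \<in> V \<and> \<tau> c (\<tau> c u) = u \<and> \<tau> c u \<noteq> u"
  proof (cases "c = i \<and> u \<in> {x, y, v, b}")
    case True
    then show ?thesis using facts ins_vals x v by auto
  next
    case False
    then have 1: "\<tau> c u = \<sigma> c u" using ins_away ins_other by metis
    have "\<tau> c (\<sigma> c u) = \<sigma> c (\<sigma> c u)"
    proof (cases "c = i")
      case True
      then have "\<sigma> i u \<notin> {x, y, v, b}" using False facts triv * by (metis insert_iff empty_iff)
      then show ?thesis using True ins_away by blast
    qed (simp add: ins_other)
    then show ?thesis using 1 * by simp
  qed
qed

lemma nontriv: "\<tau> i x \<noteq> \<tau> 0 x" using ins_vals v by simp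

lemma cut_ins: "cut \<tau> x i = \<sigma>"
proof (intro ext)
  fix c u
  have t: "\<tau> 0 x = y" "\<tau> i x = v" "\<tau> i y = b" using ins_vals by auto
  show "cut \<tau> x i c u = \<sigma> c u"
  proof (cases "c = i \<and> u \<in> {x, y, v, b}")
    case True
    then show ?thesis unfolding cut_def t using facts triv v by auto
  next
    case False
    then show ?thesis unfolding cut_def t using ins_away[of u c] ins_other[of c] by auto
  qed
qed

lemma gem_ins: "gem V \<tau> {1..q}"
proof -
  have "insert 0 {1..q} = {..q}" by auto
  then show ?thesis unfolding gem_def using inv_ins by simp
qed

sublocale c: cut_at \<tau> V x i
  by (rule gem_cut_at[OF gem_ins]) (use x i in auto)

lemma orb_ins_ge: "0 \<in> C \<Longrightarrow> C \<subseteq> {..q} \<Longrightarrow> w < N \<Longrightarrow> orb \<sigma> C w \<subseteq> orb \<tau> C w"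
  using c.orb_cut_subset[OF inv_on_mono[OF inv_ins], of C w] cut_ins by simp

lemma coloured_ins: "coloured_graph q N \<tau>"
proof (rule coloured_graphI)
  show N1: "1 \<le> N" using x by simp
  show "inv_on \<tau> {..q} V" by (rule inv_ins)
  show "\<tau> c u = u" if "q < c \<or> N \<le> u" for c u
  proof -
    have "\<not> (c = i \<and> u \<in> {x, y, v, b})" using that i0 facts x v by auto
    then have "\<tau> c u = \<sigma> c u" using ins_away ins_other by metis
    then show ?thesis using cg that by (auto simp: coloured_graph_def)
  qed
  have "{..<N} \<subseteq> orb \<tau> {..q} 0"
    using orb_ins_ge[of "{..q}" 0] coloured_graph_conn[OF cg, of 0] N1 by auto
  moreover have "orb \<tau> {..q} 0 \<subseteq> {..<N}" by (rule orb_in[OF inv_ins]) (use N1 in simp)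
  ultimately show "orb \<tau> {..q} 0 = {..<N}" by blast
qed

lemma F0_ins: "F0 q N \<tau> + 1 = F0 q N \<sigma>"
  using F0_cut[OF coloured_ins x i nontriv] cut_ins by simp

lemma bipartite_ins:
  assumes "bl 0" "\<And>c u. c \<le> q \<Longrightarrow> u < N \<Longrightarrow> bl (\<sigma> c u) \<noteq> bl u" "bl v \<noteq> bl x"
  shows "bipartite_graph q N \<tau>"
proof -
  have e: "bl y \<noteq> bl x" "bl b \<noteq> bl v" using assms(2)[of 0 x] assms(2)[of i v] x v i0 by auto
  have "bl (\<tau> c u) \<noteq> bl u" if "c \<le> q" "u < N" for c u
  proof (cases "c = i \<and> u \<in> {x, y, v, b}")
    case True
    then show ?thesis using e ins_vals assms(3) by auto
  next
    case False
    then have "\<tau> c u = \<sigma> c u" using ins_away ins_other by metis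
    then show ?thesis using assms(2)[OF that] by simp
  qed
  then show ?thesis unfolding bipartite_graph_def using assms(1) by blast
qed

text \<open>An insertion is a cut read backwards, so the monotonicity of double cuts
  applies.\<close>

lemma Sep_ins: "Sep q N \<tau> w \<subseteq> Sep q N \<sigma> w"
proof (rule subrelI)
  fix z l assume "(z, l) \<in> Sep q N \<tau> w"
  then have z: "z < N" "l \<in> {1..q}" "w \<notin> orb (cut \<tau> z l) {..q} 0" by (auto simp: Sep_def)
  have I: "insert 0 {1..q} = {..q}" by auto
  have "orb (cut (cut \<tau> x i) z l) {..q} 0 \<subseteq> orb (cut \<tau> z l) {..q} 0"
    using orb_cut_cut_subset[OF gem_ins _ i _ z(2), of x z 0] x z(1) unfolding I by simp
  then show "(z, l) \<in> Sep q N \<sigma> w" using z cut_ins by (auto simp: Sep_def)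
qed

text \<open>If the missing colour is i, nothing changes. Otherwise the new incidence merges at most
  the components of \<open>x\<close> and \<open>v\<close>.\<close>

lemma cluster_ins:
  assumes c: "c \<in> {1..q}" and w: "w < N" and M: "\<And>u. u < N \<Longrightarrow> card (orb \<sigma> ({..q} - {c}) u) \<le> M"
  shows "card (orb \<tau> ({..q} - {c}) w) \<le> 2 * M"
proof -
  let ?C = "{..q} - {c}"
  have C: "0 \<in> ?C" "?C \<subseteq> {..q}" using c by auto
  have invC: "inv_on \<tau> ?C V" "inv_on \<sigma> ?C V" using inv_on_mono[OF inv_ins C(2)] inv_on_mono[OF inv C(2)] by auto
  have wV: "w \<in> V" using w by simp
  show ?thesis
  proof (cases "c = i")
    case True
    have "orb \<tau> ?C w = orb \<sigma> ?C w" by (rule orb_cong[OF invC(2) wV]) (use True ins_other in auto)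
    then show ?thesis using M[OF w] by simp
  next
    case False
    then have iC: "i \<in> ?C" using i0 by simp
    show ?thesis
    proof (cases "w \<in> orb \<tau> ?C x")
      case True
      have "orb \<tau> ?C w = orb \<tau> ?C x" by (rule orb_eq[OF invC(1) c.xV True])
      also have "\<dots> = orb \<sigma> ?C x \<union> orb \<sigma> ?C v"
        using c.orb_uncut[OF invC(1) C(1) iC] cut_ins ins_vals by simp
      finally have "card (orb \<tau> ?C w) \<le> card (orb \<sigma> ?C x) + card (orb \<sigma> ?C v)" by (simp add: card_Un_le)
      then show ?thesis using M[OF x] M[OF v(1)] by simp
    next
      case False
      then have "orb \<tau> ?C w = orb \<sigma> ?C w" using c.orb_uncut_other[OF invC(1) C(1) wV] cut_ins by simp
      then show ?thesis using M[OF w] by simp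
    qed
  qed
qed

text \<open>An incidence that comes to lie on a cycle by the insertion must have separated
  \<open>x\<close> from \<open>v\<close>, hence one of them from the root; the incidences of colour
  i at the four vertices x, y, v and \<open>\<sigma> 0 v\<close> are simply conceded. Otherwise
  \<open>x\<close> and \<open>v\<close> both lie in the root component \<open>Q\<close> of the graph
  cut at \<open>z\<close>. The insertion then takes place inside \<open>Q\<close>, so
  \<open>Q\<close> stays closed and still separates \<open>z\<close> from its neighbour.\<close>

lemma Lset_ins: "Lset q N \<tau> \<subseteq> Lset q N \<sigma> \<union> {x, y, v, \<sigma> 0 v} \<times> {i} \<union> Sep q N \<sigma> x \<union> Sep q N \<sigma> v"
proof (rule subrelI, rule ccontr)
  fix z l assume L: "(z, l) \<in> Lset q N \<tau>"
    and no: "(z, l) \<notin> Lset q N \<sigma> \<union> {x, y, v, \<sigma> 0 v} \<times> {i} \<union> Sep q N \<sigma> x \<union> Sep q N \<sigma> v"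
  have z: "z < N" "l \<in> {1..q}" "\<tau> l z \<noteq> \<tau> 0 z" "\<tau> l z \<in> orb (cut \<tau> z l) {..q} z"
    using L by (auto simp: Lset_def)
  have ex: "\<not> (l = i \<and> z \<in> {x, y, v, \<sigma> 0 v})" using no by auto
  have zV: "z \<in> V" using z by simp
  let ?C = "{..q}"
  let ?r = "cut \<sigma> z l" and ?r' = "cut \<tau> z l"
  interpret cs: cut_at \<sigma> V z l by (rule gem_cut_at[OF coloured_gem[OF cg] zV z(2)])
  interpret ct: cut_at \<tau> V z l by (rule gem_cut_at[OF gem_ins zV z(2)])
  have invr: "inv_on ?r ?C V" by (rule cs.inv_on_cut[OF inv])
  have invr': "inv_on ?r' ?C V" by (rule ct.inv_on_cut[OF inv_ins])
  define Q where "Q = orb ?r ?C 0"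
  have N0: "0 \<in> V" using x by simp
  have QV: "Q \<subseteq> V" unfolding Q_def by (rule orb_in[OF invr N0])
  have xQ: "x \<in> Q" and vQ: "v \<in> Q" using no z(1,2) by (auto simp: Sep_def Q_def)
  have Qstep: "?r c u \<in> Q" if "u \<in> Q" "c \<in> ?C" for u c using that unfolding Q_def by (rule orb_step)
  have Qorb: "orb ?r C u \<subseteq> Q" if "u \<in> Q" "C \<subseteq> ?C" for u C
    by (rule orb_subset[OF that(1)]) (use Qstep that(2) in blast)
  have Q0: "\<sigma> 0 u \<in> Q" if "u \<in> Q" for u using Qstep[OF that, of 0] cs.cut_vals(5) by simp
  have yQ: "y \<in> Q" using Q0[OF xQ] .
  have lq: "l \<le> q" "l \<noteq> 0" using z(2) by auto
  \<comment> \<open>A trivial incidence can become nontrivial only at the four rewired vertices. The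
    vertex \<open>b\<close>, which is not conceded outright, is covered because triviality there
    means that \<open>b\<close> equals \<open>\<sigma> 0 v\<close>.\<close>
  have nts: "\<sigma> l z \<noteq> \<sigma> 0 z"
  proof
    assume tr: "\<sigma> l z = \<sigma> 0 z"
    show False
    proof (cases "l = i")
      case True
      then have "z \<notin> {x, y, v, b}"
      proof -
        have "z \<noteq> b"
        proof
          assume zb: "z = b"
          then have "\<sigma> 0 b = v" using tr True facts by simp
          then have "\<sigma> 0 v = b" using inv_onD(2)[OF inv, of 0 b] facts by auto
          then show False using ex True zb by simp
        qed
        then show ?thesis using ex True by auto
      qed
      then have "\<tau> l z = \<sigma> l z" using ins_away by simp
      then show False using z(3) tr ins_vals(5) by simp
    next
      case False
      then show False using z(3) tr ins_other[of l] ins_vals(5) by simp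
    qed
  qed
  have discon: "\<sigma> l z \<notin> orb ?r ?C z" using no z(1,2) nts by (auto simp: Lset_def)
  have split: "V = orb ?r ?C z \<union> orb ?r ?C (\<sigma> l z)"
    using cs.orb_uncut[OF inv] lq coloured_graph_conn[OF cg z(1)] by simp
  \<comment> \<open>Only for \<open>c = l = i\<close> do the cut and the insertion rewire the same
    colour and may interfere. In that case orbits of the colours 0 and i are compared instead of the
    maps.\<close>
  have closed: "?r' c u \<in> Q" if u: "u \<in> Q" and c: "c \<in> ?C" for u c
  proof -
    have uV: "u \<in> V" using u QV by blast
    consider "c = 0" | "c \<noteq> 0" "c \<noteq> l" "c \<noteq> i" | "c = i" "c \<noteq> l" | "c = l" "l \<noteq> i" | "c = l" "l = i" by blast
    then show ?thesis
    proof cases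
      case 1
      then show ?thesis using ct.cut_vals(5) ins_vals(5) Q0[OF u] by simp
    next
      case 2
      then have "?r' c u = ?r c u" using cut_other[of c l] ins_other[of c] by simp
      then show ?thesis using Qstep[OF u c] by simp
    next
      case 3
      have bQ: "b \<in> Q" using Qstep[OF vQ c] 3 cut_other[of c l \<sigma> z] by simp
      have "?r' c u = \<tau> i u" using 3 cut_other[of c l \<tau> z] by simp
      moreover have "\<tau> i u \<in> Q"
      proof (cases "u \<in> {x, y, v, b}")
        case True
        then show ?thesis using ins_vals xQ yQ vQ bQ by auto
      next
        case False
        then have "\<tau> i u = ?r c u" using ins_away[of u i] 3 cut_other[of c l \<sigma> z] by simp
        then show ?thesis using Qstep[OF u c] by simp
      qed
      ultimately show ?thesis by simp
    next
      case 4
      then have "?r' c u = ?r c u" unfolding cut_def using ins_other[of l] ins_vals(5) by simp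
      then show ?thesis using Qstep[OF u c] by simp
    next
      case 5
      have t0: "\<tau> 0 z = \<sigma> 0 z" using ins_vals(5) by simp
      have il: "{0, i} \<subseteq> ?C" "0 \<in> {0, i}" "i \<in> {0, i}" using i0 by auto
      have inv2: "inv_on \<tau> {0, i} V" by (rule inv_on_mono[OF inv_ins il(1)])
      have step: "?r' c u \<in> orb ?r' {0, i} u" using 5 by (intro orb_step) auto
      show ?thesis
      proof (cases "u \<in> {z, \<sigma> 0 z}")
        case True
        have "orb ?r' {0, i} u = {z, \<sigma> 0 z}"
          using True ct.orb_cut_pair[of "{0, l}"] ct.orb_cut_pair_y t0 5 by auto
        moreover have "{z, \<sigma> 0 z} \<subseteq> Q"
        proof -
          have "\<sigma> 0 (\<sigma> 0 z) = z" using cs.basics by simp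
          then show ?thesis using True u Q0[OF u] by auto
        qed
        ultimately show ?thesis using step by blast
      next
        case False
        have o1: "orb ?r' {0, i} u = orb \<tau> {0, i} u - {z, \<sigma> 0 z}"
          using ct.orb_cut_isolate[OF uV] False t0 5 by simp
        have o2: "orb ?r {0, i} w = orb \<sigma> {0, i} w - {z, \<sigma> 0 z}" if "w \<in> V" "w \<notin> {z, \<sigma> 0 z}" for w
          using cs.orb_cut_isolate[OF that] 5 by simp
        show ?thesis
        proof (cases "u \<in> orb \<tau> {0, i} x")
          case True
          have "orb \<tau> {0, i} u = orb \<tau> {0, i} x" by (rule orb_eq[OF inv2 c.xV True])
          also have "\<dots> = orb \<sigma> {0, i} x \<union> orb \<sigma> {0, i} v"
            using c.orb_uncut[OF inv2 il(2,3)] cut_ins ins_vals by simp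
          also have "orb \<sigma> {0, i} x = {x, y}" using c.orb_cut_pair[of "{0, i}"] cut_ins ins_vals(5) by simp
          finally have o3: "orb ?r' {0, i} u = ({x, y} \<union> orb \<sigma> {0, i} v) - {z, \<sigma> 0 z}" using o1 by simp
          have vz: "v \<notin> {z, \<sigma> 0 z}"
          proof
            assume "v \<in> {z, \<sigma> 0 z}"
            moreover have "\<sigma> 0 (\<sigma> 0 z) = z" using cs.basics by simp
            ultimately have "z \<in> {v, \<sigma> 0 v}" by auto
            then show False using ex 5 by auto
          qed
          have "orb \<sigma> {0, i} v - {z, \<sigma> 0 z} \<subseteq> Q"
            using o2[OF _ vz] v(1) Qorb[OF vQ il(1)] by simp
          then have "orb ?r' {0, i} u \<subseteq> Q" unfolding o3 using xQ yQ by auto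
          then show ?thesis by (rule subsetD[OF _ step])
        next
          case F2: False
          have "orb \<tau> {0, i} u = orb \<sigma> {0, i} u"
            using c.orb_uncut_other[OF inv2 il(2) uV F2] cut_ins by simp
          then have "orb ?r' {0, i} u = orb ?r {0, i} u" using o1 o2[OF uV False] by simp
          then have "orb ?r' {0, i} u \<subseteq> Q" using Qorb[OF u il(1)] by simp
          then show ?thesis by (rule subsetD[OF _ step])
        qed
      qed
    qed
  qed
  have same: "\<tau> l z \<in> Q" if "\<sigma> l z \<in> Q" "z \<notin> Q"
  proof (cases "l = i \<and> z \<in> {x, y, v, b}")
    case True
    then have "z = b" using ex by auto
    then show ?thesis using True ins_vals yQ by simp
  next
    case False
    then show ?thesis using ins_away[of z l] ins_other[of l] that by auto
  qed
  have same': "\<tau> l z \<notin> Q" if "\<sigma> l z \<notin> Q" "z \<in> Q"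
  proof (cases "l = i \<and> z \<in> {x, y, v, b}")
    case True
    then have "z = b" using ex by auto
    then have "\<sigma> l z = v" using True facts by simp
    then show ?thesis using that vQ by simp
  next
    case False
    then show ?thesis using ins_away[of z l] ins_other[of l] that by auto
  qed
  have "0 \<in> orb ?r ?C z \<or> 0 \<in> orb ?r ?C (\<sigma> l z)" using split N0 by blast
  then show False
  proof
    assume "0 \<in> orb ?r ?C z"
    then have Qz: "Q = orb ?r ?C z" unfolding Q_def by (rule orb_eq[OF invr zV])
    then have "z \<in> Q" "\<sigma> l z \<notin> Q" using discon by auto
    moreover have "orb ?r' ?C z \<subseteq> Q" by (rule orb_subset) (use closed \<open>z \<in> Q\<close> in auto)
    ultimately show False using same' z(4) by blast
  next
    assume 0: "0 \<in> orb ?r ?C (\<sigma> l z)"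
    have sV: "\<sigma> l z \<in> V" using cs.basics by simp
    have Qa: "Q = orb ?r ?C (\<sigma> l z)" unfolding Q_def by (rule orb_eq[OF invr sV 0])
    then have aQ: "\<sigma> l z \<in> Q" by simp
    have zQ: "z \<notin> Q"
    proof
      assume "z \<in> Q"
      then have "orb ?r ?C z = orb ?r ?C (\<sigma> l z)" unfolding Qa by (rule orb_eq[OF invr sV])
      then show False using discon by simp
    qed
    have "\<tau> l z \<in> Q" by (rule same[OF aQ zQ])
    have "orb ?r' ?C (\<tau> l z) \<subseteq> Q" by (rule orb_subset) (use closed \<open>\<tau> l z \<in> Q\<close> in auto)
    moreover have "z \<in> orb ?r' ?C (\<tau> l z)" by (rule orb_sym[OF invr' zV z(4)])
    ultimately show False using zQ by blast
  qed
qed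

lemma thin_ins:
  assumes "thin q N D s j \<sigma>"
  shows "thin q N D s (Suc j) \<tau>"
  unfolding thin_def
proof (intro conjI allI impI ballI)
  have S: "card (Sep q N \<sigma> w) \<le> D" if "w < N" for w using assms that by (simp add: thin_def)
  show "card (Sep q N \<tau> w) \<le> D" if "w < N" for w
    using card_mono[OF finite_Sep Sep_ins, of w] S[OF that] by simp
  have "card (Lset q N \<tau>) \<le> card (Lset q N \<sigma> \<union> {x, y, v, \<sigma> 0 v} \<times> {i} \<union> Sep q N \<sigma> x \<union> Sep q N \<sigma> v)"
    by (rule card_mono[OF _ Lset_ins]) (use finite_Lset finite_Sep in auto)
  also have "\<dots> \<le> card (Lset q N \<sigma> \<union> {x, y, v, \<sigma> 0 v} \<times> {i} \<union> Sep q N \<sigma> x) + card (Sep q N \<sigma> v)" by (rule card_Un_le)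
  also have "\<dots> \<le> card (Lset q N \<sigma> \<union> {x, y, v, \<sigma> 0 v} \<times> {i}) + card (Sep q N \<sigma> x) + card (Sep q N \<sigma> v)"
    by (intro add_right_mono card_Un_le)
  also have "\<dots> \<le> card (Lset q N \<sigma>) + card ({x, y, v, \<sigma> 0 v} \<times> {i}) + card (Sep q N \<sigma> x) + card (Sep q N \<sigma> v)"
    by (intro add_right_mono card_Un_le)
  also have "\<dots> \<le> j * (2 * D + 4) + 4 + D + D"
  proof (intro add_mono S x v)
    show "card (Lset q N \<sigma>) \<le> j * (2 * D + 4)" using assms by (simp add: thin_def)
    have "card {x, y, v, \<sigma> 0 v} \<le> 4" by (simp add: card_insert_if)
    then show "card ({x, y, v, \<sigma> 0 v} \<times> {i}) \<le> 4"
      unfolding card_cartesian_product by (simp only: card.empty card.insert_remove finite.emptyI) simp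
  qed
  finally show "card (Lset q N \<tau>) \<le> Suc j * (2 * D + 4)" by simp
  show "card (orb \<tau> ({..q} - {c}) w) \<le> 2 ^ Suc j * s" if "c \<in> {1..q}" "w < N" for c w
    using cluster_ins[OF that, of "2 ^ j * s"] assms that(1) by (simp add: thin_def mult.assoc)
qed

end

section \<open>Thinness of graphs of order zero\<close>

fun path_cuts :: "(nat \<Rightarrow> nat \<Rightarrow> nat) \<Rightarrow> nat list \<Rightarrow> (nat \<times> nat) set" where
  "path_cuts \<sigma> [] = {}"
| "path_cuts \<sigma> (j # u) = {walk \<sigma> 0 u, \<sigma> 0 (walk \<sigma> 0 u), walk \<sigma> 0 (j # u), \<sigma> 0 (walk \<sigma> 0 (j # u))} \<times> {j} \<union> path_cuts \<sigma> u"

lemma path_cuts_card: "finite (path_cuts \<sigma> w) \<and> card (path_cuts \<sigma> w) \<le> 4 * length w"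
proof (induction w)
  case (Cons j u)
  let ?S = "{walk \<sigma> 0 u, \<sigma> 0 (walk \<sigma> 0 u), walk \<sigma> 0 (j # u), \<sigma> 0 (walk \<sigma> 0 (j # u))}"
  have "card ?S \<le> 4" by (simp add: card_insert_if)
  moreover have "card (?S \<times> {j}) = card ?S" unfolding card_cartesian_product by simp
  moreover have "card (?S \<times> {j} \<union> path_cuts \<sigma> u) \<le> card (?S \<times> {j}) + card (path_cuts \<sigma> u)" by (rule card_Un_le)
  ultimately have "card (?S \<times> {j} \<union> path_cuts \<sigma> u) \<le> 4 * length (j # u)" using Cons by simp
  moreover have "finite (?S \<times> {j} \<union> path_cuts \<sigma> u)" using Cons by simp
  ultimately show ?case by (simp only: path_cuts.simps)
qed simp

text \<open>A cut of colour i at \<open>x\<close> changes colour i at \<open>x\<close>, at its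
  colour-0 neighbour and at the i-neighbours of these two. The four entries of
  \<open>path_cuts\<close> for a step are the positions of \<open>x\<close> for which the start of
  the step is one of these vertices. Otherwise the whole walk survives.\<close>

lemma walk_avoids_cut:
  assumes cg: "coloured_graph q N \<sigma>" and x: "x < N" and i: "i \<in> {1..q}"
    and "set w \<subseteq> {1..q}" "(x, i) \<notin> path_cuts \<sigma> w"
  shows "walk \<sigma> 0 w < N \<and> walk \<sigma> 0 w \<in> orb (cut \<sigma> x i) {..q} 0"
  using assms(4,5)
proof (induction w)
  case Nil
  then show ?case using x by simp
next
  case (Cons j u)
  have inv: "inv_on \<sigma> {..q} {..<N}" by (rule coloured_graph_inv[OF cg])
  have xV: "x \<in> {..<N}" using x by simp
  interpret cut_at \<sigma> "{..<N}" x i by (rule gem_cut_at[OF coloured_gem[OF cg] xV i])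
  have j: "j \<in> {1..q}" using Cons.prems by simp
  have u: "walk \<sigma> 0 u < N" "walk \<sigma> 0 u \<in> orb \<tau> {..q} 0" using Cons by auto
  let ?p = "\<sigma> 0 (walk \<sigma> 0 u)"
  have p: "?p < N" "\<sigma> 0 ?p = walk \<sigma> 0 u" using inv_onD[OF inv, of 0 "walk \<sigma> 0 u"] u by auto
  have p2: "?p \<in> orb \<tau> {..q} 0" using orb_step[OF u(2), of 0] cut_vals(5) by simp
  let ?r = "\<sigma> j ?p"
  have r: "?r < N" "\<sigma> j ?r = ?p" using inv_onD[OF inv, of j ?p] p j by auto
  have eq: "\<tau> j ?p = ?r"
  proof (cases "j = i")
    case False
    then show ?thesis using cut_other by simp
  next
    case True
    have nx: "x \<notin> {walk \<sigma> 0 u, ?p, ?r, \<sigma> 0 ?r}" using Cons.prems(2) True by auto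
    have "?p \<noteq> x" using nx by auto
    moreover have "?p \<noteq> y" using nx p(2) basics(4) by auto
    moreover have "?p \<noteq> a" using nx basics(5) True by auto
    moreover have "?p \<noteq> b"
    proof
      assume "?p = b"
      then have "?r = y" using basics(6) True by simp
      then have "\<sigma> 0 ?r = x" using basics(4) by simp
      then show False using nx by simp
    qed
    ultimately show ?thesis using cut_val_away[of ?p j] by simp
  qed
  have "\<tau> j ?p \<in> orb \<tau> {..q} 0" by (rule orb_step[OF p2]) (use j in simp)
  then show ?case using eq r by simp
qed

text \<open>\<open>t\<close> is the nearest ancestor of \<open>w\<close>, or \<open>w\<close>
  itself, that is entered through colour c, or else the root. Edges of the other colours stay among
  the descendants of \<open>t\<close> reached without c, and every node accounts for two
  vertices.\<close>

lemma cluster_bound: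
  assumes cg: "coloured_graph q (2 * n) \<sigma>" and A: "A = {1..q}" and e: "enc A n \<sigma> P" and c: "c \<in> A"
    and y: "y < 2 * n" and fine: "\<And>u. u \<in> P \<Longrightarrow> comp_sz c (sub P u) < s"
  shows "card (orb \<sigma> ({..q} - {c}) y) \<le> 2 * s"
proof -
  have qt: "qtree A P" and fP: "finite P" using e by (auto simp: enc_def PN_def qtree_def)
  have inv: "inv_on \<sigma> {..q} {..<2 * n}" by (rule coloured_graph_inv[OF cg])
  have "y \<in> lab \<sigma> 0 ` (P \<times> UNIV)" using e y unfolding enc_def bij_betw_def by auto
  then obtain z where z: "y = lab \<sigma> 0 z" "z \<in> P \<times> UNIV" by (rule imageE)
  define w where "w = fst z"
  define d where "d = snd z"
  have w: "w \<in> P" "y = lab \<sigma> 0 (w, d)" using z by (auto simp: w_def d_def)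
  define t where "t = dropWhile (\<lambda>j. j \<noteq> c) w"
  have tP: "t \<in> P" unfolding t_def by (rule dropWhile_in[OF qt w(1)])
  have ht: "t = [] \<or> (\<exists>t'. t = c # t')"
    unfolding t_def using hd_dropWhile[of "\<lambda>j. j \<noteq> c" w] by (cases "dropWhile (\<lambda>j. j \<noteq> c) w") auto
  let ?U = "{u \<in> sub P t. c \<notin> set u}"
  let ?S = "(\<lambda>(u, d). lab \<sigma> 0 (u @ t, d)) ` (?U \<times> UNIV)"
  have fU: "finite ?U"
  proof -
    have "finite ((\<lambda>u. u @ t) ` sub P t)" by (rule finite_subset[OF _ fP]) (auto simp: sub_def)
    then have "finite (sub P t)" by (rule finite_imageD) (auto simp: inj_on_def)
    then show ?thesis by simp
  qed
  have WP: "walk \<sigma> 0 u < 2 * n" if "u \<in> P" for u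
  proof -
    have "lab \<sigma> 0 (u, False) \<in> {..<2 * n}" using e that unfolding enc_def bij_betw_def by blast
    then show ?thesis by (simp add: lab_def)
  qed
  have s0: "\<sigma> 0 (\<sigma> 0 v) = v" if "v < 2 * n" for v using inv_onD(2)[OF inv, of 0 v] that by simp
  have S_I: "lab \<sigma> 0 (u @ t, d) \<in> ?S" if "u @ t \<in> P" "c \<notin> set u" for u d
    using that by (auto simp: sub_def intro!: image_eqI[of _ _ "(u, d)"])
  have "orb \<sigma> ({..q} - {c}) y \<subseteq> ?S"
  proof (rule orb_subset)
    have "takeWhile (\<lambda>j. j \<noteq> c) w @ t = w" unfolding t_def by simp
    moreover have "c \<notin> set (takeWhile (\<lambda>j. j \<noteq> c) w)" using set_takeWhileD by fastforce
    ultimately show "y \<in> ?S" using S_I[of "takeWhile (\<lambda>j. j \<noteq> c) w" d] w by simp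
    fix v j assume v: "v \<in> ?S" and j: "j \<in> {..q} - {c}"
    obtain u d' where u: "v = lab \<sigma> 0 (u @ t, d')" "u @ t \<in> P" "c \<notin> set u" using v by (auto simp: sub_def)
    show "\<sigma> j v \<in> ?S"
    proof (cases "j = 0")
      case True
      have "\<sigma> j v = lab \<sigma> 0 (u @ t, \<not> d')" using u True s0[OF WP[OF u(2)]] by (cases d') (auto simp: lab_def)
      then show ?thesis using S_I[OF u(2,3)] by simp
    next
      case False
      then have jA: "j \<in> A" "j \<noteq> c" using j by (auto simp: A)
      have dt: "dropWhile ((=) j) t = t" using ht jA by auto
      show ?thesis
      proof (cases d')
        case True
        have "\<sigma> j v = walk \<sigma> 0 (rot P j (u @ t))" using e u jA True by (auto simp: lab_def enc_def)
        moreover have "\<exists>u'. rot P j (u @ t) = u' @ t \<and> c \<notin> set u'"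
        proof (cases "j # u @ t \<in> P")
          case True
          then show ?thesis using u jA by (intro exI[of _ "j # u"]) (auto simp: rot_def)
        next
          case False
          have "dropWhile ((=) j) (u @ t) = dropWhile ((=) j) u @ t"
            using dt by (induction u) auto
          moreover have "c \<notin> set (dropWhile ((=) j) u)" using u(3) set_dropWhileD by metis
          ultimately show ?thesis using False by (auto simp: rot_def)
        qed
        then obtain u' where u': "rot P j (u @ t) = u' @ t" "c \<notin> set u'" by blast
        moreover have "u' @ t \<in> P" using rot_in[OF qt u(2), of j] u' by simp
        ultimately show ?thesis using S_I[of u' False] by (simp add: lab_def)
      next
        case d: False
        have "u @ t \<in> rot P j ` P" using e jA u(2) by (auto simp: enc_def)
        then obtain w' where w': "w' \<in> P" "u @ t = rot P j w'" by blast
        have "\<sigma> j (\<sigma> 0 (walk \<sigma> 0 w')) = v" using e w' jA u(1) d by (auto simp: lab_def enc_def)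
        then have sv: "\<sigma> j v = \<sigma> 0 (walk \<sigma> 0 w')"
          using inv_onD(1)[OF inv, of 0 "walk \<sigma> 0 w'"] inv_onD(2)[OF inv, of j "\<sigma> 0 (walk \<sigma> 0 w')"] WP[OF w'(1)] j by auto
        have "\<exists>u'. w' = u' @ t \<and> c \<notin> set u'"
        proof (cases "j # w' \<in> P")
          case True
          then have eq: "u @ t = j # w'" using w' by (simp add: rot_def)
          then obtain u' where "u = j # u'" using ht jA by (cases u) auto
          then show ?thesis using eq u(3) by auto
        next
          case False
          then have "u @ t = dropWhile ((=) j) w'" using w' by (simp add: rot_def)
          then have "w' = (takeWhile ((=) j) w' @ u) @ t" by (metis append_assoc takeWhile_dropWhile_id)
          moreover have "c \<notin> set (takeWhile ((=) j) w')" using jA set_takeWhileD by fastforce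
          ultimately show ?thesis using u(3) by (metis Un_iff set_append)
        qed
        then obtain u' where u': "w' = u' @ t" "c \<notin> set u'" by blast
        then show ?thesis using S_I[of u' True] w'(1) sv by (simp add: lab_def)
      qed
    qed
  qed
  then have "card (orb \<sigma> ({..q} - {c}) y) \<le> card ?S" by (rule card_mono[rotated]) (use fU in simp)
  also have "\<dots> \<le> card (?U \<times> (UNIV :: bool set))" by (rule card_image_le) (use fU in simp)
  also have "\<dots> = 2 * comp_sz c (sub P t)" by (simp add: card_cartesian_product comp_sz_def)
  finally show ?thesis using fine[OF tP] by simp
qed

text \<open>No incidence lies on a cycle, as cutting it would give a graph of negative
  order.\<close>

lemma order0_thin:
  assumes s: "\<sigma> \<in> GK \<beta> q n 0" and q: "1 \<le> q" and A: "A = {1..q}" and e: "enc A n \<sigma> P" and f: "fine A h s P"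
  shows "thin q (2 * n) (4 * h) (2 * s) 0 \<sigma>"
proof -
  have cg: "coloured_graph q (2 * n) \<sigma>" using s by (simp add: GK_def)
  have qt: "qtree A P" using e by (auto simp: enc_def PN_def)
  have inv: "inv_on \<sigma> {..q} {..<2 * n}" by (rule coloured_graph_inv[OF cg])
  have Sep: "card (Sep q (2 * n) \<sigma> y) \<le> 4 * h" if y: "y < 2 * n" for y
  proof -
    have "y \<in> lab \<sigma> 0 ` (P \<times> UNIV)" using e y unfolding enc_def bij_betw_def by auto
    then obtain z where z: "y = lab \<sigma> 0 z" "z \<in> P \<times> UNIV" by (rule imageE)
    define w where "w = fst z"
    have w: "w \<in> P" "y = lab \<sigma> 0 (w, snd z)" using z by (auto simp: w_def)
    have wA: "set w \<subseteq> {1..q}" using qt w A by (auto simp: qtree_def)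
    have "Sep q (2 * n) \<sigma> y \<subseteq> path_cuts \<sigma> w"
    proof (rule subrelI, rule ccontr)
      fix x i assume xi: "(x, i) \<in> Sep q (2 * n) \<sigma> y" and no: "(x, i) \<notin> path_cuts \<sigma> w"
      then have x: "x < 2 * n" "i \<in> {1..q}" "y \<notin> orb (cut \<sigma> x i) {..q} 0" by (auto simp: Sep_def)
      have m: "walk \<sigma> 0 w \<in> orb (cut \<sigma> x i) {..q} 0" using walk_avoids_cut[OF cg x(1,2) wA no] by blast
      have "cut \<sigma> x i 0 (walk \<sigma> 0 w) \<in> orb (cut \<sigma> x i) {..q} 0" by (rule orb_step[OF m]) simp
      moreover have "cut \<sigma> x i 0 = \<sigma> 0" using x(2) by (intro cut_other) auto
      ultimately have "y \<in> orb (cut \<sigma> x i) {..q} 0" using m w(2) by (auto simp: lab_def)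
      then show False using x(3) by blast
    qed
    then have "card (Sep q (2 * n) \<sigma> y) \<le> card (path_cuts \<sigma> w)" using path_cuts_card by (intro card_mono) auto
    also have "\<dots> \<le> 4 * length w" using path_cuts_card by blast
    also have "\<dots> \<le> 4 * h" using f w(1) by (auto simp: fine_def less_imp_le)
    finally show ?thesis .
  qed
  have L: "Lset q (2 * n) \<sigma> = {}"
  proof (rule ccontr)
    assume "Lset q (2 * n) \<sigma> \<noteq> {}"
    then obtain x i where "x < 2 * n" "i \<in> {1..q}" "\<sigma> i x \<noteq> \<sigma> 0 x" "\<sigma> i x \<in> orb (cut \<sigma> x i) {..q} x"
      by (auto simp: Lset_def)
    from GK_cut(1)[OF s this q] show False by simp
  qed
  have C: "card (orb \<sigma> ({..q} - {c}) y) \<le> 2 ^ 0 * (2 * s)" if "c \<in> {1..q}" "y < 2 * n" for c y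
    using cluster_bound[OF cg A e _ that(2), of c s] f that(1) A by (simp add: fine_def)
  show ?thesis unfolding thin_def using Sep L C by simp
qed

section \<open>Comparing consecutive orders\<close>

lemma GK_ex_cut:
  assumes s: "\<sigma> \<in> GK \<beta> q n (Suc k)" and q: "1 \<le> q"
  shows "\<exists>x i. x < 2 * n \<and> i \<in> {1..q} \<and> \<sigma> i x \<noteq> \<sigma> 0 x \<and> \<sigma> i x \<in> orb (cut \<sigma> x i) {..q} x"
proof (rule ccontr)
  assume no: "\<not> ?thesis"
  have cg: "coloured_graph q (2 * n) \<sigma>" and F: "F0 q (2 * n) \<sigma> + Suc k = (q - 1) * n + 1" using s by (auto simp: GK_def)
  have g: "gem {..<2 * n} \<sigma> {1..q}" by (rule coloured_gem[OF cg])
  have inv: "inv_on \<sigma> {..q} {..<2 * n}" by (rule coloured_graph_inv[OF cg])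
  have I: "insert 0 {1..q} = {..q}" by auto
  have ac: "acyc {..<2 * n} \<sigma> {1..q}" unfolding acyc_def I
  proof (intro ballI impI notI)
    fix x i assume "x \<in> {..<2 * n}" "i \<in> {1..q}" "\<sigma> i x \<noteq> \<sigma> 0 x" "\<sigma> i x \<in> orb (cut \<sigma> x i) {..q} x"
    then show False using no by (metis lessThan_iff)
  qed
  have n: "0 < 2 * n" using cg by (simp add: coloured_graph_def)
  have "card (cls \<sigma> {..q} {..<2 * n}) \<ge> 1"
    using n by (simp add: cls_def Suc_le_eq card_gt_0_iff lessThan_empty_iff)
  then have "2 * n + 2 * F0 q (2 * n) \<sigma> \<ge> 2 + q * (2 * n)"
    using excess[OF g] ac unfolding I F0_eq_cls[OF inv] by simp
  moreover have "q * (2 * n) = 2 * ((q - 1) * n) + 2 * n" using q by (cases q) auto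
  ultimately show False using F by simp
qed

text \<open>In the bipartite case \<open>v\<close> must have the colour opposite to that of
  \<open>x\<close>; there are n such vertices, and one of them is the excluded
  \<open>\<sigma> 0 x\<close>.\<close>

lemma GK_ins:
  assumes s: "\<sigma> \<in> GK \<beta> q n k" and x: "x < 2 * n" and i: "i \<in> {1..q}" and tr: "\<sigma> i x = \<sigma> 0 x" and k: "k \<le> (q - 1) * n"
  shows "\<exists>Ad. Ad \<subseteq> {v. v < 2 * n \<and> v \<noteq> x \<and> v \<noteq> \<sigma> 0 x} \<and> n - 1 \<le> card Ad \<and>
    (\<forall>v\<in>Ad. ins \<sigma> x i v \<in> GK \<beta> q n (Suc k))"
proof -
  have cg: "coloured_graph q (2 * n) \<sigma>" and F: "F0 q (2 * n) \<sigma> + k = (q - 1) * n + 1" using s by (auto simp: GK_def)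
  have inv: "inv_on \<sigma> {..q} {..<2 * n}" by (rule coloured_graph_inv[OF cg])
  have y: "\<sigma> 0 x < 2 * n" "\<sigma> 0 x \<noteq> x" using inv_onD[OF inv, of 0 x] x by auto
  have I: "insertion q (2 * n) \<sigma> x i v" if "v < 2 * n" "v \<noteq> x" "v \<noteq> \<sigma> 0 x" for v
    using cg x i tr that by unfold_locales
  have Fi: "coloured_graph q (2 * n) (ins \<sigma> x i v) \<and> F0 q (2 * n) (ins \<sigma> x i v) + Suc k = (q - 1) * n + 1"
    if "v < 2 * n" "v \<noteq> x" "v \<noteq> \<sigma> 0 x" for v
    using insertion.coloured_ins[OF I[OF that]] insertion.F0_ins[OF I[OF that]] F by simp
  show ?thesis
  proof (cases \<beta>)
    case False
    let ?Ad = "{..<2 * n} - {x, \<sigma> 0 x}"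
    have "card ?Ad = 2 * n - 2" using x y by (simp add: card_Diff_subset)
    then have "n - 1 \<le> card ?Ad" by simp
    then show ?thesis using Fi False by (intro exI[of _ ?Ad]) (auto simp: GK_def)
  next
    case True
    then obtain bl :: "nat \<Rightarrow> bool" where bl0: "bl 0" and bl: "\<And>c v. c \<le> q \<Longrightarrow> v < 2 * n \<Longrightarrow> bl (\<sigma> c v) \<noteq> bl v"
      using s unfolding GK_def bipartite_graph_def by auto
    let ?P = "{v. v < 2 * n \<and> bl v \<noteq> bl x}" and ?R = "{v. v < 2 * n \<and> bl v = bl x}"
    let ?Ad = "?P - {\<sigma> 0 x}"
    have "bij_betw (\<sigma> 0) ?P ?R"
      by (rule bij_betw_byWitness[where f' = "\<sigma> 0"])
         (use inv_onD[OF inv, of 0] bl[of 0] in auto)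
    then have "card ?P = card ?R" by (rule bij_betw_same_card)
    moreover have "card (?P \<union> ?R) = card ?P + card ?R" by (rule card_Un_disjoint) auto
    moreover have "?P \<union> ?R = {..<2 * n}" by auto
    ultimately have "card ?P = n" by simp
    then have "n - 1 \<le> card ?Ad" using card_Diff_subset[of "{\<sigma> 0 x}" ?P] by (simp add: card_Diff_singleton_if)
    moreover have "ins \<sigma> x i v \<in> GK \<beta> q n (Suc k)" if v: "v \<in> ?Ad" for v
    proof -
      have v': "v < 2 * n" "v \<noteq> x" "v \<noteq> \<sigma> 0 x" "bl v \<noteq> bl x" using v by auto
      have "bipartite_graph q (2 * n) (ins \<sigma> x i v)"
        by (rule insertion.bipartite_ins[OF I[OF v'(1-3)], of bl]) (use bl0 bl v' in auto)
      then show ?thesis using Fi[OF v'(1-3)] by (simp add: GK_def)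
    qed
    ultimately show ?thesis by (intro exI[of _ ?Ad]) auto
  qed
qed

text \<open>If no 0i-cycle had length two, each would have at least four vertices and there would be
  at most q n / 2 of them, whereas order k requires (q - 1) n + 1 - k. For q at least 3 and 2 k
  \<le> n this is impossible.\<close>

lemma GK_ex_trivial:
  assumes s: "\<sigma> \<in> GK \<beta> q n k" and q: "3 \<le> q" and n: "2 * k \<le> n"
  shows "\<exists>x i. x < 2 * n \<and> i \<in> {1..q} \<and> \<sigma> i x = \<sigma> 0 x"
proof (rule ccontr)
  assume no: "\<not> ?thesis"
  have cg: "coloured_graph q (2 * n) \<sigma>" and F: "F0 q (2 * n) \<sigma> + k = (q - 1) * n + 1" using s by (auto simp: GK_def)
  have inv: "inv_on \<sigma> {..q} {..<2 * n}" by (rule coloured_graph_inv[OF cg])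
  have "4 * card (cls \<sigma> {0, i} {..<2 * n}) \<le> 2 * n" if i: "i \<in> {1..q}" for i
  proof -
    have "4 * card (cls \<sigma> {0, i} {..<2 * n}) \<le> (\<Sum>v\<in>{..<2 * n}. if \<sigma> i v = \<sigma> 0 v then 2 else 1)"
      by (rule card_cls_le_weight) (use i in \<open>auto intro: inv_on_mono[OF inv]\<close>)
    also have "\<dots> = (\<Sum>v\<in>{..<2 * n}. 1)" by (rule sum.cong) (use no i in auto)
    finally show ?thesis by simp
  qed
  then have "(\<Sum>i\<in>{1..q}. 4 * card (cls \<sigma> {0, i} {..<2 * n})) \<le> (\<Sum>i\<in>{1..q}. 2 * n)" by (rule sum_mono)
  then have "4 * F0 q (2 * n) \<sigma> \<le> q * (2 * n)" unfolding F0_eq_cls[OF inv] by (simp add: sum_distrib_left)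
  moreover obtain r where r: "q = r + 3" using q by (metis add.commute le_Suc_ex)
  moreover have "(r + 3) * (2 * n) = 2 * (r * n) + 6 * n" "(r + 3 - 1) * n = r * n + 2 * n" by (auto simp: algebra_simps)
  ultimately have "4 * F0 q (2 * n) \<sigma> \<le> 2 * (r * n) + 6 * n" "F0 q (2 * n) \<sigma> + k = r * n + 2 * n + 1" using F by auto
  then show False using n by linarith
qed

text \<open>Every graph is the cut of one of the next order, at one of 2 n q incidences. This is the
  lower bound on graphs of positive order that makes an exact enumeration dispensable.\<close>

lemma card_GK_mono:
  assumes q: "3 \<le> q" and n: "2 * k \<le> n" "2 \<le> n"
  shows "card (GK \<beta> q n k) \<le> (2 * n * q) * card (GK \<beta> q n (Suc k))"
proof -
  let ?D = "GK \<beta> q n (Suc k) \<times> ({..<2 * n} \<times> {1..q})"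
  have sub: "GK \<beta> q n k \<subseteq> (\<lambda>(\<tau>, x, i). cut \<tau> x i) ` ?D"
  proof
    fix \<sigma> assume s: "\<sigma> \<in> GK \<beta> q n k"
    obtain x i where xi: "x < 2 * n" "i \<in> {1..q}" "\<sigma> i x = \<sigma> 0 x" using GK_ex_trivial[OF s q n(1)] by blast
    have "k \<le> (q - 1) * n"
    proof -
      have "1 * n \<le> (q - 1) * n" using q by (intro mult_le_mono1) simp
      then show ?thesis using n by linarith
    qed
    from GK_ins[OF s xi this] obtain Ad where Ad: "Ad \<subseteq> {v. v < 2 * n \<and> v \<noteq> x \<and> v \<noteq> \<sigma> 0 x}" "n - 1 \<le> card Ad"
      "\<forall>v\<in>Ad. ins \<sigma> x i v \<in> GK \<beta> q n (Suc k)" by blast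
    have "Ad \<noteq> {}" using Ad(2) n(2) by auto
    then obtain v where vA: "v \<in> Ad" by blast
    have cg: "coloured_graph q (2 * n) \<sigma>" using s by (simp add: GK_def)
    interpret insertion q "2 * n" \<sigma> x i v
      by unfold_locales (use cg xi Ad(1) vA in auto)
    have "(ins \<sigma> x i v, x, i) \<in> ?D" using bspec[OF Ad(3) vA] xi by auto
    moreover have "\<sigma> = (\<lambda>(\<tau>, x, i). cut \<tau> x i) (ins \<sigma> x i v, x, i)" using cut_ins by simp
    ultimately show "\<sigma> \<in> (\<lambda>(\<tau>, x, i). cut \<tau> x i) ` ?D" by (rule rev_image_eqI)
  qed
  have fin: "finite ?D" using finite_GK by simp
  have "card (GK \<beta> q n k) \<le> card ((\<lambda>(\<tau>, x, i). cut \<tau> x i) ` ?D)" by (rule card_mono[OF _ sub]) (use fin in simp)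
  also have "\<dots> \<le> card ?D" by (rule card_image_le[OF fin])
  also have "\<dots> = (2 * n * q) * card (GK \<beta> q n (Suc k))" by (simp add: card_cartesian_product)
  finally show ?thesis .
qed

text \<open>The exceptional graphs to which the switching argument does not apply.\<close>
definition XK :: "bool \<Rightarrow> nat \<Rightarrow> nat \<Rightarrow> nat \<Rightarrow> nat \<Rightarrow> nat \<Rightarrow> (nat \<Rightarrow> nat \<Rightarrow> nat) set" where
  "XK \<beta> q n D s k = {\<sigma> \<in> GK \<beta> q n k. \<not> thin q (2 * n) D s k \<sigma>}"

lemma finite_XK: "finite (XK \<beta> q n D s k)"
  unfolding XK_def using finite_GK by simp

lemma card_le_ins_image:
  assumes "finite Y" and "\<And>\<sigma>. \<sigma> \<in> S \<Longrightarrow> \<exists>\<tau> x i v. \<tau> \<in> Y \<and> x < N \<and> i \<in> {1..q} \<and> v < N \<and> \<sigma> = ins \<tau> x i v"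
  shows "card S \<le> (N * (q * N)) * card Y"
proof -
  let ?D = "Y \<times> ({..<N} \<times> ({1..q} \<times> {..<N}))"
  let ?f = "\<lambda>(\<tau>, x, i, v). ins \<tau> x i v"
  have sub: "S \<subseteq> ?f ` ?D"
  proof
    fix \<sigma> assume "\<sigma> \<in> S"
    then obtain \<tau> x i v where *: "\<tau> \<in> Y" "x < N" "i \<in> {1..q}" "v < N" "\<sigma> = ins \<tau> x i v" using assms(2) by blast
    then have "(\<tau>, x, i, v) \<in> ?D" by auto
    moreover have "\<sigma> = ?f (\<tau>, x, i, v)" using * by simp
    ultimately show "\<sigma> \<in> ?f ` ?D" by (rule rev_image_eqI)
  qed
  have fin: "finite ?D" using assms(1) by simp
  have "card S \<le> card (?f ` ?D)" by (rule card_mono[OF _ sub]) (use fin in simp)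
  also have "\<dots> \<le> card ?D" by (rule card_image_le[OF fin])
  also have "\<dots> = (N * (q * N)) * card Y" by (simp add: card_cartesian_product)
  finally show ?thesis .
qed

text \<open>Insertions preserve thinness, so cutting a cycle of a graph that is not thin gives
  another such graph, and only x, i and v have to be known to undo the cut.\<close>

lemma card_XK_Suc:
  assumes q: "1 \<le> q"
  shows "card (XK \<beta> q n D s (Suc k)) \<le> (2 * n * (q * (2 * n))) * card (XK \<beta> q n D s k)"
proof (rule card_le_ins_image[OF finite_XK])
  fix \<sigma> assume "\<sigma> \<in> XK \<beta> q n D s (Suc k)"
  then have s: "\<sigma> \<in> GK \<beta> q n (Suc k)" and nt: "\<not> thin q (2 * n) D s (Suc k) \<sigma>" by (auto simp: XK_def)
  obtain x i where xi: "x < 2 * n" "i \<in> {1..q}" "\<sigma> i x \<noteq> \<sigma> 0 x" "\<sigma> i x \<in> orb (cut \<sigma> x i) {..q} x"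
    using GK_ex_cut[OF s q] by blast
  have cg: "coloured_graph q (2 * n) \<sigma>" using s by (simp add: GK_def)
  have t: "cut \<sigma> x i \<in> GK \<beta> q n k" using GK_cut(2)[OF s xi q] by simp
  have cg': "coloured_graph q (2 * n) (cut \<sigma> x i)" using t by (simp add: GK_def)
  note ic = ins_cut[OF cg xi(1-3)]
  have inv: "inv_on \<sigma> {..q} {..<2 * n}" by (rule coloured_graph_inv[OF cg])
  have a: "\<sigma> i x < 2 * n" "\<sigma> i x \<noteq> x" using inv_onD[OF inv, of i x] xi by auto
  have c0: "cut \<sigma> x i 0 = \<sigma> 0" using xi(2) by (intro cut_other) auto
  interpret insertion q "2 * n" "cut \<sigma> x i" x i "\<sigma> i x"
    by unfold_locales (use cg' xi ic a c0 in auto)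
  have "\<not> thin q (2 * n) D s k (cut \<sigma> x i)" using thin_ins ic(1) nt by auto
  then have "cut \<sigma> x i \<in> XK \<beta> q n D s k" using t by (simp add: XK_def)
  then show "\<exists>\<tau> x i v. \<tau> \<in> XK \<beta> q n D s k \<and> x < 2 * n \<and> i \<in> {1..q} \<and> v < 2 * n \<and> \<sigma> = ins \<tau> x i v"
    using xi(1,2) a(1) ic(1) by metis
qed

section \<open>Switching and the limit\<close>

lemma card_Sigma_le:
  assumes "finite X" "\<And>a. a \<in> X \<Longrightarrow> finite (B a) \<and> card (B a) \<le> M"
  shows "finite (Sigma X B) \<and> card (Sigma X B) \<le> card X * M"
proof
  show "finite (Sigma X B)" using assms by (intro finite_SigmaI) auto
  have "card (Sigma X B) = (\<Sum>a\<in>X. card (B a))" using assms by (intro card_SigmaI) auto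
  also have "\<dots> \<le> (\<Sum>a\<in>X. M)" using assms by (intro sum_mono) auto
  finally show "card (Sigma X B) \<le> card X * M" by simp
qed

lemma bchoice3:
  assumes "\<forall>x\<in>S. \<exists>a b c. R x a b c"
  shows "\<exists>f g h. \<forall>x\<in>S. R x (f x) (g x) (h x)"
  using assms by metis

definition all_colours_on_cycles :: "nat \<Rightarrow> nat \<Rightarrow> (nat \<Rightarrow> nat \<Rightarrow> nat) \<Rightarrow> bool" where
  "all_colours_on_cycles q n \<sigma> \<longleftrightarrow> (\<forall>c\<in>{1..q}. acyc {..<2 * n} \<sigma> ({1..q} - {c}))"

text \<open>Double counting of pairs of a bad graph and a new endpoint \<open>v\<close>. The image
  of a pair consists of the new graph, the moved incidence, the missing colour and the old endpoint;
  thinness bounds the number of incidences and of endpoints. The last term pays for the bad graphs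
  whose cut is not thin.\<close>

lemma switching_bound:
  assumes q: "3 \<le> q" and k: "k \<le> (q - 1) * n"
  shows "card {\<sigma> \<in> GK \<beta> q n (Suc k). \<not> all_colours_on_cycles q n \<sigma>} * (n - 1)
    \<le> card (GK \<beta> q n (Suc k)) * (Suc k * (2 * D + 4) * (q * (2 ^ k * s)))
      + (2 * n * (q * (2 * n))) * card (XK \<beta> q n D s k) * (n - 1)"
proof -
  let ?Bd = "{\<sigma> \<in> GK \<beta> q n (Suc k). \<not> all_colours_on_cycles q n \<sigma>}"
  have q1: "1 \<le> q" using q by simp
  have ex: "\<forall>\<sigma>\<in>?Bd. \<exists>c x i. c \<in> {1..q} \<and> i \<in> {1..q} \<and> x < 2 * n \<and> \<sigma> i x \<noteq> \<sigma> 0 x \<and>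
      \<sigma> i x \<in> orb (cut \<sigma> x i) ({..q} - {c}) x"
  proof
    fix \<sigma> assume bd: "\<sigma> \<in> ?Bd"
    obtain c where c: "c \<in> {1..q}" "\<not> acyc {..<2 * n} \<sigma> ({1..q} - {c})"
      using bd by (auto simp: all_colours_on_cycles_def)
    from c(2) obtain x i where xi: "x < 2 * n" "i \<in> {1..q} - {c}" "\<sigma> i x \<noteq> \<sigma> 0 x"
      "\<sigma> i x \<in> orb (cut \<sigma> x i) (insert 0 ({1..q} - {c})) x"
      unfolding acyc_def by blast
    have "insert 0 ({1..q} - {c}) = {..q} - {c}" using c(1) by auto
    with c(1) xi show "\<exists>c x i. c \<in> {1..q} \<and> i \<in> {1..q} \<and> x < 2 * n \<and> \<sigma> i x \<noteq> \<sigma> 0 x \<and>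
      \<sigma> i x \<in> orb (cut \<sigma> x i) ({..q} - {c}) x" by (intro exI[of _ c] exI[of _ x] exI[of _ i]) simp
  qed
  from bchoice3[OF ex] obtain cf xf jf where f0: "\<forall>\<sigma>\<in>?Bd. cf \<sigma> \<in> {1..q} \<and> jf \<sigma> \<in> {1..q} \<and> xf \<sigma> < 2 * n \<and>
      \<sigma> (jf \<sigma>) (xf \<sigma>) \<noteq> \<sigma> 0 (xf \<sigma>) \<and> \<sigma> (jf \<sigma>) (xf \<sigma>) \<in> orb (cut \<sigma> (xf \<sigma>) (jf \<sigma>)) ({..q} - {cf \<sigma>}) (xf \<sigma>)"
    by (elim exE) (rule that)
  note f = bspec[OF f0]
  define ct where "ct \<sigma> = cut \<sigma> (xf \<sigma>) (jf \<sigma>)" for \<sigma>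
  define af where "af \<sigma> = \<sigma> (jf \<sigma>) (xf \<sigma>)" for \<sigma>
  have facts: "coloured_graph q (2 * n) \<sigma>" "ct \<sigma> \<in> GK \<beta> q n k" "ins (ct \<sigma>) (xf \<sigma>) (jf \<sigma>) (af \<sigma>) = \<sigma>"
    "ct \<sigma> (jf \<sigma>) (xf \<sigma>) = ct \<sigma> 0 (xf \<sigma>)" "af \<sigma> < 2 * n" if s: "\<sigma> \<in> ?Bd" for \<sigma>
  proof -
    have sG: "\<sigma> \<in> GK \<beta> q n (Suc k)" using s by simp
    show cg: "coloured_graph q (2 * n) \<sigma>" using sG by (simp add: GK_def)
    have xi: "xf \<sigma> < 2 * n" "jf \<sigma> \<in> {1..q}" "\<sigma> (jf \<sigma>) (xf \<sigma>) \<noteq> \<sigma> 0 (xf \<sigma>)" using f[OF s] by auto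
    have con: "\<sigma> (jf \<sigma>) (xf \<sigma>) \<in> orb (cut \<sigma> (xf \<sigma>) (jf \<sigma>)) {..q} (xf \<sigma>)"
      using f[OF s] orb_mono[of "{..q} - {cf \<sigma>}" "{..q}" "cut \<sigma> (xf \<sigma>) (jf \<sigma>)" "xf \<sigma>"] by blast
    show "ct \<sigma> \<in> GK \<beta> q n k" using GK_cut(2)[OF sG xi con q1] by (simp add: ct_def)
    show "ins (ct \<sigma>) (xf \<sigma>) (jf \<sigma>) (af \<sigma>) = \<sigma>" "ct \<sigma> (jf \<sigma>) (xf \<sigma>) = ct \<sigma> 0 (xf \<sigma>)"
      unfolding ct_def af_def using ins_cut[OF cg xi] by auto
    show "af \<sigma> < 2 * n" using inv_onD(1)[OF coloured_graph_inv[OF cg], of "jf \<sigma>" "xf \<sigma>"] xi by (auto simp: af_def)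
  qed
  \<comment> \<open>The component containing the old endpoint is small only if the cut graph is
    thin, so the other bad graphs are split off and counted through their cuts.\<close>
  let ?B1 = "{\<sigma> \<in> ?Bd. ct \<sigma> \<in> XK \<beta> q n D s k}" and ?B2 = "{\<sigma> \<in> ?Bd. ct \<sigma> \<notin> XK \<beta> q n D s k}"
  have finBd: "finite ?Bd" using finite_GK by simp
  have B1: "card ?B1 \<le> (2 * n * (q * (2 * n))) * card (XK \<beta> q n D s k)"
  proof (rule card_le_ins_image[OF finite_XK])
    fix \<sigma> assume "\<sigma> \<in> ?B1"
    then have s: "\<sigma> \<in> ?Bd" "ct \<sigma> \<in> XK \<beta> q n D s k" by auto
    show "\<exists>\<tau> x i v. \<tau> \<in> XK \<beta> q n D s k \<and> x < 2 * n \<and> i \<in> {1..q} \<and> v < 2 * n \<and> \<sigma> = ins \<tau> x i v"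
      using s(2) f[OF s(1)] facts(3,5)[OF s(1)]
      by (intro exI[of _ "ct \<sigma>"] exI[of _ "xf \<sigma>"] exI[of _ "jf \<sigma>"] exI[of _ "af \<sigma>"]) simp
  qed
  have thinB: "thin q (2 * n) D s k (ct \<sigma>)" if "\<sigma> \<in> ?B2" for \<sigma>
    using that facts(2)[of \<sigma>] by (auto simp: XK_def)
  have exAd: "\<forall>\<sigma>\<in>?B2. \<exists>Ad. Ad \<subseteq> {v. v < 2 * n \<and> v \<noteq> xf \<sigma> \<and> v \<noteq> ct \<sigma> 0 (xf \<sigma>)} \<and> n - 1 \<le> card Ad \<and>
    (\<forall>v\<in>Ad. ins (ct \<sigma>) (xf \<sigma>) (jf \<sigma>) v \<in> GK \<beta> q n (Suc k))"
  proof
    fix \<sigma> assume "\<sigma> \<in> ?B2"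
    then have sB: "\<sigma> \<in> ?Bd" by simp
    from f[OF sB] have "xf \<sigma> < 2 * n" "jf \<sigma> \<in> {1..q}" by auto
    then show "\<exists>Ad. Ad \<subseteq> {v. v < 2 * n \<and> v \<noteq> xf \<sigma> \<and> v \<noteq> ct \<sigma> 0 (xf \<sigma>)} \<and> n - 1 \<le> card Ad \<and>
    (\<forall>v\<in>Ad. ins (ct \<sigma>) (xf \<sigma>) (jf \<sigma>) v \<in> GK \<beta> q n (Suc k))" by (rule GK_ins[OF facts(2)[OF sB] _ _ facts(4)[OF sB] k])
  qed
  from bchoice[OF exAd] obtain Ad where Ad0: "\<forall>\<sigma>\<in>?B2. Ad \<sigma> \<subseteq> {v. v < 2 * n \<and> v \<noteq> xf \<sigma> \<and> v \<noteq> ct \<sigma> 0 (xf \<sigma>)} \<and> n - 1 \<le> card (Ad \<sigma>) \<and>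
    (\<forall>v\<in>Ad \<sigma>. ins (ct \<sigma>) (xf \<sigma>) (jf \<sigma>) v \<in> GK \<beta> q n (Suc k))" by (elim exE) (rule that)
  note Ad = bspec[OF Ad0]
  have finAd: "finite (Ad \<sigma>)" if "\<sigma> \<in> ?B2" for \<sigma>
    by (rule finite_subset[of _ "{..<2 * n}"]) (use Ad[OF that] in auto)
  let ?O = "\<lambda>\<tau> p c. orb (cut \<tau> (fst p) (snd p)) ({..q} - {c}) (fst p)"
  let ?T3 = "\<lambda>\<tau> p. Sigma {1..q} (?O \<tau> p)"
  let ?Ls = "\<lambda>\<tau>. {p \<in> Lset q (2 * n) \<tau>. thin q (2 * n) D s k (cut \<tau> (fst p) (snd p)) \<and> coloured_graph q (2 * n) (cut \<tau> (fst p) (snd p))}"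
  let ?G = "{\<tau> \<in> GK \<beta> q n (Suc k). thin q (2 * n) D s (Suc k) \<tau>}"
  let ?Tg = "Sigma ?G (\<lambda>\<tau>. Sigma (?Ls \<tau>) (?T3 \<tau>))"
  let ?F = "\<lambda>(\<sigma>, v). (ins (ct \<sigma>) (xf \<sigma>) (jf \<sigma>) v, (xf \<sigma>, jf \<sigma>), cf \<sigma>, af \<sigma>)"
  have T3: "finite (?T3 \<tau> p) \<and> card (?T3 \<tau> p) \<le> q * (2 ^ k * s)" if p: "p \<in> ?Ls \<tau>" for \<tau> p
  proof -
    have O: "finite (?O \<tau> p c) \<and> card (?O \<tau> p c) \<le> 2 ^ k * s" if c: "c \<in> {1..q}" for c
    proof
      have pN: "fst p < 2 * n" using p by (auto simp: Lset_def)
      have inv: "inv_on (cut \<tau> (fst p) (snd p)) {..q} {..<2 * n}" using p coloured_graph_inv by blast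
      have "?O \<tau> p c \<subseteq> {..<2 * n}" by (rule orb_in[OF inv_on_mono[OF inv]]) (use pN in auto)
      then show "finite (?O \<tau> p c)" by (rule finite_subset) simp
      show "card (?O \<tau> p c) \<le> 2 ^ k * s" using p pN c by (simp add: thin_def)
    qed
    have "finite (?T3 \<tau> p) \<and> card (?T3 \<tau> p) \<le> card {1..q} * (2 ^ k * s)" by (rule card_Sigma_le[OF finite_atLeastAtMost O])
    moreover have "card {1..q} = q" by simp
    ultimately show ?thesis by (simp only:)
  qed
  have T2: "finite (Sigma (?Ls \<tau>) (?T3 \<tau>)) \<and> card (Sigma (?Ls \<tau>) (?T3 \<tau>)) \<le> Suc k * (2 * D + 4) * (q * (2 ^ k * s))"
    if t: "\<tau> \<in> ?G" for \<tau>
  proof -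
    have fL: "finite (?Ls \<tau>)" using finite_Lset by simp
    have S: "finite (Sigma (?Ls \<tau>) (?T3 \<tau>)) \<and> card (Sigma (?Ls \<tau>) (?T3 \<tau>)) \<le> card (?Ls \<tau>) * (q * (2 ^ k * s))"
      by (rule card_Sigma_le[OF fL T3])
    have "card (?Ls \<tau>) \<le> card (Lset q (2 * n) \<tau>)" by (rule card_mono[OF finite_Lset]) auto
    also have "\<dots> \<le> Suc k * (2 * D + 4)" using t by (simp add: thin_def)
    finally have "card (?Ls \<tau>) * (q * (2 ^ k * s)) \<le> Suc k * (2 * D + 4) * (q * (2 ^ k * s))" by (rule mult_le_mono1)
    then show ?thesis using S by (meson le_trans)
  qed
  have fG: "finite ?G" using finite_GK by simp
  have Tg: "finite ?Tg \<and> card ?Tg \<le> card ?G * (Suc k * (2 * D + 4) * (q * (2 ^ k * s)))"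
    by (rule card_Sigma_le[OF fG T2])
  have insB: "insertion q (2 * n) (ct \<sigma>) (xf \<sigma>) (jf \<sigma>) v" if s: "\<sigma> \<in> ?B2" and v: "v \<in> Ad \<sigma>" for \<sigma> v
  proof -
    have sB: "\<sigma> \<in> ?Bd" using s by simp
    show ?thesis
      by unfold_locales (use facts(2,4)[OF sB] f[OF sB] Ad[OF s] v in \<open>auto simp: GK_def\<close>)
  qed
  \<comment> \<open>Cutting the new graph at the recorded incidence restores the cut graph, its
    i-neighbour of \<open>x\<close> is \<open>v\<close>, and inserting at the recorded endpoint
    restores the old graph.\<close>
  have inj: "inj_on ?F (Sigma ?B2 Ad)"
  proof (rule inj_onI, clarify)
    fix \<sigma> v \<sigma>' v'
    assume s: "\<sigma> \<in> GK \<beta> q n (Suc k)" "\<not> all_colours_on_cycles q n \<sigma>" "ct \<sigma> \<notin> XK \<beta> q n D s k" "v \<in> Ad \<sigma>"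
      and s': "\<sigma>' \<in> GK \<beta> q n (Suc k)" "\<not> all_colours_on_cycles q n \<sigma>'" "ct \<sigma>' \<notin> XK \<beta> q n D s k" "v' \<in> Ad \<sigma>'"
      and eq: "ins (ct \<sigma>) (xf \<sigma>) (jf \<sigma>) v = ins (ct \<sigma>') (xf \<sigma>') (jf \<sigma>') v'" "xf \<sigma> = xf \<sigma>'" "jf \<sigma> = jf \<sigma>'" "af \<sigma> = af \<sigma>'"
    have B: "\<sigma> \<in> ?B2" "\<sigma>' \<in> ?B2" using s s' by auto
    have ctq: "ct \<sigma> = ct \<sigma>'"
      using insertion.cut_ins[OF insB[OF B(1) s(4)]] insertion.cut_ins[OF insB[OF B(2) s'(4)]] eq by simp
    moreover have "v = v'"
      using insertion.ins_vals(1)[OF insB[OF B(1) s(4)]] insertion.ins_vals(1)[OF insB[OF B(2) s'(4)]] eq by simp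
    moreover have "\<sigma> = \<sigma>'"
    proof -
      have sB: "\<sigma> \<in> ?Bd" "\<sigma>' \<in> ?Bd" using s s' by auto
      have "\<sigma> = ins (ct \<sigma>) (xf \<sigma>) (jf \<sigma>) (af \<sigma>)" by (rule facts(3)[OF sB(1), symmetric])
      also have "\<dots> = ins (ct \<sigma>') (xf \<sigma>') (jf \<sigma>') (af \<sigma>')" by (simp only: ctq eq(2-4))
      also have "\<dots> = \<sigma>'" by (rule facts(3)[OF sB(2)])
      finally show ?thesis .
    qed
    ultimately show "\<sigma> = \<sigma>' \<and> v = v'" by simp
  qed
  have img: "?F ` (Sigma ?B2 Ad) \<subseteq> ?Tg"
  proof (rule image_subsetI)
    fix z assume "z \<in> Sigma ?B2 Ad"
    then obtain \<sigma> v where z: "z = (\<sigma>, v)" "\<sigma> \<in> ?B2" "v \<in> Ad \<sigma>" by blast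
    have sB: "\<sigma> \<in> ?Bd" using z(2) by simp
    note fs = f[OF sB] and ctG = facts(2)[OF sB]
    interpret insertion q "2 * n" "ct \<sigma>" "xf \<sigma>" "jf \<sigma>" v by (rule insB[OF z(2,3)])
    have tG: "\<tau> \<in> ?G" using Ad[OF z(2)] z(3) thin_ins[OF thinB[OF z(2)]] by blast
    have cgc: "coloured_graph q (2 * n) (ct \<sigma>)" using ctG by (simp add: GK_def)
    \<comment> \<open>The moved incidence lies on a cycle because the graph was still connected
      after the cut.\<close>
    have "\<tau> (jf \<sigma>) (xf \<sigma>) \<in> orb (cut \<tau> (xf \<sigma>) (jf \<sigma>)) {..q} (xf \<sigma>)"
      unfolding cut_ins coloured_graph_conn[OF cgc x] ins_vals(1) using v by simp
    then have "(xf \<sigma>, jf \<sigma>) \<in> Lset q (2 * n) \<tau>" using x i nontriv by (simp add: Lset_def)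
    then have L: "(xf \<sigma>, jf \<sigma>) \<in> ?Ls \<tau>" using thinB[OF z(2)] cgc cut_ins by simp
    have "af \<sigma> \<in> ?O \<tau> (xf \<sigma>, jf \<sigma>) (cf \<sigma>)" using fs cut_ins by (simp add: af_def ct_def)
    then have TT: "(cf \<sigma>, af \<sigma>) \<in> ?T3 \<tau> (xf \<sigma>, jf \<sigma>)" using fs by (intro SigmaI) auto
    from tG L TT show "?F z \<in> ?Tg" by (simp only: z(1) prod.case mem_Sigma_iff simp_thms)
  qed
  have "card ?B2 * (n - 1) \<le> card (Sigma ?B2 Ad)"
  proof -
    have "card (Sigma ?B2 Ad) = (\<Sum>\<sigma>\<in>?B2. card (Ad \<sigma>))"
    proof (rule card_SigmaI)
      show "finite ?B2" by (rule finite_subset[OF _ finBd]) auto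
      show "\<forall>\<sigma>\<in>?B2. finite (Ad \<sigma>)" using finAd by (rule ballI)
    qed
    also have "\<dots> \<ge> (\<Sum>\<sigma>\<in>?B2. n - 1)" by (rule sum_mono) (use Ad in blast)
    finally show ?thesis by simp
  qed
  also have "\<dots> \<le> card ?Tg" by (rule card_inj_on_le[OF inj img]) (use Tg in blast)
  also have "\<dots> \<le> card ?G * (Suc k * (2 * D + 4) * (q * (2 ^ k * s)))" using Tg by blast
  also have "\<dots> \<le> card (GK \<beta> q n (Suc k)) * (Suc k * (2 * D + 4) * (q * (2 ^ k * s)))"
    by (rule mult_le_mono1[OF card_mono[OF finite_GK]]) auto
  finally have B2: "card ?B2 * (n - 1) \<le> card (GK \<beta> q n (Suc k)) * (Suc k * (2 * D + 4) * (q * (2 ^ k * s)))" .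
  have "card ?Bd = card (?B1 \<union> ?B2)" by (rule arg_cong[of _ _ card]) auto
  also have "\<dots> \<le> card ?B1 + card ?B2" by (rule card_Un_le)
  finally have "card ?Bd * (n - 1) \<le> (card ?B1 + card ?B2) * (n - 1)" by (rule mult_le_mono1)
  also have "\<dots> = card ?B2 * (n - 1) + card ?B1 * (n - 1)" by (simp add: distrib_right)
  also have "\<dots> \<le> card (GK \<beta> q n (Suc k)) * (Suc k * (2 * D + 4) * (q * (2 ^ k * s)))
      + (2 * n * (q * (2 * n))) * card (XK \<beta> q n D s k) * (n - 1)"
    by (rule add_mono[OF B2 mult_le_mono1[OF B1]])
  finally show ?thesis .
qed

lemma card_XK_bound:
  assumes q: "1 \<le> q"
  shows "card (XK \<beta> q n D s k) \<le> (2 * n * (q * (2 * n))) ^ k * card (XK \<beta> q n D s 0)"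
proof (induction k)
  case (Suc k)
  have "card (XK \<beta> q n D s (Suc k)) \<le> (2 * n * (q * (2 * n))) * card (XK \<beta> q n D s k)" by (rule card_XK_Suc[OF q])
  also have "\<dots> \<le> (2 * n * (q * (2 * n))) * ((2 * n * (q * (2 * n))) ^ k * card (XK \<beta> q n D s 0))"
    by (rule mult_le_mono2[OF Suc.IH])
  finally show ?case by (simp only: power_Suc mult.assoc)
qed simp

lemma card_GK_0_bound:
  assumes q: "3 \<le> q" and n: "2 * k \<le> n" "2 \<le> n"
  shows "card (GK \<beta> q n 0) \<le> (2 * n * q) ^ k * card (GK \<beta> q n k)"
  using n(1)
proof (induction k)
  case (Suc k)
  have "card (GK \<beta> q n 0) \<le> (2 * n * q) ^ k * card (GK \<beta> q n k)" using Suc by simp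
  also have "\<dots> \<le> (2 * n * q) ^ k * ((2 * n * q) * card (GK \<beta> q n (Suc k)))"
    by (rule mult_le_mono2[OF card_GK_mono[OF q _ n(2)]]) (use Suc in simp)
  finally show ?case by (simp only: power_Suc mult.assoc mult.left_commute)
qed simp

text \<open>The factor (2n)! occurs both in the upper bound for the exceptional graphs and in the
  lower bound for all graphs of order zero and cancels.\<close>

lemma card_XK_0_bound:
  assumes q: "3 \<le> q" and n: "1 \<le> n"
    and rare: "real (card {P \<in> PN {1..q} n. \<not> fine {1..q} h s P}) \<le> real (card (PN {1..q} n)) * \<rho>" and \<rho>: "0 \<le> \<rho>"
  shows "real (card (XK \<beta> q n (4 * h) (2 * s) 0)) \<le> \<rho> * (2 * real n * real (card (GK \<beta> q n 0)))"
proof -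
  let ?A = "{1..q}"
  let ?Bad = "{P \<in> PN ?A n. \<not> fine ?A h s P}"
  have q1: "1 \<le> q" using q by simp
  have "card (XK \<beta> q n (4 * h) (2 * s) 0) \<le> card ?Bad * fact (2 * n)"
  proof (rule order0_count_upper[OF refl q1])
    fix \<sigma> P assume s: "\<sigma> \<in> XK \<beta> q n (4 * h) (2 * s) 0"
    then have sG: "\<sigma> \<in> GK \<beta> q n 0" "\<not> thin q (2 * n) (4 * h) (2 * s) 0 \<sigma>" by (auto simp: XK_def)
    show "coloured_graph q (2 * n) \<sigma> \<and> F0 q (2 * n) \<sigma> = (q - 1) * n + 1" using sG(1) by (simp add: GK_def)
    assume e: "enc ?A n \<sigma> P"
    have "\<not> fine ?A h s P" using order0_thin[OF sG(1) q1 refl e] sG(2) by blast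
    then show "P \<in> ?Bad" using e by (simp add: enc_def)
  qed auto
  then have "real (card (XK \<beta> q n (4 * h) (2 * s) 0)) \<le> real (card ?Bad * fact (2 * n))" by (simp only: of_nat_le_iff)
  also have "\<dots> = real (card ?Bad) * real (fact (2 * n))" by (rule of_nat_mult)
  also have "\<dots> \<le> (real (card (PN ?A n)) * \<rho>) * real (fact (2 * n))" by (rule mult_right_mono[OF rare]) simp
  also have "\<dots> = \<rho> * real (card (PN ?A n) * fact (2 * n))" by (simp only: of_nat_mult mult_ac)
  also have "real (card (PN ?A n) * fact (2 * n)) \<le> 2 * real n * real (card (GK \<beta> q n 0))"
  proof -
    have "{\<sigma>. coloured_graph q (2 * n) \<sigma> \<and> F0 q (2 * n) \<sigma> = (q - 1) * n + 1 \<and> bipartite_graph q (2 * n) \<sigma>} \<subseteq> GK \<beta> q n 0"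
      by (auto simp: GK_def)
    from card_mono[OF finite_GK this] order0_count_lower[OF refl q1 n]
    have "card (PN ?A n) * fact (2 * n) \<le> 2 * n * card (GK \<beta> q n 0)" by (meson le_trans mult_le_mono2)
    then have "real (card (PN ?A n) * fact (2 * n)) \<le> real (2 * n * card (GK \<beta> q n 0))" by (simp only: of_nat_le_iff)
    then show ?thesis by simp
  qed
  finally show ?thesis using \<rho> by (simp add: mult_left_mono)
qed



section \<open>Asymptotics of the error terms\<close>

lemma null_comparison:
  fixes f g :: "nat \<Rightarrow> real"
  assumes "\<forall>\<^sub>F n in sequentially. norm (f n) \<le> g n" "g \<longlonglongrightarrow> 0"
  shows "f \<longlonglongrightarrow> 0"
  using tendsto_sandwich[of "\<lambda>_. 0" "\<lambda>n. norm (f n)" sequentially g 0] assms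
  by (auto intro: tendsto_norm_zero_cancel)

lemma poly_times_stretched_exp_tendsto_0:
  fixes c :: real
  assumes "0 < c"
  shows "(\<lambda>n. real n ^ m * exp (- (c * real n powr (1/8)))) \<longlonglongrightarrow> 0"
  using assms by real_asymp

text \<open>For t = n^(-3/8) the numerator is at most exp (- n^(3/8)), while the denominator is at
  least exp (- 2 n^(1/4)). Both summands are therefore below a polynomial times exp (- c n^(1/8))
  with c = ln l, which beats every power of n.\<close>

lemma rare_error_tendsto_0:
  fixes l K :: real and q m :: nat
  assumes l: "1 < l" and K: "1 \<le> K"
  shows "(\<lambda>n. real n ^ m * (2 * (real q * real n + 1)\<^sup>2 *
      ((1 - real n powr (-3/8)) ^ nat \<lceil>real n powr (3/4)\<rceil> / (1 - (real n powr (-3/8))\<^sup>2) ^ n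
        + real q * real n * K / l ^ nat \<lceil>real n powr (1/8)\<rceil>))) \<longlonglongrightarrow> 0" (is "?f \<longlonglongrightarrow> 0")
proof -
  define c where "c = ln l"
  have c: "0 < c" using l by (simp add: c_def)
  define C where "C = 2 * (real q + 1)\<^sup>2 * (1 + real q * K)"
  have ev: "\<forall>\<^sub>F n in sequentially. 1 \<le> n \<and> real n powr (-3/4) \<le> 1 / 2 \<and> real n powr (-3/8) \<le> 1 \<and>
      2 * real n powr (1/4) - real n powr (3/8) \<le> - (c * real n powr (1/8))"
  proof (intro eventually_conj)
    show "\<forall>\<^sub>F n in sequentially. 1 \<le> n" by (rule eventually_ge_at_top)
    show "\<forall>\<^sub>F n in sequentially. real n powr (-3/4) \<le> 1 / 2" by real_asymp
    show "\<forall>\<^sub>F n in sequentially. real n powr (-3/8) \<le> 1" by real_asymp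
    show "\<forall>\<^sub>F n in sequentially. 2 * real n powr (1/4) - real n powr (3/8) \<le> - (c * real n powr (1/8))"
      using c by real_asymp
  qed
  have "\<forall>\<^sub>F n in sequentially. norm (?f n) \<le> C * (real n ^ (m + 3) * exp (- (c * real n powr (1/8))))"
    using ev
  proof eventually_elim
    case (elim n)
    let ?t = "real n powr (-3/8)" and ?h = "nat \<lceil>real n powr (3/4)\<rceil>" and ?s = "nat \<lceil>real n powr (1/8)\<rceil>"
    let ?e = "exp (- (c * real n powr (1/8)))"
    have n: "1 \<le> real n" using elim by simp
    have t2: "?t\<^sup>2 = real n powr (-3/4)" using n by (simp add: power2_eq_square flip: powr_add)
    have "(1 - ?t) ^ ?h \<le> exp (- ?t) ^ ?h"
      using exp_ge_add_one_self[of "- ?t"] elim by (intro power_mono) auto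
    also have "\<dots> = exp (- (real ?h * ?t))" by (simp flip: exp_of_nat_mult)
    also have "\<dots> \<le> exp (- (real n powr (3/8)))"
    proof -
      have "real n powr (3/8) = real n powr (3/4) * ?t" using n by (simp flip: powr_add)
      also have "\<dots> \<le> real ?h * ?t" by (intro mult_right_mono) (auto simp: real_nat_ceiling_ge)
      finally show ?thesis by simp
    qed
    finally have num: "(1 - ?t) ^ ?h \<le> exp (- (real n powr (3/8)))" .
    have "exp (- (2 * real n powr (1/4))) \<le> (1 - ?t\<^sup>2) ^ n"
    proof -
      let ?x = "real n powr (-3/4)"
      have x: "0 \<le> ?x" "?x \<le> 1 / 2" using elim by auto
      have "?x * (2 * ?x) \<le> ?x * 1" by (rule mult_left_mono) (use x in auto)
      then have "- (2 * ?x) \<le> - ?x - 2 * ?x\<^sup>2" by (simp add: power2_eq_square)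
      also have "\<dots> \<le> ln (1 - ?x)" by (rule ln_one_minus_pos_lower_bound[OF x])
      finally have "exp (- (2 * ?x)) \<le> 1 - ?x" using x by (subst (asm) ln_ge_iff) auto
      then have "exp (- (2 * ?x)) ^ n \<le> (1 - ?x) ^ n" by (rule power_mono) simp
      moreover have "exp (- (2 * ?x)) ^ n = exp (- (2 * (real n powr 1 * ?x)))" by (simp add: mult_ac flip: exp_of_nat_mult)
      moreover have "real n powr 1 * ?x = real n powr (1/4)" by (simp only: powr_add[symmetric]) simp
      ultimately show ?thesis using t2 by simp
    qed
    then have "(1 - ?t) ^ ?h / (1 - ?t\<^sup>2) ^ n \<le> exp (- (real n powr (3/8))) / exp (- (2 * real n powr (1/4)))"
      using num elim by (intro frac_le) auto
    also have "\<dots> = exp (2 * real n powr (1/4) - real n powr (3/8))" by (simp flip: exp_diff)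
    also have "\<dots> \<le> ?e" using elim by simp
    finally have 1: "(1 - ?t) ^ ?h / (1 - ?t\<^sup>2) ^ n \<le> ?e" .
    have "exp (c * real n powr (1/8)) \<le> exp (c * real ?s)"
      using c real_nat_ceiling_ge[of "real n powr (1/8)"] by simp
    also have "\<dots> = exp c ^ ?s" by (simp only: mult.commute[of c] exp_of_nat_mult)
    also have "\<dots> = l ^ ?s" using l by (simp add: c_def)
    finally have "1 / l ^ ?s \<le> 1 / exp (c * real n powr (1/8))" by (intro divide_left_mono) (use l in auto)
    then have "1 / l ^ ?s \<le> ?e" by (simp add: exp_minus inverse_eq_divide)
    then have "real q * real n * K * (1 / l ^ ?s) \<le> real q * real n * K * ?e" by (rule mult_left_mono) (use K in auto)
    then have 2: "real q * real n * K / l ^ ?s \<le> real q * K * (real n * ?e)" by (simp add: mult_ac)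
    have "?e \<le> real n * ?e" using n by (simp add: mult_le_cancel_right1)
    from add_mono[OF order_trans[OF 1 this] 2] have 3: "(1 - ?t) ^ ?h / (1 - ?t\<^sup>2) ^ n + real q * real n * K / l ^ ?s \<le> (1 + real q * K) * (real n * ?e)"
      by (simp only: distrib_right mult_1)
    have "real q * real n + 1 \<le> (real q + 1) * real n" using n by (simp add: algebra_simps)
    then have "(real q * real n + 1)\<^sup>2 \<le> ((real q + 1) * real n)\<^sup>2" by (rule power_mono) simp
    then have 4: "2 * (real q * real n + 1)\<^sup>2 \<le> 2 * ((real q + 1) * real n)\<^sup>2" by simp
    have tx: "0 \<le> 1 - ?t" "0 \<le> 1 - ?t\<^sup>2" using elim t2 by auto
    have pos: "0 \<le> (1 - ?t) ^ ?h / (1 - ?t\<^sup>2) ^ n + real q * real n * K / l ^ ?s"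
      using l K tx by (intro add_nonneg_nonneg divide_nonneg_nonneg zero_le_power mult_nonneg_nonneg) auto
    have "?f n \<le> real n ^ m * (2 * ((real q + 1) * real n)\<^sup>2 * ((1 + real q * K) * (real n * ?e)))"
      by (intro mult_left_mono mult_mono 3 4) (use pos in auto)
    also have "\<dots> = C * (real n ^ (m + 3) * ?e)" by (simp add: C_def power_add power2_eq_square power3_eq_cube)
    finally have "?f n \<le> C * (real n ^ (m + 3) * ?e)" .
    moreover have "0 \<le> ?f n" using pos by (intro mult_nonneg_nonneg) auto
    ultimately show ?case by simp
  qed
  moreover have "(\<lambda>n. C * (real n ^ (m + 3) * exp (- (c * real n powr (1/8))))) \<longlonglongrightarrow> 0"
    using tendsto_mult_right_zero[OF poly_times_stretched_exp_tendsto_0[OF c]] by blast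
  ultimately show ?thesis by (rule null_comparison)
qed

text \<open>The exponents 3/4 and 1/8 add up to less than 1.\<close>

lemma switching_error_tendsto_0:
  fixes C :: real
  shows "(\<lambda>n. C * (8 * real (nat \<lceil>real n powr (3/4)\<rceil>) + 4) * real (nat \<lceil>real n powr (1/8)\<rceil>) / real (n - 1)) \<longlonglongrightarrow> 0" (is "?f \<longlonglongrightarrow> 0")
proof -
  have "\<forall>\<^sub>F n in sequentially. norm (?f n) \<le> \<bar>C\<bar> * ((8 * (real n powr (3/4) + 1) + 4) * (real n powr (1/8) + 1) / (real n - 1))"
    using eventually_ge_at_top[of 2]
  proof eventually_elim
    case (elim n)
    have c: "real (nat \<lceil>x\<rceil>) \<le> x + 1" if "0 \<le> x" for x :: real using that by linarith
    have "(8 * real (nat \<lceil>real n powr (3/4)\<rceil>) + 4) * real (nat \<lceil>real n powr (1/8)\<rceil>)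
      \<le> (8 * (real n powr (3/4) + 1) + 4) * (real n powr (1/8) + 1)"
    proof (rule mult_mono)
      show "8 * real (nat \<lceil>real n powr (3/4)\<rceil>) + 4 \<le> 8 * (real n powr (3/4) + 1) + 4" by (intro add_right_mono mult_left_mono c powr_ge_zero) simp
      show "real (nat \<lceil>real n powr (1/8)\<rceil>) \<le> real n powr (1/8) + 1" by (rule c[OF powr_ge_zero])
      show "0 \<le> 8 * (real n powr (3/4) + 1) + 4" by (intro add_nonneg_nonneg mult_nonneg_nonneg powr_ge_zero) simp_all
    qed (rule of_nat_0_le_iff)
    then have "\<bar>C\<bar> * ((8 * real (nat \<lceil>real n powr (3/4)\<rceil>) + 4) * real (nat \<lceil>real n powr (1/8)\<rceil>) / (real n - 1))
      \<le> \<bar>C\<bar> * ((8 * (real n powr (3/4) + 1) + 4) * (real n powr (1/8) + 1) / (real n - 1))"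
      using elim by (intro mult_left_mono divide_right_mono) auto
    moreover have m: "real (n - 1) = real n - 1" using elim by simp
    have ab: "0 \<le> (8 * real (nat \<lceil>real n powr (3/4)\<rceil>) + 4) * real (nat \<lceil>real n powr (1/8)\<rceil>) / (real n - 1)"
      using elim by (intro divide_nonneg_nonneg mult_nonneg_nonneg add_nonneg_nonneg of_nat_0_le_iff) simp_all
    have "?f n = C * ((8 * real (nat \<lceil>real n powr (3/4)\<rceil>) + 4) * real (nat \<lceil>real n powr (1/8)\<rceil>) / (real n - 1))"
      by (simp only: m mult.assoc times_divide_eq_right)
    then have "norm (?f n) = \<bar>C\<bar> * ((8 * real (nat \<lceil>real n powr (3/4)\<rceil>) + 4) * real (nat \<lceil>real n powr (1/8)\<rceil>) / (real n - 1))"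
      by (simp only: real_norm_def abs_mult abs_of_nonneg[OF ab])
    ultimately show ?case by (simp only:)
  qed
  moreover have "(\<lambda>n. \<bar>C\<bar> * ((8 * (real n powr (3/4) + 1) + 4) * (real n powr (1/8) + 1) / (real n - 1))) \<longlonglongrightarrow> 0"
    by (rule tendsto_mult_right_zero) real_asymp
  ultimately show ?thesis by (rule null_comparison)
qed

lemma GK_eq:
  assumes q: "1 \<le> q"
  shows "GK False q n k = Gtilde q n (real k)" "GK True q n k = Gbip q n (real k)"
proof -
  have "F0 q (2 * n) \<sigma> + k = (q - 1) * n + 1 \<longleftrightarrow> graph_order q (2 * n) \<sigma> = real k" for \<sigma>
  proof -
    have "F0 q (2 * n) \<sigma> + k = (q - 1) * n + 1 \<longleftrightarrow> real (F0 q (2 * n) \<sigma> + k) = real ((q - 1) * n + 1)"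
      by (simp only: of_nat_eq_iff)
    also have "\<dots> \<longleftrightarrow> graph_order q (2 * n) \<sigma> = real k"
    proof -
      have "(real q - 1) / 2 * real (2 * n) = (real q - 1) * real n" by simp
      moreover have "real ((q - 1) * n + 1) = (real q - 1) * real n + 1" using q by (simp add: of_nat_diff)
      ultimately show ?thesis unfolding graph_order_def of_nat_add by linarith
    qed
    finally show ?thesis .
  qed
  then show "GK False q n k = Gtilde q n (real k)" "GK True q n k = Gbip q n (real k)"
    by (auto simp: GK_def Gbip_def Gtilde_def)
qed

text \<open>The number of vertices is even, so the half in the definition of the order cancels and
  orders are integers.\<close>

lemma Gtilde_order_nat:
  assumes "\<sigma> \<in> Gtilde q n \<delta>" "1 \<le> q" "1 \<le> \<delta>"
  shows "\<exists>k. \<delta> = real (Suc k)"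
proof -
  have e: "\<delta> = of_int (1 + (int q - 1) * int n - int (F0 q (2 * n) \<sigma>))"
    using assms(1) by (simp add: Gtilde_def graph_order_def)
  define z where "z = 1 + (int q - 1) * int n - int (F0 q (2 * n) \<sigma>)"
  have "1 \<le> z" using e assms(3) unfolding z_def[symmetric] by simp
  then have "\<delta> = real (Suc (nat z - 1))" using e unfolding z_def[symmetric] by simp
  then show ?thesis by blast
qed

lemma bad_ratio_tendsto_0:
  assumes q: "3 \<le> q"
  shows "(\<lambda>n. real (card {\<sigma> \<in> GK \<beta> q n (Suc k). \<not> (is_SYK q (2 * n) \<sigma> \<and> dual_PL_manifold \<sigma> (2 * n) {1..q})})
    / real (card (GK \<beta> q n (Suc k)))) \<longlonglongrightarrow> 0" (is "?r \<longlonglongrightarrow> 0")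
proof -
  have q2: "2 \<le> q" and q1: "1 \<le> q" using q by auto
  obtain l K :: real where l: "1 < l" and K: "1 \<le> K" and rare:
    "\<And>A n h s t. finite A \<Longrightarrow> card A = q \<Longrightarrow> 0 \<le> t \<Longrightarrow> t < 1 \<Longrightarrow> real (card {P \<in> PN A n. \<not> fine A h s P})
      \<le> real (card (PN A n)) * (2 * (real q * real n + 1)\<^sup>2 * ((1 - t) ^ h / (1 - t\<^sup>2) ^ n + real q * real n * K / l ^ s))"
    using rare_trees[OF q2] by blast
  define h s :: "nat \<Rightarrow> nat" where "h n = nat \<lceil>real n powr (3/4)\<rceil>" and "s n = nat \<lceil>real n powr (1/8)\<rceil>" for n
  define t where "t n = real n powr (-3/8)" for n :: nat
  define \<rho> where "\<rho> n = 2 * (real q * real n + 1)\<^sup>2 * ((1 - t n) ^ h n / (1 - (t n)\<^sup>2) ^ n + real q * real n * K / l ^ s n)" for n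
  \<comment> \<open>\<open>C1\<close> gathers the constants of \<open>switching_bound\<close> at D =
    4 h and component size 2 s. \<open>C2\<close> gathers those of the exceptional graphs: k + 1
    factors 4 q n^2 for insertions, 2 n for the comparison with trees, and k + 1 factors 2 n q for
    passing from order zero to order k + 1. The powers of n amount to 3 (k + 1) + 1.\<close>
  define C1 where "C1 = 2 * real (Suc k) * real q * 2 ^ k"
  define C2 where "C2 = (4 * real q) ^ Suc k * 2 * (2 * real q) ^ Suc k"
  have lim1: "(\<lambda>n. C1 * (8 * real (h n) + 4) * real (s n) / real (n - 1)) \<longlonglongrightarrow> 0"
    unfolding h_def s_def by (rule switching_error_tendsto_0)
  have lim2: "(\<lambda>n. C2 * (real n ^ (3 * Suc k + 1) * \<rho> n)) \<longlonglongrightarrow> 0"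
    unfolding \<rho>_def h_def s_def t_def by (intro tendsto_mult_right_zero rare_error_tendsto_0 l K)
  have ev: "\<forall>\<^sub>F n in sequentially. norm (?r n) \<le> C1 * (8 * real (h n) + 4) * real (s n) / real (n - 1) + C2 * (real n ^ (3 * Suc k + 1) * \<rho> n)"
    using eventually_ge_at_top[of "2 * Suc k + 2"]
  proof eventually_elim
    case (elim n)
    let ?G = "GK \<beta> q n (Suc k)"
    let ?g = "real (card ?G)" and ?M = "2 * n * (q * (2 * n))"
    let ?Bd = "{\<sigma> \<in> ?G. \<not> all_colours_on_cycles q n \<sigma>}"
    let ?X = "\<lambda>j. card (XK \<beta> q n (4 * h n) (2 * s n) j)"
    let ?E1 = "C1 * (8 * real (h n) + 4) * real (s n)" and ?E2 = "C2 * (real n ^ (3 * Suc k + 1) * \<rho> n)"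
    have n: "1 \<le> n" "2 \<le> n" "2 * Suc k \<le> n" using elim by auto
    have t: "0 \<le> t n" "t n < 1"
      using powr_less_mono[of "-3/8" 0 "real n"] n by (auto simp: t_def)
    have \<rho>0: "0 \<le> \<rho> n"
      unfolding \<rho>_def using l K t power_le_one[of "t n" 2]
      by (intro mult_nonneg_nonneg add_nonneg_nonneg divide_nonneg_nonneg zero_le_power) auto
    have "k \<le> 1 * n" using n by simp
    also have "\<dots> \<le> (q - 1) * n" by (rule mult_le_mono1) (use q in simp)
    finally have kn: "k \<le> (q - 1) * n" .
    have sub: "{\<sigma> \<in> ?G. \<not> (is_SYK q (2 * n) \<sigma> \<and> dual_PL_manifold \<sigma> (2 * n) {1..q})} \<subseteq> ?Bd"
    proof -
      have "is_SYK q (2 * n) \<sigma> \<and> dual_PL_manifold \<sigma> (2 * n) {1..q}" if s: "\<sigma> \<in> ?G" "all_colours_on_cycles q n \<sigma>" for \<sigma>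
      proof -
        interpret good_graph q "2 * n" \<sigma> "{1..q}"
          by unfold_locales (use q s in \<open>auto simp: GK_def all_colours_on_cycles_def\<close>)
        show ?thesis using SYK manifold by simp
      qed
      then show ?thesis by blast
    qed
    have X: "real (?X k) \<le> real (?M ^ k) * (\<rho> n * (2 * real n * (real ((2 * n * q) ^ Suc k) * ?g)))"
    proof -
      have "real (?X k) \<le> real (?M ^ k * ?X 0)" using card_XK_bound[OF q1] by (simp only: of_nat_le_iff)
      also have "\<dots> = real (?M ^ k) * real (?X 0)" by (rule of_nat_mult)
      also have "real (?X 0) \<le> \<rho> n * (2 * real n * real (card (GK \<beta> q n 0)))"
        by (rule card_XK_0_bound[OF q n(1) _ \<rho>0]) (use rare[OF _ _ t, of "{1..q}"] in \<open>simp add: \<rho>_def\<close>)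
      also have "real (card (GK \<beta> q n 0)) \<le> real ((2 * n * q) ^ Suc k * card ?G)"
        using card_GK_0_bound[OF q n(3,2)] by (simp only: of_nat_le_iff)
      also have "\<dots> = real ((2 * n * q) ^ Suc k) * ?g" by (rule of_nat_mult)
      finally show ?thesis using \<rho>0 by (simp add: mult_left_mono)
    qed
    have "real (card ?Bd) * real (n - 1) = real (card ?Bd * (n - 1))" by (rule of_nat_mult[symmetric])
    also have "\<dots> \<le> real (card ?G * (Suc k * (2 * (4 * h n) + 4) * (q * (2 ^ k * (2 * s n)))) + ?M * ?X k * (n - 1))"
      using switching_bound[OF q kn] by (simp only: of_nat_le_iff)
    also have "\<dots> = ?g * ?E1 + real ?M * real (?X k) * real (n - 1)"
      by (simp add: C1_def) (simp add: algebra_simps)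
    finally have S: "real (card ?Bd) * real (n - 1) \<le> ?g * ?E1 + real ?M * real (?X k) * real (n - 1)" .
    have "real ?M * real (?X k) \<le> real ?M * (real (?M ^ k) * (\<rho> n * (2 * real n * (real ((2 * n * q) ^ Suc k) * ?g))))"
      by (rule mult_left_mono[OF X]) (rule of_nat_0_le_iff)
    also have "\<dots> = ?g * ?E2"
    proof -
      have M: "real ?M = 4 * real q * (real n * real n)" and N: "real (2 * n * q) = 2 * real q * real n" by simp_all
      have a1: "real ?M * real (?M ^ k) = (4 * real q) ^ Suc k * (real n ^ Suc k * real n ^ Suc k)"
        unfolding of_nat_power M power_Suc[symmetric] by (simp only: power_mult_distrib)
      have a2: "real ((2 * n * q) ^ Suc k) = (2 * real q) ^ Suc k * real n ^ Suc k"
        unfolding of_nat_power N by (simp only: power_mult_distrib)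
      have "3 * Suc k + 1 = Suc k + Suc k + Suc k + 1" by simp
      then have a3: "real n ^ (3 * Suc k + 1) = real n ^ Suc k * real n ^ Suc k * real n ^ Suc k * real n"
        by (simp only: power_add power_one_right)
      have "real ?M * (real (?M ^ k) * (\<rho> n * (2 * real n * (real ((2 * n * q) ^ Suc k) * ?g))))
        = (real ?M * real (?M ^ k)) * (\<rho> n * (2 * real n * (real ((2 * n * q) ^ Suc k) * ?g)))"
        by (rule mult.assoc[symmetric])
      also have "\<dots> = ?g * ?E2" unfolding a1 a2 a3 C2_def by (simp only: mult_ac)
      finally show ?thesis .
    qed
    finally have MX: "real ?M * real (?X k) \<le> ?g * ?E2" .
    have "real (card ?Bd) * real (n - 1) \<le> ?g * ?E1 + ?g * ?E2 * real (n - 1)"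
      by (rule order_trans[OF S add_left_mono[OF mult_right_mono[OF MX of_nat_0_le_iff]]])
    then have "real (card ?Bd) \<le> ?g * (?E1 / real (n - 1) + ?E2)"
      using n by (simp add: field_simps)
    moreover have "real (card {\<sigma> \<in> ?G. \<not> (is_SYK q (2 * n) \<sigma> \<and> dual_PL_manifold \<sigma> (2 * n) {1..q})}) \<le> real (card ?Bd)"
      using card_mono[OF _ sub] finite_GK by simp
    ultimately have b: "real (card {\<sigma> \<in> ?G. \<not> (is_SYK q (2 * n) \<sigma> \<and> dual_PL_manifold \<sigma> (2 * n) {1..q})}) \<le> (?E1 / real (n - 1) + ?E2) * ?g"
      by (simp only: mult.commute)
    have E0: "0 \<le> ?E1 / real (n - 1) + ?E2" using \<rho>0 by (simp add: C1_def C2_def)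
    show ?case
    proof (cases "?g = 0")
      case False
      then have "?r n \<le> ?E1 / real (n - 1) + ?E2" using b by (simp add: pos_divide_le_eq)
      then show ?thesis by simp
    qed (use E0 in simp)
  qed
  show ?thesis by (rule null_comparison[OF ev]) (use tendsto_add[OF lim1 lim2] in simp)
qed

theorem mainTheorem16:
  fixes q :: nat and \<delta> :: real
  assumes "3 \<le> q" and "1 \<le> \<delta>"
  shows "(\<lambda>n. real (card {\<sigma> \<in> Gbip q n \<delta>.
              \<not> (is_SYK q (2 * n) \<sigma> \<and> dual_PL_manifold \<sigma> (2 * n) {1..q})})
            / real (card (Gbip q n \<delta>))) \<longlonglongrightarrow> 0
       \<and> (\<lambda>n. real (card {\<sigma> \<in> Gtilde q n \<delta>.
              \<not> (is_SYK q (2 * n) \<sigma> \<and> dual_PL_manifold \<sigma> (2 * n) {1..q})})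
            / real (card (Gtilde q n \<delta>))) \<longlonglongrightarrow> 0"
proof (cases "\<exists>k. \<delta> = real (Suc k)")
  case True
  then obtain k where k: "\<delta> = real (Suc k)" by blast
  have q1: "1 \<le> q" using assms(1) by simp
  show ?thesis
    unfolding k GK_eq[OF q1, symmetric] by (intro conjI bad_ratio_tendsto_0 assms(1))
next
  case False
  \<comment> \<open>For every other \<delta> both families are empty and the quotients are 0 / 0 =
    0.\<close>
  have "Gtilde q n \<delta> = {}" for n using Gtilde_order_nat[of _ q n \<delta>] assms False by fastforce
  then have "Gtilde q n \<delta> = {}" "Gbip q n \<delta> = {}" for n by (auto simp: Gbip_def)
  then show ?thesis by simp
qed

end
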